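(* Let $1<p_1\le p_2<\infty$, $-1<\alpha_1,\alpha_2,\xi<\infty$ and $\mu\in\mathcal{M}_+$. Suppose that $$n+1+\xi>n\max\left(1,\frac1{p_i}\right)+\frac{1+\alpha_i}{p_i},\qquad i=1,2.$$ Let $$\lambda=1+\frac1{p_1}-\frac1{p_2},\qquad \gamma=\frac1\lambda\left(\xi+\frac{\alpha_1}{p_1}-\frac{\alpha_2}{p_2}\right).$$ Then the following statements are equivalent: (1) $B_\mu^\xi$ is compact from $A^{p_1}_{\alpha_1}(T_B)$ to $L^{p_2}_{\alpha_2}(T_B)$. (2) $T_\mu^\xi$ is compact from $A^{p_1}_{\alpha_1}(T_B)$ to $A^{p_2}_{\alpha_2}(T_B)$. (3) $\mu$ is a vanishing $(\lambda,\gamma)$-Carleson measure.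
   Context: Let $n\ge 1$. Write $z=(z',z_n)\in\mathbb{C}^n$ with $z'=(z_1,\dots,z_{n-1})$, and $u^2:=u\cdot u=\sum_j u_j^2$ for a vector $u$ (no conjugation). The tubular domain is $T_B=\{z=x+iy\in\mathbb{C}^n: x\in\mathbb{R}^n,\ y\in B\}$ with $B=\{(y',y_n)\in\mathbb{R}^n: |y'|^2=y_1^2+\cdots+y_{n-1}^2<y_n\}$. For $z,w\in T_B$ put $$\rho(z,w)=\tfrac14\left((z'-\overline{w'})^2-2i(z_n-\overline{w_n})\right),\qquad \rho(z)=\rho(z,z)=y_n-|y'|^2 .$$ One has $\operatorname{Re}\rho(z,w)>0$, and non-integer powers of $\rho(z,w)$ are taken with the principal branch. Let $\mathbf{i}=(0',i)\in T_B$. For $\alpha>-1$ let $dV_\alpha(z)=\rho(z)^\alpha dV(z)$, with $dV$ Lebesgue measure on $\mathbb{C}^n$. For $0<p<\infty$, $L^p_\alpha(T_B)$ is the space of Lebesgue measurable $f$ on $T_B$ with $\|f\|_{p,\alpha}=\left(\int_{T_B}|f|^p\,dV_\alpha\right)^{1/p}<\infty$, and the Bergman space $A^p_\alpha(T_B)$ is the set of holomorphic functions in $L^p_\alpha(T_B)$. $\mathcal{M}_+$ is the set of positive Borel measures $\mu$ on $T_B$ with $\int_{T_B}|\rho(z,\mathbf{i})|^{-t}\,d\mu(z)<\infty$ for some $t>0$. For $\xi>-1$, $\mu\in\mathcal{M}_+$ and $f$ holomorphic on $T_B$, the Berezin-type operator (sublinear) and the Toeplitz operator are $$B_\mu^\xi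 f(z)=\int_{T_B}\frac{|f(w)|}{|\rho(z,w)|^{n+1+\xi}}\,d\mu(w),\qquad T_\mu^\xi f(z)=\int_{T_B}\frac{f(w)}{\rho(z,w)^{n+1+\xi}}\,d\mu(w),\qquad z\in T_B.$$ An operator $S$ (linear or sublinear) is bounded from $X$ to $Y$ if it is well defined from $X$ to $Y$ (for $T_\mu^\xi$, the defining integral converges absolutely for every $f\in X$ and $z\in T_B$) and there is $C$ with $\|Sf\|_Y\le C\|f\|_X$ for all $f\in X$. It is compact if it is bounded and maps every bounded subset of $X$ to a relatively compact subset of $Y$. For $\lambda>0$ and $\alpha>-1$, a positive Borel measure $\mu$ on $T_B$ is a vanishing $(\lambda,\alpha)$-Carleson measure if for all positive numbers $p,q$ with $q/p=\lambda$ and every bounded sequence $\{f_k\}$ in $A^p_\alpha(T_B)$ converging to $0$ uniformly on every compact subset of $T_B$, one has $\lim_{k\to\infty}\int_{T_B}|f_k|^q\,d\mu=0$. *)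

theory Defs
  imports "HOL-Analysis.Analysis"
begin

text \<open>
  Points of \<open>\<complex>\<^sup>n\<close> are vectors over a finite linearly ordered index type with \<open>n\<close> elements, so that
  \<open>n \<ge> 1\<close> is arbitrary; the coordinate \<open>z\<^sub>n\<close> is the one at the largest index. Functions on
  the domain \<open>tube\<close> are total functions whose values off \<open>tube\<close> are irrelevant.
\<close>

definition last_ix :: "'n::{finite,linorder}" where
  "last_ix = Max UNIV"

definition tube :: "(complex^'n::{finite,linorder}) set" where
  "tube = {z. (\<Sum>j\<in>UNIV - {last_ix}. (Im (z $ j))\<^sup>2) < Im (z $ last_ix)}"

definition rho :: "complex^'n::{finite,linorder} \<Rightarrow> complex^'n::{finite,linorder} \<Rightarrow> complex" where
  "rho z w = 1/4 * ((\<Sum>j\<in>UNIV - {last_ix}. (z $ j - cnj (w $ j))\<^sup>2)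
                    - 2 * \<i> * (z $ last_ix - cnj (w $ last_ix)))"

definition rho_diag :: "complex^'n::{finite,linorder} \<Rightarrow> real" where
  "rho_diag z = Im (z $ last_ix) - (\<Sum>j\<in>UNIV - {last_ix}. (Im (z $ j))\<^sup>2)"

lemma rho_same: "rho z z = of_real (rho_diag z)"
proof -
  have "(u - cnj u)\<^sup>2 = -4 * of_real ((Im u)\<^sup>2)" for u
    by (simp add: complex_diff_cnj power_mult_distrib)
  moreover have "2 * \<i> * (u - cnj u) = -4 * of_real (Im u)" for u
    by (simp add: complex_diff_cnj)
  ultimately have "rho z z = 1/4 * ((\<Sum>j\<in>UNIV - {last_ix}. -4 * of_real ((Im (z $ j))\<^sup>2))
                                    - (-4 * of_real (Im (z $ last_ix))))"
    unfolding rho_def by presburger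
  then show ?thesis
    by (simp only: rho_diag_def sum_distrib_left[symmetric] of_real_sum[symmetric]) simp
qed

definition base_point :: "complex^'n::{finite,linorder}" where
  "base_point = axis last_ix \<i>"

text \<open>Complex differentiability: the real Frechet derivative is complex linear.\<close>

definition holomorphic_tube :: "(complex^'n::{finite,linorder} \<Rightarrow> complex) \<Rightarrow> bool" where
  "holomorphic_tube f \<longleftrightarrow>
     (\<forall>z\<in>tube. \<exists>D. (f has_derivative D) (at z) \<and> (\<forall>c v. D (c *s v) = c * D v))"

definition dV :: "real \<Rightarrow> (complex^'n::{finite,linorder}) measure" where
  "dV \<alpha> = density (lebesgue_on tube) (\<lambda>z. ennreal (rho_diag z powr \<alpha>))"

definition Lp :: "real \<Rightarrow> real \<Rightarrow> (complex^'n::{finite,linorder} \<Rightarrow> complex) set" where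
  "Lp p \<alpha> = {f \<in> borel_measurable (lebesgue_on tube). integrable (dV \<alpha>) (\<lambda>z. cmod (f z) powr p)}"

definition Lp_norm :: "real \<Rightarrow> real \<Rightarrow> (complex^'n::{finite,linorder} \<Rightarrow> complex) \<Rightarrow> real" where
  "Lp_norm p \<alpha> f = (\<integral>z. cmod (f z) powr p \<partial>dV \<alpha>) powr (1 / p)"

definition Bergman :: "real \<Rightarrow> real \<Rightarrow> (complex^'n::{finite,linorder} \<Rightarrow> complex) set" where
  "Bergman p \<alpha> = {f \<in> Lp p \<alpha>. holomorphic_tube f}"

definition M_plus :: "(complex^'n::{finite,linorder}) measure set" where
  "M_plus = {\<mu>. sets \<mu> = sets (restrict_space borel tube) \<and>
     (\<exists>t>0. (\<integral>\<^sup>+z. ennreal (cmod (rho z base_point) powr (- t)) \<partial>\<mu>) < \<infinity>)}"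

definition Berezin ::
  "(complex^'n::{finite,linorder}) measure \<Rightarrow> real \<Rightarrow> (complex^'n::{finite,linorder} \<Rightarrow> complex) \<Rightarrow> complex^'n::{finite,linorder} \<Rightarrow> ennreal" where
  "Berezin \<mu> \<xi> f z =
     (\<integral>\<^sup>+w. ennreal (cmod (f w) / cmod (rho z w) powr (real CARD('n) + 1 + \<xi>)) \<partial>\<mu>)"

text \<open>
  The integral defining the Berezin-type operator always exists in \<open>[0,\<infinity>]\<close>. It defines an element of an
  \<open>L\<^sup>p\<close> space only if it is finite almost everywhere, and then the values assigned to the
  remaining points do not matter.
\<close>

definition Berezin_dom :: "(complex^'n::{finite,linorder}) measure \<Rightarrow> real \<Rightarrow> (complex^'n::{finite,linorder} \<Rightarrow> complex) set" where
  "Berezin_dom \<mu> \<xi> = {f. AE z in lebesgue_on tube. Berezin \<mu> \<xi> f z < \<infinity>}"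

definition Berezin_op ::
  "(complex^'n::{finite,linorder}) measure \<Rightarrow> real \<Rightarrow> (complex^'n::{finite,linorder} \<Rightarrow> complex) \<Rightarrow> complex^'n::{finite,linorder} \<Rightarrow> complex" where
  "Berezin_op \<mu> \<xi> f = (\<lambda>z. of_real (enn2real (Berezin \<mu> \<xi> f z)))"

definition Toeplitz_dom :: "(complex^'n::{finite,linorder}) measure \<Rightarrow> real \<Rightarrow> (complex^'n::{finite,linorder} \<Rightarrow> complex) set" where
  "Toeplitz_dom \<mu> \<xi> =
     {f. \<forall>z\<in>tube. integrable \<mu> (\<lambda>w. f w / rho z w powr of_real (real CARD('n) + 1 + \<xi>))}"

definition Toeplitz_op ::
  "(complex^'n::{finite,linorder}) measure \<Rightarrow> real \<Rightarrow> (complex^'n::{finite,linorder} \<Rightarrow> complex) \<Rightarrow> complex^'n::{finite,linorder} \<Rightarrow> complex" where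
  "Toeplitz_op \<mu> \<xi> f = (\<lambda>z. \<integral>w. f w / rho z w powr of_real (real CARD('n) + 1 + \<xi>) \<partial>\<mu>)"

text \<open>
  The topology of the (semi)norm \<open>N\<close> on \<open>Y\<close>. Functions that agree almost everywhere on
  \<open>tube\<close> are topologically indistinguishable, so compactness here is the same as compactness
  in the quotient space of equivalence classes.
\<close>

definition norm_topology :: "('a \<Rightarrow> complex) set \<Rightarrow> (('a \<Rightarrow> complex) \<Rightarrow> real) \<Rightarrow> ('a \<Rightarrow> complex) topology" where
  "norm_topology Y N =
     topology (\<lambda>U. U \<subseteq> Y \<and> (\<forall>f\<in>U. \<exists>\<epsilon>>0. \<forall>g\<in>Y. N (\<lambda>z. g z - f z) < \<epsilon> \<longrightarrow> g \<in> U))"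

lemma openin_norm_topology:
  "openin (norm_topology Y N) U \<longleftrightarrow>
     U \<subseteq> Y \<and> (\<forall>f\<in>U. \<exists>\<epsilon>>0. \<forall>g\<in>Y. N (\<lambda>z. g z - f z) < \<epsilon> \<longrightarrow> g \<in> U)"
proof -
  have "istopology (\<lambda>U. U \<subseteq> Y \<and> (\<forall>f\<in>U. \<exists>\<epsilon>>0. \<forall>g\<in>Y. N (\<lambda>z. g z - f z) < \<epsilon> \<longrightarrow> g \<in> U))"
    unfolding istopology_def
  proof (intro conjI allI impI)
    fix S T
    assume S: "S \<subseteq> Y \<and> (\<forall>f\<in>S. \<exists>\<epsilon>>0. \<forall>g\<in>Y. N (\<lambda>z. g z - f z) < \<epsilon> \<longrightarrow> g \<in> S)"
      and T: "T \<subseteq> Y \<and> (\<forall>f\<in>T. \<exists>\<epsilon>>0. \<forall>g\<in>Y. N (\<lambda>z. g z - f z) < \<epsilon> \<longrightarrow> g \<in> T)"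
    show "S \<inter> T \<subseteq> Y" using S by blast
    show "\<forall>f\<in>S \<inter> T. \<exists>\<epsilon>>0. \<forall>g\<in>Y. N (\<lambda>z. g z - f z) < \<epsilon> \<longrightarrow> g \<in> S \<inter> T"
    proof
      fix f assume "f \<in> S \<inter> T"
      then obtain a b where "a > 0" "\<forall>g\<in>Y. N (\<lambda>z. g z - f z) < a \<longrightarrow> g \<in> S"
        and "b > 0" "\<forall>g\<in>Y. N (\<lambda>z. g z - f z) < b \<longrightarrow> g \<in> T"
        using S T by (metis IntD1 IntD2)
      then show "\<exists>\<epsilon>>0. \<forall>g\<in>Y. N (\<lambda>z. g z - f z) < \<epsilon> \<longrightarrow> g \<in> S \<inter> T"
        by (intro exI[of _ "min a b"]) auto
    qed
  next
    fix K
    assume K: "\<forall>S\<in>K. S \<subseteq> Y \<and> (\<forall>f\<in>S. \<exists>\<epsilon>>0. \<forall>g\<in>Y. N (\<lambda>z. g z - f z) < \<epsilon> \<longrightarrow> g \<in> S)"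
    show "\<Union>K \<subseteq> Y" using K by blast
    show "\<forall>f\<in>\<Union>K. \<exists>\<epsilon>>0. \<forall>g\<in>Y. N (\<lambda>z. g z - f z) < \<epsilon> \<longrightarrow> g \<in> \<Union>K"
      using K by (meson UnionE UnionI)
  qed
  then show ?thesis
    by (simp add: norm_topology_def topology_inverse')
qed

definition relatively_compact ::
  "('a \<Rightarrow> complex) set \<Rightarrow> (('a \<Rightarrow> complex) \<Rightarrow> real) \<Rightarrow> ('a \<Rightarrow> complex) set \<Rightarrow> bool" where
  "relatively_compact Y N S \<longleftrightarrow>
     S \<subseteq> Y \<and> compactin (norm_topology Y N) (norm_topology Y N closure_of S)"

text \<open>Below, \<open>D\<close> is the set of functions on which the (possibly sublinear) operator \<open>T\<close> is defined.\<close>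

definition bounded_op ::
  "('a \<Rightarrow> complex) set \<Rightarrow> (('a \<Rightarrow> complex) \<Rightarrow> 'a \<Rightarrow> complex) \<Rightarrow>
   ('a \<Rightarrow> complex) set \<Rightarrow> (('a \<Rightarrow> complex) \<Rightarrow> real) \<Rightarrow>
   ('a \<Rightarrow> complex) set \<Rightarrow> (('a \<Rightarrow> complex) \<Rightarrow> real) \<Rightarrow> bool" where
  "bounded_op D T X NX Y NY \<longleftrightarrow>
     X \<subseteq> D \<and> T ` X \<subseteq> Y \<and> (\<exists>C. \<forall>f\<in>X. NY (T f) \<le> C * NX f)"

definition compact_op ::
  "('a \<Rightarrow> complex) set \<Rightarrow> (('a \<Rightarrow> complex) \<Rightarrow> 'a \<Rightarrow> complex) \<Rightarrow>
   ('a \<Rightarrow> complex) set \<Rightarrow> (('a \<Rightarrow> complex) \<Rightarrow> real) \<Rightarrow>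
   ('a \<Rightarrow> complex) set \<Rightarrow> (('a \<Rightarrow> complex) \<Rightarrow> real) \<Rightarrow> bool" where
  "compact_op D T X NX Y NY \<longleftrightarrow>
     bounded_op D T X NX Y NY \<and>
     (\<forall>S. S \<subseteq> X \<and> (\<exists>M. \<forall>f\<in>S. NX f \<le> M) \<longrightarrow> relatively_compact Y NY (T ` S))"

definition vanishing_Carleson :: "real \<Rightarrow> real \<Rightarrow> (complex^'n::{finite,linorder}) measure \<Rightarrow> bool" where
  "vanishing_Carleson l \<alpha> \<mu> \<longleftrightarrow>
     (\<forall>p q. \<forall>f :: nat \<Rightarrow> complex^'n::{finite,linorder} \<Rightarrow> complex.
        p > 0 \<and> q > 0 \<and> q / p = l \<and>
        (\<forall>k. f k \<in> Bergman p \<alpha>) \<and> (\<exists>M. \<forall>k. Lp_norm p \<alpha> (f k) \<le> M) \<and>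
        (\<forall>K. compact K \<and> K \<subseteq> tube \<longrightarrow> uniform_limit K f (\<lambda>_. 0) sequentially)
        \<longrightarrow> (\<lambda>k. \<integral>\<^sup>+z. ennreal (cmod (f k z) powr q) \<partial>\<mu>) \<longlonglongrightarrow> 0)"

end

theory Submission
  imports Defs "HOL-Complex_Analysis.Cauchy_Integral_Formula"
begin

text \<open>
  All three conditions are equivalent to \<open>\<mu>(D(a)) = o(\<rho>(a)\<^bsup>b\<^esup>)\<close> as \<open>a\<close> leaves every compact subset of the
  domain, where \<open>D(a) = {w. |\<rho>(a,w)| < 2 min(\<rho>(a), \<rho>(w))}\<close> and \<open>b = \<lambda> (n + 1 + \<gamma>)\<close>. Sufficiency: subharmonicity
  gives \<open>|f(w)|\<^bsup>p\<^esup> \<le> C \<rho>(w)\<^bsup>-(n+1)\<^esup> \<integral>\<^bsub>D(w)\<^esub> |f|\<^bsup>p\<^esup>\<close>, which turns integrals against \<open>\<mu>\<close> into integrals against Lebesgue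
  measure; with the Forelli-Rudin estimate for \<open>\<integral> \<rho>\<^bsup>s\<^esup> |\<rho>(z,w)|\<^bsup>-t\<^esup>\<close> and Schur's test the Berezin-type operator is bounded with norm
  controlled by \<open>sup \<mu>(D(a)) \<rho>(a)\<^bsup>-b\<^esup>\<close>. Splitting \<open>\<mu>\<close> into a compactly supported part and one of small norm makes it continuous
  from the unit ball of the Bergman space with the topology of pointwise convergence, which is compact, to
  \<open>L\<^bsup>p2\<^esup>\<close>; the Toeplitz operator is dominated by it. Necessity: test on
  \<open>\<rho>(a)\<^bsup>s\<^esup> \<rho>(w,a)\<^bsup>-t\<^esup>\<close>, whose image has \<open>L\<^bsup>p2\<^esup>\<close> mass at least \<open>c (\<mu>(D(a)) \<rho>(a)\<^bsup>-b\<^esup>)\<^bsup>p2\<^esup>\<close> on \<open>D(a)\<close>,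
  while a relatively compact subset of \<open>L\<^bsup>p2\<^esup>\<close> has uniformly small tails.
\<close>

section \<open>Geometry of the tubular domain\<close>

text \<open>The exponent b comes from homogeneity: \<open>rho\<close> scales by d^2 under (z', z_n)
  -> (d z', d^2 z_n), whose Jacobian is d^(2n+2), and b is the power of \<open>rho_diag\<close> that
  balances both sides. Four features shape the argument. The transfer from the measure to Lebesgue
  measure is Tonelli on the symmetric relation w in D(u), so no lattice or covering lemma enters.
  The Carleson condition quantifies over all p, q of a given ratio, so mean value estimates are
  needed for every p > 0, including p < 1, where convexity gives nothing. The Berezin-type operator
  is only sublinear and its values need not be holomorphic: compactness is therefore derived from a
  bound on differences |S g - S f| rather than from linearity, and its lower bound is proved on all
  of D(a), whereas for the Toeplitz operator the value at a suffices. Finally, pointwise convergence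
  on uncountably many points is not metrizable, so compactness is handled by open covers, with
  finite nets and Cauchy estimates supplying local uniformity.\<close>

lemma Re_rho:
  "4 * Re (rho z w) =
    (\<Sum>j\<in>UNIV - {last_ix}. (cmod (z $ j - w $ j))\<^sup>2) + 2 * rho_diag z + 2 * rho_diag w"
proof -
  \<comment> \<open>Applied to each coordinate, this turns the real part into a sum of terms that
    are nonnegative on \<open>tube\<close>; positivity of Re rho and all lower bounds for |rho| come
    from here.\<close>
  have "Re ((a - cnj b)\<^sup>2) = (cmod (a - b))\<^sup>2 - 2 * (Im a)\<^sup>2 - 2 * (Im b)\<^sup>2" for a b
    unfolding cmod_power2 by (simp add: power2_eq_square algebra_simps)
  then show ?thesis
    by (simp add: rho_def rho_diag_def sum_subtractf sum_distrib_left sum_distrib_right mult.commute)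
qed

text \<open>Complements \<open>Re_rho\<close>: the real part measures |z' - w'|^2 and the two
  heights, the imaginary part the real shift in the last coordinate, twisted by the others. Size
  estimates for \<open>rho\<close> read off one of the two.\<close>

lemma Im_rho:
  "2 * Im (rho z w) =
    (\<Sum>j\<in>UNIV - {last_ix}. (Re (z $ j) - Re (w $ j)) * (Im (z $ j) + Im (w $ j)))
      - (Re (z $ last_ix) - Re (w $ last_ix))"
proof -
  have "Im ((a - cnj b)\<^sup>2) = 2 * ((Re a - Re b) * (Im a + Im b))" for a b
    by (simp add: power2_eq_square)
  then show ?thesis
    by (simp add: rho_def sum_distrib_left sum_distrib_right mult.commute)
qed

lemma rho_commute: "rho w z = cnj (rho z w)"
proof -
  have "(cnj a - b)\<^sup>2 = (b - cnj a)\<^sup>2" for a b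
    by (rule power2_commute)
  then show ?thesis
    by (simp add: rho_def right_diff_distrib)
qed

lemma cmod_rho_commute: "cmod (rho w z) = cmod (rho z w)"
  by (metis complex_mod_cnj rho_commute)

lemma mem_tube: "z \<in> tube \<longleftrightarrow> 0 < rho_diag z"
  by (simp add: tube_def rho_diag_def)

lemma Re_rho_ge: "rho_diag z + rho_diag w \<le> 2 * Re (rho z w)"
  using Re_rho[of z w] sum_nonneg[of "UNIV - {last_ix}" "\<lambda>j. (cmod (z $ j - w $ j))\<^sup>2"] by simp

lemma Re_rho_pos: "z \<in> tube \<Longrightarrow> w \<in> tube \<Longrightarrow> 0 < Re (rho z w)"
  using Re_rho_ge[of z w] by (simp add: mem_tube)

lemma cmod_rho_ge: "w \<in> tube \<Longrightarrow> rho_diag z \<le> 2 * cmod (rho z w)"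
  using Re_rho_ge[of z w] abs_Re_le_cmod[of "rho z w"] by (simp add: mem_tube)

lemma cmod_rho_ge': "z \<in> tube \<Longrightarrow> rho_diag w \<le> 2 * cmod (rho z w)"
  using cmod_rho_ge[of z w] cmod_rho_commute[of w z] by simp

lemma cmod_rho_pos: "z \<in> tube \<Longrightarrow> w \<in> tube \<Longrightarrow> 0 < cmod (rho z w)"
  using Re_rho_pos by fastforce

text \<open>The real part consists of squared distances and heights and so obeys a triangle
  inequality with constant 2. The imaginary part is additive up to the bilinear defect
  \<open>E\<close>, a Heisenberg-type cocycle, which is again dominated by real parts. Altogether
  three real parts and one imaginary part, hence the constant 4.\<close>

lemma rho_quasi_triangle:
  assumes "z \<in> tube" "w \<in> tube" "v \<in> tube"
  shows "cmod (rho z v) \<le> 4 * (cmod (rho z w) + cmod (rho w v))"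
proof -
  define J :: "'a set" where "J = UNIV - {last_ix}"
  define A where "A = (\<Sum>j\<in>J. (cmod (z $ j - w $ j))\<^sup>2)"
  define B where "B = (\<Sum>j\<in>J. (cmod (w $ j - v $ j))\<^sup>2)"
  note [simp] = J_def[symmetric]
  have "(cmod (z $ j - v $ j))\<^sup>2 \<le> 2 * (cmod (z $ j - w $ j))\<^sup>2 + 2 * (cmod (w $ j - v $ j))\<^sup>2" for j
  proof -
    have "(cmod (z $ j - v $ j))\<^sup>2 \<le> (cmod (z $ j - w $ j) + cmod (w $ j - v $ j))\<^sup>2"
      by (intro power_mono norm_diff_triangle_ineq[THEN order_trans]) (auto intro: norm_diff_triangle_le)
    then show ?thesis
      using sum_squares_bound[of "cmod (z $ j - w $ j)" "cmod (w $ j - v $ j)"]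
      by (simp add: power2_sum)
  qed
  then have "(\<Sum>j\<in>J. (cmod (z $ j - v $ j))\<^sup>2) \<le> 2 * A + 2 * B"
    unfolding A_def B_def sum_distrib_left sum.distrib[symmetric] by (intro sum_mono)
  then have Re: "Re (rho z v) \<le> 2 * Re (rho z w) + 2 * Re (rho w v)"
    using Re_rho[of z v] Re_rho[of z w] Re_rho[of w v] assms
    by (simp add: A_def B_def mem_tube)
  define E where "E = (\<Sum>j\<in>J. (Re (z $ j) - Re (w $ j)) * (Im (v $ j) - Im (w $ j))
      + (Re (w $ j) - Re (v $ j)) * (Im (z $ j) - Im (w $ j)))"
  have xy: "\<bar>a * b\<bar> \<le> (a\<^sup>2 + b\<^sup>2) / 2" for a b :: real
    using sum_squares_bound[of "\<bar>a\<bar>" "\<bar>b\<bar>"] by (simp add: abs_mult)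
  have "\<bar>E\<bar> \<le> (\<Sum>j\<in>J. ((cmod (z $ j - w $ j))\<^sup>2 + (cmod (w $ j - v $ j))\<^sup>2) / 2)"
    unfolding E_def
  proof (rule sum_abs[THEN order_trans], rule sum_mono)
    fix j
    show "\<bar>(Re (z $ j) - Re (w $ j)) * (Im (v $ j) - Im (w $ j))
      + (Re (w $ j) - Re (v $ j)) * (Im (z $ j) - Im (w $ j))\<bar>
      \<le> ((cmod (z $ j - w $ j))\<^sup>2 + (cmod (w $ j - v $ j))\<^sup>2) / 2"
      using xy[of "Re (z $ j) - Re (w $ j)" "Im (v $ j) - Im (w $ j)"]
        xy[of "Re (w $ j) - Re (v $ j)" "Im (z $ j) - Im (w $ j)"]
      by (simp add: cmod_power2 power2_commute add_divide_distrib)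
  qed
  also have "\<dots> = (A + B) / 2"
    by (simp add: A_def B_def sum.distrib sum_divide_distrib[symmetric])
  also have "\<dots> \<le> 2 * Re (rho z w) + 2 * Re (rho w v)"
    using Re_rho[of z w] Re_rho[of w v] assms by (simp add: A_def B_def mem_tube)
  finally have E: "\<bar>E\<bar> \<le> 2 * Re (rho z w) + 2 * Re (rho w v)" .
  have "2 * Im (rho z v) - 2 * Im (rho z w) - 2 * Im (rho w v) = E"
    unfolding Im_rho E_def by (simp add: algebra_simps sum.distrib sum_subtractf)
  then have "\<bar>Im (rho z v)\<bar> \<le> \<bar>Im (rho z w)\<bar> + \<bar>Im (rho w v)\<bar> + Re (rho z w) + Re (rho w v)"
    using E by linarith
  then have Im: "\<bar>Im (rho z v)\<bar> \<le> \<bar>Im (rho z w)\<bar> + \<bar>Im (rho w v)\<bar> + Re (rho z w) + Re (rho w v)"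
    by simp
  have arith: "n \<le> 4 * (n1 + n2)"
    if "n \<le> x + y" "x \<le> 2 * r1 + 2 * r2" "y \<le> i1 + i2 + r1 + r2" "r1 \<le> n1" "r2 \<le> n2" "i1 \<le> n1" "i2 \<le> n2"
    for n n1 n2 x y r1 r2 i1 i2 :: real
    using that by simp
  show ?thesis
    by (rule arith[OF cmod_le[of "rho z v", unfolded abs_of_pos[OF Re_rho_pos[OF assms(1,3)]]] Re Im])
      (rule complex_Re_le_cmod abs_Im_le_cmod)+
qed

text \<open>Since \<open>rho_diag w\<close> is at most 2 |rho w v|, the summand |rho z w| of the
  quasi-triangle inequality can be absorbed into |rho w v|, at the cost of a factor that depends on
  z and w only and is uniform in v.\<close>

lemma rho_quasi_invariant:
  assumes "z \<in> tube" "w \<in> tube" "v \<in> tube"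
  shows "cmod (rho z v) \<le> (4 + 8 * cmod (rho z w) / rho_diag w) * cmod (rho w v)"
proof -
  have "1 \<le> 2 * cmod (rho w v) / rho_diag w"
    using cmod_rho_ge[of v w] assms by (simp add: mem_tube)
  then have "cmod (rho z w) \<le> cmod (rho z w) * (2 * cmod (rho w v) / rho_diag w)"
    by (metis mult_left_mono mult.right_neutral norm_ge_zero)
  moreover have "4 * cmod (rho w v) + 4 * (cmod (rho z w) * (2 * cmod (rho w v) / rho_diag w))
      = (4 + 8 * cmod (rho z w) / rho_diag w) * cmod (rho w v)"
    by (simp add: distrib_right)
  ultimately show ?thesis
    using rho_quasi_triangle[OF assms] unfolding distrib_left by linarith
qed

text \<open>Stands in for a Bergman metric ball of fixed radius about z. As |rho z w| is never below
  half of either height, membership says that |rho z w| and both heights are comparable. The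
  relation is symmetric, which the exchange of integrals in \<open>nn_integral_near_le\<close>
  exploits, and the factor 2 leaves room for a full coordinate ball around z, see
  \<open>near_chart\<close>.\<close>

definition near :: "complex^'n::{finite,linorder} \<Rightarrow> complex^'n::{finite,linorder} \<Rightarrow> bool" where
  "near z w \<longleftrightarrow> cmod (rho z w) < 2 * rho_diag z \<and> cmod (rho z w) < 2 * rho_diag w"

lemma near_commute: "near z w \<longleftrightarrow> near w z"
  by (auto simp: near_def cmod_rho_commute)

lemma near_tube: "near z w \<Longrightarrow> z \<in> tube \<and> w \<in> tube"
  unfolding near_def mem_tube by (smt (verit) norm_ge_zero)

lemma near_rho_diag:
  assumes "near z w" shows "rho_diag w < 4 * rho_diag z" "rho_diag z < 4 * rho_diag w"
  using assms near_tube[OF assms] cmod_rho_ge[of w z] cmod_rho_ge'[of z w] by (auto simp: near_def)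

lemma near_rho:
  assumes "near z w" "v \<in> tube"
  shows "cmod (rho z v) \<le> 20 * cmod (rho w v)"
proof -
  have t: "z \<in> tube" "w \<in> tube" using near_tube[OF assms(1)] by auto
  \<comment> \<open>The quotient is at most 2 by nearness, so the factor in
    \<open>rho_quasi_invariant\<close> is at most 4 + 8 * 2 = 20.\<close>
  have "8 * cmod (rho z w) / rho_diag w \<le> 16"
    using assms(1) t by (simp add: near_def mem_tube divide_le_eq)
  then have "(4 + 8 * cmod (rho z w) / rho_diag w) * cmod (rho w v) \<le> 20 * cmod (rho w v)"
    by (intro mult_right_mono) auto
  then show ?thesis using rho_quasi_invariant[OF t assms(2)] by linarith
qed

text \<open>Comparability in both directions, so that one bound serves positive and negative
  exponents; most exponents below have no fixed sign.\<close>

lemma powr_comparable: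
  fixes x y K :: real
  assumes "0 < x" "0 < y" "x \<le> K * y" "y \<le> K * x"
  shows "x powr e \<le> K powr \<bar>e\<bar> * y powr e"
proof (cases "e \<ge> 0")
  case True
  have "0 < K" using assms by (smt (verit) mult_nonpos_nonneg)
  then show ?thesis using powr_mono2[OF True, of x "K * y"] assms True by (simp add: powr_mult)
next
  case False
  have K: "0 < K" using assms by (smt (verit) mult_nonpos_nonneg)
  have "x powr e \<le> (y / K) powr e"
    using powr_mono2'[of e "y / K" x] assms K False by (simp add: divide_simps mult.commute)
  then show ?thesis using assms K False by (simp add: powr_divide powr_minus_divide)
qed

lemma near_rho_diag_powr:
  assumes "near z w" shows "rho_diag z powr e \<le> 4 powr \<bar>e\<bar> * rho_diag w powr e"
  using near_rho_diag[OF assms] near_tube[OF assms] by (intro powr_comparable) (auto simp: mem_tube)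

lemma near_rho_powr:
  assumes "near z w" "v \<in> tube"
  shows "cmod (rho v z) powr e \<le> 20 powr \<bar>e\<bar> * cmod (rho v w) powr e"
  using near_rho[OF assms] near_rho[of w z v] assms near_tube[OF assms(1)] cmod_rho_pos[of v]
  by (intro powr_comparable) (auto simp: near_commute cmod_rho_commute[of v])

section \<open>Topology of the domain and its compact exhaustion\<close>

lemma continuous_on_rho_diag [continuous_intros]: "continuous_on S rho_diag"
  unfolding rho_diag_def by (intro continuous_intros)

lemma continuous_on_rho [continuous_intros]:
  assumes "continuous_on S f" "continuous_on S g"
  shows "continuous_on S (\<lambda>x. rho (f x) (g x))"
  unfolding rho_def by (intro continuous_intros assms)

lemma open_tube [simp]: "open (tube :: (complex^'n::{finite,linorder}) set)"
proof -
  have "open {z :: complex^'n::{finite,linorder}. 0 < rho_diag z}"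
    by (intro open_Collect_less continuous_intros)
  then show ?thesis
    by (simp add: mem_tube[symmetric])
qed

lemma base_point_nth: "base_point $ j = (if j = last_ix then \<i> else 0)"
  by (simp add: base_point_def axis_def)

lemma rho_diag_base_point [simp]: "rho_diag base_point = 1"
  by (simp add: rho_diag_def base_point_nth)

lemma base_point_tube [simp]: "base_point \<in> tube"
  by (simp add: mem_tube)

text \<open>A compact exhaustion phrased through \<open>rho\<close> alone, so that it interacts with
  \<open>near\<close> and with kernel bounds. The single parameter keeps a point away from the
  boundary and from infinity at the same time.\<close>

definition exhaust :: "real \<Rightarrow> (complex^'n::{finite,linorder}) set" where
  "exhaust R = {w \<in> tube. 1 \<le> R * rho_diag w \<and> cmod (rho w base_point) \<le> R}"

lemma exhaust_subset_tube: "exhaust R \<subseteq> tube"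
  by (auto simp: exhaust_def)

text \<open>The inequality 1 <= R * rho_diag w already forces a positive height when R is
  nonnegative. In this form the set is cut out by non-strict inequalities between continuous
  functions on the whole space, hence closed there.\<close>

lemma exhaust_eq: "0 \<le> R \<Longrightarrow> exhaust R = {w. 1 \<le> R * rho_diag w \<and> cmod (rho w base_point) \<le> R}"
proof (intro equalityI subsetI)
  fix w assume "0 \<le> R" "w \<in> {w. 1 \<le> R * rho_diag w \<and> cmod (rho w base_point) \<le> R}"
  then show "w \<in> exhaust R"
    using mult_nonneg_nonpos[of R "rho_diag w"] by (auto simp: exhaust_def mem_tube not_less[symmetric])
qed (auto simp: exhaust_def)

lemma exhaust_mono: "R \<le> S \<Longrightarrow> exhaust R \<subseteq> exhaust S"
proof
  fix w assume "R \<le> S" "w \<in> exhaust R"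
  then show "w \<in> exhaust S"
    unfolding exhaust_def mem_tube
    by (auto intro: order_trans[OF _ mult_right_mono[of R S "rho_diag w"]])
qed

lemma exhaust_cover: "z \<in> tube \<Longrightarrow> z \<in> exhaust (max (1 / rho_diag z) (cmod (rho z base_point)))"
proof -
  assume "z \<in> tube"
  then have "1 / rho_diag z * rho_diag z \<le> max (1 / rho_diag z) (cmod (rho z base_point)) * rho_diag z"
    by (intro mult_right_mono) (auto simp: mem_tube)
  then show ?thesis using \<open>z \<in> tube\<close> by (simp add: exhaust_def mem_tube)
qed

lemma closed_exhaust: "0 \<le> R \<Longrightarrow> closed (exhaust R)"
  by (simp only: exhaust_eq) (intro closed_Collect_conj closed_Collect_le continuous_intros)

text \<open>With \<open>base_point\<close> as second argument, \<open>Re_rho\<close> bounds |w'| and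
  the height; the height plus |Im w'|^2 is Im w_n; and \<open>Im_rho\<close> then bounds Re
  w_n.\<close>

lemma bounded_exhaust: "0 \<le> R \<Longrightarrow> bounded (exhaust R :: (complex^'n::{finite,linorder}) set)"
proof -
  assume R: "0 \<le> R"
  have comp: "cmod (w $ j) \<le> 16 * (R + 1)" if w: "w \<in> exhaust R" for w :: "complex^'n::{finite,linorder}" and j
  proof -
    define J :: "'n::{finite,linorder} set" where "J = UNIV - {last_ix}"
    have wt: "0 < rho_diag w" and wR: "cmod (rho w base_point) \<le> R"
      using w by (auto simp: exhaust_def mem_tube)
    have "(\<Sum>j\<in>J. (cmod (w $ j - base_point $ j))\<^sup>2) = (\<Sum>j\<in>J. (cmod (w $ j))\<^sup>2)"
      by (intro sum.cong) (auto simp: J_def base_point_nth)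
    then have S: "(\<Sum>j\<in>J. (cmod (w $ j))\<^sup>2) \<le> 4 * R" and d: "rho_diag w \<le> 2 * R"
      using Re_rho[of w base_point, folded J_def] wt wR abs_Re_le_cmod[of "rho w base_point"]
        sum_nonneg[of J "\<lambda>j. (cmod (w $ j))\<^sup>2"] by auto
    have sq: "(cmod (w $ j))\<^sup>2 \<le> 4 * R" if "j \<in> J" for j
      using member_le_sum[of j J "\<lambda>j. (cmod (w $ j))\<^sup>2"] that S by auto
    have small: "cmod (w $ j) \<le> 2 * (R + 1)" if "j \<in> J" for j
      proof (rule power2_le_imp_le)
      have "0 \<le> R * R" using R by simp
      then have "4 * R \<le> (2 * (R + 1))\<^sup>2" using R by (simp add: power2_eq_square algebra_simps)
      then show "(cmod (w $ j))\<^sup>2 \<le> (2 * (R + 1))\<^sup>2" using sq[OF that] by linarith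
    qed (use R in simp)
    show ?thesis
    proof (cases "j \<in> J")
      case True
      then show ?thesis using small[OF True] R by (simp add: algebra_simps)
    next
      case False
      then have j: "j = last_ix" by (simp add: J_def)
      have "(\<Sum>j\<in>J. (Im (w $ j))\<^sup>2) \<le> (\<Sum>j\<in>J. (cmod (w $ j))\<^sup>2)"
        by (intro sum_mono) (simp add: cmod_power2)
      moreover have "0 \<le> (\<Sum>j\<in>J. (Im (w $ j))\<^sup>2)" by (simp add: sum_nonneg)
      ultimately have Im: "\<bar>Im (w $ last_ix)\<bar> \<le> 6 * R" using S d wt by (simp add: rho_diag_def[of w, folded J_def])
      have "2 * Im (rho w base_point) = (\<Sum>j\<in>J. Re (w $ j) * Im (w $ j)) - Re (w $ last_ix)"
        unfolding Im_rho J_def[symmetric] by (simp add: base_point_nth, intro sum.cong) (auto simp: J_def)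
      moreover have "\<bar>\<Sum>j\<in>J. Re (w $ j) * Im (w $ j)\<bar> \<le> (\<Sum>j\<in>J. (cmod (w $ j))\<^sup>2)"
      proof (rule sum_abs[THEN order_trans], rule sum_mono)
        show "\<bar>Re (w $ j) * Im (w $ j)\<bar> \<le> (cmod (w $ j))\<^sup>2" for j
          unfolding abs_mult power2_eq_square by (intro mult_mono abs_Re_le_cmod abs_Im_le_cmod) auto
      qed
      ultimately have "\<bar>Re (w $ last_ix)\<bar> \<le> 6 * R"
        using S wR abs_Im_le_cmod[of "rho w base_point"] by linarith
      then show ?thesis using Im cmod_le[of "w $ last_ix"] R by (simp add: j)
    qed
  qed
  show ?thesis
    unfolding bounded_iff
  proof (intro exI ballI)
    fix w :: "complex^'n::{finite,linorder}" assume w: "w \<in> exhaust R"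
    show "norm w \<le> (\<Sum>j\<in>(UNIV::'n::{finite,linorder} set). 16 * (R + 1))"
      unfolding norm_vec_def using comp[OF w] by (intro order_trans[OF L2_set_le_sum] sum_mono) auto
  qed
qed

lemma compact_exhaust: "0 \<le> R \<Longrightarrow> compact (exhaust R)"
  by (simp add: compact_eq_bounded_closed bounded_exhaust closed_exhaust)

lemma compact_subset_exhaust:
  assumes "compact K" "K \<subseteq> tube"
  obtains R where "0 < R" "K \<subseteq> exhaust R"
proof (cases "K = {}")
  case False
  have c: "continuous_on K (\<lambda>z. max (1 / rho_diag z) (cmod (rho z base_point)))"
    using assms by (intro continuous_intros) (auto simp: mem_tube)
  obtain M where M: "\<And>z. z \<in> K \<Longrightarrow> max (1 / rho_diag z) (cmod (rho z base_point)) \<le> M"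
    using continuous_attains_sup[OF assms(1) False c] by blast
  show thesis
  proof
    show "0 < max M 1" by simp
    show "K \<subseteq> exhaust (max M 1)"
    proof
      fix z assume z: "z \<in> K"
      show "z \<in> exhaust (max M 1)"
        using exhaust_cover[of z] exhaust_mono[OF max.coboundedI1[OF M[OF z]], of 1] z assms by blast
    qed
  qed
qed (use that[of 1] in auto)

text \<open>Heights change by a factor at most 4 and |rho . base_point| by a factor at most 20 under
  \<open>near\<close>; the larger of the two serves for both conditions.\<close>

lemma near_exhaust:
  assumes "near z w" "w \<in> exhaust R" "0 \<le> R" shows "z \<in> exhaust (20 * R)"
proof -
  have "1 \<le> R * rho_diag w" using assms by (auto simp: exhaust_def)
  also have "\<dots> \<le> R * (4 * rho_diag z)" using near_rho_diag[OF assms(1)] assms by (intro mult_left_mono) auto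
  also have "\<dots> \<le> R * (20 * rho_diag z)" using near_tube[OF assms(1)] assms by (intro mult_left_mono) (auto simp: mem_tube)
  finally show ?thesis
    using near_rho[OF assms(1), of base_point] near_tube[OF assms(1)] assms by (auto simp: exhaust_def algebra_simps)
qed

text \<open>All points of a compact part of the domain give comparable kernels, uniformly in the
  other argument. The two directions produce 4 + 8 R and 4 + 8 R^2; the common constant dominates
  both.\<close>

lemma exhaust_rho_comparable:
  assumes "z \<in> exhaust R" "w \<in> tube" "0 \<le> R"
  shows "cmod (rho z w) \<le> (4 + 8 * R\<^sup>2 + 8 * R) * cmod (rho base_point w)"
    and "cmod (rho base_point w) \<le> (4 + 8 * R\<^sup>2 + 8 * R) * cmod (rho z w)"
proof -
  have z: "z \<in> tube" "1 \<le> R * rho_diag z" "cmod (rho z base_point) \<le> R" using assms by (auto simp: exhaust_def)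
  have "cmod (rho z w) \<le> (4 + 8 * cmod (rho z base_point)) * cmod (rho base_point w)"
    using rho_quasi_invariant[of z base_point w] z assms by simp
  also have "\<dots> \<le> (4 + 8 * R\<^sup>2 + 8 * R) * cmod (rho base_point w)"
    using z by (intro mult_right_mono) (auto simp: add_increasing)
  finally show "cmod (rho z w) \<le> (4 + 8 * R\<^sup>2 + 8 * R) * cmod (rho base_point w)" .
  have "1 / rho_diag z \<le> R" using z by (simp add: mem_tube divide_le_eq)
  then have "cmod (rho base_point z) * (1 / rho_diag z) \<le> R * R"
    using z assms cmod_rho_commute[of base_point z] by (intro mult_mono) (auto simp: mem_tube)
  then have "4 + 8 * cmod (rho base_point z) / rho_diag z \<le> 4 + 8 * R\<^sup>2 + 8 * R"
    using assms by (simp add: power2_eq_square)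
  then have "(4 + 8 * cmod (rho base_point z) / rho_diag z) * cmod (rho z w)
    \<le> (4 + 8 * R\<^sup>2 + 8 * R) * cmod (rho z w)" by (intro mult_right_mono) auto
  then show "cmod (rho base_point w) \<le> (4 + 8 * R\<^sup>2 + 8 * R) * cmod (rho z w)"
    using rho_quasi_invariant[of base_point z w] z assms by simp
qed

section \<open>Symmetries of Lebesgue measure\<close>

lemma nn_integral_lborel_translate:
  fixes f :: "'a::euclidean_space \<Rightarrow> ennreal"
  assumes [measurable]: "f \<in> borel_measurable borel"
  shows "(\<integral>\<^sup>+x. f (x + c) \<partial>lborel) = (\<integral>\<^sup>+x. f x \<partial>lborel)"
proof -
  have "(\<integral>\<^sup>+x. f x \<partial>lborel) = (\<integral>\<^sup>+x. f x \<partial>distr lborel borel ((+) c))"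
    by (simp add: lborel_distr_plus)
  then show ?thesis
    by (simp add: nn_integral_distr add.commute)
qed

text \<open>
  A measure \<open>\<nu>\<close> that is invariant under translations satisfies \<open>\<nu>(A) |B| = \<nu>(-B) |A|\<close>, by Tonelli;
  with \<open>B\<close> the unit ball this determines the image of Lebesgue measure under an isometry.
\<close>

lemma nn_integral_lborel_isometry:
  fixes L :: "'a::euclidean_space \<Rightarrow> 'a"
  assumes L: "linear L" "\<And>x. norm (L x) = norm x" and [measurable]: "f \<in> borel_measurable borel"
  shows "(\<integral>\<^sup>+x. f (L x) \<partial>lborel) = (\<integral>\<^sup>+x. f x \<partial>lborel)"
proof -
  have [measurable]: "L \<in> borel_measurable borel"
    using linear_continuous_on[OF linear_conv_bounded_linear[THEN iffD1, OF L(1)], of UNIV]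
    by (rule borel_measurable_continuous_onI)
  have "inj L" using L by (simp add: linear_injective_0) (metis norm_eq_zero)
  then have "surj L" using L(1) by (simp add: linear_injective_imp_surjective)
  then obtain L' where L': "\<And>y. L (L' y) = y" by (metis surjD)
  interpret linear L by fact
  define B where "B = ball (0::'a) 1"
  have B [measurable]: "B \<in> sets borel" by (simp add: B_def)
  have LB: "- L x \<in> B \<longleftrightarrow> x \<in> B" for x by (simp add: B_def L)
  have B0: "emeasure lborel B \<noteq> 0" "emeasure lborel B \<noteq> \<infinity>"
    using content_ball_pos[of 1 "0::'a"] by (auto simp: B_def measure_def emeasure_lborel_ball_finite less_top[symmetric] enn2real_eq_0_iff)
  have "emeasure (distr lborel borel L) A = emeasure lborel A" if [measurable]: "A \<in> sets borel" for A
  proof -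
    have "emeasure (distr lborel borel L) A * emeasure lborel B
      = (\<integral>\<^sup>+x. (\<integral>\<^sup>+y. indicator A (L x) * indicator B y \<partial>lborel) \<partial>lborel)"
    proof -
      have "emeasure (distr lborel borel L) A = (\<integral>\<^sup>+x. indicator A (L x) \<partial>lborel)"
        using nn_integral_distr[of L lborel borel "indicator A"] by simp
      then show ?thesis
        by (simp add: nn_integral_cmult nn_integral_multc)
    qed
    also have "\<dots> = (\<integral>\<^sup>+x. (\<integral>\<^sup>+y. indicator A (L x) * indicator B (y + - L x) \<partial>lborel) \<partial>lborel)"
      by (subst nn_integral_lborel_translate[of "\<lambda>y. indicator A _ * indicator B y"]) auto
    also have "\<dots> = (\<integral>\<^sup>+y. (\<integral>\<^sup>+x. indicator A (L x) * indicator B (y + - L x) \<partial>lborel) \<partial>lborel)"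
      by (rule lborel_pair.Fubini') measurable
    \<comment> \<open>Translating x by L' y moves y from the argument of B to that of A, because L
      (L' y) = y.\<close>
    also have "\<dots> = (\<integral>\<^sup>+y. (\<integral>\<^sup>+x. indicator A (L (x + L' y)) * indicator B (y + - L (x + L' y)) \<partial>lborel) \<partial>lborel)"
      by (subst nn_integral_lborel_translate[of "\<lambda>x. indicator A (L x) * indicator B (_ + - L x)"]) auto
    also have "\<dots> = (\<integral>\<^sup>+y. (\<integral>\<^sup>+x. indicator A (y + L x) * indicator B x \<partial>lborel) \<partial>lborel)"
      by (simp add: add L' LB indicator_def add.commute)
    also have "\<dots> = (\<integral>\<^sup>+x. (\<integral>\<^sup>+y. indicator A (y + L x) * indicator B x \<partial>lborel) \<partial>lborel)"
      by (rule lborel_pair.Fubini') measurable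
    also have "\<dots> = (\<integral>\<^sup>+x. (\<integral>\<^sup>+y. indicator A y * indicator B x \<partial>lborel) \<partial>lborel)"
      by (subst nn_integral_lborel_translate[of "\<lambda>y. indicator A y * indicator B _"]) auto
    also have "\<dots> = emeasure lborel A * emeasure lborel B"
      by (simp add: nn_integral_cmult nn_integral_multc)
    finally show ?thesis
      using B0 by (simp add: ennreal_mult_cancel_left mult.commute[of _ "emeasure lborel B"])
  qed
  then have "distr lborel borel L = lborel"
    by (intro measure_eqI) auto
  then show ?thesis
    using nn_integral_distr[of L lborel borel f] by simp
qed

text \<open>A shear is a translation by an amount that depends on the point. Averaging over t in
  [0,1] adds a free variable along e: shifting x by t e and then t by l x, both harmless because l
  is constant along e, turns the shear into translations that Tonelli can integrate out.\<close>

lemma nn_integral_lborel_shear: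
  fixes f :: "'a::euclidean_space \<Rightarrow> ennreal" and l :: "'a \<Rightarrow> real"
  assumes [measurable]: "f \<in> borel_measurable borel" "l \<in> borel_measurable borel"
    and l: "\<And>x t. l (x + t *\<^sub>R e) = l x"
  shows "(\<integral>\<^sup>+x. f (x + l x *\<^sub>R e) \<partial>lborel) = (\<integral>\<^sup>+x. f x \<partial>lborel)"
proof -
  define c :: "real \<Rightarrow> ennreal" where "c = indicator {0..1}"
  have [measurable]: "c \<in> borel_measurable borel" by (simp add: c_def)
  have c: "(\<integral>\<^sup>+t. c t \<partial>lborel) = 1" by (simp add: c_def)
  have "(\<integral>\<^sup>+x. f (x + l x *\<^sub>R e) \<partial>lborel) = (\<integral>\<^sup>+x. (\<integral>\<^sup>+t. c t * f (x + l x *\<^sub>R e) \<partial>lborel) \<partial>lborel)"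
    by (simp add: nn_integral_multc c)
  also have "\<dots> = (\<integral>\<^sup>+t. (\<integral>\<^sup>+x. c t * f (x + l x *\<^sub>R e) \<partial>lborel) \<partial>lborel)"
    by (rule lborel_pair.Fubini') measurable
  also have "\<dots> = (\<integral>\<^sup>+t. (\<integral>\<^sup>+x. c t * f ((x + t *\<^sub>R e) + l (x + t *\<^sub>R e) *\<^sub>R e) \<partial>lborel) \<partial>lborel)"
    by (subst nn_integral_lborel_translate[of "\<lambda>x. c _ * f (x + l x *\<^sub>R e)"]) auto
  also have "\<dots> = (\<integral>\<^sup>+t. (\<integral>\<^sup>+x. c t * f (x + (t + l x) *\<^sub>R e) \<partial>lborel) \<partial>lborel)"
    by (simp add: l scaleR_add_left add.assoc)
  also have "\<dots> = (\<integral>\<^sup>+x. (\<integral>\<^sup>+t. c t * f (x + (t + l x) *\<^sub>R e) \<partial>lborel) \<partial>lborel)"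
    by (rule lborel_pair.Fubini') measurable
  also have "\<dots> = (\<integral>\<^sup>+x. (\<integral>\<^sup>+t. c (t + - l x) * f (x + ((t + - l x) + l x) *\<^sub>R e) \<partial>lborel) \<partial>lborel)"
    by (subst nn_integral_lborel_translate[of "\<lambda>t. c t * f (_ + (t + l _) *\<^sub>R e)"]) auto
  also have "\<dots> = (\<integral>\<^sup>+x. (\<integral>\<^sup>+t. c (t - l x) * f (x + t *\<^sub>R e) \<partial>lborel) \<partial>lborel)"
    by simp
  also have "\<dots> = (\<integral>\<^sup>+t. (\<integral>\<^sup>+x. c (t - l x) * f (x + t *\<^sub>R e) \<partial>lborel) \<partial>lborel)"
    by (rule lborel_pair.Fubini') measurable
  also have "\<dots> = (\<integral>\<^sup>+t. (\<integral>\<^sup>+x. c (t - l (x + t *\<^sub>R e)) * f (x + t *\<^sub>R e) \<partial>lborel) \<partial>lborel)"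
    by (simp add: l)
  also have "\<dots> = (\<integral>\<^sup>+t. (\<integral>\<^sup>+x. c (t - l x) * f x \<partial>lborel) \<partial>lborel)"
    by (subst nn_integral_lborel_translate[of "\<lambda>x. c (_ - l x) * f x"]) auto
  also have "\<dots> = (\<integral>\<^sup>+x. (\<integral>\<^sup>+t. c (t - l x) * f x \<partial>lborel) \<partial>lborel)"
    by (rule lborel_pair.Fubini') measurable
  also have "\<dots> = (\<integral>\<^sup>+x. (\<integral>\<^sup>+t. c t * f x \<partial>lborel) \<partial>lborel)"
    using nn_integral_lborel_translate[of "\<lambda>t. c t * f _" "- l _"] by simp
  also have "\<dots> = (\<integral>\<^sup>+x. f x \<partial>lborel)"
    by (simp add: nn_integral_multc c)
  finally show ?thesis .
qed

lemma nn_integral_lborel_diagonal: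
  fixes f :: "'a::euclidean_space \<Rightarrow> ennreal" and c :: "'a \<Rightarrow> real"
  assumes c: "\<And>b. b \<in> Basis \<Longrightarrow> 0 < c b" and T: "\<And>x b. b \<in> Basis \<Longrightarrow> T x \<bullet> b = c b * (x \<bullet> b)"
    and [measurable]: "f \<in> borel_measurable borel"
  shows "(\<integral>\<^sup>+x. f x \<partial>lborel) = ennreal (\<Prod>b\<in>Basis. c b) * (\<integral>\<^sup>+x. f (T x) \<partial>lborel)"
proof -
  have T: "T = (\<lambda>x. 0 + (\<Sum>j\<in>Basis. (c j * (x \<bullet> j)) *\<^sub>R j))"
    by (intro ext, rule euclidean_eqI) (simp add: T)
  have [measurable]: "T \<in> borel_measurable borel" unfolding T by measurable
  have "(\<Prod>b\<in>Basis. \<bar>c b\<bar>) = (\<Prod>b\<in>Basis. c b)"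
    using c by (intro prod.cong) (auto simp: less_imp_le)
  then have "lborel = density (distr lborel borel T) (\<lambda>_. ennreal (\<Prod>b\<in>Basis. c b))"
    using lborel_affine_euclidean[of c 0, folded T] c by force
  then have "(\<integral>\<^sup>+x. f x \<partial>lborel) = (\<integral>\<^sup>+x. f x \<partial>density (distr lborel borel T) (\<lambda>_. ennreal (\<Prod>b\<in>Basis. c b)))"
    by simp
  also have "\<dots> = ennreal (\<Prod>b\<in>Basis. c b) * (\<integral>\<^sup>+x. f (T x) \<partial>lborel)"
    by (simp add: nn_integral_density nn_integral_distr nn_integral_cmult)
  finally show ?thesis .
qed

section \<open>Measurability of rho, and parabolic dilations\<close>

lemma borel_measurable_rho_diag [measurable]: "rho_diag \<in> borel_measurable borel"
  by (intro borel_measurable_continuous_onI continuous_intros)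

lemma borel_measurable_rho [measurable]:
  assumes [measurable]: "f \<in> borel_measurable M" "g \<in> borel_measurable M"
  shows "(\<lambda>x. rho (f x) (g x)) \<in> borel_measurable M"
  by (rule borel_measurable_continuous_Pair) (auto intro!: continuous_intros)

lemma tube_sets [measurable]: "tube \<in> sets borel"
  by (simp add: borel_open)

text \<open>The non-isotropic dilation for which \<open>rho\<close> and \<open>rho_diag\<close> are
  homogeneous of degree 2.\<close>

definition parabolic_dilation :: "real \<Rightarrow> complex^'n::{finite,linorder} \<Rightarrow> complex^'n::{finite,linorder}" where
  "parabolic_dilation d z = (\<chi> j. if j = last_ix then of_real (d\<^sup>2) * z $ j else of_real d * z $ j)"

text \<open>Two real coordinates scale by d^2 and the other 2n - 2 by d. The homogeneous dimension
  is thus 2n + 2, and half of it is the exponent n + 1 seen throughout.\<close>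

lemma nn_integral_parabolic_dilation:
  fixes f :: "complex^'n::{finite,linorder} \<Rightarrow> ennreal"
  assumes d: "0 < d" and [measurable]: "f \<in> borel_measurable borel"
  shows "(\<integral>\<^sup>+x. f x \<partial>lborel)
    = ennreal (d powr (2 * (real CARD('n) + 1))) * (\<integral>\<^sup>+x. f (parabolic_dilation d x) \<partial>lborel)"
proof -
  define F :: "(complex^'n::{finite,linorder}) set" where "F = {axis last_ix 1, axis last_ix \<i>}"
  define c where "c b = (if b \<in> F then d\<^sup>2 else d)" for b
  have F: "F \<subseteq> Basis" "card F = 2"
    by (auto simp: F_def Basis_vec_def Basis_complex_def axis_eq_axis)
  have inF: "axis j u \<in> F \<longleftrightarrow> j = last_ix" if "u \<in> Basis" for j and u :: complex
    using that by (auto simp: F_def axis_eq_axis Basis_complex_def)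
  have prod: "(\<Prod>b\<in>Basis. c b) = d powr (2 * (real CARD('n) + 1))"
  proof -
    have "(\<Prod>b\<in>Basis. c b) = (\<Prod>b\<in>F. c b) * (\<Prod>b\<in>Basis - F. c b)"
      by (subst prod.subset_diff[OF F(1)]) (auto simp: mult.commute)
    also have "\<dots> = (d\<^sup>2) ^ 2 * d ^ (2 * CARD('n) - 2)"
      using F by (simp add: c_def card_Diff_subset finite_subset[OF F(1)] mult.commute)
    also have "\<dots> = d ^ (2 * (CARD('n) + 1))"
    proof -
      have "2 * (CARD('n) + 1) = 4 + (2 * CARD('n) - 2)"
        using zero_less_card_finite[where 'a='n] by (cases "CARD('n)") auto
      moreover have "(d\<^sup>2) ^ 2 = d ^ 4" by simp
      ultimately show ?thesis by (simp only: power_add)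
    qed
    also have "\<dots> = d powr (2 * (real CARD('n) + 1))"
      using d by (subst powr_realpow[symmetric]) (auto simp: add.commute)
    finally show ?thesis .
  qed
  have "parabolic_dilation d x \<bullet> b = c b * (x \<bullet> b)" if "b \<in> Basis" for x b
    using that by (auto simp: Basis_vec_def parabolic_dilation_def c_def inF inner_axis inner_complex_def distrib_left)
  moreover have "0 < c b" for b
    using d by (simp add: c_def)
  ultimately show ?thesis
    unfolding prod[symmetric] by (intro nn_integral_lborel_diagonal) auto
qed

section \<open>The Forelli-Rudin estimate\<close>

lemma summable_geometric_powr:
  fixes e :: real assumes "e < 0" shows "summable (\<lambda>k. (2 powr e) ^ k)"
proof -
  have "2 powr e < (1::real)" using assms powr_less_mono[of e 0 2] by simp
  then show ?thesis by (intro summable_geometric) simp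
qed

lemma borel_measurable_vec_nth [measurable (raw)]:
  fixes f :: "'a \<Rightarrow> 'b::euclidean_space ^ 'n"
  assumes [measurable]: "f \<in> borel_measurable M"
  shows "(\<lambda>x. f x $ j) \<in> borel_measurable M"
  by (rule borel_measurable_continuous_on[of "\<lambda>v. v $ j"]) (auto intro!: continuous_intros)

text \<open>In the coordinates (w' - z', 2 Im (rho z w) + i rho_diag w) the set of w with |rho z w|
  < R lies in this box: |w_j - z_j|^2 < 4 R by \<open>Re_rho\<close>, and the height is below 2
  R.\<close>

definition parabolic_box :: "real \<Rightarrow> (complex^'n::{finite,linorder}) set" where
  "parabolic_box R = {z. (\<forall>j. j \<noteq> last_ix \<longrightarrow> cmod (z $ j) < 2 * sqrt R)
     \<and> \<bar>Re (z $ last_ix)\<bar> < 2 * R \<and> 0 < Im (z $ last_ix) \<and> Im (z $ last_ix) < 2 * R}"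

lemma parabolic_box_sets [measurable]: "parabolic_box R \<in> sets borel"
  unfolding parabolic_box_def by measurable

lemma finite_parabolic_box: "emeasure lborel (parabolic_box R :: (complex^'n::{finite,linorder}) set) < \<infinity>"
proof -
  have "parabolic_box R \<subseteq> (cball 0 (\<Sum>j\<in>(UNIV::'n set). 2 * sqrt \<bar>R\<bar> + 4 * \<bar>R\<bar>) :: (complex^'n::{finite,linorder}) set)"
  proof
    fix z :: "complex^'n::{finite,linorder}" assume z: "z \<in> parabolic_box R"
    have "cmod (z $ j) \<le> 2 * sqrt \<bar>R\<bar> + 4 * \<bar>R\<bar>" for j
    proof (cases "j = last_ix")
      case True
      have "0 < R" using z by (simp add: parabolic_box_def)
      then have "0 \<le> sqrt \<bar>R\<bar>" "\<bar>R\<bar> = R" by simp_all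
      moreover have "\<bar>Re (z $ j)\<bar> < 2 * R" "\<bar>Im (z $ j)\<bar> < 2 * R"
        using z True by (auto simp: parabolic_box_def)
      ultimately show ?thesis
        using cmod_le[of "z $ j"] by linarith
    next
      case False
      then have "cmod (z $ j) < 2 * sqrt R" using z by (simp add: parabolic_box_def)
      moreover have "sqrt R \<le> sqrt \<bar>R\<bar>" by simp
      ultimately show ?thesis using abs_ge_zero[of R] by linarith
    qed
    then have "norm z \<le> (\<Sum>j\<in>(UNIV::'n set). 2 * sqrt \<bar>R\<bar> + 4 * \<bar>R\<bar>)"
      unfolding norm_vec_def by (intro order_trans[OF L2_set_le_sum] sum_mono) auto
    then show "z \<in> cball 0 (\<Sum>j\<in>(UNIV::'n set). 2 * sqrt \<bar>R\<bar> + 4 * \<bar>R\<bar>)" by simp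
  qed
  then have "emeasure lborel (parabolic_box R :: (complex^'n::{finite,linorder}) set)
    \<le> emeasure lborel (cball 0 (\<Sum>j\<in>(UNIV::'n set). 2 * sqrt \<bar>R\<bar> + 4 * \<bar>R\<bar>) :: (complex^'n::{finite,linorder}) set)"
    by (intro emeasure_mono) auto
  then show ?thesis
    using emeasure_lborel_cball_finite le_less_trans by blast
qed

text \<open>For negative s the weight blows up at Im z_n = 0. Scaling Im z_n alone by 2^(-k) maps
  the slab \<open>D 0\<close> onto \<open>D k\<close> and multiplies its contribution by 2^(-k (1 +
  s)), a convergent geometric series because s > -1.\<close>

lemma finite_weight_parabolic_box:
  assumes s: "-1 < s"
  shows "(\<integral>\<^sup>+z. ennreal (Im (z $ last_ix) powr s) * indicator (parabolic_box 1) z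
    \<partial>(lborel :: (complex^'n::{finite,linorder}) measure)) < \<infinity>"
proof -
  let ?M = "lborel :: (complex^'n::{finite,linorder}) measure"
  define Q where "Q = {z :: complex^'n::{finite,linorder}. (\<forall>j. j \<noteq> last_ix \<longrightarrow> cmod (z $ j) < 2) \<and> \<bar>Re (z $ last_ix)\<bar> < 2}"
  define D where "D k = {z :: complex^'n::{finite,linorder}. z \<in> Q \<and> (1/2) ^ k \<le> Im (z $ last_ix) \<and> Im (z $ last_ix) < 2 * (1/2) ^ k}" for k :: nat
  have Q [measurable]: "Q \<in> sets borel"
    unfolding Q_def by measurable
  have [measurable]: "D k \<in> sets borel" for k
    unfolding D_def by measurable
  define I where "I k = (\<integral>\<^sup>+z. ennreal (Im (z $ last_ix) powr s) * indicator (D k) z \<partial>?M)" for k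
  have I: "I k = ennreal ((2 powr (- (1 + s))) ^ k) * I 0" for k
  proof -
    define c where "c b = (if b = axis last_ix \<i> then (1/2) ^ k else 1 :: real)" for b :: "complex^'n::{finite,linorder}"
    define T where "T z = (\<chi> j. if j = last_ix then Complex (Re (z $ j)) ((1/2) ^ k * Im (z $ j)) else z $ j)" for z :: "complex^'n::{finite,linorder}"
    have e: "axis last_ix \<i> \<in> (Basis :: (complex^'n::{finite,linorder}) set)"
      by (auto simp: Basis_vec_def Basis_complex_def)
    have prod: "(\<Prod>b\<in>Basis. c b) = (1/2) ^ k"
      unfolding c_def using e by (subst prod.delta) auto
    have T: "T z \<bullet> b = c b * (z \<bullet> b)" if "b \<in> Basis" for z b
      using that by (auto simp: Basis_vec_def Basis_complex_def T_def c_def inner_axis inner_complex_def axis_eq_axis)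
    have "I k = ennreal ((1/2) ^ k) * (\<integral>\<^sup>+z. ennreal (Im (T z $ last_ix) powr s) * indicator (D k) (T z) \<partial>?M)"
      unfolding I_def prod[symmetric] by (rule nn_integral_lborel_diagonal) (auto simp: T c_def)
    also have "(\<lambda>z. ennreal (Im (T z $ last_ix) powr s) * indicator (D k) (T z))
      = (\<lambda>z. ennreal (((1/2) ^ k) powr s) * (ennreal (Im (z $ last_ix) powr s) * indicator (D 0) z))"
    proof
      fix z
      have "T z \<in> D k \<longleftrightarrow> z \<in> D 0"
        by (auto simp: D_def Q_def T_def)
      moreover have "Im (T z $ last_ix) powr s = ((1/2) ^ k) powr s * Im (z $ last_ix) powr s" if "z \<in> D 0"
        using that by (simp add: T_def D_def powr_mult)
      ultimately show "ennreal (Im (T z $ last_ix) powr s) * indicator (D k) (T z)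
        = ennreal (((1/2) ^ k) powr s) * (ennreal (Im (z $ last_ix) powr s) * indicator (D 0) z)"
        by (auto simp: indicator_def ennreal_mult)
    qed
    also have "ennreal ((1/2) ^ k) * (\<integral>\<^sup>+z. ennreal (((1/2) ^ k) powr s) * (ennreal (Im (z $ last_ix) powr s) * indicator (D 0) z) \<partial>?M)
      = ennreal ((1/2) ^ k * ((1/2) ^ k) powr s) * I 0"
      by (simp add: nn_integral_cmult I_def ennreal_mult mult.assoc)
    also have "(1/2) ^ k * ((1/2) ^ k) powr s = (2 powr (- (1 + s))) ^ k"
    proof -
      have "(1/2::real) ^ k = 2 powr (- real k)"
        by (simp add: powr_minus powr_realpow power_one_over inverse_eq_divide)
      moreover have "(2 powr (- (1 + s))) ^ k = (2 powr (- (1 + s))) powr real k"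
        by (rule powr_realpow[symmetric]) simp
      ultimately show ?thesis
        by (simp only: powr_powr powr_add[symmetric]) (simp add: algebra_simps)
    qed
    finally show ?thesis by simp
  qed
  have "I 0 \<le> (\<integral>\<^sup>+z. ennreal (2 powr \<bar>s\<bar>) * indicator (parabolic_box 1) z \<partial>?M)"
    unfolding I_def
  proof (rule nn_integral_mono)
    fix z :: "complex^'n::{finite,linorder}"
    have "Im (z $ last_ix) powr s \<le> 2 powr \<bar>s\<bar>" if "z \<in> D 0"
      using powr_comparable[of "Im (z $ last_ix)" 1 2 s] that by (simp add: D_def)
    then show "ennreal (Im (z $ last_ix) powr s) * indicator (D 0) z \<le> ennreal (2 powr \<bar>s\<bar>) * indicator (parabolic_box 1) z"
      by (auto simp: indicator_def D_def Q_def parabolic_box_def intro!: ennreal_leI)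
  qed
  also have "\<dots> < \<infinity>"
    using finite_parabolic_box[of 1, where 'n='n] by (simp add: nn_integral_cmult ennreal_mult_less_top)
  finally have I0: "I 0 < \<infinity>" .
  have "(\<integral>\<^sup>+z. ennreal (Im (z $ last_ix) powr s) * indicator (parabolic_box 1) z \<partial>?M)
    \<le> (\<integral>\<^sup>+z. (\<Sum>k. ennreal (Im (z $ last_ix) powr s) * indicator (D k) z) \<partial>?M)"
  proof (rule nn_integral_mono)
    fix z :: "complex^'n::{finite,linorder}"
    show "ennreal (Im (z $ last_ix) powr s) * indicator (parabolic_box 1) z
      \<le> (\<Sum>k. ennreal (Im (z $ last_ix) powr s) * indicator (D k) z)"
    proof (cases "z \<in> parabolic_box 1")
      case True
      define y where "y = Im (z $ last_ix)"
      have y: "0 < y" "y < 2" using True by (auto simp: y_def parabolic_box_def)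
      have ex: "\<exists>k. (1/2) ^ k \<le> y"
        using real_arch_pow_inv[of y "1/2"] y less_imp_le by auto
      \<comment> \<open>The first k with 2^(-k) <= y also gives y < 2 * 2^(-k); for k = 0 this is
        the bound y < 2 built into the box.\<close>
      define k where "k = (LEAST k. (1/2) ^ k \<le> y)"
      have k: "(1/2) ^ k \<le> y" unfolding k_def using ex by (rule LeastI_ex)
      have "y < 2 * (1/2) ^ k"
      proof (cases k)
        case (Suc m)
        then have "\<not> (1/2) ^ m \<le> y" using not_less_Least[of m "\<lambda>k. (1/2) ^ k \<le> y"] by (simp add: k_def)
        then show ?thesis by (simp add: Suc)
      qed (use y in simp)
      then have "z \<in> D k" using k True by (auto simp: D_def Q_def y_def parabolic_box_def)
      then show ?thesis
        using True sum_le_suminf[of "\<lambda>k. ennreal (Im (z $ last_ix) powr s) * indicator (D k) z" "{k}"] by simp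
    qed simp
  qed
  also have "\<dots> = (\<Sum>k. I k)"
    unfolding I_def by (rule nn_integral_suminf) measurable
  also have "\<dots> = (\<Sum>k. ennreal ((2 powr (- (1 + s))) ^ k)) * I 0"
    by (subst I) simp
  also have "(\<Sum>k. ennreal ((2 powr (- (1 + s))) ^ k)) = ennreal (\<Sum>k. (2 powr (- (1 + s))) ^ k)"
    using s by (intro suminf_ennreal2 summable_geometric_powr) auto
  also have "\<dots> * I 0 < \<infinity>"
    using I0 by (simp add: ennreal_mult_less_top)
  finally show ?thesis .
qed

text \<open>The dilation by sqrt R carries the unit box to the box of size R; the Jacobian
  contributes n + 1 and the weight s to the exponent.\<close>

lemma weight_parabolic_box:
  assumes s: "-1 < s"
  obtains C where "0 \<le> C" "\<And>R. 0 < R \<Longrightarrow>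
    (\<integral>\<^sup>+z. ennreal (Im (z $ last_ix) powr s) * indicator (parabolic_box R) z
      \<partial>(lborel :: (complex^'n::{finite,linorder}) measure)) = ennreal (C * R powr (real CARD('n) + 1 + s))"
proof -
  let ?M = "lborel :: (complex^'n::{finite,linorder}) measure"
  define C where "C = (\<integral>\<^sup>+z. ennreal (Im (z $ last_ix) powr s) * indicator (parabolic_box 1) z \<partial>?M)"
  have C: "C = ennreal (enn2real C)"
    using finite_weight_parabolic_box[OF s, where 'n='n] by (simp add: C_def)
  show thesis
  proof (rule that)
    fix R :: real assume R: "0 < R"
    define d where "d = sqrt R"
    have d: "0 < d" "d\<^sup>2 = R" using R by (auto simp: d_def)
    have box: "parabolic_dilation d z \<in> parabolic_box R \<longleftrightarrow> z \<in> parabolic_box 1" for z :: "complex^'n::{finite,linorder}"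
      using d R by (auto simp: parabolic_box_def parabolic_dilation_def norm_mult abs_mult zero_less_mult_iff d_def[symmetric])
    have "(\<integral>\<^sup>+z. ennreal (Im (z $ last_ix) powr s) * indicator (parabolic_box R) z \<partial>?M)
      = ennreal (d powr (2 * (real CARD('n) + 1))) *
        (\<integral>\<^sup>+z. ennreal (Im (parabolic_dilation d z $ last_ix) powr s) * indicator (parabolic_box R) (parabolic_dilation d z) \<partial>?M)"
      by (rule nn_integral_parabolic_dilation[OF d(1)]) measurable
    also have "(\<lambda>z. ennreal (Im (parabolic_dilation d z $ last_ix) powr s) * indicator (parabolic_box R) (parabolic_dilation d z))
      = (\<lambda>z. ennreal (R powr s) * (ennreal (Im (z $ last_ix) powr s) * indicator (parabolic_box 1) (z :: complex^'n::{finite,linorder})))"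
    proof
      fix z :: "complex^'n::{finite,linorder}"
      have "Im (parabolic_dilation d z $ last_ix) = R * Im (z $ last_ix)"
        using d by (simp add: parabolic_dilation_def)
      moreover have "0 < Im (z $ last_ix)" if "z \<in> parabolic_box 1"
        using that by (simp add: parabolic_box_def)
      ultimately show "ennreal (Im (parabolic_dilation d z $ last_ix) powr s) * indicator (parabolic_box R) (parabolic_dilation d z)
        = ennreal (R powr s) * (ennreal (Im (z $ last_ix) powr s) * indicator (parabolic_box 1) z)"
        using R by (auto simp: indicator_def box powr_mult ennreal_mult)
    qed
    also have "ennreal (d powr (2 * (real CARD('n) + 1))) * (\<integral>\<^sup>+z. ennreal (R powr s) * (ennreal (Im (z $ last_ix) powr s) * indicator (parabolic_box 1) z) \<partial>?M)
      = ennreal (d powr (2 * (real CARD('n) + 1)) * R powr s * enn2real C)"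
      by (simp add: nn_integral_cmult C_def[symmetric] ennreal_mult mult.assoc C[symmetric])
    also have "d powr (2 * (real CARD('n) + 1)) = R powr (real CARD('n) + 1)"
      using R by (simp add: d_def powr_half_sqrt[symmetric] powr_powr add_divide_distrib)
    finally show "(\<integral>\<^sup>+z. ennreal (Im (z $ last_ix) powr s) * indicator (parabolic_box R) z \<partial>?M)
      = ennreal (enn2real C * R powr (real CARD('n) + 1 + s))"
      by (simp add: powr_add mult_ac)
  qed simp
qed

text \<open>The straightening map \<open>P\<close>, two shears followed by a translation, preserves
  Lebesgue measure and sends w to (w' - z', 2 Im (rho z w) + i rho_diag w). The ball about any z
  lands in the same box and the weight becomes a power of the last imaginary part, so the bound is
  uniform in z.\<close>

lemma weight_rho_ball:
  assumes s: "-1 < s"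
  obtains C where "0 \<le> C" "\<And>z R. z \<in> tube \<Longrightarrow> 0 < R \<Longrightarrow>
    (\<integral>\<^sup>+w. ennreal (rho_diag w powr s) * indicator {w \<in> tube. cmod (rho z w) < R} w
      \<partial>(lborel :: (complex^'n::{finite,linorder}) measure)) \<le> ennreal (C * R powr (real CARD('n) + 1 + s))"
proof -
  let ?M = "lborel :: (complex^'n::{finite,linorder}) measure"
  obtain C where C: "0 \<le> C" "\<And>R. 0 < R \<Longrightarrow>
    (\<integral>\<^sup>+z. ennreal (Im (z $ last_ix) powr s) * indicator (parabolic_box R) z \<partial>?M) = ennreal (C * R powr (real CARD('n) + 1 + s))"
    by (rule weight_parabolic_box[OF s, where 'n='n]) blast
  show thesis
  proof (rule that[OF C(1)])
    fix z :: "complex^'n::{finite,linorder}" and R :: real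
    assume z: "z \<in> tube" and R: "0 < R"
    define g where "g v = ennreal (Im (v $ last_ix) powr s) * indicator (parabolic_box R) v" for v :: "complex^'n::{finite,linorder}"
    have [measurable]: "g \<in> borel_measurable borel" unfolding g_def by measurable
    \<comment> \<open>The translation subtracts z but keeps the last imaginary part: that coordinate
      must end up as \<open>rho_diag w\<close> itself, not as a difference.\<close>
    define t where "t = axis last_ix (\<i> * of_real (Im (z $ last_ix))) - z"
    define l1 where "l1 w = - (\<Sum>j\<in>UNIV - {last_ix}. (Re (w $ j) - Re (z $ j)) * (Im (z $ j) + Im (w $ j)))" for w :: "complex^'n::{finite,linorder}"
    define l2 where "l2 w = - (\<Sum>j\<in>UNIV - {last_ix}. (Im (w $ j))\<^sup>2)" for w :: "complex^'n::{finite,linorder}"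
    define A1 where "A1 w = w + l1 w *\<^sub>R axis last_ix 1" for w :: "complex^'n::{finite,linorder}"
    define A2 where "A2 w = w + l2 w *\<^sub>R axis last_ix \<i>" for w :: "complex^'n::{finite,linorder}"
    have [measurable]: "l1 \<in> borel_measurable borel" "l2 \<in> borel_measurable borel"
      unfolding l1_def l2_def by measurable
    have [measurable]: "A1 \<in> borel_measurable borel" "A2 \<in> borel_measurable borel"
      unfolding A1_def A2_def by measurable
    have nth: "(w + a *\<^sub>R axis last_ix b) $ j = (if j = last_ix then w $ j + a *\<^sub>R b else w $ j)" for w :: "complex^'n::{finite,linorder}" and a b j
      by (simp add: axis_def)
    have inv: "l1 (w + a *\<^sub>R axis last_ix b) = l1 w" "l2 (w + a *\<^sub>R axis last_ix b) = l2 w" for w a b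
      unfolding l1_def l2_def nth by (auto intro!: sum.cong)
    define P where "P w = A1 (A2 w) + t" for w
    have P: "P w $ j = (if j = last_ix then Complex (2 * Im (rho z w)) (rho_diag w) else w $ j - z $ j)" for w j
    proof (cases "j = last_ix")
      case True
      have "P w $ j = w $ j + l2 w *\<^sub>R \<i> + l1 w *\<^sub>R 1 + (\<i> * of_real (Im (z $ j)) - z $ j)"
      proof -
        have "P w = (w + l2 w *\<^sub>R axis last_ix \<i>) + l1 w *\<^sub>R axis last_ix 1 + t"
          by (simp add: P_def A1_def A2_def inv)
        then show ?thesis by (simp add: True t_def axis_def)
      qed
      moreover have "2 * Im (rho z w) = (Re (w $ last_ix) - Re (z $ last_ix)) + l1 w"
        unfolding Im_rho l1_def by (simp add: algebra_simps sum.distrib sum_subtractf)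
      moreover have "rho_diag w = Im (w $ last_ix) + l2 w"
        by (simp add: rho_diag_def l2_def)
      ultimately show ?thesis using True by (auto intro!: complex_eqI)
    next
      case False
      then show ?thesis by (simp add: P_def A1_def A2_def t_def axis_def)
    qed
    have le: "ennreal (rho_diag w powr s) * indicator {w \<in> tube. cmod (rho z w) < R} w \<le> g (P w)" for w
    proof (cases "w \<in> tube \<and> cmod (rho z w) < R")
      case True
      have "cmod (w $ j - z $ j) < 2 * sqrt R" if j: "j \<noteq> last_ix" for j
      proof -
        have "(cmod (w $ j - z $ j))\<^sup>2 \<le> (\<Sum>j\<in>UNIV - {last_ix}. (cmod (z $ j - w $ j))\<^sup>2)"
          using j member_le_sum[of j "UNIV - {last_ix}" "\<lambda>j. (cmod (z $ j - w $ j))\<^sup>2"] by (simp add: norm_minus_commute)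
        also have "\<dots> < 4 * R"
          using Re_rho[of z w] complex_Re_le_cmod[of "rho z w"] True z by (simp add: mem_tube)
        also have "4 * R = (2 * sqrt R)\<^sup>2" using R by (simp add: power_mult_distrib)
        finally show ?thesis by (rule power2_less_imp_less) (use R in simp)
      qed
      moreover have "\<bar>2 * Im (rho z w)\<bar> < 2 * R"
        using abs_Im_le_cmod[of "rho z w"] True by (simp add: abs_mult)
      moreover have "0 < rho_diag w" "rho_diag w < 2 * R"
        using cmod_rho_ge'[of z w] True z by (auto simp: mem_tube)
      ultimately have "P w \<in> parabolic_box R"
        unfolding parabolic_box_def by (simp add: P)
      then show ?thesis using True by (simp add: g_def P)
    qed simp
    have "(\<integral>\<^sup>+w. ennreal (rho_diag w powr s) * indicator {w \<in> tube. cmod (rho z w) < R} w \<partial>?M) \<le> (\<integral>\<^sup>+w. g (P w) \<partial>?M)"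
      by (intro nn_integral_mono le)
    also have "\<dots> = (\<integral>\<^sup>+w. g (A1 w + t) \<partial>?M)"
      unfolding P_def A2_def by (rule nn_integral_lborel_shear[of "\<lambda>w. g (A1 w + t)"]) (auto simp: inv)
    also have "\<dots> = (\<integral>\<^sup>+w. g (w + t) \<partial>?M)"
      unfolding A1_def by (rule nn_integral_lborel_shear[of "\<lambda>w. g (w + t)"]) (auto simp: inv)
    also have "\<dots> = (\<integral>\<^sup>+w. g w \<partial>?M)"
      by (rule nn_integral_lborel_translate) simp
    also have "\<dots> = ennreal (C * R powr (real CARD('n) + 1 + s))"
      unfolding g_def by (rule C(2)[OF R])
    finally show "(\<integral>\<^sup>+w. ennreal (rho_diag w powr s) * indicator {w \<in> tube. cmod (rho z w) < R} w \<partial>?M)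
      \<le> ennreal (C * R powr (real CARD('n) + 1 + s))" .
  qed
qed

text \<open>Decompose into shells where |rho z w| is about 2^k rho_diag z. By
  \<open>weight_rho_ball\<close>, shell k contributes at most a multiple of (2^k rho_diag z)^(n + 1
  + s - t), and the negative exponent makes the series geometric.\<close>

lemma kernel_integral:
  assumes s: "-1 < s" and t: "real CARD('n) + 1 + s < t"
  obtains C where "0 \<le> C" "\<And>z. z \<in> tube \<Longrightarrow>
    (\<integral>\<^sup>+w. ennreal (rho_diag w powr s * cmod (rho z w) powr (- t)) * indicator tube w
      \<partial>(lborel :: (complex^'n::{finite,linorder}) measure)) \<le> ennreal (C * rho_diag z powr (real CARD('n) + 1 + s - t))"
proof -
  let ?M = "lborel :: (complex^'n::{finite,linorder}) measure"
  define N where "N = real CARD('n) + 1 + s"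
  have N: "N - t < 0" "0 < t" "0 \<le> N" using s t by (auto simp: N_def)
  obtain C where C: "0 \<le> C" "\<And>z R. z \<in> tube \<Longrightarrow> 0 < R \<Longrightarrow>
    (\<integral>\<^sup>+w. ennreal (rho_diag w powr s) * indicator {w \<in> tube. cmod (rho z w) < R} w \<partial>?M) \<le> ennreal (C * R powr N)"
    unfolding N_def by (rule weight_rho_ball[OF s, where 'n='n]) blast
  define S where "S = (\<Sum>k. (2 powr (N - t)) ^ k)"
  have S: "summable (\<lambda>k. (2 powr (N - t)) ^ k)" using N by (intro summable_geometric_powr) auto
  show thesis
  proof (rule that)
    show "0 \<le> 2 powr t * C * S" using C(1) S by (auto simp: S_def intro!: mult_nonneg_nonneg suminf_nonneg)
    fix z :: "complex^'n::{finite,linorder}" assume z: "z \<in> tube"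
    define r where "r = rho_diag z"
    have r: "0 < r" using z by (simp add: r_def mem_tube)
    define E where "E k = {w \<in> tube. cmod (rho z w) < 2 ^ k * r}" for k :: nat
    have [measurable]: "E k \<in> sets borel" for k unfolding E_def by measurable
    \<comment> \<open>Built from the lower radius of shell k. For k = 0 the radius r / 2 is correct
      too, since |rho z w| is never below half of \<open>rho_diag z\<close>.\<close>
    define a where "a k = (2 powr (real k - 1) * r) powr (- t)" for k :: nat
    have "(\<integral>\<^sup>+w. ennreal (rho_diag w powr s * cmod (rho z w) powr (- t)) * indicator tube w \<partial>?M)
      \<le> (\<integral>\<^sup>+w. (\<Sum>k. ennreal (a k) * (ennreal (rho_diag w powr s) * indicator (E k) w)) \<partial>?M)"
    proof (rule nn_integral_mono)
      fix w :: "complex^'n::{finite,linorder}"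
      show "ennreal (rho_diag w powr s * cmod (rho z w) powr (- t)) * indicator tube w
        \<le> (\<Sum>k. ennreal (a k) * (ennreal (rho_diag w powr s) * indicator (E k) w))"
      proof (cases "w \<in> tube")
        case True
        obtain m where "cmod (rho z w) / r < 2 ^ m" using real_arch_pow[of 2 "cmod (rho z w) / r"] by auto
        then have ex: "\<exists>k. cmod (rho z w) < 2 ^ k * r" using r by (auto simp: field_simps)
        define k where "k = (LEAST k. cmod (rho z w) < 2 ^ k * r)"
        have k: "cmod (rho z w) < 2 ^ k * r" unfolding k_def using ex by (rule LeastI_ex)
        have "2 powr (real k - 1) * r \<le> cmod (rho z w)"
        proof (cases k)
          case 0
          then show ?thesis using cmod_rho_ge[OF True, of z] by (simp add: r_def powr_minus)
        next
          case (Suc m)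
          then have "\<not> cmod (rho z w) < 2 ^ m * r" using not_less_Least[of m "\<lambda>k. cmod (rho z w) < 2 ^ k * r"] by (simp add: k_def)
          then show ?thesis by (simp add: Suc powr_realpow)
        qed
        then have "cmod (rho z w) powr (- t) \<le> a k"
          unfolding a_def using r N by (intro powr_mono2') auto
        then have "ennreal (rho_diag w powr s * cmod (rho z w) powr (- t)) * indicator tube w
          \<le> ennreal (a k) * (ennreal (rho_diag w powr s) * indicator (E k) w)"
        proof -
          have "ennreal (rho_diag w powr s * cmod (rho z w) powr (- t)) \<le> ennreal (a k * rho_diag w powr s)"
            using \<open>cmod (rho z w) powr (- t) \<le> a k\<close>
            by (subst mult.commute) (intro ennreal_leI mult_right_mono, auto)
          also have "\<dots> = ennreal (a k) * ennreal (rho_diag w powr s)"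
            by (simp add: a_def ennreal_mult)
          finally show ?thesis using True k by (simp add: E_def)
        qed
        also have "\<dots> \<le> (\<Sum>k. ennreal (a k) * (ennreal (rho_diag w powr s) * indicator (E k) w))"
          using sum_le_suminf[of "\<lambda>k. ennreal (a k) * (ennreal (rho_diag w powr s) * indicator (E k) w)" "{k}"] by simp
        finally show ?thesis .
      qed simp
    qed
    also have "\<dots> = (\<Sum>k. ennreal (a k) * (\<integral>\<^sup>+w. ennreal (rho_diag w powr s) * indicator (E k) w \<partial>?M))"
      by (subst nn_integral_suminf) (auto simp: nn_integral_cmult)
    also have "\<dots> \<le> (\<Sum>k. ennreal (2 powr t * C * r powr (N - t) * (2 powr (N - t)) ^ k))"
    proof (intro suminf_le)
      fix k
      have "ennreal (a k) * (\<integral>\<^sup>+w. ennreal (rho_diag w powr s) * indicator (E k) w \<partial>?M) \<le> ennreal (a k) * ennreal (C * (2 ^ k * r) powr N)"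
        unfolding E_def using r by (intro mult_left_mono C(2) z) auto
      also have "\<dots> = ennreal (a k * (C * (2 ^ k * r) powr N))"
        using C(1) by (simp add: a_def ennreal_mult)
      also have "a k * (C * (2 ^ k * r) powr N) = 2 powr t * C * r powr (N - t) * (2 powr (N - t)) ^ k"
      proof -
        have "a k = 2 powr t * (2 powr (- t)) ^ k * r powr (- t)"
          using r by (simp add: a_def powr_mult powr_powr powr_realpow[symmetric] powr_add[symmetric] algebra_simps)
        moreover have "(2 ^ k * r) powr N = (2 powr N) ^ k * r powr N"
          using r by (simp add: powr_mult powr_realpow[symmetric] powr_powr mult.commute)
        moreover have "(2 powr (N - t)) ^ k = (2 powr N) ^ k * (2 powr (- t)) ^ k"
          by (simp add: power_mult_distrib[symmetric] powr_add[symmetric])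
        moreover have "r powr (N - t) = r powr N * r powr (- t)"
          by (simp add: powr_add[symmetric])
        ultimately show ?thesis by (simp add: mult_ac)
      qed
      finally show "ennreal (a k) * (\<integral>\<^sup>+w. ennreal (rho_diag w powr s) * indicator (E k) w \<partial>?M)
        \<le> ennreal (2 powr t * C * r powr (N - t) * (2 powr (N - t)) ^ k)" .
    qed auto
    also have "\<dots> = ennreal (\<Sum>k. 2 powr t * C * r powr (N - t) * (2 powr (N - t)) ^ k)"
      using C(1) S by (intro suminf_ennreal2) (auto intro!: mult_nonneg_nonneg summable_mult)
    also have "(\<Sum>k. 2 powr t * C * r powr (N - t) * (2 powr (N - t)) ^ k) = 2 powr t * C * S * r powr (N - t)"
      using S by (simp add: S_def suminf_mult mult_ac)
    finally show "(\<integral>\<^sup>+w. ennreal (rho_diag w powr s * cmod (rho z w) powr (- t)) * indicator tube w \<partial>?M)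
      \<le> ennreal (2 powr t * C * S * rho_diag z powr (real CARD('n) + 1 + s - t))"
      by (simp add: N_def r_def)
  qed
qed

section \<open>Mean value estimates\<close>

text \<open>
  Continuous functions that are holomorphic on complex lines. Unlike complex differentiability this
  passes to locally uniform limits by the one-variable theorem, and it suffices for mean value estimates.
\<close>

definition line_holomorphic_on :: "(complex^'n \<Rightarrow> complex) \<Rightarrow> (complex^'n) set \<Rightarrow> bool" where
  "line_holomorphic_on f S \<longleftrightarrow> continuous_on S f \<and>
     (\<forall>a v. (\<lambda>t. f (a + t *s v)) holomorphic_on {t. a + t *s v \<in> S})"

lemma norm_vector_scalar_mult: "norm (c *s v) = cmod c * norm (v :: complex^'n)"
  by (simp add: norm_vec_def L2_set_def norm_mult power_mult_distrib real_sqrt_mult flip: sum_distrib_left)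

lemma bounded_linear_vector_scalar_mult: "bounded_linear (\<lambda>t. t *s (v :: complex^'n))"
  by (rule bounded_linear_intro[of _ "norm v"])
    (auto simp: vec_eq_iff algebra_simps norm_vector_scalar_mult)

lemma linear_vector_scalar_mult: "linear (\<lambda>v :: complex^'n. c *s v)"
  by (rule linearI) (simp_all add: vec_eq_iff algebra_simps scaleR_conv_of_real)

lemma continuous_on_vector_scalar_mult [continuous_intros]:
  assumes "continuous_on S f" "continuous_on S g"
  shows "continuous_on S (\<lambda>x. f x *s (g x :: complex^'n))"
  unfolding vector_scalar_mult_def by (intro continuous_intros assms)

text \<open>Cauchy's formula on the unit circle with the parameter running over [0,1], written as an
  extended nonnegative integral because Tonelli's theorem is applied to it next.\<close>

lemma holomorphic_circle_mean:
  assumes "continuous_on (cball 0 1) g" "g holomorphic_on ball 0 1"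
  shows "ennreal (cmod (g 0)) \<le>
    (\<integral>\<^sup>+x. indicator {0..1} x * ennreal (cmod (g (exp (2 * of_real pi * \<i> * of_real x)))) \<partial>lborel)"
proof -
  define c where "c x = exp (2 * of_real pi * \<i> * complex_of_real x)" for x
  have c: "c x \<noteq> 0" for x by (simp add: c_def)
  define k where "k = 2 * of_real pi * \<i>"
  have k: "k \<noteq> 0" by (simp add: k_def)
  have "((\<lambda>u. g u / (u - 0)) has_contour_integral (2 * of_real pi * \<i> * g 0)) (circlepath 0 1)"
    by (rule Cauchy_integral_circlepath) (use assms in auto)
  then have "((\<lambda>x. g (c x) / c x * (2 * of_real pi * \<i> * c x)) has_integral (2 * of_real pi * \<i> * g 0)) {0..1}"
    unfolding has_contour_integral_def
  proof (rule has_integral_eq[rotated])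
    fix x :: real assume "x \<in> {0..1}"
    then have "vector_derivative (circlepath 0 1) (at x within {0..1}) = 2 * of_real pi * \<i> * c x"
      by (simp add: vector_derivative_circlepath01 c_def)
    moreover have "circlepath 0 1 x = c x"
      by (simp add: circlepath c_def)
    ultimately show "g (circlepath 0 1 x) / (circlepath 0 1 x - 0) * vector_derivative (circlepath 0 1) (at x within {0..1})
      = g (c x) / c x * (2 * of_real pi * \<i> * c x)"
      by simp
  qed
  then have "((\<lambda>x. inverse k * (g (c x) / c x * (k * c x))) has_integral (inverse k * (k * g 0))) {0..1}"
    unfolding k_def by (rule has_integral_mult_right)
  moreover have "inverse k * (a / b * (k * b)) = a" if "b \<noteq> 0" for a b
    using that k by (simp add: field_simps)
  moreover have "inverse k * (k * a) = a" for a
    using k by simp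
  ultimately have int: "((\<lambda>x. g (c x)) has_integral g 0) {0..1}"
    by (simp only: c not_False_eq_True)
  have cont: "continuous_on {0..1} (\<lambda>x. g (c x))"
    unfolding c_def by (intro continuous_on_compose2[OF assms(1)] continuous_intros) (auto simp: norm_exp_eq_Re)
  then have nint: "((\<lambda>x. cmod (g (c x))) has_integral integral {0..1} (\<lambda>x. cmod (g (c x)))) {0..1}"
    by (intro integrable_integral integrable_continuous_interval continuous_on_norm)
  have "cmod (g 0) = cmod (integral {0..1} (\<lambda>x. g (c x)))"
    by (simp only: integral_unique[OF int])
  also have "\<dots> \<le> integral {0..1} (\<lambda>x. cmod (g (c x)))"
    by (rule integral_norm_bound_integral[OF has_integral_integrable[OF int] has_integral_integrable[OF nint]]) simp
  finally have le: "cmod (g 0) \<le> integral {0..1} (\<lambda>x. cmod (g (c x)))" .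
  have "ennreal (integral {0..1} (\<lambda>x. cmod (g (c x)))) = (\<integral>\<^sup>+x. ennreal (indicator {0..1} x * cmod (g (c x))) \<partial>lborel)"
    using nn_integral_has_integral_lebesgue[OF _ nint] by simp
  also have "\<dots> = (\<integral>\<^sup>+x. indicator {0..1} x * ennreal (cmod (g (c x))) \<partial>lborel)"
    by (intro nn_integral_cong) (auto simp: indicator_def)
  finally show ?thesis
    using ennreal_leI[OF le] by (simp only: c_def)
qed

lemma borel_measurable_indicator_continuous:
  fixes f :: "'a::topological_space \<Rightarrow> complex"
  assumes "continuous_on S f" "S \<in> sets borel" "A \<in> sets borel" "A \<subseteq> S"
  shows "(\<lambda>x. ennreal (cmod (f x) powr p) * indicator A x) \<in> borel_measurable borel"
proof -
  define g where "g x = indicator A x *\<^sub>R f x" for x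
  have [measurable]: "g \<in> borel_measurable borel"
    unfolding g_def using assms by (intro borel_measurable_continuous_on_indicator) (auto intro: continuous_on_subset)
  note [measurable] = \<open>A \<in> sets borel\<close>
  have "(\<lambda>x. ennreal (cmod (g x) powr p) * indicator A x) \<in> borel_measurable borel"
    by measurable
  also have "(\<lambda>x. ennreal (cmod (g x) powr p) * indicator A x) = (\<lambda>x. ennreal (cmod (f x) powr p) * indicator A x)"
    by (simp add: fun_eq_iff g_def indicator_def)
  finally show ?thesis .
qed

text \<open>Average the circle mean inequality for t -> f (a + t v) over v in the ball. For a fixed
  unimodular factor e the map v -> e v is an isometry, so after Tonelli every inner integral is the
  same integral over the ball.\<close>

lemma line_holomorphic_mean:
  fixes f :: "complex^'n \<Rightarrow> complex"
  assumes f: "line_holomorphic_on f S" and S: "ball a r \<subseteq> S" and r: "0 \<le> r"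
  shows "ennreal (cmod (f a)) * emeasure lborel (ball a r)
    \<le> (\<integral>\<^sup>+x. ennreal (cmod (f x)) * indicator (ball a r) x \<partial>lborel)"
proof -
  define F where "F x = ennreal (cmod (f x)) * indicator (ball a r) x" for x
  have "F \<in> borel_measurable borel"
    using borel_measurable_indicator_continuous[of "ball a r" f "ball a r" 1] f S
    by (auto simp: F_def[abs_def] line_holomorphic_on_def intro: continuous_on_subset)
  note [measurable] = this
  define e where "e x = exp (2 * of_real pi * \<i> * complex_of_real x)" for x
  have e: "cmod (e x) = 1" for x by (simp add: e_def norm_exp_eq_Re)
  have meas: "(\<lambda>(x, v). indicator {0..1} x * F (a + e x *s v)) \<in> borel_measurable (lborel \<Otimes>\<^sub>M lborel)"
  proof -
    have "(\<lambda>p :: real \<times> (complex^'n). a + e (fst p) *s snd p) \<in> borel_measurable borel"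
      unfolding e_def by (intro borel_measurable_continuous_onI continuous_intros)
    then have "(\<lambda>p :: real \<times> (complex^'n). F (a + e (fst p) *s snd p)) \<in> borel_measurable borel"
      by (rule measurable_compose) fact
    moreover have "(\<lambda>p :: real \<times> (complex^'n). indicator {0..1} (fst p) :: ennreal) \<in> borel_measurable borel"
      unfolding borel_prod[symmetric] by measurable
    ultimately show ?thesis
      unfolding lborel_prod case_prod_beta by simp
  qed
  have "ennreal (cmod (f a)) * emeasure lborel (ball a r) = (\<integral>\<^sup>+v. ennreal (cmod (f a)) * indicator (ball (0 :: complex^'n) r) v \<partial>lborel)"
    by (subst nn_integral_cmult_indicator) (use r in \<open>auto simp: emeasure_ball\<close>)
  also have "\<dots> \<le> (\<integral>\<^sup>+v. (\<integral>\<^sup>+x. indicator {0..1} x * F (a + e x *s v) \<partial>lborel) \<partial>lborel)"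
  proof (rule nn_integral_mono)
    fix v :: "complex^'n"
    show "ennreal (cmod (f a)) * indicator (ball 0 r) v \<le> (\<integral>\<^sup>+x. indicator {0..1} x * F (a + e x *s v) \<partial>lborel)"
    proof (cases "v \<in> ball 0 r")
      case True
      have in_ball: "a + t *s v \<in> ball a r" if "t \<in> cball 0 1" for t
      proof -
        have "cmod t * norm v \<le> 1 * norm v" using that by (intro mult_right_mono) auto
        then show ?thesis using True by (simp add: dist_norm norm_vector_scalar_mult)
      qed
      have h: "(\<lambda>t. f (a + t *s v)) holomorphic_on {t. a + t *s v \<in> S}" "continuous_on S f"
        using f by (auto simp: line_holomorphic_on_def)
      have "ennreal (cmod (f (a + 0 *s v))) \<le> (\<integral>\<^sup>+x. indicator {0..1} x * ennreal (cmod (f (a + e x *s v))) \<partial>lborel)"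
        unfolding e_def
      proof (rule holomorphic_circle_mean)
        show "continuous_on (cball 0 1) (\<lambda>t. f (a + t *s v))"
          using in_ball S by (intro continuous_on_compose2[OF h(2)] continuous_intros) auto
        show "(\<lambda>t. f (a + t *s v)) holomorphic_on ball 0 1"
          using in_ball S by (intro holomorphic_on_subset[OF h(1)]) auto
      qed
      moreover have "F (a + e x *s v) = ennreal (cmod (f (a + e x *s v)))" for x
        using in_ball[of "e x"] e by (simp add: F_def)
      ultimately show ?thesis using True by simp
    qed simp
  qed
  also have "\<dots> = (\<integral>\<^sup>+x. (\<integral>\<^sup>+v. indicator {0..1} x * F (a + e x *s v) \<partial>lborel) \<partial>lborel)"
    by (rule lborel_pair.Fubini'[OF meas])
  also have "\<dots> = (\<integral>\<^sup>+x. indicator {0..1::real} x * (\<integral>\<^sup>+v. F v \<partial>lborel) \<partial>lborel)"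
  proof (rule nn_integral_cong)
    fix x :: real
    have "(\<integral>\<^sup>+v. F (a + e x *s v) \<partial>lborel) = (\<integral>\<^sup>+v. F (a + v) \<partial>lborel)"
      by (rule nn_integral_lborel_isometry[OF linear_vector_scalar_mult, of _ "\<lambda>v. F (a + v)"])
        (simp_all add: norm_vector_scalar_mult e)
    also have "\<dots> = (\<integral>\<^sup>+v. F v \<partial>lborel)"
      using nn_integral_lborel_translate[of F a] by (simp add: add.commute)
    moreover have [measurable]: "(\<lambda>v. F (a + e x *s v)) \<in> borel_measurable borel"
    proof -
      have [measurable]: "(\<lambda>v. a + e x *s v) \<in> borel_measurable borel"
        by (intro borel_measurable_continuous_onI continuous_intros)
      show ?thesis by measurable
    qed
    ultimately show "(\<integral>\<^sup>+v. indicator {0..1} x * F (a + e x *s v) \<partial>lborel) = indicator {0..1} x * (\<integral>\<^sup>+v. F v \<partial>lborel)"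
      by (simp add: nn_integral_cmult)
  qed
  also have "\<dots> = (\<integral>\<^sup>+v. F v \<partial>lborel)"
    by (simp add: nn_integral_multc)
  finally show ?thesis by (simp add: F_def)
qed

text \<open>
  For \<open>p < 1\<close> the estimate follows from the case \<open>p = 1\<close> applied at a point where
  \<open>(1 - |v|)\<^bsup>D/p\<^esup> |f v|\<close> is maximal, \<open>D\<close> being the real dimension.
\<close>

lemma line_holomorphic_mean_powr_le_1:
  assumes p: "0 < p" "p \<le> 1"
  obtains C where "0 < C" "\<And>(f :: complex^'n \<Rightarrow> complex) S. line_holomorphic_on f S \<Longrightarrow> cball 0 1 \<subseteq> S \<Longrightarrow>
    ennreal (cmod (f 0) powr p) \<le> ennreal C * (\<integral>\<^sup>+x. ennreal (cmod (f x) powr p) * indicator (ball 0 1) x \<partial>lborel)"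
proof -
  define D where "D = DIM(complex^'n)"
  define K where "K = unit_ball_vol (real D)"
  have K: "0 < K" unfolding K_def by simp
  \<comment> \<open>With this exponent the powers of r, the length scale at the maximum point,
    cancel in the last inequality, so the constant does not depend on that point.\<close>
  define m where "m = real D / p"
  have m: "m * p = real D" "0 < m" using p by (auto simp: m_def D_def)
  show thesis
  proof (rule that)
    show "0 < 2 powr m / K" using K by simp
    fix f :: "complex^'n \<Rightarrow> complex" and S
    assume f: "line_holomorphic_on f S" and S: "cball 0 1 \<subseteq> S"
    define I where "I = (\<integral>\<^sup>+x. ennreal (cmod (f x) powr p) * indicator (ball 0 1) x \<partial>lborel)"
    have cont: "continuous_on (cball 0 1) f"
      using f S by (auto simp: line_holomorphic_on_def intro: continuous_on_subset)
    show "ennreal (cmod (f 0) powr p) \<le> ennreal (2 powr m / K) * I"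
    proof (cases I)
      case top
      then show ?thesis using K by (simp add: ennreal_mult_top)
    next
      case (real i)
      define h where "h v = (1 - norm v) powr m * cmod (f v)" for v
      have "continuous_on (cball 0 1) h"
        unfolding h_def using cont m
        by (intro continuous_on_mult continuous_on_powr' continuous_intros) auto
      then obtain w where w: "w \<in> cball 0 1" "\<And>v. v \<in> cball 0 1 \<Longrightarrow> h v \<le> h w"
        using continuous_attains_sup[of "cball 0 1" h] by auto
      have f0: "cmod (f 0) \<le> h w" using w(2)[of 0] by (simp add: h_def)
      show ?thesis
      proof (cases "h w = 0")
        case True
        then show ?thesis using f0 by simp
      next
        case False
        define s where "s = h w"
        have s: "0 < s" using False by (auto simp: s_def h_def less_le)
        \<comment> \<open>Half the distance from w to the unit sphere: on \<open>ball w r\<close>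
          the factor 1 - |v| is at least r, so maximality bounds |f v| by s * r^(-m) there.\<close>
        define r where "r = (1 - norm w) / 2"
        have "norm w \<noteq> 1" using s m by (auto simp: s_def h_def)
        then have r: "0 < r" "1 - norm w = 2 * r" using w(1) by (auto simp: r_def)
        have sw: "s = 2 powr m * r powr m * cmod (f w)"
          using r by (simp add: s_def h_def powr_mult)
        \<comment> \<open>Bounding the first factor of |f| = |f|^(1-p) |f|^p by b reduces exponent p
          to the mean value inequality for |f| on the smaller ball.\<close>
        define b where "b = (s * r powr (- m)) powr (1 - p)"
        have sub: "ball w r \<subseteq> ball 0 1"
        proof
          fix v assume "v \<in> ball w r"
          then show "v \<in> ball 0 1"
            using norm_triangle_ineq2[of v w] r by (simp add: dist_norm norm_minus_commute)
        qed
        have bound: "cmod (f v) \<le> b * cmod (f v) powr p" if v: "v \<in> ball w r" for v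
        proof (cases "f v = 0")
          case False
          have nv: "norm v \<le> 1" "r \<le> 1 - norm v"
            using v norm_triangle_ineq2[of v w] r by (auto simp: dist_norm norm_minus_commute)
          have "r powr m * cmod (f v) \<le> h v"
            unfolding h_def using nv r m by (intro mult_right_mono powr_mono2) auto
          also have "\<dots> \<le> s" using w(2)[of v] nv by (simp add: s_def)
          finally have "cmod (f v) \<le> s * r powr (- m)"
            using r by (simp add: powr_minus field_simps)
          then have "cmod (f v) powr (1 - p) \<le> b"
            unfolding b_def using p by (intro powr_mono2) auto
          then have "cmod (f v) powr (1 - p) * cmod (f v) powr p \<le> b * cmod (f v) powr p"
            by (intro mult_right_mono) auto
          then show ?thesis using False by (simp flip: powr_add)
        qed (use p in simp)
        have meas: "(\<lambda>x. ennreal (cmod (f x) powr p) * indicator (ball 0 1) x) \<in> borel_measurable borel"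
          by (rule borel_measurable_indicator_continuous[OF cont]) auto
        have "ennreal (cmod (f w) * (K * r ^ D)) = ennreal (cmod (f w)) * emeasure lborel (ball w r)"
          using r K by (simp add: emeasure_ball K_def D_def ennreal_mult)
        also have "\<dots> \<le> (\<integral>\<^sup>+x. ennreal (cmod (f x)) * indicator (ball w r) x \<partial>lborel)"
          using sub S r ball_subset_cball[of "0 :: complex^'n" 1]
          by (intro line_holomorphic_mean[OF f]) (blast, simp)
        also have "\<dots> \<le> (\<integral>\<^sup>+x. ennreal b * (ennreal (cmod (f x) powr p) * indicator (ball 0 1) x) \<partial>lborel)"
        proof (rule nn_integral_mono)
          fix x
          show "ennreal (cmod (f x)) * indicator (ball w r) x \<le> ennreal b * (ennreal (cmod (f x) powr p) * indicator (ball 0 1) x)"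
            using bound[of x] sub by (auto simp: indicator_def b_def ennreal_mult[symmetric] intro!: ennreal_leI)
        qed
        also have "\<dots> = ennreal (b * i)"
          using meas real by (simp add: nn_integral_cmult I_def[symmetric] b_def ennreal_mult)
        finally have main: "cmod (f w) * (K * r ^ D) \<le> b * i"
          using real by (simp add: b_def)
        have "b = s powr (1 - p) * r powr (real D - m)"
        proof -
          have "- (m * (1 - p)) = real D - m" by (simp add: right_diff_distrib m)
          then show ?thesis using s r by (simp add: b_def powr_mult powr_powr)
        qed
        then have "cmod (f w) * (K * r powr real D) \<le> s powr (1 - p) * r powr (real D - m) * i"
          using main r by (simp add: powr_realpow)
        then have "2 powr m * r powr m * (cmod (f w) * (K * r powr real D)) \<le> 2 powr m * r powr m * (s powr (1 - p) * r powr (real D - m) * i)"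
          by (intro mult_left_mono) auto
        moreover have "2 powr m * r powr m * (cmod (f w) * (K * r powr real D)) = r powr real D * (s * K)"
          by (simp add: sw)
        moreover have "2 powr m * r powr m * (s powr (1 - p) * r powr (real D - m) * i)
          = (r powr m * r powr (real D - m)) * (2 powr m * s powr (1 - p) * i)"
          by (simp only: mult_ac)
        moreover have "r powr m * r powr (real D - m) = r powr real D"
          by (simp flip: powr_add)
        ultimately have "r powr real D * (s * K) \<le> r powr real D * (2 powr m * s powr (1 - p) * i)"
          by simp
        then have "s * K \<le> 2 powr m * s powr (1 - p) * i"
          using r by simp
        moreover have "s = s powr p * s powr (1 - p)" using s by (simp flip: powr_add)
        ultimately have "s powr (1 - p) * (s powr p * K) \<le> s powr (1 - p) * (2 powr m * i)"
          by (metis mult.assoc mult.commute)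
        then have "s powr p * K \<le> 2 powr m * i"
          using s by simp
        then have "s powr p \<le> 2 powr m / K * i"
          using K by (simp add: field_simps)
        moreover have "cmod (f 0) powr p \<le> s powr p"
          using f0 p by (intro powr_mono2) (auto simp: s_def)
        ultimately have "ennreal (cmod (f 0) powr p) \<le> ennreal (2 powr m / K * i)"
          by (intro ennreal_leI) linarith
        also have "\<dots> = ennreal (2 powr m / K) * ennreal i"
          using real K by (intro ennreal_mult) auto
        finally show ?thesis by (simp only: real)
      qed
    qed
  qed
qed

lemma line_holomorphic_power: "line_holomorphic_on f S \<Longrightarrow> line_holomorphic_on (\<lambda>x. f x ^ k) S"
  by (auto simp: line_holomorphic_on_def intro!: continuous_intros holomorphic_intros)

text \<open>With k the ceiling of p, the previous case applies to f^k with exponent p / k <= 1, and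
  |f^k|^(p/k) is |f|^p. Passing to powers does the work of Jensen's inequality.\<close>

lemma line_holomorphic_mean_powr:
  assumes p: "0 < p"
  obtains C where "0 < C" "\<And>(f :: complex^'n \<Rightarrow> complex) S. line_holomorphic_on f S \<Longrightarrow> cball 0 1 \<subseteq> S \<Longrightarrow>
    ennreal (cmod (f 0) powr p) \<le> ennreal C * (\<integral>\<^sup>+x. ennreal (cmod (f x) powr p) * indicator (ball 0 1) x \<partial>lborel)"
proof -
  define k where "k = nat \<lceil>p\<rceil>"
  have k: "0 < k" "p \<le> real k" using p by (auto simp: k_def)
  have q: "0 < p / real k" "p / real k \<le> 1" using p k by auto
  obtain C where C: "0 < C" "\<And>(f :: complex^'n \<Rightarrow> complex) S. line_holomorphic_on f S \<Longrightarrow> cball 0 1 \<subseteq> S \<Longrightarrow>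
    ennreal (cmod (f 0) powr (p / real k)) \<le> ennreal C * (\<integral>\<^sup>+x. ennreal (cmod (f x) powr (p / real k)) * indicator (ball 0 1) x \<partial>lborel)"
    by (rule line_holomorphic_mean_powr_le_1[OF q, where 'n='n]) blast
  have pow: "cmod (z ^ k) powr (p / real k) = cmod z powr p" for z
    using k by (cases "z = 0") (simp_all add: norm_power powr_powr flip: powr_realpow)
  show thesis
  proof (rule that[OF C(1)])
    fix f :: "complex^'n \<Rightarrow> complex" and S assume "line_holomorphic_on f S" "cball 0 1 \<subseteq> S"
    then show "ennreal (cmod (f 0) powr p) \<le> ennreal C * (\<integral>\<^sup>+x. ennreal (cmod (f x) powr p) * indicator (ball 0 1) x \<partial>lborel)"
      using C(2)[OF line_holomorphic_power[of f S k]] unfolding pow by simp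
  qed
qed

section \<open>Affine charts and the mean value estimate on the domain\<close>

lemma open_near: "open {w. near z w}"
  unfolding near_def by (intro open_Collect_conj open_Collect_less continuous_intros)

lemma pred_near [measurable (raw)]:
  assumes [measurable]: "f \<in> borel_measurable M" "g \<in> borel_measurable M"
  shows "Measurable.pred M (\<lambda>x. near (f x) (g x))"
  unfolding near_def by measurable

text \<open>Complex linear part of an affine map that preserves the family of paraboloids: the
  height of z + chart z v is rho_diag z + Im v_n - |Im v'|^2, free of cross terms between z and v.
  Being complex linear in v, it respects holomorphy on lines.\<close>

definition chart :: "complex^'n::{finite,linorder} \<Rightarrow> complex^'n::{finite,linorder} \<Rightarrow> complex^'n::{finite,linorder}" where
  "chart z v = v + (2 * (\<Sum>j\<in>UNIV - {last_ix}. of_real (Im (z $ j)) * v $ j)) *s axis last_ix 1"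

lemma chart_nth: "chart z v $ i =
    (if i = last_ix then v $ i + 2 * (\<Sum>j\<in>UNIV - {last_ix}. of_real (Im (z $ j)) * v $ j) else v $ i)"
  by (simp add: chart_def axis_def)

lemma chart_linear: "chart z (x + t *s y) = chart z x + t *s chart z y"
proof -
  define l where "l v = (\<Sum>j\<in>UNIV - {last_ix}. complex_of_real (Im (z $ j)) * v $ j)" for v
  have "l (x + t *s y) = (\<Sum>j\<in>UNIV - {last_ix}. of_real (Im (z $ j)) * x $ j + t * (of_real (Im (z $ j)) * y $ j))"
    unfolding l_def by (intro sum.cong) (auto simp: algebra_simps)
  also have "\<dots> = l x + t * l y"
    unfolding l_def by (simp only: sum.distrib sum_distrib_left)
  finally have l: "l (x + t *s y) = l x + t * l y" .
  show ?thesis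
    unfolding chart_def l_def[symmetric] l by (simp add: vec_eq_iff algebra_simps)
qed

lemma continuous_on_chart: "continuous_on UNIV (chart z)"
  unfolding chart_def by (intro continuous_intros)

lemma continuous_on_parabolic_dilation: "continuous_on UNIV (parabolic_dilation d)"
proof -
  have eq: "parabolic_dilation d = (\<lambda>x. \<chi> j. of_real (if j = last_ix then d\<^sup>2 else d) * x $ j)"
    by (auto simp: parabolic_dilation_def vec_eq_iff)
  show ?thesis
    unfolding eq by (intro continuous_intros)
qed

lemma parabolic_dilation_linear:
  "parabolic_dilation d (x + t *s y) = parabolic_dilation d x + t *s parabolic_dilation d y"
  by (simp add: vec_eq_iff parabolic_dilation_def distrib_left mult.left_commute)

text \<open>The map is a composition of two real shears, along the real and the imaginary direction
  of the last coordinate, with amounts that depend on the other coordinates only.\<close>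

lemma nn_integral_chart:
  fixes z :: "complex^'n::{finite,linorder}"
  assumes [measurable]: "f \<in> borel_measurable borel"
  shows "(\<integral>\<^sup>+v. f (chart z v) \<partial>lborel) = (\<integral>\<^sup>+v. f v \<partial>lborel)"
proof -
  define l1 where "l1 v = 2 * (\<Sum>j\<in>UNIV - {last_ix}. Im (z $ j) * Re (v $ j))" for v :: "complex^'n::{finite,linorder}"
  define l2 where "l2 v = 2 * (\<Sum>j\<in>UNIV - {last_ix}. Im (z $ j) * Im (v $ j))" for v :: "complex^'n::{finite,linorder}"
  have [measurable]: "l1 \<in> borel_measurable borel" "l2 \<in> borel_measurable borel"
    unfolding l1_def l2_def by measurable
  have inv: "l1 (w + a *\<^sub>R axis last_ix b) = l1 w" "l2 (w + a *\<^sub>R axis last_ix b) = l2 w" for w a b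
    unfolding l1_def l2_def by (auto simp: axis_def intro!: sum.cong)
  have "chart z v = (v + l2 v *\<^sub>R axis last_ix \<i>) + l1 v *\<^sub>R axis last_ix 1" for v
    by (auto simp: vec_eq_iff chart_nth axis_def l1_def l2_def intro!: complex_eqI)
  then have "(\<integral>\<^sup>+v. f (chart z v) \<partial>lborel)
    = (\<integral>\<^sup>+v. f ((v + l2 v *\<^sub>R axis last_ix \<i>) + l1 (v + l2 v *\<^sub>R axis last_ix \<i>) *\<^sub>R axis last_ix 1) \<partial>lborel)"
    by (simp add: inv)
  also have "\<dots> = (\<integral>\<^sup>+v. f (v + l1 v *\<^sub>R axis last_ix 1) \<partial>lborel)"
    by (rule nn_integral_lborel_shear[of "\<lambda>v. f (v + l1 v *\<^sub>R axis last_ix 1)"]) (auto simp: inv)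
  also have "\<dots> = (\<integral>\<^sup>+v. f v \<partial>lborel)"
    by (rule nn_integral_lborel_shear) (auto simp: inv)
  finally show ?thesis .
qed

text \<open>With q = d^2 = rho_diag z / 16, the height of the image point lies between 14 q and 17
  q, and |rho| is at most 71 q / 4, which stays below both 2 * 14 q and 2 * 16 q. The factor 1/4 in
  d provides this margin.\<close>

lemma near_chart:
  fixes z v :: "complex^'n::{finite,linorder}"
  assumes z: "z \<in> tube" and v: "norm v \<le> 1" and d: "d = sqrt (rho_diag z) / 4"
  shows "near z (z + chart z (parabolic_dilation d v))"
proof -
  define J where "J = UNIV - {last_ix :: 'n::{finite,linorder}}"
  define w where "w = z + chart z (parabolic_dilation d v)"
  define q where "q = d\<^sup>2"
  have q: "rho_diag z = 16 * q" "0 < q" using z by (auto simp: q_def d power_divide mem_tube)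
  have wj: "w $ j = z $ j + of_real d * v $ j" if "j \<in> J" for j
    using that by (simp add: w_def chart_nth parabolic_dilation_def J_def)
  have wn: "w $ last_ix = z $ last_ix + of_real q * v $ last_ix + 2 * (\<Sum>j\<in>J. of_real (Im (z $ j)) * (of_real d * v $ j))"
    by (simp add: w_def chart_nth parabolic_dilation_def q_def J_def[symmetric], intro sum.cong)
      (auto simp: J_def)
  have vn: "\<bar>Re (v $ last_ix)\<bar> \<le> 1" "\<bar>Im (v $ last_ix)\<bar> \<le> 1"
    using Finite_Cartesian_Product.norm_nth_le[of v last_ix] v abs_Re_le_cmod[of "v $ last_ix"] abs_Im_le_cmod[of "v $ last_ix"] by linarith+
  define s where "s = (\<Sum>j\<in>J. (cmod (v $ j))\<^sup>2)"
  have "s \<le> (\<Sum>j\<in>UNIV. (cmod (v $ j))\<^sup>2)" unfolding s_def by (intro sum_mono2) auto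
  also have "\<dots> = (norm v)\<^sup>2" by (simp add: norm_vec_def L2_set_def sum_nonneg)
  also have "\<dots> \<le> 1" using v by (simp add: power_le_one)
  finally have s: "0 \<le> s" "s \<le> 1" by (auto simp: s_def sum_nonneg)
  have im: "0 \<le> (\<Sum>j\<in>J. (Im (v $ j))\<^sup>2)" "(\<Sum>j\<in>J. (Im (v $ j))\<^sup>2) \<le> s"
    unfolding s_def by (auto simp: cmod_power2 intro!: sum_nonneg sum_mono)
  have reim: "\<bar>\<Sum>j\<in>J. Re (v $ j) * Im (v $ j)\<bar> \<le> s"
    unfolding s_def
  proof (rule sum_abs[THEN order_trans], rule sum_mono)
    show "\<bar>Re (v $ j) * Im (v $ j)\<bar> \<le> (cmod (v $ j))\<^sup>2" for j
      unfolding abs_mult power2_eq_square by (intro mult_mono abs_Re_le_cmod abs_Im_le_cmod) auto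
  qed
  have "(\<Sum>j\<in>J. (Im (w $ j))\<^sup>2) = (\<Sum>j\<in>J. (Im (z $ j))\<^sup>2) + 2 * (\<Sum>j\<in>J. Im (z $ j) * (d * Im (v $ j))) + q * (\<Sum>j\<in>J. (Im (v $ j))\<^sup>2)"
    unfolding sum_distrib_left sum.distrib[symmetric]
    by (intro sum.cong) (auto simp: wj q_def power2_eq_square algebra_simps)
  moreover have "Im (w $ last_ix) = Im (z $ last_ix) + q * Im (v $ last_ix) + 2 * (\<Sum>j\<in>J. Im (z $ j) * (d * Im (v $ j)))"
    by (simp add: wn)
  ultimately have rw: "rho_diag w = rho_diag z + q * (Im (v $ last_ix) - (\<Sum>j\<in>J. (Im (v $ j))\<^sup>2))"
    unfolding rho_diag_def J_def[symmetric] by (simp add: algebra_simps)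
  have rw': "14 * q \<le> rho_diag w" "rho_diag w \<le> 17 * q"
  proof -
    have "q * (-2) \<le> q * (Im (v $ last_ix) - (\<Sum>j\<in>J. (Im (v $ j))\<^sup>2))"
      using vn im s q by (intro mult_left_mono) auto
    moreover have "q * (Im (v $ last_ix) - (\<Sum>j\<in>J. (Im (v $ j))\<^sup>2)) \<le> q * 1"
      using vn im s q by (intro mult_left_mono) auto
    ultimately show "14 * q \<le> rho_diag w" "rho_diag w \<le> 17 * q" unfolding rw q(1) by linarith+
  qed
  have "(\<Sum>j\<in>J. (cmod (z $ j - w $ j))\<^sup>2) = q * s"
    unfolding s_def sum_distrib_left by (intro sum.cong) (auto simp: wj q_def norm_mult power_mult_distrib)
  then have "4 * Re (rho z w) = q * s + 2 * rho_diag z + 2 * rho_diag w"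
    unfolding Re_rho J_def[symmetric] by simp
  moreover have "q * s \<le> q * 1" using s q by (intro mult_left_mono) auto
  ultimately have Re: "4 * Re (rho z w) \<le> 67 * q" "0 \<le> Re (rho z w)"
    using q rw' mult_nonneg_nonneg[of q s] s by linarith+
  have "(\<Sum>j\<in>J. (Re (z $ j) - Re (w $ j)) * (Im (z $ j) + Im (w $ j)))
    = - 2 * (\<Sum>j\<in>J. Im (z $ j) * (d * Re (v $ j))) - q * (\<Sum>j\<in>J. Re (v $ j) * Im (v $ j))"
    unfolding sum_distrib_left sum_subtractf[symmetric]
    by (intro sum.cong) (auto simp: wj q_def power2_eq_square algebra_simps)
  moreover have "Re (w $ last_ix) = Re (z $ last_ix) + q * Re (v $ last_ix) + 2 * (\<Sum>j\<in>J. Im (z $ j) * (d * Re (v $ j)))"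
    by (simp add: wn)
  ultimately have "2 * Im (rho z w) = q * (Re (v $ last_ix) - (\<Sum>j\<in>J. Re (v $ j) * Im (v $ j)))"
    unfolding Im_rho J_def[symmetric] by (simp add: algebra_simps)
  then have "\<bar>2 * Im (rho z w)\<bar> = \<bar>q * (Re (v $ last_ix) - (\<Sum>j\<in>J. Re (v $ j) * Im (v $ j)))\<bar>"
    by (rule arg_cong)
  then have "2 * \<bar>Im (rho z w)\<bar> = q * \<bar>Re (v $ last_ix) - (\<Sum>j\<in>J. Re (v $ j) * Im (v $ j))\<bar>"
    using q by (simp add: abs_mult)
  also have "\<dots> \<le> q * 2" using q vn reim s by (intro mult_left_mono) auto
  finally have "\<bar>Im (rho z w)\<bar> \<le> q" by simp
  then have "4 * cmod (rho z w) \<le> 71 * q"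
    using Re cmod_le[of "rho z w"] by linarith
  then show ?thesis
    using rw' q unfolding w_def[symmetric] near_def by auto
qed

text \<open>Pull f back by the complex affine map v -> z + chart z (parabolic_dilation d v), which
  keeps it holomorphic on lines and sends the unit ball into the set near z, and use the estimate at
  the origin. The Jacobian d^(2n+2) with d^2 = rho_diag z / 16 is the source of the power -(n +
  1).\<close>

lemma line_holomorphic_tube_mean:
  assumes p: "0 < p"
  obtains C where "0 < C" "\<And>(f :: complex^'n::{finite,linorder} \<Rightarrow> complex) z. line_holomorphic_on f tube \<Longrightarrow> z \<in> tube \<Longrightarrow>
    ennreal (cmod (f z) powr p) \<le> ennreal (C * rho_diag z powr (- (real CARD('n) + 1))) *
      (\<integral>\<^sup>+w. ennreal (cmod (f w) powr p) * indicator {w. near z w} w \<partial>lborel)"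
proof -
  define N where "N = real CARD('n) + 1"
  obtain C where C: "0 < C" "\<And>(f :: complex^'n::{finite,linorder} \<Rightarrow> complex) S. line_holomorphic_on f S \<Longrightarrow> cball 0 1 \<subseteq> S \<Longrightarrow>
    ennreal (cmod (f 0) powr p) \<le> ennreal C * (\<integral>\<^sup>+x. ennreal (cmod (f x) powr p) * indicator (ball 0 1) x \<partial>lborel)"
    by (rule line_holomorphic_mean_powr[OF p, where 'n='n]) blast
  show thesis
  proof (rule that)
    show "0 < C * 16 powr N" using C(1) by simp
    fix f :: "complex^'n::{finite,linorder} \<Rightarrow> complex" and z :: "complex^'n::{finite,linorder}"
    assume f: "line_holomorphic_on f tube" and z: "z \<in> tube"
    define d where "d = sqrt (rho_diag z) / 4"
    have d: "0 < d" "d powr 2 = rho_diag z / 16"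
      using z by (auto simp: d_def mem_tube power_divide)
    define T where "T v = z + chart z (parabolic_dilation d v)" for v
    have T_line: "T (a + t *s v) = T a + t *s chart z (parabolic_dilation d v)" for a t v
      by (simp add: T_def chart_linear parabolic_dilation_linear add.assoc)
    have T_cont: "continuous_on UNIV T"
      unfolding T_def
      by (intro continuous_on_add continuous_on_const
          continuous_on_compose2[OF continuous_on_chart continuous_on_parabolic_dilation]) auto
    have near: "near z (T v)" if "norm v \<le> 1" for v
      unfolding T_def by (rule near_chart[OF z that d_def])
    have lh: "line_holomorphic_on (\<lambda>v. f (T v)) (T -` tube)"
      unfolding line_holomorphic_on_def
    proof (intro conjI allI)
      show "continuous_on (T -` tube) (\<lambda>v. f (T v))"
        by (rule continuous_on_compose2[of tube f])
          (use f continuous_on_subset[OF T_cont] in \<open>auto simp: line_holomorphic_on_def\<close>)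
      show "(\<lambda>t. f (T (a + t *s v))) holomorphic_on {t. a + t *s v \<in> T -` tube}" for a v
      proof -
        have "(\<lambda>t. f (T a + t *s chart z (parabolic_dilation d v))) holomorphic_on
          {t. T a + t *s chart z (parabolic_dilation d v) \<in> tube}"
          using f by (simp add: line_holomorphic_on_def)
        then show ?thesis by (simp only: T_line vimage_eq)
      qed
    qed
    have sub: "cball 0 1 \<subseteq> T -` tube" using near[THEN near_tube] by auto
    define F where "F w = ennreal (cmod (f w) powr p) * indicator {w. near z w} w" for w
    have [measurable]: "F \<in> borel_measurable borel"
      unfolding F_def using f near_tube
      by (intro borel_measurable_indicator_continuous[of tube]) (auto simp: line_holomorphic_on_def borel_open open_near)
    have [measurable]: "chart z \<in> borel_measurable borel"
      by (rule borel_measurable_continuous_onI[OF continuous_on_chart])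
    have "ennreal (cmod (f z) powr p) = ennreal (cmod (f (T 0)) powr p)"
    proof -
      have "parabolic_dilation d 0 = (0 :: complex^'n::{finite,linorder})"
        by (simp add: parabolic_dilation_def vec_eq_iff)
      then show ?thesis by (simp add: T_def chart_def)
    qed
    also have "\<dots> \<le> ennreal C * (\<integral>\<^sup>+x. ennreal (cmod (f (T x)) powr p) * indicator (ball 0 1) x \<partial>lborel)"
      by (rule C(2)[OF lh sub])
    also have "\<dots> \<le> ennreal C * (\<integral>\<^sup>+x. F (T x) \<partial>lborel)"
      using near by (intro mult_left_mono nn_integral_mono) (auto simp: F_def indicator_def)
    also have "(\<integral>\<^sup>+x. F (T x) \<partial>lborel) = ennreal (16 powr N * rho_diag z powr (- N)) * (\<integral>\<^sup>+w. F w \<partial>lborel)"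
    proof -
      have "(\<integral>\<^sup>+w. F w \<partial>lborel) = (\<integral>\<^sup>+w. F (z + w) \<partial>lborel)"
        using nn_integral_lborel_translate[of F z] by (simp add: add.commute)
      also have "\<dots> = (\<integral>\<^sup>+w. F (z + chart z w) \<partial>lborel)"
        by (rule nn_integral_chart[symmetric]) simp
      also have "\<dots> = ennreal (d powr (2 * N)) * (\<integral>\<^sup>+x. F (T x) \<partial>lborel)"
        unfolding N_def T_def by (rule nn_integral_parabolic_dilation[OF d(1)]) measurable
      finally have "ennreal (d powr (- (2 * N))) * (\<integral>\<^sup>+w. F w \<partial>lborel) = ennreal (d powr (- (2 * N)) * d powr (2 * N)) * (\<integral>\<^sup>+x. F (T x) \<partial>lborel)"
        by (simp add: ennreal_mult mult.assoc)
      moreover have "d powr (- (2 * N)) * d powr (2 * N) = 1"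
        using d by (simp flip: powr_add)
      moreover have "d powr (- (2 * N)) = (d powr 2) powr (- N)"
        using d(1) by (simp add: powr_powr del: powr_numeral)
      moreover have "(d powr 2) powr (- N) = 16 powr N * rho_diag z powr (- N)"
        unfolding d(2) using z by (simp add: powr_divide mem_tube powr_minus field_simps)
      ultimately show ?thesis by simp
    qed
    also have "ennreal C * (ennreal (16 powr N * rho_diag z powr (- N)) * (\<integral>\<^sup>+w. F w \<partial>lborel))
      = ennreal (C * 16 powr N * rho_diag z powr (- N)) * (\<integral>\<^sup>+w. F w \<partial>lborel)"
      using C(1) by (simp add: ennreal_mult mult.assoc)
    finally show "ennreal (cmod (f z) powr p) \<le> ennreal (C * 16 powr N * rho_diag z powr (- (real CARD('n) + 1))) *
      (\<integral>\<^sup>+w. ennreal (cmod (f w) powr p) * indicator {w. near z w} w \<partial>lborel)"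
      by (simp add: F_def N_def)
  qed
qed

lemma holomorphic_tube_line_holomorphic:
  fixes f :: "complex^'n::{finite,linorder} \<Rightarrow> complex"
  assumes "holomorphic_tube f" shows "line_holomorphic_on f tube"
  unfolding line_holomorphic_on_def
proof (intro conjI allI)
  show "continuous_on tube f"
    using assms unfolding holomorphic_tube_def
    by (meson continuous_at_imp_continuous_on has_derivative_continuous)
  fix a v :: "complex^'n::{finite,linorder}"
  show "(\<lambda>t. f (a + t *s v)) holomorphic_on {t. a + t *s v \<in> tube}"
    unfolding holomorphic_on_def
  proof (intro ballI)
    fix t assume "t \<in> {t. a + t *s v \<in> tube}"
    then obtain D where D: "(f has_derivative D) (at (a + t *s v))" "\<And>c v. D (c *s v) = c * D v"
      using assms by (auto simp: holomorphic_tube_def)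
    have "((\<lambda>t. a + t *s v) has_derivative (\<lambda>t. t *s v)) (at t)"
      using bounded_linear_imp_has_derivative[OF bounded_linear_vector_scalar_mult]
      by (auto intro!: derivative_eq_intros)
    from has_derivative_compose[OF this D(1)]
    have "((\<lambda>t. f (a + t *s v)) has_field_derivative D v) (at t)"
      unfolding has_field_derivative_def D(2) by (metis (no_types) ext mult.commute)
    then show "(\<lambda>t. f (a + t *s v)) field_differentiable at t within {t. a + t *s v \<in> tube}"
      using field_differentiable_at_within field_differentiable_def by blast
  qed
qed

section \<open>Carleson embedding and the Berezin-type operator\<close>

text \<open>The pointwise inequality k <= y + y^(1-p) k^p, valid for every y > 0, is integrated
  against h and used at y = (j / m)^(1/p), where both terms agree; hence the factor 2. If j = 0
  there is no such positive y, and y is sent to 0 instead.\<close>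

lemma nn_integral_weighted_Holder:
  fixes h k :: "'a \<Rightarrow> real"
  assumes p: "1 < p" and m: "0 < m" and j: "0 \<le> j"
    and [measurable]: "h \<in> borel_measurable M" "k \<in> borel_measurable M"
    and h: "\<And>x. 0 \<le> h x" and k: "\<And>x. 0 \<le> k x"
    and hm: "(\<integral>\<^sup>+x. ennreal (h x) \<partial>M) \<le> ennreal m"
    and hj: "(\<integral>\<^sup>+x. ennreal (h x * k x powr p) \<partial>M) \<le> ennreal j"
  shows "(\<integral>\<^sup>+x. ennreal (h x * k x) \<partial>M) \<le> ennreal (2 * m powr (1 - 1 / p) * j powr (1 / p))"
proof -
  have le: "(\<integral>\<^sup>+x. ennreal (h x * k x) \<partial>M) \<le> ennreal (y * m + y powr (1 - p) * j)" if y: "0 < y" for y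
  proof -
    have pt: "k x \<le> y + y powr (1 - p) * k x powr p" for x
    proof (cases "k x \<le> y")
      case False
      then have "k x powr (1 - p) \<le> y powr (1 - p)" using y p by (intro powr_mono2') auto
      then have "k x powr (1 - p) * k x powr p \<le> y powr (1 - p) * k x powr p" by (rule mult_right_mono) auto
      moreover have "k x powr (1 - p) * k x powr p = k x" using False y by (simp flip: powr_add)
      ultimately show ?thesis using y by linarith
    qed (simp add: add_increasing2)
    have "(\<integral>\<^sup>+x. ennreal (h x * k x) \<partial>M)
      \<le> (\<integral>\<^sup>+x. ennreal y * ennreal (h x) + ennreal (y powr (1 - p)) * ennreal (h x * k x powr p) \<partial>M)"
    proof (rule nn_integral_mono)
      fix x
      have "h x * k x \<le> y * h x + y powr (1 - p) * (h x * k x powr p)"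
        using mult_left_mono[OF pt h, of x x] by (simp add: algebra_simps)
      then show "ennreal (h x * k x) \<le> ennreal y * ennreal (h x) + ennreal (y powr (1 - p)) * ennreal (h x * k x powr p)"
        using y h[of x] by (simp add: ennreal_mult[symmetric] ennreal_plus[symmetric] ennreal_leI del: ennreal_plus)
    qed
    also have "\<dots> = ennreal y * (\<integral>\<^sup>+x. ennreal (h x) \<partial>M) + ennreal (y powr (1 - p)) * (\<integral>\<^sup>+x. ennreal (h x * k x powr p) \<partial>M)"
      by (simp add: nn_integral_add nn_integral_cmult)
    also have "\<dots> \<le> ennreal y * ennreal m + ennreal (y powr (1 - p)) * ennreal j"
      by (intro add_mono mult_left_mono hm hj) auto
    also have "\<dots> = ennreal (y * m + y powr (1 - p) * j)"
      using y m j by (simp add: ennreal_mult ennreal_plus)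
    finally show ?thesis .
  qed
  show ?thesis
  proof (cases "j = 0")
    case True
    have "(\<integral>\<^sup>+x. ennreal (h x * k x) \<partial>M) \<le> 0"
    proof (rule ennreal_le_epsilon)
      fix e :: real assume "0 < e"
      then show "(\<integral>\<^sup>+x. ennreal (h x * k x) \<partial>M) \<le> 0 + ennreal e"
        using le[of "e / m"] m True by simp
    qed
    then show ?thesis by simp
  next
    case False
    then have j: "0 < j" using j by simp
    define y where "y = (j / m) powr (1 / p)"
    have "y * m = m powr (1 - 1 / p) * j powr (1 / p)"
      using m j by (simp add: y_def powr_divide powr_diff)
    moreover have "y powr (1 - p) * j = m powr (1 - 1 / p) * j powr (1 / p)"
    proof -
      have "y powr (1 - p) = (j / m) powr (1 / p - 1)"
        using p by (simp add: y_def powr_powr diff_divide_distrib)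
      also have "\<dots> = j powr (1 / p) / j * (m / m powr (1 / p))"
        using m j by (simp add: powr_divide powr_diff)
      finally show ?thesis using m j by (simp add: powr_diff)
    qed
    ultimately show ?thesis
      using le[of y] m j by (simp add: y_def mult_ac)
  qed
qed

text \<open>Measures on the whole space rather than on \<open>tube\<close>: the estimates are
  applied both to the extension by zero of the given measure and to its restriction off a compact
  set. Sigma-finiteness provides Tonelli.\<close>

locale tube_measure = sigma_finite_measure \<nu>
  for \<nu> :: "(complex^'n::{finite,linorder}) measure" +
  assumes sets_nu [measurable_cong]: "sets \<nu> = sets borel"
begin

text \<open>Tonelli on the pairs with \<open>near u w\<close>. By symmetry of the relation, averages
  of H over the set near w become H weighted with the measure of the set near u.\<close>

lemma nn_integral_near_le:
  assumes [measurable]: "G \<in> borel_measurable borel" "H \<in> borel_measurable borel"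
    and le: "\<And>w. w \<in> tube \<Longrightarrow> G w \<le> (\<integral>\<^sup>+u. H u * indicator {u. near w u} u \<partial>lborel)"
  shows "(\<integral>\<^sup>+w. G w * indicator tube w \<partial>\<nu>) \<le> (\<integral>\<^sup>+u. H u * emeasure \<nu> {w. near u w} * indicator tube u \<partial>lborel)"
proof -
  interpret pair_sigma_finite lborel \<nu>
    by (intro pair_sigma_finite.intro sigma_finite_lborel sigma_finite_measure_axioms)
  have near_sets [measurable]: "{w. near u w} \<in> sets \<nu>" for u
    using open_near[of u] by (simp add: sets_nu borel_open)
  have "(\<integral>\<^sup>+w. G w * indicator tube w \<partial>\<nu>) \<le> (\<integral>\<^sup>+w. (\<integral>\<^sup>+u. H u * indicator {p. near (fst p) (snd p)} (u, w) \<partial>lborel) \<partial>\<nu>)"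
    using le by (intro nn_integral_mono) (auto simp: indicator_def near_commute)
  also have "\<dots> = (\<integral>\<^sup>+u. (\<integral>\<^sup>+w. H u * indicator {p. near (fst p) (snd p)} (u, w) \<partial>\<nu>) \<partial>lborel)"
  proof (rule Fubini')
    have [measurable]: "{p :: (complex^'n::{finite,linorder}) \<times> (complex^'n::{finite,linorder}). near (fst p) (snd p)} \<in> sets (borel \<Otimes>\<^sub>M borel)"
    proof -
      have "continuous_on UNIV (\<lambda>p :: (complex^'n::{finite,linorder}) \<times> (complex^'n::{finite,linorder}). rho_diag (fst p))"
        "continuous_on UNIV (\<lambda>p :: (complex^'n::{finite,linorder}) \<times> (complex^'n::{finite,linorder}). rho_diag (snd p))"
        by (rule continuous_on_compose2[OF continuous_on_rho_diag[of UNIV]], auto intro: continuous_intros)+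
      then show ?thesis
        unfolding borel_prod near_def
        by (intro borel_open open_Collect_conj open_Collect_less continuous_on_mult continuous_on_const
            continuous_on_norm continuous_on_rho continuous_on_fst continuous_on_snd continuous_on_id)
    qed
    show "(\<lambda>(u, w). H u * indicator {p. near (fst p) (snd p)} (u, w)) \<in> borel_measurable (lborel \<Otimes>\<^sub>M \<nu>)"
      by measurable
  qed
  also have "\<dots> = (\<integral>\<^sup>+u. H u * emeasure \<nu> {w. near u w} * indicator tube u \<partial>lborel)"
  proof (rule nn_integral_cong)
    fix u
    have "(\<integral>\<^sup>+w. H u * indicator {p. near (fst p) (snd p)} (u, w) \<partial>\<nu>) = (\<integral>\<^sup>+w. H u * indicator {w. near u w} w \<partial>\<nu>)"
      by (simp add: indicator_def)
    also have "\<dots> = H u * emeasure \<nu> {w. near u w}"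
      by (simp add: nn_integral_cmult_indicator)
    also have "\<dots> = H u * emeasure \<nu> {w. near u w} * indicator tube u"
    proof (cases "u \<in> tube")
      case False
      then have "{w. near u w} = {}" using near_tube by auto
      then show ?thesis by simp
    qed simp
    finally show "(\<integral>\<^sup>+w. H u * indicator {p. near (fst p) (snd p)} (u, w) \<partial>\<nu>)
      = H u * emeasure \<nu> {w. near u w} * indicator tube u" .
  qed
  finally show ?thesis .
qed

end

text \<open>On the set near z the height agrees with \<open>rho_diag z\<close> up to a factor 4, so
  any power of it may be moved inside the integral. The exponent is an arbitrary real number, and
  later uses insert shifted ones such as \<open>\<alpha> - b\<close>.\<close>

lemma weighted_mean:
  assumes p: "0 < p"
  obtains C where "0 < C" "\<And>(f :: complex^'n::{finite,linorder} \<Rightarrow> complex) z. line_holomorphic_on f tube \<Longrightarrow>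
    f \<in> borel_measurable borel \<Longrightarrow> z \<in> tube \<Longrightarrow>
    ennreal (cmod (f z) powr p) \<le> ennreal (C * rho_diag z powr (- (real CARD('n) + 1 + \<alpha>))) *
      (\<integral>\<^sup>+w. ennreal (cmod (f w) powr p * rho_diag w powr \<alpha>) * indicator {w. near z w} w \<partial>lborel)"
proof -
  define N where "N = real CARD('n) + 1"
  obtain C where C: "0 < C" "\<And>(f :: complex^'n::{finite,linorder} \<Rightarrow> complex) z. line_holomorphic_on f tube \<Longrightarrow> z \<in> tube \<Longrightarrow>
    ennreal (cmod (f z) powr p) \<le> ennreal (C * rho_diag z powr (- N)) *
      (\<integral>\<^sup>+w. ennreal (cmod (f w) powr p) * indicator {w. near z w} w \<partial>lborel)"
    unfolding N_def by (rule line_holomorphic_tube_mean[OF p, where 'n='n]) blast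
  show thesis
  proof (rule that)
    show "0 < C * 4 powr \<bar>\<alpha>\<bar>" using C(1) by simp
    fix f :: "complex^'n::{finite,linorder} \<Rightarrow> complex" and z :: "complex^'n::{finite,linorder}"
    assume f: "line_holomorphic_on f tube" and [measurable]: "f \<in> borel_measurable borel" and z: "z \<in> tube"
    have r: "0 < rho_diag z" using z by (simp add: mem_tube)
    have [measurable]: "{w. near z w} \<in> sets borel" using open_near by (rule borel_open)
    have "ennreal (cmod (f z) powr p) \<le> ennreal (C * rho_diag z powr (- N)) *
      (\<integral>\<^sup>+w. ennreal (cmod (f w) powr p) * indicator {w. near z w} w \<partial>lborel)"
      by (rule C(2)[OF f z])
    also have "\<dots> \<le> ennreal (C * rho_diag z powr (- N)) *
      (\<integral>\<^sup>+w. ennreal (4 powr \<bar>\<alpha>\<bar> * rho_diag z powr (- \<alpha>)) * (ennreal (cmod (f w) powr p * rho_diag w powr \<alpha>) * indicator {w. near z w} w) \<partial>lborel)"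
    proof (intro mult_left_mono nn_integral_mono)
      fix w
      show "ennreal (cmod (f w) powr p) * indicator {w. near z w} w
        \<le> ennreal (4 powr \<bar>\<alpha>\<bar> * rho_diag z powr (- \<alpha>)) * (ennreal (cmod (f w) powr p * rho_diag w powr \<alpha>) * indicator {w. near z w} w)"
      proof (cases "near z w")
        case True
        have "1 \<le> 4 powr \<bar>\<alpha>\<bar> * rho_diag z powr (- \<alpha>) * rho_diag w powr \<alpha>"
          using near_rho_diag_powr[OF True, of \<alpha>] r by (simp add: powr_minus field_simps)
        then have "cmod (f w) powr p * 1 \<le> cmod (f w) powr p * (4 powr \<bar>\<alpha>\<bar> * rho_diag z powr (- \<alpha>) * rho_diag w powr \<alpha>)"
          by (intro mult_left_mono) auto
        then have "ennreal (cmod (f w) powr p) \<le> ennreal ((4 powr \<bar>\<alpha>\<bar> * rho_diag z powr (- \<alpha>)) * (cmod (f w) powr p * rho_diag w powr \<alpha>))"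
          by (intro ennreal_leI) (simp add: mult_ac)
        also have "\<dots> = ennreal (4 powr \<bar>\<alpha>\<bar> * rho_diag z powr (- \<alpha>)) * ennreal (cmod (f w) powr p * rho_diag w powr \<alpha>)"
          by (intro ennreal_mult) auto
        finally show ?thesis using True by simp
      qed simp
    qed simp
    also have "\<dots> = ennreal (C * rho_diag z powr (- N)) * ennreal (4 powr \<bar>\<alpha>\<bar> * rho_diag z powr (- \<alpha>)) *
      (\<integral>\<^sup>+w. ennreal (cmod (f w) powr p * rho_diag w powr \<alpha>) * indicator {w. near z w} w \<partial>lborel)"
      by (simp add: nn_integral_cmult mult.assoc)
    also have "ennreal (C * rho_diag z powr (- N)) * ennreal (4 powr \<bar>\<alpha>\<bar> * rho_diag z powr (- \<alpha>))
      = ennreal (C * 4 powr \<bar>\<alpha>\<bar> * rho_diag z powr (- (N + \<alpha>)))"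
      using C(1) r by (simp add: ennreal_mult[symmetric] powr_diff powr_minus_divide)
    finally show "ennreal (cmod (f z) powr p) \<le> ennreal (C * 4 powr \<bar>\<alpha>\<bar> * rho_diag z powr (- (real CARD('n) + 1 + \<alpha>))) *
      (\<integral>\<^sup>+w. ennreal (cmod (f w) powr p * rho_diag w powr \<alpha>) * indicator {w. near z w} w \<partial>lborel)"
      by (simp add: N_def)
  qed
qed

text \<open>Enlarges the region of the local mean to all of \<open>tube\<close>. This makes Bergman
  balls locally uniformly bounded, and it also prices the surplus power |f|^(q-p) in
  \<open>carleson_embedding\<close>.\<close>

lemma pointwise_bound:
  assumes p: "0 < p"
  obtains C where "0 < C" "\<And>(f :: complex^'n::{finite,linorder} \<Rightarrow> complex) z A. line_holomorphic_on f tube \<Longrightarrow>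
    f \<in> borel_measurable borel \<Longrightarrow> 0 < A \<Longrightarrow>
    (\<integral>\<^sup>+w. ennreal (cmod (f w) powr p * rho_diag w powr \<alpha>) * indicator tube w \<partial>lborel) \<le> ennreal (A powr p) \<Longrightarrow>
    z \<in> tube \<Longrightarrow> cmod (f z) \<le> C * A * rho_diag z powr (- ((real CARD('n) + 1 + \<alpha>) / p))"
proof -
  define N where "N = real CARD('n) + 1 + \<alpha>"
  obtain C where C: "0 < C" "\<And>(f :: complex^'n::{finite,linorder} \<Rightarrow> complex) z. line_holomorphic_on f tube \<Longrightarrow>
    f \<in> borel_measurable borel \<Longrightarrow> z \<in> tube \<Longrightarrow>
    ennreal (cmod (f z) powr p) \<le> ennreal (C * rho_diag z powr (- N)) *
      (\<integral>\<^sup>+w. ennreal (cmod (f w) powr p * rho_diag w powr \<alpha>) * indicator {w. near z w} w \<partial>lborel)"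
    unfolding N_def by (rule weighted_mean[OF p, where 'n='n]) blast
  show thesis
  proof (rule that)
    show "0 < C powr (1 / p)" using C(1) by simp
    fix f :: "complex^'n::{finite,linorder} \<Rightarrow> complex" and z :: "complex^'n::{finite,linorder}" and A
    assume f: "line_holomorphic_on f tube" "f \<in> borel_measurable borel" and A: "0 < A"
      and int: "(\<integral>\<^sup>+w. ennreal (cmod (f w) powr p * rho_diag w powr \<alpha>) * indicator tube w \<partial>lborel) \<le> ennreal (A powr p)"
      and z: "z \<in> tube"
    have "(\<integral>\<^sup>+w. ennreal (cmod (f w) powr p * rho_diag w powr \<alpha>) * indicator {w. near z w} w \<partial>lborel)
      \<le> (\<integral>\<^sup>+w. ennreal (cmod (f w) powr p * rho_diag w powr \<alpha>) * indicator tube w \<partial>lborel)"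
      using near_tube by (intro nn_integral_mono) (auto simp: indicator_def)
    then have "ennreal (cmod (f z) powr p) \<le> ennreal (C * rho_diag z powr (- N)) * ennreal (A powr p)"
      using int by (intro order_trans[OF C(2)[OF f z]] mult_left_mono) auto
    also have "\<dots> = ennreal (C * rho_diag z powr (- N) * A powr p)"
      using C(1) by (intro ennreal_mult[symmetric]) auto
    finally have "cmod (f z) powr p \<le> C * rho_diag z powr (- N) * A powr p"
      using C(1) by (simp add: ennreal_le_iff)
    then have "(cmod (f z) powr p) powr (1 / p) \<le> (C * rho_diag z powr (- N) * A powr p) powr (1 / p)"
      using p by (intro powr_mono2) auto
    then show "cmod (f z) \<le> C powr (1 / p) * A * rho_diag z powr (- ((real CARD('n) + 1 + \<alpha>) / p))"
      unfolding N_def[symmetric] using p A C(1) by (simp add: powr_mult powr_powr mult_ac)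
  qed
qed

text \<open>As p <= q, write |f|^q = |f|^(q-p) |f|^p, bound the first factor pointwise and the
  second by a local mean, then exchange the integrals. The relation between b and c is the
  homogeneity condition. The constant is linear in m, so a measure that is small on all the sets
  near u embeds with a small constant.\<close>

lemma carleson_embedding:
  assumes p: "0 < p" "p \<le> q" and bc: "b + c = (real CARD('n) + 1 + \<alpha>) * q / p"
  obtains C where "0 < C" "\<And>(f :: complex^'n::{finite,linorder} \<Rightarrow> complex) A \<nu> m. line_holomorphic_on f tube \<Longrightarrow>
    f \<in> borel_measurable borel \<Longrightarrow> 0 < A \<Longrightarrow>
    (\<integral>\<^sup>+w. ennreal (cmod (f w) powr p * rho_diag w powr \<alpha>) * indicator tube w \<partial>lborel) \<le> ennreal (A powr p) \<Longrightarrow>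
    tube_measure \<nu> \<Longrightarrow> 0 < m \<Longrightarrow> (\<And>u. u \<in> tube \<Longrightarrow> emeasure \<nu> {w. near u w} \<le> ennreal (m * rho_diag u powr b)) \<Longrightarrow>
    (\<integral>\<^sup>+w. ennreal (cmod (f w) powr q * rho_diag w powr c) * indicator tube w \<partial>\<nu>) \<le> ennreal (C * m * A powr q)"
proof -
  define N where "N = real CARD('n) + 1 + \<alpha>"
  obtain C1 where C1: "0 < C1" "\<And>(f :: complex^'n::{finite,linorder} \<Rightarrow> complex) z A. line_holomorphic_on f tube \<Longrightarrow>
    f \<in> borel_measurable borel \<Longrightarrow> 0 < A \<Longrightarrow>
    (\<integral>\<^sup>+w. ennreal (cmod (f w) powr p * rho_diag w powr \<alpha>) * indicator tube w \<partial>lborel) \<le> ennreal (A powr p) \<Longrightarrow>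
    z \<in> tube \<Longrightarrow> cmod (f z) \<le> C1 * A * rho_diag z powr (- (N / p))"
    unfolding N_def by (rule pointwise_bound[OF p(1), where 'n='n]) blast
  \<comment> \<open>The mean is taken with weight exponent \<open>\<alpha> - b\<close>, because the
    measure of the set near u later supplies the missing power
    \<open>rho_diag u powr b\<close>.\<close>
  have eN: "real CARD('n) + 1 + (\<alpha> - b) = N - b" by (simp add: N_def)
  obtain C2 where C2: "0 < C2" "\<And>(f :: complex^'n::{finite,linorder} \<Rightarrow> complex) z. line_holomorphic_on f tube \<Longrightarrow>
    f \<in> borel_measurable borel \<Longrightarrow> z \<in> tube \<Longrightarrow>
    ennreal (cmod (f z) powr p) \<le> ennreal (C2 * rho_diag z powr (- (N - b))) *
      (\<integral>\<^sup>+w. ennreal (cmod (f w) powr p * rho_diag w powr (\<alpha> - b)) * indicator {w. near z w} w \<partial>lborel)"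
    unfolding eN[symmetric] by (rule weighted_mean[OF p(1), where 'n='n]) blast
  have bc': "b + c = N * q / p" using bc by (simp only: N_def)
  show thesis
  proof (rule that)
    show "0 < C1 powr (q - p) * C2" using C1(1) C2(1) by simp
    fix f :: "complex^'n::{finite,linorder} \<Rightarrow> complex" and A m and \<nu> :: "(complex^'n::{finite,linorder}) measure"
    assume f: "line_holomorphic_on f tube" and fb [measurable]: "f \<in> borel_measurable borel" and A: "0 < A"
      and int: "(\<integral>\<^sup>+w. ennreal (cmod (f w) powr p * rho_diag w powr \<alpha>) * indicator tube w \<partial>lborel) \<le> ennreal (A powr p)"
      and nu: "tube_measure \<nu>" and m: "0 < m"
      and near: "\<And>u. u \<in> tube \<Longrightarrow> emeasure \<nu> {w. near u w} \<le> ennreal (m * rho_diag u powr b)"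
    interpret tube_measure \<nu> by fact
    define K where "K = (C1 * A) powr (q - p) * C2"
    have K: "0 < K" using C1(1) C2(1) A by (simp add: K_def)
    define H where "H u = ennreal K * ennreal (cmod (f u) powr p * rho_diag u powr (\<alpha> - b))" for u
    have [measurable]: "H \<in> borel_measurable borel" unfolding H_def by measurable
    have le: "ennreal (cmod (f w) powr q * rho_diag w powr c) \<le> (\<integral>\<^sup>+u. H u * indicator {u. near w u} u \<partial>lborel)"
      if w: "w \<in> tube" for w
    proof -
      have r: "0 < rho_diag w" using w by (simp add: mem_tube)
      have "cmod (f w) powr (q - p) \<le> (C1 * A * rho_diag w powr (- (N / p))) powr (q - p)"
        using p by (intro powr_mono2 C1(2)[OF f fb A int w]) auto
      also have "\<dots> = (C1 * A) powr (q - p) * rho_diag w powr (- (N / p) * (q - p))"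
        using C1(1) A by (simp add: powr_mult powr_powr)
      finally have "cmod (f w) powr (q - p) * (cmod (f w) powr p * rho_diag w powr c)
        \<le> (C1 * A) powr (q - p) * rho_diag w powr (- (N / p) * (q - p)) * (cmod (f w) powr p * rho_diag w powr c)"
        by (rule mult_right_mono) auto
      moreover have "cmod (f w) powr q = cmod (f w) powr (q - p) * cmod (f w) powr p"
        by (simp flip: powr_add)
      moreover have "rho_diag w powr (- (N / p) * (q - p)) * rho_diag w powr c = rho_diag w powr (N - b)"
      proof -
        have "- (N / p) * (q - p) + c = N - b"
          using bc' p by (simp add: field_simps)
        then show ?thesis by (simp only: powr_add[symmetric])
      qed
      moreover have "(C1 * A) powr (q - p) * rho_diag w powr (- (N / p) * (q - p)) * (cmod (f w) powr p * rho_diag w powr c)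
        = (C1 * A) powr (q - p) * (rho_diag w powr (- (N / p) * (q - p)) * rho_diag w powr c) * cmod (f w) powr p"
        by (simp only: mult_ac)
      ultimately have "cmod (f w) powr q * rho_diag w powr c \<le> (C1 * A) powr (q - p) * rho_diag w powr (N - b) * cmod (f w) powr p"
        by (simp only: mult.assoc)
      then have "ennreal (cmod (f w) powr q * rho_diag w powr c) \<le> ennreal ((C1 * A) powr (q - p) * rho_diag w powr (N - b)) * ennreal (cmod (f w) powr p)"
        by (simp add: ennreal_mult[symmetric] ennreal_leI)
      also have "\<dots> \<le> ennreal ((C1 * A) powr (q - p) * rho_diag w powr (N - b)) * (ennreal (C2 * rho_diag w powr (- (N - b))) *
        (\<integral>\<^sup>+u. ennreal (cmod (f u) powr p * rho_diag u powr (\<alpha> - b)) * indicator {u. near w u} u \<partial>lborel))"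
        by (intro mult_left_mono C2(2)[OF f fb w]) auto
      also have "\<dots> = ennreal ((C1 * A) powr (q - p) * rho_diag w powr (N - b) * (C2 * rho_diag w powr (- (N - b)))) *
        (\<integral>\<^sup>+u. ennreal (cmod (f u) powr p * rho_diag u powr (\<alpha> - b)) * indicator {u. near w u} u \<partial>lborel)"
        using C2(1) by (simp add: ennreal_mult[symmetric] mult.assoc[symmetric])
      also have "(C1 * A) powr (q - p) * rho_diag w powr (N - b) * (C2 * rho_diag w powr (- (N - b))) = K"
      proof -
        have "rho_diag w powr (N - b) * rho_diag w powr (- (N - b)) = 1"
          using r by (simp flip: powr_add)
        then show ?thesis by (simp add: K_def mult_ac)
      qed
      also have "ennreal K * (\<integral>\<^sup>+u. ennreal (cmod (f u) powr p * rho_diag u powr (\<alpha> - b)) * indicator {u. near w u} u \<partial>lborel)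
        = (\<integral>\<^sup>+u. H u * indicator {u. near w u} u \<partial>lborel)"
        unfolding H_def mult.assoc using open_near[of w] by (intro nn_integral_cmult[symmetric]) (simp add: borel_open)
      finally show ?thesis .
    qed
    have "(\<integral>\<^sup>+w. ennreal (cmod (f w) powr q * rho_diag w powr c) * indicator tube w \<partial>\<nu>)
      \<le> (\<integral>\<^sup>+u. H u * emeasure \<nu> {w. near u w} * indicator tube u \<partial>lborel)"
      by (intro nn_integral_near_le le) measurable
    also have "\<dots> \<le> (\<integral>\<^sup>+u. ennreal (K * m) * (ennreal (cmod (f u) powr p * rho_diag u powr \<alpha>) * indicator tube u) \<partial>lborel)"
    proof (rule nn_integral_mono)
      fix u :: "complex^'n::{finite,linorder}"
      show "H u * emeasure \<nu> {w. near u w} * indicator tube u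
        \<le> ennreal (K * m) * (ennreal (cmod (f u) powr p * rho_diag u powr \<alpha>) * indicator tube u)"
      proof (cases "u \<in> tube")
        case True
        have "H u * emeasure \<nu> {w. near u w} \<le> H u * ennreal (m * rho_diag u powr b)"
          by (intro mult_left_mono near True) auto
        also have "\<dots> = ennreal (K * (cmod (f u) powr p * rho_diag u powr (\<alpha> - b)) * (m * rho_diag u powr b))"
          using K m by (simp add: H_def ennreal_mult)
        also have "K * (cmod (f u) powr p * rho_diag u powr (\<alpha> - b)) * (m * rho_diag u powr b)
          = K * m * (cmod (f u) powr p * (rho_diag u powr (\<alpha> - b) * rho_diag u powr b))"
          by (simp only: mult_ac)
        also have "rho_diag u powr (\<alpha> - b) * rho_diag u powr b = rho_diag u powr \<alpha>"
          by (simp flip: powr_add)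
        finally show ?thesis using True K m by (simp add: ennreal_mult)
      qed simp
    qed
    also have "\<dots> = ennreal (K * m) * (\<integral>\<^sup>+u. ennreal (cmod (f u) powr p * rho_diag u powr \<alpha>) * indicator tube u \<partial>lborel)"
      by (rule nn_integral_cmult) measurable
    also have "\<dots> \<le> ennreal (K * m) * ennreal (A powr p)"
      by (intro mult_left_mono int) auto
    also have "\<dots> = ennreal (C1 powr (q - p) * C2 * m * A powr q)"
    proof -
      have "A powr (q - p) * A powr p = A powr q" by (simp flip: powr_add)
      then have eq: "K * m * A powr p = C1 powr (q - p) * C2 * m * A powr q"
        using C1(1) A by (simp add: K_def powr_mult mult_ac)
      have "ennreal (K * m) * ennreal (A powr p) = ennreal (K * m * A powr p)"
        using K m by (intro ennreal_mult[symmetric]) auto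
      then show ?thesis by (simp only: eq)
    qed
    finally show "(\<integral>\<^sup>+w. ennreal (cmod (f w) powr q * rho_diag w powr c) * indicator tube w \<partial>\<nu>)
      \<le> ennreal (C1 powr (q - p) * C2 * m * A powr q)" .
  qed
qed

lemma line_holomorphic_const: "line_holomorphic_on (\<lambda>_. c) S"
  by (simp add: line_holomorphic_on_def)

text \<open>On the set near w the kernel changes by at most a constant factor, so
  \<open>weighted_mean\<close> for the constant function 1 spreads the point w over that set and
  reduces the integral to a Forelli-Rudin integral with weight exponent a + b - (n + 1). The two
  hypotheses are its convergence conditions.\<close>

lemma kernel_carleson:
  assumes a: "-1 < a + b - (real CARD('n) + 1)" "a + b < t"
  obtains C where "0 < C" "\<And>(z :: complex^'n::{finite,linorder}) \<nu> m. z \<in> tube \<Longrightarrow>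
    tube_measure \<nu> \<Longrightarrow> 0 < m \<Longrightarrow> (\<And>u. u \<in> tube \<Longrightarrow> emeasure \<nu> {w. near u w} \<le> ennreal (m * rho_diag u powr b)) \<Longrightarrow>
    (\<integral>\<^sup>+w. ennreal (rho_diag w powr a * cmod (rho z w) powr (- t)) * indicator tube w \<partial>\<nu>)
      \<le> ennreal (C * m * rho_diag z powr (a + b - t))"
proof -
  define N where "N = real CARD('n) + 1"
  obtain C1 where C1: "0 \<le> C1" "\<And>z :: complex^'n::{finite,linorder}. z \<in> tube \<Longrightarrow>
    (\<integral>\<^sup>+w. ennreal (rho_diag w powr (a + b - N) * cmod (rho z w) powr (- t)) * indicator tube w \<partial>lborel)
      \<le> ennreal (C1 * rho_diag z powr (N + (a + b - N) - t))"
    unfolding N_def by (rule kernel_integral[of "a + b - N" t, where 'n='n]) (use a in \<open>auto simp: N_def\<close>)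
  obtain C2 where C2: "0 < C2" "\<And>(f :: complex^'n::{finite,linorder} \<Rightarrow> complex) z. line_holomorphic_on f tube \<Longrightarrow>
    f \<in> borel_measurable borel \<Longrightarrow> z \<in> tube \<Longrightarrow>
    ennreal (cmod (f z) powr 1) \<le> ennreal (C2 * rho_diag z powr (- (N + (a - N)))) *
      (\<integral>\<^sup>+w. ennreal (cmod (f w) powr 1 * rho_diag w powr (a - N)) * indicator {w. near z w} w \<partial>lborel)"
    unfolding N_def by (rule weighted_mean[OF zero_less_one, where 'n='n and \<alpha>="a - (real CARD('n) + 1)"]) blast
  show thesis
  proof (rule that)
    define K where "K = C2 * 20 powr \<bar>t\<bar>"
    have K: "0 < K" using C2(1) by (simp add: K_def)
    show "0 < K * (C1 + 1)" using K C1(1) by simp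
    fix z :: "complex^'n::{finite,linorder}" and \<nu> :: "(complex^'n::{finite,linorder}) measure" and m
    assume z: "z \<in> tube" and nu: "tube_measure \<nu>" and m: "0 < m"
      and near: "\<And>u. u \<in> tube \<Longrightarrow> emeasure \<nu> {w. near u w} \<le> ennreal (m * rho_diag u powr b)"
    interpret tube_measure \<nu> by fact
    define H where "H u = ennreal (K * (rho_diag u powr (a - N) * cmod (rho z u) powr (- t)))" for u
    have [measurable]: "H \<in> borel_measurable borel" unfolding H_def by measurable
    have le: "ennreal (rho_diag w powr a * cmod (rho z w) powr (- t)) \<le> (\<integral>\<^sup>+u. H u * indicator {u. near w u} u \<partial>lborel)"
      if w: "w \<in> tube" for w
    proof -
      have [measurable]: "{u. near w u} \<in> sets borel" using open_near by (rule borel_open)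
      have r: "0 < rho_diag w" using w by (simp add: mem_tube)
      have "ennreal (rho_diag w powr a * cmod (rho z w) powr (- t)) * 1
        \<le> ennreal (rho_diag w powr a * cmod (rho z w) powr (- t)) * (ennreal (C2 * rho_diag w powr (- a)) *
        (\<integral>\<^sup>+u. ennreal (rho_diag u powr (a - N)) * indicator {u. near w u} u \<partial>lborel))"
        using C2(2)[OF line_holomorphic_const[of 1] _ w] by (intro mult_left_mono) auto
      also have "\<dots> = ennreal (rho_diag w powr a * cmod (rho z w) powr (- t) * (C2 * rho_diag w powr (- a))) *
        (\<integral>\<^sup>+u. ennreal (rho_diag u powr (a - N)) * indicator {u. near w u} u \<partial>lborel)"
        using C2(1) by (simp add: ennreal_mult[symmetric] mult.assoc[symmetric])
      also have "rho_diag w powr a * cmod (rho z w) powr (- t) * (C2 * rho_diag w powr (- a)) = C2 * cmod (rho z w) powr (- t)"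
      proof -
        have "rho_diag w powr a * rho_diag w powr (- a) = 1" using r by (simp flip: powr_add)
        then show ?thesis by (simp add: mult_ac)
      qed
      also have "ennreal (C2 * cmod (rho z w) powr (- t)) * (\<integral>\<^sup>+u. ennreal (rho_diag u powr (a - N)) * indicator {u. near w u} u \<partial>lborel)
        = (\<integral>\<^sup>+u. ennreal (C2 * cmod (rho z w) powr (- t)) * (ennreal (rho_diag u powr (a - N)) * indicator {u. near w u} u) \<partial>lborel)"
        by (rule nn_integral_cmult[symmetric]) measurable
      also have "\<dots> \<le> (\<integral>\<^sup>+u. H u * indicator {u. near w u} u \<partial>lborel)"
      proof (rule nn_integral_mono)
        fix u
        show "ennreal (C2 * cmod (rho z w) powr (- t)) * (ennreal (rho_diag u powr (a - N)) * indicator {u. near w u} u)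
          \<le> H u * indicator {u. near w u} u"
        proof (cases "near w u")
          case True
          have "C2 * cmod (rho z w) powr (- t) * rho_diag u powr (a - N)
            \<le> C2 * (20 powr \<bar>t\<bar> * cmod (rho z u) powr (- t)) * rho_diag u powr (a - N)"
            using C2(1) near_rho_powr[OF True z, of "- t"] by (intro mult_right_mono mult_left_mono) auto
          then have "ennreal (C2 * cmod (rho z w) powr (- t) * rho_diag u powr (a - N)) \<le> H u"
            unfolding H_def K_def by (intro ennreal_leI) (simp add: mult_ac)
          then show ?thesis using True C2(1) by (simp add: ennreal_mult)
        qed simp
      qed
      finally show ?thesis by simp
    qed
    have "(\<integral>\<^sup>+w. ennreal (rho_diag w powr a * cmod (rho z w) powr (- t)) * indicator tube w \<partial>\<nu>)
      \<le> (\<integral>\<^sup>+u. H u * emeasure \<nu> {w. near u w} * indicator tube u \<partial>lborel)"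
      by (intro nn_integral_near_le le) measurable
    also have "\<dots> \<le> (\<integral>\<^sup>+u. ennreal (K * m) * (ennreal (rho_diag u powr (a + b - N) * cmod (rho z u) powr (- t)) * indicator tube u) \<partial>lborel)"
    proof (rule nn_integral_mono)
      fix u :: "complex^'n::{finite,linorder}"
      show "H u * emeasure \<nu> {w. near u w} * indicator tube u
        \<le> ennreal (K * m) * (ennreal (rho_diag u powr (a + b - N) * cmod (rho z u) powr (- t)) * indicator tube u)"
      proof (cases "u \<in> tube")
        case True
        have "H u * emeasure \<nu> {w. near u w} \<le> H u * ennreal (m * rho_diag u powr b)"
          by (intro mult_left_mono near True) auto
        also have "\<dots> = ennreal (K * (rho_diag u powr (a - N) * cmod (rho z u) powr (- t)) * (m * rho_diag u powr b))"
          using K m by (simp add: H_def ennreal_mult)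
        also have "K * (rho_diag u powr (a - N) * cmod (rho z u) powr (- t)) * (m * rho_diag u powr b)
          = K * m * ((rho_diag u powr (a - N) * rho_diag u powr b) * cmod (rho z u) powr (- t))"
          by (simp only: mult_ac)
        also have "rho_diag u powr (a - N) * rho_diag u powr b = rho_diag u powr (a + b - N)"
          by (simp add: powr_add[symmetric] algebra_simps)
        finally show ?thesis using True K m by (simp add: ennreal_mult)
      qed simp
    qed
    also have "\<dots> = ennreal (K * m) * (\<integral>\<^sup>+u. ennreal (rho_diag u powr (a + b - N) * cmod (rho z u) powr (- t)) * indicator tube u \<partial>lborel)"
      by (rule nn_integral_cmult) measurable
    also have "\<dots> \<le> ennreal (K * m) * ennreal (C1 * rho_diag z powr (N + (a + b - N) - t))"
      by (intro mult_left_mono C1(2) z) auto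
    also have "\<dots> = ennreal (K * m * (C1 * rho_diag z powr (N + (a + b - N) - t)))"
      using K m C1(1) by (intro ennreal_mult[symmetric]) auto
    also have "\<dots> \<le> ennreal (K * (C1 + 1) * m * rho_diag z powr (a + b - t))"
      using K m by (intro ennreal_leI) (simp add: algebra_simps)
    finally show "(\<integral>\<^sup>+w. ennreal (rho_diag w powr a * cmod (rho z w) powr (- t)) * indicator tube w \<partial>\<nu>)
      \<le> ennreal (K * (C1 + 1) * m * rho_diag z powr (a + b - t))" .
  qed
qed

text \<open>The counterpart of \<open>Berezin\<close> for measures on the whole space and a free
  exponent t; the indicator cuts down to the region where \<open>rho\<close> is controlled.\<close>

definition berezin_integral ::
  "(complex^'n::{finite,linorder}) measure \<Rightarrow> real \<Rightarrow> (complex^'n::{finite,linorder} \<Rightarrow> complex) \<Rightarrow> complex^'n::{finite,linorder} \<Rightarrow> ennreal" where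
  "berezin_integral \<nu> t f z = (\<integral>\<^sup>+w. ennreal (cmod (f w) * cmod (rho z w) powr (- t)) * indicator tube w \<partial>\<nu>)"

text \<open>Kernels with different first arguments in \<open>tube\<close> are comparable uniformly
  in w, by \<open>rho_quasi_invariant\<close> in both directions. Schur's test alone yields
  finiteness almost everywhere, while the Toeplitz integral must converge at every point.\<close>

lemma (in tube_measure) berezin_integral_finite:
  assumes z0: "z0 \<in> tube" and fin: "berezin_integral \<nu> t f z0 < \<infinity>" and z: "z \<in> tube"
    and [measurable]: "f \<in> borel_measurable borel"
  shows "berezin_integral \<nu> t f z < \<infinity>"
proof -
  define K where "K = max (4 + 8 * cmod (rho z0 z) / rho_diag z) (4 + 8 * cmod (rho z z0) / rho_diag z0)"
  have K: "0 < K" using z by (simp add: K_def mem_tube add_pos_nonneg less_max_iff_disj)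
  have "berezin_integral \<nu> t f z
    \<le> (\<integral>\<^sup>+w. ennreal (K powr \<bar>- t\<bar>) * (ennreal (cmod (f w) * cmod (rho z0 w) powr (- t)) * indicator tube w) \<partial>\<nu>)"
    unfolding berezin_integral_def
  proof (rule nn_integral_mono)
    fix w
    show "ennreal (cmod (f w) * cmod (rho z w) powr (- t)) * indicator tube w
      \<le> ennreal (K powr \<bar>- t\<bar>) * (ennreal (cmod (f w) * cmod (rho z0 w) powr (- t)) * indicator tube w)"
    proof (cases "w \<in> tube")
      case True
      have "(4 + 8 * cmod (rho z z0) / rho_diag z0) * cmod (rho z0 w) \<le> K * cmod (rho z0 w)"
        "(4 + 8 * cmod (rho z0 z) / rho_diag z) * cmod (rho z w) \<le> K * cmod (rho z w)"
        unfolding K_def by (intro mult_right_mono; simp)+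
      then have "cmod (rho z w) \<le> K * cmod (rho z0 w)" "cmod (rho z0 w) \<le> K * cmod (rho z w)"
        using rho_quasi_invariant[OF z z0 True] rho_quasi_invariant[OF z0 z True] by linarith+
      then have "cmod (rho z w) powr (- t) \<le> K powr \<bar>- t\<bar> * cmod (rho z0 w) powr (- t)"
        using cmod_rho_pos z z0 True by (intro powr_comparable) auto
      then have "cmod (f w) * cmod (rho z w) powr (- t) \<le> cmod (f w) * (K powr \<bar>- t\<bar> * cmod (rho z0 w) powr (- t))"
        by (intro mult_left_mono) auto
      then have "ennreal (cmod (f w) * cmod (rho z w) powr (- t)) \<le> ennreal (K powr \<bar>- t\<bar> * (cmod (f w) * cmod (rho z0 w) powr (- t)))"
        by (intro ennreal_leI) (simp add: mult_ac)
      then show ?thesis using True by (simp add: ennreal_mult)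
    qed simp
  qed
  also have "\<dots> = ennreal (K powr \<bar>- t\<bar>) * berezin_integral \<nu> t f z0"
    unfolding berezin_integral_def by (rule nn_integral_cmult) measurable
  also have "\<dots> < \<infinity>" using fin by (simp add: ennreal_mult_less_top)
  finally show ?thesis .
qed

text \<open>The first two inequalities make the kernel integral in w converge, the last two the one
  in z. An admissible exponent exists because (\<open>\<alpha>\<close> - \<open>\<xi>\<close>) / (p
  - 1) < \<open>\<xi>\<close> + 1 is the hypothesis 1 + \<open>\<alpha>\<close> < p (1 +
  \<open>\<xi>\<close>) rearranged.\<close>

lemma Schur_exponent:
  fixes p \<alpha> \<xi> :: real
  assumes "1 < p" "-1 < \<alpha>" "-1 < \<xi>" "1 + \<alpha> < p * (1 + \<xi>)"
  obtains \<sigma> where "0 < \<sigma>" "\<sigma> < \<xi> + 1" "\<alpha> - \<xi> < \<sigma> * (p - 1)" "\<sigma> * (p - 1) < \<alpha> + 1"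
proof -
  have "(\<alpha> - \<xi>) / (p - 1) < \<xi> + 1"
    using assms by (simp add: pos_divide_less_eq algebra_simps)
  moreover have "(\<alpha> - \<xi>) / (p - 1) < (\<alpha> + 1) / (p - 1)"
    using assms by (intro divide_strict_right_mono) auto
  moreover have "0 < (\<alpha> + 1) / (p - 1)"
    using assms by simp
  ultimately have "max 0 ((\<alpha> - \<xi>) / (p - 1)) < min (\<xi> + 1) ((\<alpha> + 1) / (p - 1))"
    using assms by simp
  then obtain \<sigma> where "max 0 ((\<alpha> - \<xi>) / (p - 1)) < \<sigma>" "\<sigma> < min (\<xi> + 1) ((\<alpha> + 1) / (p - 1))"
    using dense by blast
  then show thesis
    using assms by (intro that[of \<sigma>]) (simp_all add: divide_less_eq less_divide_eq)
qed

text \<open>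
  Schur's test on the measure side: Hoelder's inequality for \<open>d\<nu>\<close> with the test function
  \<open>\<rho>\<^bsup>a\<^esup>\<close>, integration in \<open>z\<close>, and the embedding of \<open>L\<^bsup>p1\<^esup>\<close> into \<open>L\<^bsup>p2\<^esup>(\<nu>)\<close>.
\<close>

lemma berezin_integral_bound:
  fixes p1 p2 \<alpha>1 \<alpha>2 \<xi> :: real
  assumes p: "0 < p1" "p1 \<le> p2" "1 < p2" and al: "-1 < \<alpha>2" and xi: "-1 < \<xi>" and cond: "1 + \<alpha>2 < p2 * (1 + \<xi>)"
    and t: "t = real CARD('n) + 1 + \<xi>"
    and b: "b = t + (real CARD('n) + 1 + \<alpha>1) / p1 - (real CARD('n) + 1 + \<alpha>2) / p2"
  obtains C where "0 < C" "\<And>(f :: complex^'n::{finite,linorder} \<Rightarrow> complex) A \<nu> m. line_holomorphic_on f tube \<Longrightarrow>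
    f \<in> borel_measurable borel \<Longrightarrow> 0 < A \<Longrightarrow>
    (\<integral>\<^sup>+w. ennreal (cmod (f w) powr p1 * rho_diag w powr \<alpha>1) * indicator tube w \<partial>lborel) \<le> ennreal (A powr p1) \<Longrightarrow>
    tube_measure \<nu> \<Longrightarrow> 0 < m \<Longrightarrow> (\<And>u. u \<in> tube \<Longrightarrow> emeasure \<nu> {w. near u w} \<le> ennreal (m * rho_diag u powr b)) \<Longrightarrow>
    (\<forall>z\<in>tube. berezin_integral \<nu> t f z < \<infinity>) \<and>
    (\<integral>\<^sup>+z. ennreal (enn2real (berezin_integral \<nu> t f z) powr p2 * rho_diag z powr \<alpha>2) * indicator tube z \<partial>lborel)
      \<le> ennreal (C * (m * A) powr p2)"
proof -
  define N where "N = real CARD('n) + 1"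
  obtain \<sigma> where s: "0 < \<sigma>" "\<sigma> < \<xi> + 1" "\<alpha>2 - \<xi> < \<sigma> * (p2 - 1)" "\<sigma> * (p2 - 1) < \<alpha>2 + 1"
    using Schur_exponent[OF p(3) al xi cond] .
  \<comment> \<open>\<open>\<tau>\<close> is b - t. The power a makes the integral of the test
    function come out as a multiple of \<open>rho_diag z powr (- \<sigma>)\<close>, e is the weight
    left over in z after Hoelder, and c collects the powers at w; b + c is then the exponent that
    \<open>carleson_embedding\<close> demands.\<close>
  define \<tau> where "\<tau> = (N + \<alpha>1) / p1 - (N + \<alpha>2) / p2"
  define a where "a = - \<tau> - \<sigma>"
  define e where "e = \<alpha>2 - \<sigma> * (p2 - 1)"
  define c where "c = a * (1 - p2) + (N + e - t)"
  have tN: "t = N + \<xi>" by (simp add: t N_def)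
  have bt: "b = t + \<tau>" by (simp add: b \<tau>_def N_def)
  have ab: "a + b = t - \<sigma>" by (simp add: a_def bt)
  have bc: "b + c = (real CARD('n) + 1 + \<alpha>1) * p2 / p1"
  proof -
    have "b + c = \<tau> * p2 + (N + \<alpha>2)"
      by (simp add: bt c_def a_def e_def algebra_simps)
    also have "\<dots> = (N + \<alpha>1) * p2 / p1"
      using p by (simp add: \<tau>_def field_simps)
    finally show ?thesis by (simp add: N_def)
  qed
  obtain C1 where C1: "0 < C1" "\<And>(z :: complex^'n::{finite,linorder}) \<nu> m. z \<in> tube \<Longrightarrow>
    tube_measure \<nu> \<Longrightarrow> 0 < m \<Longrightarrow> (\<And>u. u \<in> tube \<Longrightarrow> emeasure \<nu> {w. near u w} \<le> ennreal (m * rho_diag u powr b)) \<Longrightarrow>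
    (\<integral>\<^sup>+w. ennreal (rho_diag w powr a * cmod (rho z w) powr (- t)) * indicator tube w \<partial>\<nu>)
      \<le> ennreal (C1 * m * rho_diag z powr (a + b - t))"
    by (rule kernel_carleson[of a b t, where 'n='n]) (use s tN ab in \<open>auto simp: N_def\<close>)
  obtain C2 where C2: "0 \<le> C2" "\<And>w :: complex^'n::{finite,linorder}. w \<in> tube \<Longrightarrow>
    (\<integral>\<^sup>+z. ennreal (rho_diag z powr e * cmod (rho w z) powr (- t)) * indicator tube z \<partial>lborel)
      \<le> ennreal (C2 * rho_diag w powr (N + e - t))"
    unfolding N_def by (rule kernel_integral[of e t, where 'n='n]) (use s tN in \<open>auto simp: N_def e_def\<close>)
  obtain C3 where C3: "0 < C3" "\<And>(f :: complex^'n::{finite,linorder} \<Rightarrow> complex) A \<nu> m. line_holomorphic_on f tube \<Longrightarrow>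
    f \<in> borel_measurable borel \<Longrightarrow> 0 < A \<Longrightarrow>
    (\<integral>\<^sup>+w. ennreal (cmod (f w) powr p1 * rho_diag w powr \<alpha>1) * indicator tube w \<partial>lborel) \<le> ennreal (A powr p1) \<Longrightarrow>
    tube_measure \<nu> \<Longrightarrow> 0 < m \<Longrightarrow> (\<And>u. u \<in> tube \<Longrightarrow> emeasure \<nu> {w. near u w} \<le> ennreal (m * rho_diag u powr b)) \<Longrightarrow>
    (\<integral>\<^sup>+w. ennreal (cmod (f w) powr p2 * rho_diag w powr c) * indicator tube w \<partial>\<nu>) \<le> ennreal (C3 * m * A powr p2)"
    by (rule carleson_embedding[OF p(1,2) bc]) blast
  define D where "D = 2 powr p2 * C1 powr (p2 - 1)"
  have D: "0 < D" using C1(1) by (simp add: D_def)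
  show thesis
  proof (rule that)
    show "0 < D * (C2 + 1) * C3" using D C2(1) C3(1) by simp
    fix f :: "complex^'n::{finite,linorder} \<Rightarrow> complex" and A m and \<nu> :: "(complex^'n::{finite,linorder}) measure"
    assume f: "line_holomorphic_on f tube" and fb [measurable]: "f \<in> borel_measurable borel" and A: "0 < A"
      and int: "(\<integral>\<^sup>+w. ennreal (cmod (f w) powr p1 * rho_diag w powr \<alpha>1) * indicator tube w \<partial>lborel) \<le> ennreal (A powr p1)"
      and nu: "tube_measure \<nu>" and m: "0 < m"
      and near: "\<And>u. u \<in> tube \<Longrightarrow> emeasure \<nu> {w. near u w} \<le> ennreal (m * rho_diag u powr b)"
    interpret tube_measure \<nu> by fact
    interpret pair_sigma_finite lborel \<nu>
      by (intro pair_sigma_finite.intro sigma_finite_lborel sigma_finite_measure_axioms)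
    define J where "J z = (\<integral>\<^sup>+w. ennreal (cmod (f w) powr p2 * rho_diag w powr (a * (1 - p2)) * cmod (rho z w) powr (- t)) * indicator tube w \<partial>\<nu>)" for z
    have I: "berezin_integral \<nu> t f z < \<infinity> \<and>
        enn2real (berezin_integral \<nu> t f z) powr p2 \<le> D * m powr (p2 - 1) * rho_diag z powr (- (\<sigma> * (p2 - 1))) * j"
      if z: "z \<in> tube" and j: "0 \<le> j" "J z \<le> ennreal j" for z j
    proof -
      have r: "0 < rho_diag z" using z by (simp add: mem_tube)
      define M where "M = C1 * m * rho_diag z powr (- \<sigma>)"
      have M: "0 < M" using C1(1) m r by (simp add: M_def)
      define h where "h w = rho_diag w powr a * cmod (rho z w) powr (- t) * indicator tube w" for w
      define k where "k w = cmod (f w) * rho_diag w powr (- a)" for w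
      have "berezin_integral \<nu> t f z = (\<integral>\<^sup>+w. ennreal (h w * k w) \<partial>\<nu>)"
        unfolding berezin_integral_def
      proof (rule nn_integral_cong)
        fix w
        show "ennreal (cmod (f w) * cmod (rho z w) powr (- t)) * indicator tube w = ennreal (h w * k w)"
        proof (cases "w \<in> tube")
          case True
          then have "rho_diag w powr a * rho_diag w powr (- a) = 1" by (simp add: mem_tube flip: powr_add)
          then have "h w * k w = cmod (f w) * cmod (rho z w) powr (- t)"
            using True by (simp add: h_def k_def mult_ac)
          then show ?thesis using True by simp
        qed (simp add: h_def)
      qed
      also have "\<dots> \<le> ennreal (2 * M powr (1 - 1 / p2) * j powr (1 / p2))"
      proof (rule nn_integral_weighted_Holder[OF p(3) M j(1)])
        show "h \<in> borel_measurable \<nu>" "k \<in> borel_measurable \<nu>"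
          unfolding h_def k_def by measurable
        show "0 \<le> h x" "0 \<le> k x" for x by (auto simp: h_def k_def)
        have "(\<integral>\<^sup>+w. ennreal (h w) \<partial>\<nu>) = (\<integral>\<^sup>+w. ennreal (rho_diag w powr a * cmod (rho z w) powr (- t)) * indicator tube w \<partial>\<nu>)"
          by (intro nn_integral_cong) (simp add: h_def indicator_def)
        also have "\<dots> \<le> ennreal (C1 * m * rho_diag z powr (a + b - t))"
          by (rule C1(2)[OF z nu m near])
        finally show "(\<integral>\<^sup>+w. ennreal (h w) \<partial>\<nu>) \<le> ennreal M" by (simp add: M_def ab)
        have "(\<integral>\<^sup>+w. ennreal (h w * k w powr p2) \<partial>\<nu>) = J z"
          unfolding J_def
        proof (rule nn_integral_cong)
          fix w
          show "ennreal (h w * k w powr p2) = ennreal (cmod (f w) powr p2 * rho_diag w powr (a * (1 - p2)) * cmod (rho z w) powr (- t)) * indicator tube w"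
          proof (cases "w \<in> tube")
            case True
            then have "rho_diag w powr a * (rho_diag w powr (- a)) powr p2 = rho_diag w powr (a * (1 - p2))"
              by (simp add: powr_powr powr_add[symmetric] algebra_simps)
            then have "h w * k w powr p2 = cmod (f w) powr p2 * rho_diag w powr (a * (1 - p2)) * cmod (rho z w) powr (- t)"
              using True by (simp add: h_def k_def powr_mult mult_ac)
            then show ?thesis using True by simp
          qed (simp add: h_def)
        qed
        then show "(\<integral>\<^sup>+w. ennreal (h w * k w powr p2) \<partial>\<nu>) \<le> ennreal j" using j by simp
      qed
      finally have le: "berezin_integral \<nu> t f z \<le> ennreal (2 * M powr (1 - 1 / p2) * j powr (1 / p2))" .
      then have "enn2real (berezin_integral \<nu> t f z) \<le> 2 * M powr (1 - 1 / p2) * j powr (1 / p2)"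
        by (intro enn2real_leI) auto
      then have "enn2real (berezin_integral \<nu> t f z) powr p2 \<le> (2 * M powr (1 - 1 / p2) * j powr (1 / p2)) powr p2"
        using p by (intro powr_mono2) auto
      also have "\<dots> = 2 powr p2 * M powr (p2 - 1) * j"
      proof -
        have "(1 - 1 / p2) * p2 = p2 - 1" using p by (simp add: field_simps)
        then show ?thesis using p j by (simp add: powr_mult powr_powr)
      qed
      also have "M powr (p2 - 1) = C1 powr (p2 - 1) * m powr (p2 - 1) * rho_diag z powr (- (\<sigma> * (p2 - 1)))"
        using C1(1) m by (simp add: M_def powr_mult powr_powr)
      finally have "enn2real (berezin_integral \<nu> t f z) powr p2 \<le> D * m powr (p2 - 1) * rho_diag z powr (- (\<sigma> * (p2 - 1))) * j"
        by (simp add: D_def mult_ac)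
      moreover have "berezin_integral \<nu> t f z < \<infinity>"
        using le by (rule le_less_trans) simp
      ultimately show ?thesis by simp
    qed
    have Jint: "(\<integral>\<^sup>+z. ennreal (rho_diag z powr e) * J z * indicator tube z \<partial>lborel) \<le> ennreal (C2 * C3 * m * A powr p2)"
    proof -
      define g where "g z w = ennreal (rho_diag z powr e * cmod (rho z w) powr (- t)) * indicator tube z *
        (ennreal (cmod (f w) powr p2 * rho_diag w powr (a * (1 - p2))) * indicator tube w)" for z w
      have g [measurable]: "(\<lambda>(z, w). g z w) \<in> borel_measurable (lborel \<Otimes>\<^sub>M \<nu>)"
        unfolding g_def by measurable
      have "(\<integral>\<^sup>+z. ennreal (rho_diag z powr e) * J z * indicator tube z \<partial>lborel) = (\<integral>\<^sup>+z. (\<integral>\<^sup>+w. g z w \<partial>\<nu>) \<partial>lborel)"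
      proof (rule nn_integral_cong)
        fix z
        have "ennreal (rho_diag z powr e) * J z * indicator tube z = (ennreal (rho_diag z powr e) * indicator tube z) * J z"
          by (simp add: mult_ac)
        also have "\<dots> = (\<integral>\<^sup>+w. (ennreal (rho_diag z powr e) * indicator tube z) *
          (ennreal (cmod (f w) powr p2 * rho_diag w powr (a * (1 - p2)) * cmod (rho z w) powr (- t)) * indicator tube w) \<partial>\<nu>)"
          unfolding J_def by (rule nn_integral_cmult[symmetric]) measurable
        also have "\<dots> = (\<integral>\<^sup>+w. g z w \<partial>\<nu>)"
          by (intro nn_integral_cong) (simp add: g_def indicator_def ennreal_mult mult_ac)
        finally show "ennreal (rho_diag z powr e) * J z * indicator tube z = (\<integral>\<^sup>+w. g z w \<partial>\<nu>)" .
      qed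
      also have "\<dots> = (\<integral>\<^sup>+w. (\<integral>\<^sup>+z. g z w \<partial>lborel) \<partial>\<nu>)"
        by (rule Fubini'[symmetric]) fact
      also have "\<dots> \<le> (\<integral>\<^sup>+w. ennreal C2 * (ennreal (cmod (f w) powr p2 * rho_diag w powr c) * indicator tube w) \<partial>\<nu>)"
      proof (rule nn_integral_mono)
        fix w
        show "(\<integral>\<^sup>+z. g z w \<partial>lborel) \<le> ennreal C2 * (ennreal (cmod (f w) powr p2 * rho_diag w powr c) * indicator tube w)"
        proof (cases "w \<in> tube")
          case True
          have "(\<integral>\<^sup>+z. g z w \<partial>lborel) = (\<integral>\<^sup>+z. ennreal (rho_diag z powr e * cmod (rho w z) powr (- t)) * indicator tube z \<partial>lborel)
            * ennreal (cmod (f w) powr p2 * rho_diag w powr (a * (1 - p2)))"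
            unfolding g_def using True by (simp add: nn_integral_multc cmod_rho_commute[of w])
          also have "\<dots> \<le> ennreal (C2 * rho_diag w powr (N + e - t)) * ennreal (cmod (f w) powr p2 * rho_diag w powr (a * (1 - p2)))"
            by (intro mult_right_mono C2(2) True) auto
          also have "\<dots> = ennreal (C2 * (cmod (f w) powr p2 * (rho_diag w powr (a * (1 - p2)) * rho_diag w powr (N + e - t))))"
            using C2(1) by (simp add: ennreal_mult[symmetric] mult_ac)
          also have "rho_diag w powr (a * (1 - p2)) * rho_diag w powr (N + e - t) = rho_diag w powr c"
            by (simp only: c_def powr_add[symmetric])
          finally show ?thesis using True C2(1) by (simp add: ennreal_mult)
        qed (simp add: g_def)
      qed
      also have "\<dots> = ennreal C2 * (\<integral>\<^sup>+w. ennreal (cmod (f w) powr p2 * rho_diag w powr c) * indicator tube w \<partial>\<nu>)"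
        by (rule nn_integral_cmult) measurable
      also have "\<dots> \<le> ennreal C2 * ennreal (C3 * m * A powr p2)"
        by (intro mult_left_mono C3(2)[OF f fb A int nu m near]) auto
      also have "\<dots> = ennreal (C2 * C3 * m * A powr p2)"
        using C2(1) C3(1) m by (simp add: ennreal_mult[symmetric] mult_ac)
      finally show ?thesis .
    qed
    show "(\<forall>z\<in>tube. berezin_integral \<nu> t f z < \<infinity>) \<and>
      (\<integral>\<^sup>+z. ennreal (enn2real (berezin_integral \<nu> t f z) powr p2 * rho_diag z powr \<alpha>2) * indicator tube z \<partial>lborel)
        \<le> ennreal (D * (C2 + 1) * C3 * (m * A) powr p2)"
    proof
      have [measurable]: "(\<lambda>z. J z) \<in> borel_measurable lborel"
        unfolding J_def
        by (rule sigma_finite_measure.borel_measurable_nn_integral) (unfold_locales, measurable)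
      have "(\<integral>\<^sup>+z. ennreal (rho_diag z powr e) * J z * indicator tube z \<partial>lborel) \<noteq> \<infinity>"
        using Jint by (auto simp: top_unique)
      then have "AE z in lborel. ennreal (rho_diag z powr e) * J z * indicator tube z \<noteq> \<infinity>"
        by (intro nn_integral_PInf_AE) measurable
      \<comment> \<open>Finiteness of J almost everywhere gives a point of the non-null set
        \<open>tube\<close> with J finite; Hoelder at this one point is what
        \<open>berezin_integral_finite\<close> starts from.\<close>
      moreover have "\<not> (AE z in lborel. z \<notin> (tube :: (complex^'n::{finite,linorder}) set))"
      proof
        assume "AE z in lborel. z \<notin> (tube :: (complex^'n::{finite,linorder}) set)"
        then have "(tube :: (complex^'n::{finite,linorder}) set) \<in> null_sets lborel"
          by (simp add: AE_iff_null_sets)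
        then have "negligible (tube :: (complex^'n::{finite,linorder}) set)"
          by (simp add: negligible_iff_null_sets null_sets_completionI)
        then show False
          using open_not_negligible[OF open_tube] base_point_tube by blast
      qed
      ultimately obtain z0 where z0: "z0 \<in> tube" "ennreal (rho_diag z0 powr e) * J z0 * indicator tube z0 \<noteq> \<infinity>"
        by (metis (mono_tags, lifting) AE_mp AE_I2)
      then have "J z0 \<noteq> \<infinity>" by (auto simp: ennreal_mult_eq_top_iff mem_tube)
      then have "berezin_integral \<nu> t f z0 < \<infinity>"
        using I[OF z0(1), of "enn2real (J z0)"] by (simp add: less_top)
      then show "\<forall>z\<in>tube. berezin_integral \<nu> t f z < \<infinity>"
        using berezin_integral_finite[OF z0(1)] by auto
      define K where "K = D * m powr (p2 - 1)"
      have K: "0 < K" using D m by (simp add: K_def)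
      have "(\<integral>\<^sup>+z. ennreal (enn2real (berezin_integral \<nu> t f z) powr p2 * rho_diag z powr \<alpha>2) * indicator tube z \<partial>lborel)
        \<le> (\<integral>\<^sup>+z. ennreal K * (ennreal (rho_diag z powr e) * J z * indicator tube z) \<partial>lborel)"
      proof (rule nn_integral_mono)
        fix z :: "complex^'n::{finite,linorder}"
        show "ennreal (enn2real (berezin_integral \<nu> t f z) powr p2 * rho_diag z powr \<alpha>2) * indicator tube z
          \<le> ennreal K * (ennreal (rho_diag z powr e) * J z * indicator tube z)"
        proof (cases "z \<in> tube")
          case True
          show ?thesis
          proof (cases "J z")
            case top
            then show ?thesis using True K by (simp add: ennreal_mult_top ennreal_top_mult mem_tube)
          next
            case (real j)
            have "enn2real (berezin_integral \<nu> t f z) powr p2 * rho_diag z powr \<alpha>2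
              \<le> (K * rho_diag z powr (- (\<sigma> * (p2 - 1))) * j) * rho_diag z powr \<alpha>2"
              unfolding K_def using I[OF True real(1)] real by (intro mult_right_mono) auto
            also have "\<dots> = K * ((rho_diag z powr (- (\<sigma> * (p2 - 1))) * rho_diag z powr \<alpha>2) * j)"
              by (simp only: mult_ac)
            also have "rho_diag z powr (- (\<sigma> * (p2 - 1))) * rho_diag z powr \<alpha>2 = rho_diag z powr e"
              by (simp add: e_def powr_add[symmetric])
            finally have "ennreal (enn2real (berezin_integral \<nu> t f z) powr p2 * rho_diag z powr \<alpha>2) \<le> ennreal (K * (rho_diag z powr e * j))"
              by (rule ennreal_leI)
            also have "\<dots> = ennreal K * (ennreal (rho_diag z powr e) * J z)"
              using K real by (simp add: ennreal_mult)
            finally show ?thesis using True by simp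
          qed
        qed simp
      qed
      also have "\<dots> = ennreal K * (\<integral>\<^sup>+z. ennreal (rho_diag z powr e) * J z * indicator tube z \<partial>lborel)"
        by (rule nn_integral_cmult) measurable
      also have "\<dots> \<le> ennreal K * ennreal (C2 * C3 * m * A powr p2)"
        by (intro mult_left_mono Jint) auto
      also have "\<dots> = ennreal (K * (C2 * C3 * m * A powr p2))"
        using K C2(1) C3(1) m by (intro ennreal_mult[symmetric]) auto
      also have "\<dots> \<le> ennreal (D * (C2 + 1) * C3 * (m * A) powr p2)"
      proof (rule ennreal_leI)
        have "m powr (p2 - 1) * m = m powr p2" using m by (simp add: powr_diff)
        then have "K * (C2 * C3 * m * A powr p2) = D * C2 * C3 * (m * A) powr p2"
          using m A by (simp add: K_def powr_mult mult_ac)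
        also have "\<dots> \<le> D * (C2 + 1) * C3 * (m * A) powr p2"
          using D C2(1) C3(1) by (intro mult_right_mono mult_left_mono) auto
        finally show "K * (C2 * C3 * m * A powr p2) \<le> D * (C2 + 1) * C3 * (m * A) powr p2" .
      qed
      finally show "(\<integral>\<^sup>+z. ennreal (enn2real (berezin_integral \<nu> t f z) powr p2 * rho_diag z powr \<alpha>2) * indicator tube z \<partial>lborel)
        \<le> ennreal (D * (C2 + 1) * C3 * (m * A) powr p2)" .
    qed
  qed
qed

section \<open>Compactness of Bergman balls\<close>

lemma holomorphic_deriv_bound:
  assumes g: "g holomorphic_on ball 0 r" and B: "\<And>t. t \<in> ball 0 r \<Longrightarrow> cmod (g t) \<le> B" and t: "cmod t < r / 2"
  shows "cmod (deriv g t) \<le> 4 * B / r"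
proof -
  have r: "0 < r" using t norm_ge_zero[of t] by linarith
  have sub: "cball t (r / 4) \<subseteq> ball 0 r"
  proof
    fix x assume "x \<in> cball t (r / 4)"
    then show "x \<in> ball 0 r" using norm_triangle_sub[of x t] t r by (simp add: dist_norm norm_minus_commute)
  qed
  have "norm ((deriv ^^ 1) g t) \<le> fact 1 * B / (r / 4) ^ 1"
  proof (rule Cauchy_inequality)
    show "g holomorphic_on ball t (r / 4)"
      using sub by (intro holomorphic_on_subset[OF g]) (use ball_subset_cball in blast)
    show "continuous_on (cball t (r / 4)) g"
      using sub by (intro holomorphic_on_imp_continuous_on holomorphic_on_subset[OF g])
    show "norm (g x) \<le> B" if "norm (t - x) = r / 4" for x
      using sub that by (intro B) (auto simp: dist_norm)
  qed (use r in simp)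
  then show ?thesis using r by (simp add: field_simps)
qed

lemma holomorphic_Lipschitz:
  assumes g: "g holomorphic_on ball 0 r" and B: "\<And>t. t \<in> ball 0 r \<Longrightarrow> cmod (g t) \<le> B" and t: "cmod t < r / 2"
  shows "cmod (g t - g 0) \<le> 4 * B / r * cmod t"
proof -
  have r: "0 < r" using t norm_ge_zero[of t] by linarith
  have "norm (g t - g 0) \<le> 4 * B / r * norm (t - 0)"
  proof (rule field_differentiable_bound[of "ball 0 (r / 2)" g "deriv g"])
    fix z :: complex assume z: "z \<in> ball 0 (r / 2)"
    then show "norm (deriv g z) \<le> 4 * B / r"
      using holomorphic_deriv_bound[OF g B] by simp
    have "z \<in> ball 0 r" using z r by simp
    then show "(g has_field_derivative deriv g z) (at z within ball 0 (r / 2))"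
      using holomorphic_derivI[OF g open_ball] has_field_derivative_at_within by blast
  qed (use t r in auto)
  then show ?thesis by simp
qed

text \<open>\<open>holomorphic_Lipschitz\<close> for the derivative on the ball of radius r / 2,
  where \<open>holomorphic_deriv_bound\<close> gives 4 B / r: hence 4 (4 B / r) / (r / 2) = 32 B /
  r^2. The bound involves g through B only, which later allows integration over a parameter.\<close>

lemma holomorphic_quadratic_remainder:
  assumes g: "g holomorphic_on ball 0 r" and B: "\<And>t. t \<in> ball 0 r \<Longrightarrow> cmod (g t) \<le> B" and t: "cmod t < r / 4"
  shows "cmod (g t - g 0 - deriv g 0 * t) \<le> 32 * B / r\<^sup>2 * (cmod t)\<^sup>2"
proof -
  have r: "0 < r" using t norm_ge_zero[of t] by linarith
  have g': "deriv g holomorphic_on ball 0 (r / 2)"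
    using r by (intro holomorphic_on_subset[OF holomorphic_deriv[OF g open_ball]]) auto
  have B': "cmod (deriv g z) \<le> 4 * B / r" if "z \<in> ball 0 (r / 2)" for z
    using holomorphic_deriv_bound[OF g B] that by simp
  have d: "cmod (deriv g z - deriv g 0) \<le> 32 * B / r\<^sup>2 * cmod t" if "cmod z \<le> cmod t" for z
  proof -
    have B0: "0 \<le> B" using order_trans[OF norm_ge_zero B[of 0]] r by simp
    have "cmod (deriv g z - deriv g 0) \<le> 4 * (4 * B / r) / (r / 2) * cmod z"
      by (rule holomorphic_Lipschitz[OF g' B']) (use t that in auto)
    also have "\<dots> = 32 * B / r\<^sup>2 * cmod z" by (simp add: power2_eq_square)
    also have "\<dots> \<le> 32 * B / r\<^sup>2 * cmod t" using that B0 by (intro mult_left_mono) auto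
    finally show ?thesis .
  qed
  have "norm ((g t - deriv g 0 * t) - (g 0 - deriv g 0 * 0)) \<le> 32 * B / r\<^sup>2 * cmod t * norm (t - 0)"
  proof (rule field_differentiable_bound[of "cball 0 (cmod t)" "\<lambda>z. g z - deriv g 0 * z" "\<lambda>z. deriv g z - deriv g 0"])
    fix z :: complex assume z: "z \<in> cball 0 (cmod t)"
    then show "norm (deriv g z - deriv g 0) \<le> 32 * B / r\<^sup>2 * cmod t" using d by simp
    have "z \<in> ball 0 r" using z t r by simp
    then have "(g has_field_derivative deriv g z) (at z within cball 0 (cmod t))"
      using holomorphic_derivI[OF g open_ball] has_field_derivative_at_within by blast
    then show "((\<lambda>z. g z - deriv g 0 * z) has_field_derivative deriv g z - deriv g 0) (at z within cball 0 (cmod t))"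
      by (auto intro!: derivative_eq_intros)
  qed auto
  then show ?thesis by (simp add: power2_eq_square algebra_simps)
qed

lemma line_holomorphic_diff:
  "line_holomorphic_on f S \<Longrightarrow> line_holomorphic_on g S \<Longrightarrow> line_holomorphic_on (\<lambda>x. f x - g x) S"
  by (auto simp: line_holomorphic_on_def intro!: continuous_on_diff holomorphic_on_diff)

text \<open>One-variable estimate on the complex line through x and y, parametrised with unit
  speed.\<close>

lemma line_holomorphic_Lipschitz:
  fixes h :: "complex^'n \<Rightarrow> complex"
  assumes h: "line_holomorphic_on h S" and S: "ball x r \<subseteq> S" and B: "\<And>y. y \<in> ball x r \<Longrightarrow> cmod (h y) \<le> B"
    and y: "dist x y < r / 2"
  shows "cmod (h y - h x) \<le> 4 * B / r * dist x y"
proof (cases "x = y")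
  case False
  define d where "d = dist x y"
  have d: "0 < d" using False by (simp add: d_def)
  define u where "u = of_real (1 / d) *s (y - x)"
  have "norm (y - x) = d" by (simp add: d_def dist_norm norm_minus_commute)
  then have nu: "norm u = 1"
    unfolding u_def norm_vector_scalar_mult using d by (simp add: norm_divide)
  have in_ball: "x + t *s u \<in> ball x r" if "t \<in> ball 0 r" for t
    using that by (simp add: dist_norm norm_vector_scalar_mult nu)
  have xy: "x + of_real d *s u = y"
    using d by (simp add: u_def vec_eq_iff)
  have "cmod (h (x + of_real d *s u) - h (x + 0 *s u)) \<le> 4 * B / r * cmod (of_real d)"
  proof (rule holomorphic_Lipschitz)
    have "(\<lambda>t. h (x + t *s u)) holomorphic_on {t. x + t *s u \<in> S}"
      using h by (simp add: line_holomorphic_on_def)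
    then show "(\<lambda>t. h (x + t *s u)) holomorphic_on ball 0 r"
      by (rule holomorphic_on_subset) (use in_ball S in blast)
    show "cmod (h (x + t *s u)) \<le> B" if "t \<in> ball 0 r" for t
      by (rule B[OF in_ball[OF that]])
    show "cmod (of_real d) < r / 2" using y by (simp add: d_def)
  qed
  then show ?thesis unfolding xy using d by (simp add: d_def)
qed simp

text \<open>Plays the part of the Arzela-Ascoli theorem. A common growth bound makes all h Lipschitz
  near \<open>exhaust R\<close> with the same constant, so smallness on a fixed finite net
  propagates. It converts neighbourhoods for pointwise convergence into uniform smallness on compact
  sets.\<close>

lemma finite_net_exhaust:
  assumes R: "0 < R" and M: "0 \<le> M" and eps: "0 < (\<epsilon>::real)"
  obtains P where "finite P" "P \<subseteq> exhaust R" "\<And>h w. line_holomorphic_on h tube \<Longrightarrow>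
    (\<And>z. z \<in> tube \<Longrightarrow> cmod (h z) \<le> M * rho_diag z powr e) \<Longrightarrow> (\<And>x. x \<in> P \<Longrightarrow> cmod (h x) < \<epsilon> / 2) \<Longrightarrow>
    w \<in> (exhaust R :: (complex^'n::{finite,linorder}) set) \<Longrightarrow> cmod (h w) < \<epsilon>"
proof -
  let ?K = "exhaust R :: (complex^'n::{finite,linorder}) set"
  have K: "compact ?K" using R by (simp add: compact_exhaust)
  obtain r where r: "0 < r" "(\<Union>x\<in>?K. cball x r) \<subseteq> tube"
    by (rule compact_subset_open_imp_cball_epsilon_subset[OF K open_tube exhaust_subset_tube])
  define K' where "K' = (\<Union>x\<in>?K. cball x r)"
  have K': "compact K'" unfolding K'_def by (rule compact_minkowski_sum_cball[OF K])
  have K't: "K' \<subseteq> tube" using r(2) by (simp add: K'_def)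
  have "continuous_on K' (\<lambda>z. M * rho_diag z powr e)"
    by (intro continuous_intros) (use K't in \<open>force simp: mem_tube\<close>)
  then have "bounded ((\<lambda>z. M * rho_diag z powr e) ` K')"
    by (intro compact_imp_bounded compact_continuous_image K')
  then obtain B where B: "0 < B" "\<forall>x\<in>(\<lambda>z. M * rho_diag z powr e) ` K'. norm x \<le> B"
    unfolding bounded_pos by (elim exE conjE)
  have B2: "M * rho_diag z powr e \<le> B" if "z \<in> K'" for z
    using bspec[OF B(2) imageI[OF that]] by simp
  \<comment> \<open>The second term limits the Lipschitz error (4 B / r) * \<open>\<delta>\<close>
    to a quarter of \<open>\<epsilon>\<close>; the first keeps w in the half ball where the estimate
    is available.\<close>
  define \<delta> where "\<delta> = min (r / 2) (\<epsilon> * r / (16 * B))"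
  have \<delta>: "0 < \<delta>" using r(1) B(1) eps by (simp add: \<delta>_def)
  obtain P where P: "finite P" "P \<subseteq> ?K" "?K \<subseteq> (\<Union>x\<in>P. ball x \<delta>)"
    using seq_compact_imp_totally_bounded[OF K[unfolded compact_eq_seq_compact_metric], rule_format, OF \<delta>]
    by (elim exE conjE)
  show thesis
  proof (rule that[OF P(1,2)])
    fix h :: "complex^'n::{finite,linorder} \<Rightarrow> complex" and w :: "complex^'n::{finite,linorder}"
    assume h: "line_holomorphic_on h tube" "\<And>z. z \<in> tube \<Longrightarrow> cmod (h z) \<le> M * rho_diag z powr e"
      and small: "\<And>x. x \<in> P \<Longrightarrow> cmod (h x) < \<epsilon> / 2" and w: "w \<in> ?K"
    obtain x where x: "x \<in> P" "dist x w < \<delta>" using P(3) w by auto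
    have sub: "ball x r \<subseteq> K'" using x(1) P(2) by (auto simp: K'_def)
    have "cmod (h w - h x) \<le> 4 * B / r * dist x w"
    proof (rule line_holomorphic_Lipschitz[OF h(1)])
      show "ball x r \<subseteq> tube" using sub r(2) by (auto simp: K'_def)
      show "cmod (h y) \<le> B" if "y \<in> ball x r" for y
      proof -
        have "y \<in> K'" using sub that by (rule subsetD)
        then show ?thesis using B2[of y] h(2)[of y] K't by (meson order_trans subsetD)
      qed
      show "dist x w < r / 2" using x(2) by (simp add: \<delta>_def)
    qed
    also have "\<dots> \<le> 4 * B / r * (\<epsilon> * r / (16 * B))"
      using x(2) B(1) r(1) by (intro mult_left_mono) (auto simp: \<delta>_def)
    also have "\<dots> = \<epsilon> / 4" using B(1) r(1) by simp
    finally have "cmod (h w - h x) \<le> \<epsilon> / 4" .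
    then show "cmod (h w) < \<epsilon>"
      using small[OF x(1)] norm_triangle_sub[of "h w" "h x"] eps by linarith
  qed
qed

text \<open>Members are normalised to 0 off \<open>tube\<close> and are only required to be
  holomorphic on lines: the former places the set inside a product of discs, the latter lets it be
  closed for pointwise convergence.\<close>

definition bergman_ball :: "real \<Rightarrow> real \<Rightarrow> real \<Rightarrow> (complex^'n::{finite,linorder} \<Rightarrow> complex) set" where
  "bergman_ball p \<alpha> A = {f. (\<forall>z. z \<notin> tube \<longrightarrow> f z = 0) \<and> line_holomorphic_on f tube \<and>
    (\<integral>\<^sup>+w. ennreal (cmod (f w) powr p * rho_diag w powr \<alpha>) * indicator tube w \<partial>lborel) \<le> ennreal (A powr p)}"

lemma borel_measurable_extend_0:
  fixes f :: "complex^'n::{finite,linorder} \<Rightarrow> complex"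
  assumes "line_holomorphic_on f tube" "\<And>z. z \<notin> tube \<Longrightarrow> f z = 0"
  shows "f \<in> borel_measurable borel"
proof -
  have "(\<lambda>z. indicator tube z *\<^sub>R f z) \<in> borel_measurable borel"
    using assms by (intro borel_measurable_continuous_on_indicator) (auto simp: line_holomorphic_on_def)
  also have "(\<lambda>z. indicator tube z *\<^sub>R f z) = f"
    using assms(2) by (auto simp: indicator_def)
  finally show ?thesis .
qed

lemma bergman_ball_borel: "f \<in> bergman_ball p \<alpha> A \<Longrightarrow> f \<in> borel_measurable borel"
  by (rule borel_measurable_extend_0) (auto simp: bergman_ball_def)

lemma uniform_limit_exhaust_line_holomorphic:
  fixes g :: "nat \<Rightarrow> complex^'n::{finite,linorder} \<Rightarrow> complex"
  assumes g: "\<And>k. line_holomorphic_on (g k) tube"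
    and lim: "\<And>R. 0 < R \<Longrightarrow> uniform_limit (exhaust R) g f sequentially"
  shows "line_holomorphic_on f tube"
proof -
  have lim_K: "uniform_limit K g f sequentially" if "compact K" "K \<subseteq> tube" for K
    by (rule compact_subset_exhaust[OF that]) (rule uniform_limit_on_subset[OF lim])
  show ?thesis
    unfolding line_holomorphic_on_def
  proof (intro conjI allI)
    show "continuous_on tube f"
    proof (rule continuous_at_imp_continuous_on, rule ballI)
      fix z :: "complex^'n::{finite,linorder}" assume "z \<in> tube"
      then obtain r where r: "0 < r" "cball z r \<subseteq> tube"
        using open_tube[unfolded open_contains_cball] by (elim ballE exE conjE) auto
      have "continuous_on (cball z r) f"
      proof (rule uniform_limit_theorem[OF _ lim_K[OF compact_cball r(2)]])
        show "\<forall>\<^sub>F k in sequentially. continuous_on (cball z r) (g k)"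
          using g by (intro always_eventually allI continuous_on_subset[OF _ r(2)]) (simp add: line_holomorphic_on_def)
      qed simp
      then show "isCont f z"
        using r(1) continuous_on_interior[of "cball z r" f z] by simp
    qed
    fix a v :: "complex^'n::{finite,linorder}"
    define U where "U = {t. a + t *s v \<in> tube}"
    have cont: "continuous_on UNIV (\<lambda>t. a + t *s v)" by (intro continuous_intros)
    have U: "open U"
      using open_vimage[OF open_tube cont] by (simp add: U_def vimage_def)
    show "(\<lambda>t. f (a + t *s v)) holomorphic_on {t. a + t *s v \<in> tube}"
      unfolding U_def[symmetric]
    proof (rule holomorphic_uniform_sequence[OF U])
      show "(\<lambda>t. g k (a + t *s v)) holomorphic_on U" for k
        using g by (simp add: line_holomorphic_on_def U_def)
      fix t assume "t \<in> U"
      then obtain d where d: "0 < d" "cball t d \<subseteq> U"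
        using U[unfolded open_contains_cball] by (elim ballE exE conjE) auto
      let ?K = "(\<lambda>t. a + t *s v) ` cball t d"
      have "compact ?K"
        using continuous_on_subset[OF cont] by (intro compact_continuous_image) auto
      then have "uniform_limit ?K g f sequentially"
        using d(2) by (intro lim_K) (auto simp: U_def)
      then have "uniform_limit (cball t d) (\<lambda>k t. g k (a + t *s v)) (\<lambda>t. f (a + t *s v)) sequentially"
        by (auto simp: uniform_limit_iff)
      then show "\<exists>d. 0 < d \<and> cball t d \<subseteq> U \<and> uniform_limit (cball t d) (\<lambda>k t. g k (a + t *s v)) (\<lambda>t. f (a + t *s v)) sequentially"
        using d by blast
    qed
  qed
qed

lemma open_pointwise_nbhd:
  fixes f :: "'a \<Rightarrow> complex"
  assumes "finite P" shows "open {g. \<forall>x\<in>P. cmod (g x - f x) < \<delta>}"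
proof -
  have "open ((\<lambda>g :: 'a \<Rightarrow> complex. g x) -` ball (f x) \<delta>)" for x
    by (intro open_vimage open_ball continuous_on_product_coordinates)
  then have "open (\<Inter>x\<in>P. (\<lambda>g :: 'a \<Rightarrow> complex. g x) -` ball (f x) \<delta>)"
    using assms by (intro open_INT) auto
  also have "(\<Inter>x\<in>P. (\<lambda>g :: 'a \<Rightarrow> complex. g x) -` ball (f x) \<delta>) = {g. \<forall>x\<in>P. cmod (g x - f x) < \<delta>}"
    by (auto simp: dist_norm norm_minus_commute)
  finally show ?thesis .
qed

text \<open>A closed subset of a product of discs, compact by Tychonoff's theorem; the radii come
  from \<open>pointwise_bound\<close>. For closedness, an adherent point f is first approximated at
  finitely many points only. Finite nets upgrade this to uniform approximation on each
  \<open>exhaust R\<close>, which yields a sequence and hence holomorphy of f on lines, and Fatou's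
  lemma preserves the integral bound.\<close>

lemma compact_bergman_ball:
  assumes p: "0 < p" and A: "0 < A"
  shows "compact (bergman_ball p \<alpha> A :: (complex^'n::{finite,linorder} \<Rightarrow> complex) set)"
proof -
  let ?K = "bergman_ball p \<alpha> A :: (complex^'n::{finite,linorder} \<Rightarrow> complex) set"
  define e where "e = - ((real CARD('n) + 1 + \<alpha>) / p)"
  obtain C where C: "0 < C" "\<And>(f :: complex^'n::{finite,linorder} \<Rightarrow> complex) z A. line_holomorphic_on f tube \<Longrightarrow>
    f \<in> borel_measurable borel \<Longrightarrow> 0 < A \<Longrightarrow>
    (\<integral>\<^sup>+w. ennreal (cmod (f w) powr p * rho_diag w powr \<alpha>) * indicator tube w \<partial>lborel) \<le> ennreal (A powr p) \<Longrightarrow>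
    z \<in> tube \<Longrightarrow> cmod (f z) \<le> C * A * rho_diag z powr e"
    unfolding e_def by (rule pointwise_bound[OF p, where 'n='n]) blast
  have bound: "cmod (f z) \<le> C * A * rho_diag z powr e" if "f \<in> ?K" "z \<in> tube" for f z
    using that bergman_ball_borel[OF that(1)] A by (intro C(2)) (auto simp: bergman_ball_def)
  have "closed ?K"
    unfolding closed_def open_subopen[of "- ?K"]
  proof (rule ballI, rule ccontr)
    fix f assume f: "f \<in> - ?K" and no: "\<not> (\<exists>T. open T \<and> f \<in> T \<and> T \<subseteq> - ?K)"
    have approx: "\<exists>g\<in>?K. \<forall>x\<in>P. cmod (g x - f x) < \<delta>" if "finite P" "0 < \<delta>" for P \<delta>
    proof -
      have "f \<in> {g. \<forall>x\<in>P. cmod (g x - f x) < \<delta>}" using that(2) by simp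
      then have "\<not> {g. \<forall>x\<in>P. cmod (g x - f x) < \<delta>} \<subseteq> - ?K"
        using no open_pointwise_nbhd[OF that(1), of f \<delta>] by blast
      then show ?thesis by blast
    qed
    have zero: "f z = 0" if z: "z \<notin> tube" for z
    proof (rule ccontr)
      assume "f z \<noteq> 0"
      then obtain g where "g \<in> ?K" "cmod (g z - f z) < cmod (f z)"
        using approx[of "{z}" "cmod (f z)"] by auto
      then show False using z by (simp add: bergman_ball_def)
    qed
    have unif: "\<exists>g\<in>?K. \<forall>w\<in>exhaust R. cmod (g w - f w) < \<epsilon>" if R: "0 < R" and eps: "0 < \<epsilon>" for R \<epsilon>
    proof -
      obtain P where P: "finite P" "P \<subseteq> exhaust R" "\<And>h w. line_holomorphic_on h tube \<Longrightarrow>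
        (\<And>z. z \<in> tube \<Longrightarrow> cmod (h z) \<le> 2 * C * A * rho_diag z powr e) \<Longrightarrow> (\<And>x. x \<in> P \<Longrightarrow> cmod (h x) < \<epsilon> / 2 / 2) \<Longrightarrow>
        w \<in> (exhaust R :: (complex^'n::{finite,linorder}) set) \<Longrightarrow> cmod (h w) < \<epsilon> / 2"
        by (rule finite_net_exhaust[OF R, of "2 * C * A" "\<epsilon> / 2" e, where 'n='n]) (use C(1) A eps in auto)
      obtain g where g: "g \<in> ?K" "\<And>x. x \<in> P \<Longrightarrow> cmod (g x - f x) < \<epsilon> / 8"
        using approx[OF P(1), of "\<epsilon> / 8"] eps by auto
      have "cmod (g w - f w) < \<epsilon>" if w: "w \<in> exhaust R" for w
      proof -
        \<comment> \<open>No Lipschitz bound for f is known yet, so g is compared with a second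
          member g' of the ball that is close to f on the net and also at w.\<close>
        obtain g' where g': "g' \<in> ?K" "\<And>x. x \<in> insert w P \<Longrightarrow> cmod (g' x - f x) < \<epsilon> / 8"
          using approx[of "insert w P" "\<epsilon> / 8"] eps P(1) by auto
        have "cmod (g w - g' w) < \<epsilon> / 2"
        proof (rule P(3)[OF _ _ _ w])
          show "line_holomorphic_on (\<lambda>w. g w - g' w) tube"
            using g(1) g'(1) by (intro line_holomorphic_diff) (auto simp: bergman_ball_def)
          show "cmod (g z - g' z) \<le> 2 * C * A * rho_diag z powr e" if "z \<in> tube" for z
            using bound[OF g(1) that] bound[OF g'(1) that] norm_triangle_ineq4[of "g z" "g' z"] by linarith
          show "cmod (g x - g' x) < \<epsilon> / 2 / 2" if "x \<in> P" for x
          proof -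
            have "cmod (g x - g' x) \<le> cmod (g x - f x) + cmod (g' x - f x)"
              using norm_triangle_ineq4[of "g x - f x" "g' x - f x"] by simp
            then show ?thesis using g(2)[OF that] g'(2)[of x] that by auto
          qed
        qed
        moreover have "cmod (g' w - f w) < \<epsilon> / 8" using g'(2)[of w] by simp
        moreover have "cmod (g w - f w) \<le> cmod (g w - g' w) + cmod (g' w - f w)"
          using norm_triangle_ineq[of "g w - g' w" "g' w - f w"] by simp
        ultimately show ?thesis using eps by linarith
      qed
      then show ?thesis using g(1) by blast
    qed
    have "\<exists>g\<in>?K. \<forall>w\<in>exhaust (real k + 1). cmod (g w - f w) < 1 / (real k + 1)" for k
      by (rule unif) auto
    then have "\<forall>k. \<exists>g. g \<in> ?K \<and> (\<forall>w\<in>exhaust (real k + 1). cmod (g w - f w) < 1 / (real k + 1))"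
      by blast
    then obtain g where g': "\<forall>k. g k \<in> ?K \<and> (\<forall>w\<in>exhaust (real k + 1). cmod (g k w - f w) < 1 / (real k + 1))"
      by (rule choice[THEN exE])
    have g: "\<And>k. g k \<in> ?K" "\<And>k w. w \<in> exhaust (real k + 1) \<Longrightarrow> cmod (g k w - f w) < 1 / (real k + 1)"
      using g' by blast+
    have lim: "uniform_limit (exhaust R) g f sequentially" for R
      unfolding uniform_limit_iff
    proof (intro allI impI)
      fix \<epsilon> :: real assume eps: "0 < \<epsilon>"
      obtain n where n: "max R (1 / \<epsilon>) < real n" using reals_Archimedean2 by blast
      show "\<forall>\<^sub>F k in sequentially. \<forall>x\<in>exhaust R. dist (g k x) (f x) < \<epsilon>"
      proof (rule eventually_sequentiallyI[of n], rule ballI)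
        fix k x assume k: "n \<le> k" and x: "x \<in> (exhaust R :: (complex^'n::{finite,linorder}) set)"
        have "x \<in> exhaust (real k + 1)" using exhaust_mono[of R "real k + 1"] x k n by auto
        then have "dist (g k x) (f x) < 1 / (real k + 1)" using g(2) by (simp add: dist_norm)
        also have "1 / (real k + 1) < \<epsilon>"
        proof -
          have "1 / \<epsilon> < real k + 1" using n k by auto
          then show ?thesis using eps by (simp add: field_simps)
        qed
        finally show "dist (g k x) (f x) < \<epsilon>" .
      qed
    qed
    have fh: "line_holomorphic_on f tube"
      by (rule uniform_limit_exhaust_line_holomorphic[OF _ lim]) (use g(1) in \<open>simp add: bergman_ball_def\<close>)
    have pt: "(\<lambda>k. g k w) \<longlonglongrightarrow> f w" if "w \<in> tube" for w
      using tendsto_uniform_limitI[OF lim exhaust_cover[OF that]] .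
    have [measurable]: "g k \<in> borel_measurable borel" for k
      using g(1) by (rule bergman_ball_borel)
    have "(\<integral>\<^sup>+w. ennreal (cmod (f w) powr p * rho_diag w powr \<alpha>) * indicator tube w \<partial>lborel)
      = (\<integral>\<^sup>+w. liminf (\<lambda>k. ennreal (cmod (g k w) powr p * rho_diag w powr \<alpha>) * indicator tube w) \<partial>lborel)"
    proof (rule nn_integral_cong)
      fix w :: "complex^'n::{finite,linorder}"
      show "ennreal (cmod (f w) powr p * rho_diag w powr \<alpha>) * indicator tube w
        = liminf (\<lambda>k. ennreal (cmod (g k w) powr p * rho_diag w powr \<alpha>) * indicator tube w)"
      proof (cases "w \<in> tube")
        case True
        have "(\<lambda>k. cmod (g k w) powr p) \<longlonglongrightarrow> cmod (f w) powr p"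
          using p by (intro tendsto_powr' tendsto_norm pt True tendsto_const) auto
        then have "(\<lambda>k. ennreal (cmod (g k w) powr p * rho_diag w powr \<alpha>)) \<longlonglongrightarrow> ennreal (cmod (f w) powr p * rho_diag w powr \<alpha>)"
          by (intro tendsto_ennrealI tendsto_mult_right)
        from lim_imp_Liminf[OF sequentially_bot this] show ?thesis using True by simp
      qed (simp add: Liminf_const)
    qed
    also have "\<dots> \<le> liminf (\<lambda>k. (\<integral>\<^sup>+w. ennreal (cmod (g k w) powr p * rho_diag w powr \<alpha>) * indicator tube w \<partial>lborel))"
      by (rule nn_integral_liminf) measurable
    also have "\<dots> \<le> liminf (\<lambda>k. ennreal (A powr p))"
      using g(1) by (intro Liminf_mono always_eventually) (auto simp: bergman_ball_def)
    also have "\<dots> = ennreal (A powr p)" by (simp add: Liminf_const)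
    finally have "f \<in> ?K" using zero fh by (simp add: bergman_ball_def)
    then show False using f by simp
  qed
  moreover define Q where "Q = PiE UNIV (\<lambda>z :: complex^'n::{finite,linorder}. cball (0::complex) (if z \<in> tube then C * A * rho_diag z powr e else 0))"
  have "?K \<subseteq> Q"
    unfolding Q_def using bound by (auto simp: bergman_ball_def)
  moreover have "compact Q"
  proof -
    have "compactin (product_topology (\<lambda>_. euclidean) UNIV) Q"
      unfolding Q_def compactin_PiE by simp
    then show ?thesis by (simp only: euclidean_product_topology compactin_euclidean_iff)
  qed
  ultimately have "compact (?K \<inter> Q)" "?K \<inter> Q = ?K"
    by (auto intro: closed_Int_compact)
  then show ?thesis by simp
qed

section \<open>Weighted Lebesgue spaces and relative compactness\<close>

lemma powr_add_le:
  fixes a b p :: real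
  assumes "0 \<le> a" "0 \<le> b" "0 < p"
  shows "(a + b) powr p \<le> 2 powr p * (a powr p + b powr p)"
proof -
  have "(a + b) powr p \<le> (2 * max a b) powr p"
    using assms by (intro powr_mono2) auto
  also have "\<dots> = 2 powr p * max a b powr p"
    using assms by (simp add: powr_mult)
  also have "\<dots> \<le> 2 powr p * (a powr p + b powr p)"
    by (intro mult_left_mono) (auto simp: max_def)
  finally show ?thesis .
qed

text \<open>Compare b with k a. The gain over \<open>powr_add_le\<close> is that the factor of a^p
  tends to 1 as k tends to 0, as needed to keep a strict inequality under small
  perturbations.\<close>

lemma powr_add_le_eps:
  fixes a b p k :: real
  assumes "0 \<le> a" "0 \<le> b" "0 < p" "0 < k"
  shows "(a + b) powr p \<le> (1 + k) powr p * a powr p + (1 + 1 / k) powr p * b powr p"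
proof (cases "b \<le> k * a")
  case True
  then have "(a + b) powr p \<le> ((1 + k) * a) powr p"
    using assms by (intro powr_mono2) (auto simp: algebra_simps)
  then show ?thesis using assms by (simp add: powr_mult add_increasing2)
next
  case False
  then have "a \<le> b / k" using assms by (simp add: field_simps)
  then have "(a + b) powr p \<le> ((1 + 1 / k) * b) powr p"
    using assms by (intro powr_mono2) (auto simp: algebra_simps)
  then show ?thesis using assms by (simp add: powr_mult add_increasing)
qed

section \<open>Weighted Lebesgue spaces expressed through integrals over lborel\<close>

lemma borel_measurable_lebesgue_on_tube:
  "g \<in> borel_measurable borel \<Longrightarrow> g \<in> borel_measurable (lebesgue_on tube)"
  by (intro measurable_restrict_space1 measurable_completion) simp

lemma nn_integral_dV:
  fixes g :: "complex^'n::{finite,linorder} \<Rightarrow> ennreal"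
  assumes [measurable]: "g \<in> borel_measurable (lebesgue_on tube)"
  shows "(\<integral>\<^sup>+z. g z \<partial>dV \<alpha>) = (\<integral>\<^sup>+z. ennreal (rho_diag z powr \<alpha>) * g z * indicator tube z \<partial>lborel)"
proof -
  have [measurable]: "(\<lambda>z :: complex^'n::{finite,linorder}. ennreal (rho_diag z powr \<alpha>)) \<in> borel_measurable (lebesgue_on tube)"
    by (rule borel_measurable_lebesgue_on_tube) measurable
  have "(\<integral>\<^sup>+z. g z \<partial>dV \<alpha>) = (\<integral>\<^sup>+z. ennreal (rho_diag z powr \<alpha>) * g z \<partial>lebesgue_on tube)"
    unfolding dV_def by (rule nn_integral_density) measurable
  also have "\<dots> = (\<integral>\<^sup>+z. ennreal (rho_diag z powr \<alpha>) * g z * indicator tube z \<partial>lebesgue)"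
    by (rule nn_integral_restrict_space) simp
  finally show ?thesis by (simp only: nn_integral_completion)
qed

lemma sets_dV: "sets (dV \<alpha>) = sets (lebesgue_on tube)"
  by (simp add: dV_def)

lemma borel_measurable_dV: "borel_measurable (dV \<alpha>) = borel_measurable (lebesgue_on tube)"
  by (rule measurable_cong_sets) (simp_all add: sets_dV)

lemma Lp_integrable: "f \<in> Lp p \<alpha> \<Longrightarrow> integrable (dV \<alpha>) (\<lambda>z. cmod (f z) powr p)"
  by (simp add: Lp_def)

lemma Lp_measurable: "f \<in> Lp p \<alpha> \<Longrightarrow> f \<in> borel_measurable (dV \<alpha>)"
  unfolding borel_measurable_dV by (simp add: Lp_def)

lemma Lp_norm_nonneg: "0 \<le> Lp_norm p \<alpha> f"
  by (simp add: Lp_norm_def)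

lemma Lp_norm_powr:
  assumes "0 < p" shows "Lp_norm p \<alpha> f powr p = (\<integral>z. cmod (f z) powr p \<partial>dV \<alpha>)"
  using assms by (simp add: Lp_norm_def powr_powr)

lemma nn_integral_Lp:
  assumes f: "f \<in> Lp p \<alpha>" and p: "0 < p"
  shows "(\<integral>\<^sup>+z. ennreal (cmod (f z) powr p) \<partial>dV \<alpha>) = ennreal (Lp_norm p \<alpha> f powr p)"
  unfolding Lp_norm_powr[OF p] by (rule nn_integral_eq_integral[OF Lp_integrable[OF f]]) simp

text \<open>How image functions and test functions are shown to lie in the weighted spaces: by a
  pointwise majorant whose weighted integral over \<open>lborel\<close> is already
  estimated.\<close>

lemma Lp_dominated:
  fixes G :: "complex^'n::{finite,linorder} \<Rightarrow> real"
  assumes p: "0 < p" and c: "0 \<le> c" and F: "F \<in> borel_measurable (lebesgue_on tube)"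
    and le: "\<And>z. z \<in> tube \<Longrightarrow> cmod (F z) \<le> G z"
    and G: "(\<integral>\<^sup>+z. ennreal (G z powr p * rho_diag z powr \<alpha>) * indicator tube z \<partial>lborel) \<le> ennreal c"
  shows "F \<in> Lp p \<alpha>" "Lp_norm p \<alpha> F \<le> c powr (1 / p)"
proof -
  have [measurable]: "F \<in> borel_measurable (dV \<alpha>)" using F by (simp add: borel_measurable_dV)
  have "(\<integral>\<^sup>+z. ennreal (cmod (F z) powr p) \<partial>dV \<alpha>) = (\<integral>\<^sup>+z. ennreal (rho_diag z powr \<alpha>) * ennreal (cmod (F z) powr p) * indicator tube z \<partial>lborel)"
    by (rule nn_integral_dV) (use \<open>F \<in> borel_measurable (dV \<alpha>)\<close> in \<open>unfold borel_measurable_dV[of \<alpha>, symmetric], measurable\<close>)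
  also have "\<dots> \<le> (\<integral>\<^sup>+z. ennreal (G z powr p * rho_diag z powr \<alpha>) * indicator tube z \<partial>lborel)"
  proof (rule nn_integral_mono)
    fix z :: "complex^'n::{finite,linorder}"
    show "ennreal (rho_diag z powr \<alpha>) * ennreal (cmod (F z) powr p) * indicator tube z \<le> ennreal (G z powr p * rho_diag z powr \<alpha>) * indicator tube z"
    proof (cases "z \<in> tube")
      case True
      have "cmod (F z) powr p \<le> G z powr p" using p le[OF True] by (intro powr_mono2) auto
      then have "rho_diag z powr \<alpha> * cmod (F z) powr p \<le> G z powr p * rho_diag z powr \<alpha>"
        by (simp add: mult.commute mult_left_mono)
      then show ?thesis using True by (simp add: ennreal_mult[symmetric] ennreal_leI)
    qed simp
  qed
  finally have int: "(\<integral>\<^sup>+z. ennreal (cmod (F z) powr p) \<partial>dV \<alpha>) \<le> ennreal c" using G by (rule order_trans)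
  have integrable: "integrable (dV \<alpha>) (\<lambda>z. cmod (F z) powr p)"
    by (rule integrableI_nonneg) (use int in \<open>auto intro: le_less_trans\<close>)
  then show "F \<in> Lp p \<alpha>" using F by (simp add: Lp_def)
  have "ennreal (\<integral>z. cmod (F z) powr p \<partial>dV \<alpha>) \<le> ennreal c"
    using int nn_integral_eq_integral[OF integrable] by simp
  then have "(\<integral>z. cmod (F z) powr p \<partial>dV \<alpha>) \<le> c" using c by simp
  then show "Lp_norm p \<alpha> F \<le> c powr (1 / p)"
    unfolding Lp_norm_def using p by (intro powr_mono2) auto
qed

text \<open>A quasi-triangle inequality from \<open>powr_add_le\<close>, with constant 2 * 2^(1/p)
  in place of Minkowski's 1. It holds for all p > 0 and is enough for statements about the
  topology.\<close>

lemma Lp_diff: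
  assumes p: "0 < p" and f: "f \<in> Lp p \<alpha>" and g: "g \<in> Lp p \<alpha>"
  shows "integrable (dV \<alpha>) (\<lambda>z. cmod (f z - g z) powr p)"
    and "Lp_norm p \<alpha> (\<lambda>z. f z - g z) \<le> 2 * 2 powr (1 / p) * (Lp_norm p \<alpha> f + Lp_norm p \<alpha> g)"
proof -
  note [measurable] = Lp_measurable[OF f] Lp_measurable[OF g]
  have pt: "cmod (f z - g z) powr p \<le> 2 powr p * (cmod (f z) powr p + cmod (g z) powr p)" for z
  proof -
    have "cmod (f z - g z) powr p \<le> (cmod (f z) + cmod (g z)) powr p"
      using p norm_triangle_ineq4[of "f z" "g z"] by (intro powr_mono2) auto
    also have "\<dots> \<le> 2 powr p * (cmod (f z) powr p + cmod (g z) powr p)"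
      using p by (intro powr_add_le) auto
    finally show ?thesis .
  qed
  have sum: "integrable (dV \<alpha>) (\<lambda>z. 2 powr p * (cmod (f z) powr p + cmod (g z) powr p))"
    by (intro integrable_mult_right Bochner_Integration.integrable_add Lp_integrable f g)
  show int: "integrable (dV \<alpha>) (\<lambda>z. cmod (f z - g z) powr p)"
    by (rule Bochner_Integration.integrable_bound[OF sum]) (use pt in auto)
  have "(\<integral>z. cmod (f z - g z) powr p \<partial>dV \<alpha>) \<le> (\<integral>z. 2 powr p * (cmod (f z) powr p + cmod (g z) powr p) \<partial>dV \<alpha>)"
    by (rule integral_mono[OF int sum pt])
  also have "\<dots> = 2 powr p * (Lp_norm p \<alpha> f powr p + Lp_norm p \<alpha> g powr p)"
    unfolding Lp_norm_powr[OF p] by (simp add: Bochner_Integration.integral_add Lp_integrable f g)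
  also have "\<dots> \<le> 2 powr p * (2 * (Lp_norm p \<alpha> f + Lp_norm p \<alpha> g) powr p)"
  proof (rule mult_left_mono)
    have "Lp_norm p \<alpha> f powr p \<le> (Lp_norm p \<alpha> f + Lp_norm p \<alpha> g) powr p"
      "Lp_norm p \<alpha> g powr p \<le> (Lp_norm p \<alpha> f + Lp_norm p \<alpha> g) powr p"
      using p Lp_norm_nonneg[of p \<alpha> f] Lp_norm_nonneg[of p \<alpha> g] by (auto intro!: powr_mono2)
    then show "Lp_norm p \<alpha> f powr p + Lp_norm p \<alpha> g powr p \<le> 2 * (Lp_norm p \<alpha> f + Lp_norm p \<alpha> g) powr p"
      by linarith
  qed simp
  finally have "Lp_norm p \<alpha> (\<lambda>z. f z - g z) \<le> (2 powr p * (2 * (Lp_norm p \<alpha> f + Lp_norm p \<alpha> g) powr p)) powr (1 / p)"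
    unfolding Lp_norm_def[of p \<alpha> "\<lambda>z. f z - g z"] using p by (intro powr_mono2) auto
  also have "\<dots> = 2 * 2 powr (1 / p) * (Lp_norm p \<alpha> f + Lp_norm p \<alpha> g)"
    using p Lp_norm_nonneg[of p \<alpha> f] Lp_norm_nonneg[of p \<alpha> g] by (simp add: powr_mult powr_powr)
  finally show "Lp_norm p \<alpha> (\<lambda>z. f z - g z) \<le> 2 * 2 powr (1 / p) * (Lp_norm p \<alpha> f + Lp_norm p \<alpha> g)" .
qed

lemma Lp_norm_commute: "Lp_norm p \<alpha> (\<lambda>z. f z - g z) = Lp_norm p \<alpha> (\<lambda>z. g z - f z)"
  by (simp add: Lp_norm_def norm_minus_commute)

lemma Lp_diff_mem:
  assumes p: "0 < p" and f: "f \<in> Lp p \<alpha>" and g: "g \<in> Lp p \<alpha>"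
  shows "(\<lambda>z. f z - g z) \<in> Lp p \<alpha>"
  using Lp_diff(1)[OF assms] f g unfolding Lp_def by (auto intro: borel_measurable_diff)

lemma Lp_norm_quasi_triangle:
  assumes p: "0 < p" and f: "f \<in> Lp p \<alpha>" and g: "g \<in> Lp p \<alpha>" and h: "h \<in> Lp p \<alpha>"
  shows "Lp_norm p \<alpha> (\<lambda>z. f z - h z)
    \<le> 2 * 2 powr (1 / p) * (Lp_norm p \<alpha> (\<lambda>z. f z - g z) + Lp_norm p \<alpha> (\<lambda>z. g z - h z))"
proof -
  have "Lp_norm p \<alpha> (\<lambda>z. (f z - g z) - (h z - g z))
    \<le> 2 * 2 powr (1 / p) * (Lp_norm p \<alpha> (\<lambda>z. f z - g z) + Lp_norm p \<alpha> (\<lambda>z. h z - g z))"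
    by (rule Lp_diff(2)[OF p Lp_diff_mem[OF p f g] Lp_diff_mem[OF p h g]])
  then show ?thesis by (simp add: Lp_norm_commute[of p \<alpha> h g])
qed

lemma topspace_norm_topology: "topspace (norm_topology Y N) = Y"
proof -
  have "openin (norm_topology Y N) Y"
    unfolding openin_norm_topology using zero_less_one by blast
  then show ?thesis
    using openin_subset[of "norm_topology Y N"] openin_topspace[of "norm_topology Y N"]
    unfolding openin_norm_topology by blast
qed

text \<open>A seminorm topology need not be Hausdorff, so the image of K need not be closed. Its
  saturation \<open>E\<close> under distance zero is compact, because open sets are saturated, and
  closed, because a finite subcover of K keeps the image at a positive distance from any point
  outside \<open>E\<close>. Closures of subsets of the image then lie in \<open>E\<close>. As K is
  merely a compact topological space, covers replace sequences.\<close>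

lemma relatively_compact_continuous_image:
  fixes K :: "'b::topological_space set" and S :: "'b \<Rightarrow> 'a \<Rightarrow> complex"
  assumes K: "compact K" and S: "S ` K \<subseteq> Y" and c: "0 < c"
    and nonneg: "\<And>f. 0 \<le> N f"
    and commute: "\<And>f g. N (\<lambda>z. f z - g z) = N (\<lambda>z. g z - f z)"
    and triangle: "\<And>f g h. f \<in> Y \<Longrightarrow> g \<in> Y \<Longrightarrow> h \<in> Y \<Longrightarrow>
      N (\<lambda>z. f z - h z) \<le> c * (N (\<lambda>z. f z - g z) + N (\<lambda>z. g z - h z))"
    and cont: "\<And>f \<epsilon>. f \<in> K \<Longrightarrow> 0 < \<epsilon> \<Longrightarrow> \<exists>V. open V \<and> f \<in> V \<and> (\<forall>g\<in>K \<inter> V. N (\<lambda>z. S g z - S f z) < \<epsilon>)"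
    and zero: "N (\<lambda>_. 0) = 0"
    and A: "A \<subseteq> S ` K"
  shows "relatively_compact Y N A"
proof -
  let ?T = "norm_topology Y N"
  define E where "E = {g \<in> Y. \<exists>f\<in>K. N (\<lambda>z. g z - S f z) = 0}"
  have EY: "E \<subseteq> Y" by (auto simp: E_def)
  have EI: "g \<in> E" if "g \<in> Y" "f \<in> K" "N (\<lambda>z. g z - S f z) = 0" for g f
    unfolding E_def using that by (intro CollectI conjI bexI[of _ f])
  have SE: "S ` K \<subseteq> E"
  proof (rule image_subsetI)
    fix f assume f: "f \<in> K"
    show "S f \<in> E"
      by (rule EI[OF subsetD[OF S imageI[OF f]] f]) (simp add: zero)
  qed
  have nbhd: "\<exists>\<epsilon>>0. \<forall>g\<in>Y. N (\<lambda>z. g z - f z) < \<epsilon> \<longrightarrow> g \<in> U" if "openin ?T U" "f \<in> U" for U f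
    using that(1)[unfolded openin_norm_topology, THEN conjunct2] that(2) by (rule bspec)
  have near: "g \<in> U" if U: "openin ?T U" and fU: "S f \<in> U" and g: "g \<in> Y" "N (\<lambda>z. g z - S f z) = 0" for U f g
    using nbhd[OF U fU] g by (elim exE conjE) simp
  have cover: "\<exists>\<F>. finite \<F> \<and> \<F> \<subseteq> \<U> \<and> E \<subseteq> \<Union>\<F>"
    if U: "\<And>U. U \<in> \<U> \<Longrightarrow> openin ?T U" "E \<subseteq> \<Union>\<U>" for \<U>
  proof -
    have "\<forall>f\<in>K. \<exists>V U. open V \<and> f \<in> V \<and> U \<in> \<U> \<and> (\<forall>g\<in>K \<inter> V. S g \<in> U)"
    proof
      fix f assume f: "f \<in> K"
      then have "S f \<in> \<Union>\<U>"
        by (intro subsetD[OF U(2)] subsetD[OF SE] imageI)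
      then obtain W where W: "W \<in> \<U>" "S f \<in> W" by (rule UnionE)
      from nbhd[OF U(1)[OF W(1)] W(2)] obtain \<epsilon> where e: "0 < \<epsilon>" "\<forall>g\<in>Y. N (\<lambda>z. g z - S f z) < \<epsilon> \<longrightarrow> g \<in> W"
        by (elim exE conjE)
      obtain V where V: "open V" "f \<in> V" "\<forall>g\<in>K \<inter> V. N (\<lambda>z. S g z - S f z) < \<epsilon>"
        using cont[OF f e(1)] by (elim exE conjE)
      have "\<forall>g\<in>K \<inter> V. S g \<in> W"
      proof
        fix g assume g: "g \<in> K \<inter> V"
        then have "S g \<in> Y" using S by auto
        then show "S g \<in> W" using bspec[OF V(3) g] e(2) by simp
      qed
      then show "\<exists>V U. open V \<and> f \<in> V \<and> U \<in> \<U> \<and> (\<forall>g\<in>K \<inter> V. S g \<in> U)"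
        using V(1,2) W(1) by (intro exI conjI)
    qed
    from bchoice[OF this] obtain V where
      "\<forall>f\<in>K. \<exists>U. open (V f) \<and> f \<in> V f \<and> U \<in> \<U> \<and> (\<forall>g\<in>K \<inter> V f. S g \<in> U)" ..
    from bchoice[OF this] obtain W where
      VW: "\<forall>f\<in>K. open (V f) \<and> f \<in> V f \<and> W f \<in> \<U> \<and> (\<forall>g\<in>K \<inter> V f. S g \<in> W f)" ..
    obtain F where F: "F \<subseteq> K" "finite F" "K \<subseteq> (\<Union>f\<in>F. V f)"
      by (rule compactE_image[OF K, of K V]) (use VW in blast)+
    have "E \<subseteq> \<Union>(W ` F)"
    proof
      fix g assume "g \<in> E"
      then obtain f where f: "f \<in> K" "g \<in> Y" "N (\<lambda>z. g z - S f z) = 0" by (auto simp: E_def)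
      obtain f0 where f0: "f0 \<in> F" "f \<in> V f0" using F(3) f(1) by blast
      have "f0 \<in> K" using F(1) f0(1) by (rule subsetD)
      note W0 = bspec[OF VW this]
      have "S f \<in> W f0" using W0 f0(2) f(1) by blast
      moreover have "openin ?T (W f0)" using W0 by (intro U(1)) blast
      ultimately have "g \<in> W f0" using near f(2,3) by blast
      then show "g \<in> \<Union>(W ` F)" using f0 by blast
    qed
    moreover have "W ` F \<subseteq> \<U>" using VW F(1) by blast
    ultimately show "\<exists>\<F>. finite \<F> \<and> \<F> \<subseteq> \<U> \<and> E \<subseteq> \<Union>\<F>" using F(2) by blast
  qed
  have "compactin ?T E"
    unfolding compactin_def topspace_norm_topology
    by (intro conjI allI impI EY cover; elim conjE) (erule (1) bspec)
  moreover have "closedin ?T E"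
    unfolding closedin_def topspace_norm_topology
  proof
    show "E \<subseteq> Y" by (rule EY)
    show "openin ?T (Y - E)"
      unfolding openin_norm_topology
    proof (intro conjI ballI)
      fix g assume g: "g \<in> Y - E"
      \<comment> \<open>Half of the distance from g to S f, divided by c: the quasi-triangle
        inequality multiplies the deviation by c, and the other half of the distance must
        survive.\<close>
      define d where "d f = N (\<lambda>z. g z - S f z) / (2 * c)" for f
      have d: "0 < d f" if "f \<in> K" for f
        using g that nonneg[of "\<lambda>z. g z - S f z"] c by (auto simp: d_def E_def less_le)
      have "\<forall>f\<in>K. \<exists>V. open V \<and> f \<in> V \<and> (\<forall>f'\<in>K \<inter> V. N (\<lambda>z. S f' z - S f z) < d f)"
        by (intro ballI cont d)
      from bchoice[OF this] obtain V where
        V: "\<forall>f\<in>K. open (V f) \<and> f \<in> V f \<and> (\<forall>f'\<in>K \<inter> V f. N (\<lambda>z. S f' z - S f z) < d f)" ..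
      obtain F where F: "F \<subseteq> K" "finite F" "K \<subseteq> (\<Union>f\<in>F. V f)"
        by (rule compactE_image[OF K, of K V]) (use V in blast)+
      define \<delta> where "\<delta> = Min (insert 1 (d ` F))"
      have \<delta>: "0 < \<delta>" "\<And>f. f \<in> F \<Longrightarrow> \<delta> \<le> d f"
        using F d by (auto simp: \<delta>_def)
      have far: "\<delta> \<le> N (\<lambda>z. g z - S f' z)" if f': "f' \<in> K" for f'
      proof -
        obtain f where f: "f \<in> F" "f' \<in> V f" using F(3) f' by blast
        then have fK: "f \<in> K" using F(1) by blast
        have "N (\<lambda>z. g z - S f z) \<le> c * (N (\<lambda>z. g z - S f' z) + N (\<lambda>z. S f' z - S f z))"
          using g S f' fK by (intro triangle) auto
        moreover have "c * N (\<lambda>z. S f' z - S f z) \<le> c * d f"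
          using bspec[OF V fK] f(2) f' c by (intro mult_left_mono) (auto intro: less_imp_le)
        moreover have "N (\<lambda>z. g z - S f z) = c * d f + c * d f" using c by (simp add: d_def)
        ultimately have "c * d f \<le> c * N (\<lambda>z. g z - S f' z)" by (simp add: distrib_left)
        then show ?thesis using c \<delta>(2)[OF f(1)] by simp
      qed
      show "\<exists>\<epsilon>>0. \<forall>h\<in>Y. N (\<lambda>z. h z - g z) < \<epsilon> \<longrightarrow> h \<in> Y - E"
      proof (intro exI conjI ballI impI)
        show "0 < \<delta> / c" using \<delta> c by simp
        fix h assume h: "h \<in> Y" "N (\<lambda>z. h z - g z) < \<delta> / c"
        show "h \<in> Y - E"
        proof
          show "h \<in> Y" by fact
          show "h \<notin> E"
          proof
            assume "h \<in> E"
            then obtain f where f: "f \<in> K" "N (\<lambda>z. h z - S f z) = 0" by (auto simp: E_def)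
            have "N (\<lambda>z. g z - S f z) \<le> c * (N (\<lambda>z. g z - h z) + N (\<lambda>z. h z - S f z))"
              using g h S f by (intro triangle) auto
            also have "\<dots> = c * N (\<lambda>z. h z - g z)" by (simp add: f(2) commute[of g h])
            also have "\<dots> < \<delta>" using h(2) c by (simp add: field_simps)
            finally show False using far[OF f(1)] by simp
          qed
        qed
      qed
    qed blast
  qed
  ultimately have "?T closure_of A \<subseteq> E" "compactin ?T E"
    using closure_of_minimal[OF order_trans[OF A SE]] by simp_all
  then have "compactin ?T (?T closure_of A)"
    by (intro closed_compactin[OF _ _ closedin_closure_of])
  moreover have "A \<subseteq> Y" using A SE EY by (meson order_trans)
  ultimately show ?thesis
    unfolding relatively_compact_def by simp
qed

section \<open>Measures vanishing at the boundary\<close>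

text \<open>The little-o condition is stated for the part of the measure off
  \<open>exhaust R\<close> and for all u, not just for u far out. In this form the restriction of
  the measure to the complement of \<open>exhaust R\<close> satisfies the hypothesis of the
  boundedness estimates with a small constant; \<open>vanishing_nearI\<close> provides the passage
  from the other form.\<close>

definition vanishing_near :: "real \<Rightarrow> (complex^'n::{finite,linorder}) measure \<Rightarrow> bool" where
  "vanishing_near b \<nu> \<longleftrightarrow>
    (\<forall>\<epsilon>>0. \<exists>R>0. \<forall>u\<in>tube. emeasure \<nu> ({w. near u w} - exhaust R) \<le> ennreal (\<epsilon> * rho_diag u powr b))"

definition finite_on_exhaust :: "(complex^'n::{finite,linorder}) measure \<Rightarrow> bool" where
  "finite_on_exhaust \<nu> \<longleftrightarrow> (\<forall>R>0. emeasure \<nu> (exhaust R) < \<infinity>)"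

lemma exhaust_sets [measurable]: "0 < R \<Longrightarrow> exhaust R \<in> sets borel"
  by (simp add: borel_closed closed_exhaust)

lemma near_sets [measurable]: "{w. near u w} \<in> sets borel"
  by (rule borel_open[OF open_near])

lemma exhaust_rho_diag_powr:
  assumes "u \<in> exhaust R" "0 < R"
  shows "1 \<le> (2 * R) powr \<bar>b\<bar> * rho_diag u powr b"
proof -
  have u: "u \<in> tube" "1 \<le> R * rho_diag u" "cmod (rho u base_point) \<le> R" using assms by (auto simp: exhaust_def)
  have "1 \<le> 2 * R * rho_diag u" using u(2) by linarith
  moreover have "rho_diag u \<le> 2 * R * 1" using cmod_rho_ge[OF base_point_tube, of u] u(3) by linarith
  ultimately have "1 powr b \<le> (2 * R) powr \<bar>b\<bar> * rho_diag u powr b"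
    using u(1) by (intro powr_comparable) (auto simp: mem_tube)
  then show ?thesis by simp
qed

context tube_measure
begin

lemma tube_measure_density:
  assumes [measurable]: "A \<in> sets borel" shows "tube_measure (density \<nu> (indicator A))"
proof (intro tube_measure.intro tube_measure_axioms.intro)
  show "sigma_finite_measure (density \<nu> (indicator A))"
    using sigma_finite_iff_density_finite[of "indicator A"] by (simp add: indicator_def)
qed (simp add: sets_nu)

text \<open>Take \<open>\<epsilon>\<close> = 1 off some \<open>exhaust R\<close>. Inside it the
  measure is finite and only u in \<open>exhaust (20 * R)\<close> matter, where
  \<open>rho_diag u powr b\<close> is bounded below.\<close>

lemma near_measure_bound:
  assumes van: "vanishing_near b \<nu>" and fin: "finite_on_exhaust \<nu>"
  obtains m where "0 < m" "\<And>u. u \<in> tube \<Longrightarrow> emeasure \<nu> {w. near u w} \<le> ennreal (m * rho_diag u powr b)"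
proof -
  obtain R where R: "0 < R" "\<And>u. u \<in> tube \<Longrightarrow> emeasure \<nu> ({w. near u w} - exhaust R) \<le> ennreal (1 * rho_diag u powr b)"
    using van zero_less_one unfolding vanishing_near_def by blast
  define M where "M = enn2real (emeasure \<nu> (exhaust R))"
  have M: "emeasure \<nu> (exhaust R) = ennreal M" "0 \<le> M"
    using fin R(1) by (auto simp: M_def finite_on_exhaust_def)
  define L where "L = (2 * (20 * R)) powr \<bar>b\<bar>"
  have L: "0 < L" using R(1) by (simp add: L_def)
  show thesis
  proof (rule that)
    show "0 < 1 + M * L" using M(2) L by (simp add: add_pos_nonneg)
    fix u :: "complex^'n::{finite,linorder}" assume u: "u \<in> tube"
    have [measurable]: "exhaust R \<in> sets borel" using R(1) by measurable
    have "emeasure \<nu> {w. near u w} = emeasure \<nu> ({w. near u w} - exhaust R) + emeasure \<nu> ({w. near u w} \<inter> exhaust R)"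
      by (subst plus_emeasure) (auto simp: sets_nu intro!: arg_cong[where f = "emeasure \<nu>"])
    also have "\<dots> \<le> ennreal (rho_diag u powr b) + ennreal (M * L * rho_diag u powr b)"
    proof (rule add_mono)
      show "emeasure \<nu> ({w. near u w} - exhaust R) \<le> ennreal (rho_diag u powr b)"
        using R(2)[OF u] by simp
      show "emeasure \<nu> ({w. near u w} \<inter> exhaust R) \<le> ennreal (M * L * rho_diag u powr b)"
      proof (cases "{w. near u w} \<inter> exhaust R = {}")
        case False
        then have "u \<in> exhaust (20 * R)" using near_exhaust R(1) by fastforce
        then have "1 \<le> L * rho_diag u powr b"
          unfolding L_def using R(1) by (intro exhaust_rho_diag_powr) auto
        then have "M \<le> M * L * rho_diag u powr b"
          using M(2) mult_left_mono[of 1 "L * rho_diag u powr b" M] by (simp add: mult.assoc)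
        have "emeasure \<nu> ({w. near u w} \<inter> exhaust R) \<le> emeasure \<nu> (exhaust R)"
          by (intro emeasure_mono) (auto simp: sets_nu)
        also have "\<dots> \<le> ennreal (M * L * rho_diag u powr b)"
          unfolding M(1) by (rule ennreal_leI) fact
        finally show ?thesis .
      qed simp
    qed
    also have "\<dots> = ennreal ((1 + M * L) * rho_diag u powr b)"
      using M(2) L by (simp add: ennreal_plus[symmetric] distrib_right del: ennreal_plus)
    finally show "emeasure \<nu> {w. near u w} \<le> ennreal ((1 + M * L) * rho_diag u powr b)" .
  qed
qed

end

section \<open>Continuity of the Berezin-type integral on Bergman balls\<close>

lemma bergman_ball_diff:
  assumes p: "0 < p" and A: "0 < A" and f: "f \<in> bergman_ball p \<alpha> A" and g: "g \<in> bergman_ball p \<alpha> A"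
  shows "(\<lambda>z. f z - g z) \<in> bergman_ball p \<alpha> (2 * 2 powr (1 / p) * A)"
proof -
  note [measurable] = bergman_ball_borel[OF f] bergman_ball_borel[OF g]
  have "(\<integral>\<^sup>+w. ennreal (cmod (f w - g w) powr p * rho_diag w powr \<alpha>) * indicator tube w \<partial>lborel)
    \<le> (\<integral>\<^sup>+w. ennreal (2 powr p) * (ennreal (cmod (f w) powr p * rho_diag w powr \<alpha>) * indicator tube w
        + ennreal (cmod (g w) powr p * rho_diag w powr \<alpha>) * indicator tube w) \<partial>lborel)"
  proof (rule nn_integral_mono)
    fix w
    have "cmod (f w - g w) powr p \<le> (cmod (f w) + cmod (g w)) powr p"
      using p norm_triangle_ineq4[of "f w" "g w"] by (intro powr_mono2) auto
    also have "\<dots> \<le> 2 powr p * (cmod (f w) powr p + cmod (g w) powr p)"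
      using p by (intro powr_add_le) auto
    finally have "cmod (f w - g w) powr p * rho_diag w powr \<alpha>
      \<le> 2 powr p * (cmod (f w) powr p + cmod (g w) powr p) * rho_diag w powr \<alpha>"
      by (rule mult_right_mono) simp
    also have "\<dots> = 2 powr p * (cmod (f w) powr p * rho_diag w powr \<alpha> + cmod (g w) powr p * rho_diag w powr \<alpha>)"
      by (simp add: algebra_simps)
    finally have "ennreal (cmod (f w - g w) powr p * rho_diag w powr \<alpha>)
      \<le> ennreal (2 powr p * (cmod (f w) powr p * rho_diag w powr \<alpha> + cmod (g w) powr p * rho_diag w powr \<alpha>))"
      by (rule ennreal_leI)
    also have "\<dots> = ennreal (2 powr p) * (ennreal (cmod (f w) powr p * rho_diag w powr \<alpha>) + ennreal (cmod (g w) powr p * rho_diag w powr \<alpha>))"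
      by (simp add: ennreal_mult ennreal_plus)
    finally show "ennreal (cmod (f w - g w) powr p * rho_diag w powr \<alpha>) * indicator tube w
      \<le> ennreal (2 powr p) * (ennreal (cmod (f w) powr p * rho_diag w powr \<alpha>) * indicator tube w
        + ennreal (cmod (g w) powr p * rho_diag w powr \<alpha>) * indicator tube w)"
      by (auto simp: indicator_def)
  qed
  also have "\<dots> = ennreal (2 powr p) * ((\<integral>\<^sup>+w. ennreal (cmod (f w) powr p * rho_diag w powr \<alpha>) * indicator tube w \<partial>lborel)
    + (\<integral>\<^sup>+w. ennreal (cmod (g w) powr p * rho_diag w powr \<alpha>) * indicator tube w \<partial>lborel))"
    by (subst nn_integral_cmult) (auto simp: nn_integral_add)
  also have "\<dots> \<le> ennreal (2 powr p) * (ennreal (A powr p) + ennreal (A powr p))"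
    using f g by (intro mult_left_mono add_mono) (auto simp: bergman_ball_def)
  also have "\<dots> = ennreal ((2 * 2 powr (1 / p) * A) powr p)"
  proof -
    have "(2 * 2 powr (1 / p) * A) powr p = 2 powr p * (A powr p + A powr p)"
      using p A by (simp add: powr_mult powr_powr)
    then have "ennreal ((2 * 2 powr (1 / p) * A) powr p) = ennreal (2 powr p * (A powr p + A powr p))"
      by (rule arg_cong)
    also have "\<dots> = ennreal (2 powr p) * ennreal (A powr p + A powr p)"
      by (rule ennreal_mult) auto
    also have "ennreal (A powr p + A powr p) = ennreal (A powr p) + ennreal (A powr p)"
      by (rule ennreal_plus) auto
    finally show ?thesis by (rule sym)
  qed
  finally show ?thesis
    using f g line_holomorphic_diff[of f tube g] by (simp add: bergman_ball_def)
qed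

text \<open>Continuity at 0 for pointwise convergence. Off \<open>exhaust R\<close> the Carleson
  constant of the measure is so small that this share is below half of \<open>\<epsilon>\<close>
  whatever h is. On \<open>exhaust R\<close> a finite net makes h uniformly small, and the kernel is
  comparable to its value at \<open>base_point\<close>, whose power p2 is integrable by the
  hypothesis on t * p2.\<close>

lemma berezin_integral_continuous:
  fixes p1 p2 \<alpha>1 \<alpha>2 \<xi> :: real and \<nu> :: "(complex^'n::{finite,linorder}) measure"
  assumes p: "0 < p1" "p1 \<le> p2" "1 < p2" and al: "-1 < \<alpha>2" and xi: "-1 < \<xi>" and cond: "1 + \<alpha>2 < p2 * (1 + \<xi>)"
    and tp: "real CARD('n) + 1 + \<alpha>2 < t * p2"
    and t: "t = real CARD('n) + 1 + \<xi>"
    and b: "b = t + (real CARD('n) + 1 + \<alpha>1) / p1 - (real CARD('n) + 1 + \<alpha>2) / p2"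
    and nu: "tube_measure \<nu>" and van: "vanishing_near b \<nu>" and fin: "finite_on_exhaust \<nu>"
    and A: "0 < A" and eps: "0 < \<epsilon>"
  obtains P \<delta> where "finite P" "0 < \<delta>" "\<And>h. h \<in> bergman_ball p1 \<alpha>1 A \<Longrightarrow> (\<And>x. x \<in> P \<Longrightarrow> cmod (h x) < \<delta>) \<Longrightarrow>
    (\<integral>\<^sup>+z. ennreal (enn2real (berezin_integral \<nu> t h z) powr p2 * rho_diag z powr \<alpha>2) * indicator tube z \<partial>lborel) \<le> ennreal \<epsilon>"
proof -
  interpret tube_measure \<nu> by fact
  have t0: "0 < t" using t xi by simp
  have p2: "0 < p2" using p by simp
  obtain C where C: "0 < C" "\<And>(f :: complex^'n::{finite,linorder} \<Rightarrow> complex) A \<nu> m. line_holomorphic_on f tube \<Longrightarrow>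
    f \<in> borel_measurable borel \<Longrightarrow> 0 < A \<Longrightarrow>
    (\<integral>\<^sup>+w. ennreal (cmod (f w) powr p1 * rho_diag w powr \<alpha>1) * indicator tube w \<partial>lborel) \<le> ennreal (A powr p1) \<Longrightarrow>
    tube_measure \<nu> \<Longrightarrow> 0 < m \<Longrightarrow> (\<And>u. u \<in> tube \<Longrightarrow> emeasure \<nu> {w. near u w} \<le> ennreal (m * rho_diag u powr b)) \<Longrightarrow>
    (\<forall>z\<in>tube. berezin_integral \<nu> t f z < \<infinity>) \<and>
    (\<integral>\<^sup>+z. ennreal (enn2real (berezin_integral \<nu> t f z) powr p2 * rho_diag z powr \<alpha>2) * indicator tube z \<partial>lborel)
      \<le> ennreal (C * (m * A) powr p2)"
    by (rule berezin_integral_bound[OF p al xi cond t b]) blast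
  obtain C1 where C1: "0 < C1" "\<And>(f :: complex^'n::{finite,linorder} \<Rightarrow> complex) z A. line_holomorphic_on f tube \<Longrightarrow>
    f \<in> borel_measurable borel \<Longrightarrow> 0 < A \<Longrightarrow>
    (\<integral>\<^sup>+w. ennreal (cmod (f w) powr p1 * rho_diag w powr \<alpha>1) * indicator tube w \<partial>lborel) \<le> ennreal (A powr p1) \<Longrightarrow>
    z \<in> tube \<Longrightarrow> cmod (f z) \<le> C1 * A * rho_diag z powr (- ((real CARD('n) + 1 + \<alpha>1) / p1))"
    by (rule pointwise_bound[OF p(1), where 'n='n]) blast
  obtain C2 where C2: "0 \<le> C2" "\<And>z :: complex^'n::{finite,linorder}. z \<in> tube \<Longrightarrow>
    (\<integral>\<^sup>+w. ennreal (rho_diag w powr \<alpha>2 * cmod (rho z w) powr (- (t * p2))) * indicator tube w \<partial>lborel)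
      \<le> ennreal (C2 * rho_diag z powr (real CARD('n) + 1 + \<alpha>2 - t * p2))"
    by (rule kernel_integral[OF al tp]) blast
  \<comment> \<open>Solves C (m A)^p2 = \<open>\<epsilon>\<close> / (2 * 2^p2): half of
    \<open>\<epsilon>\<close>, with the factor 2^p2 set aside for
    \<open>powr_add_le\<close>.\<close>
  define m where "m = (\<epsilon> / (2 * 2 powr p2 * C)) powr (1 / p2) / A"
  have m: "0 < m" using eps C(1) A by (simp add: m_def)
  have mA: "C * (m * A) powr p2 = \<epsilon> / (2 * 2 powr p2)"
    using eps C(1) A p2 by (simp add: m_def powr_powr)
  obtain R where R: "0 < R" "\<And>u. u \<in> tube \<Longrightarrow> emeasure \<nu> ({w. near u w} - exhaust R) \<le> ennreal (m * rho_diag u powr b)"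
    using van m unfolding vanishing_near_def by blast
  have [measurable]: "exhaust R \<in> sets borel" using R(1) by measurable
  define \<nu>2 where "\<nu>2 = density \<nu> (indicator (- exhaust R))"
  have nu2: "tube_measure \<nu>2" unfolding \<nu>2_def by (rule tube_measure_density) measurable
  have near2: "emeasure \<nu>2 {w. near u w} \<le> ennreal (m * rho_diag u powr b)" if "u \<in> tube" for u
  proof -
    have "emeasure \<nu>2 {w. near u w} = emeasure \<nu> ({w. near u w} - exhaust R)"
      unfolding \<nu>2_def by (subst emeasure_density) (auto simp: sets_nu nn_integral_indicator[symmetric]
        indicator_inter_arith[symmetric] Diff_eq Int_commute simp del: nn_integral_indicator)
    then show ?thesis using R(2)[OF that] by simp
  qed
  define K where "K = 4 + 8 * R\<^sup>2 + 8 * R"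
  have K: "0 < K" using R(1) by (simp add: K_def add_pos_pos)
  define L where "L = K powr t * enn2real (emeasure \<nu> (exhaust R))"
  have L: "0 \<le> L" by (simp add: L_def)
  \<comment> \<open>The same budget for the compact part; L and C2 may vanish, hence the added 1 in
    both denominators.\<close>
  define \<eta> where "\<eta> = (\<epsilon> / (2 * 2 powr p2 * (C2 + 1))) powr (1 / p2) / (L + 1)"
  have eta: "0 < \<eta>" using eps C2(1) L by (simp add: \<eta>_def)
  have etaL: "(\<eta> * L) powr p2 * C2 \<le> \<epsilon> / (2 * 2 powr p2)"
  proof -
    have "\<eta> * L \<le> (\<epsilon> / (2 * 2 powr p2 * (C2 + 1))) powr (1 / p2)"
      using L eta unfolding \<eta>_def by (simp add: divide_le_eq mult_left_mono)
    then have "(\<eta> * L) powr p2 \<le> ((\<epsilon> / (2 * 2 powr p2 * (C2 + 1))) powr (1 / p2)) powr p2"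
      using p2 L eta by (intro powr_mono2) auto
    also have "\<dots> = \<epsilon> / (2 * 2 powr p2) / (C2 + 1)"
      using eps C2(1) p2 by (simp add: powr_powr)
    finally have "(\<eta> * L) powr p2 * (C2 + 1) \<le> \<epsilon> / (2 * 2 powr p2)"
      using C2(1) by (subst pos_le_divide_eq[symmetric]) auto
    moreover have "(\<eta> * L) powr p2 * C2 \<le> (\<eta> * L) powr p2 * (C2 + 1)"
      by (intro mult_left_mono) auto
    ultimately show ?thesis by linarith
  qed
  obtain P where P: "finite P" "\<And>h w. line_holomorphic_on h tube \<Longrightarrow>
    (\<And>z. z \<in> tube \<Longrightarrow> cmod (h z) \<le> C1 * A * rho_diag z powr (- ((real CARD('n) + 1 + \<alpha>1) / p1))) \<Longrightarrow>
    (\<And>x. x \<in> P \<Longrightarrow> cmod (h x) < \<eta> / 2) \<Longrightarrow>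
    w \<in> (exhaust R :: (complex^'n::{finite,linorder}) set) \<Longrightarrow> cmod (h w) < \<eta>"
    by (rule finite_net_exhaust[OF R(1) _ eta, of "C1 * A" "- ((real CARD('n) + 1 + \<alpha>1) / p1)", where 'n='n])
      (use C1(1) A in auto)
  show thesis
  proof (rule that[OF P(1)])
    show "0 < \<eta> / 2" using eta by simp
    fix h :: "complex^'n::{finite,linorder} \<Rightarrow> complex"
    assume h: "h \<in> bergman_ball p1 \<alpha>1 A" and small: "\<And>x. x \<in> P \<Longrightarrow> cmod (h x) < \<eta> / 2"
    note hb [measurable] = bergman_ball_borel[OF h]
    have hl: "line_holomorphic_on h tube"
      and hi: "(\<integral>\<^sup>+w. ennreal (cmod (h w) powr p1 * rho_diag w powr \<alpha>1) * indicator tube w \<partial>lborel) \<le> ennreal (A powr p1)"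
      using h by (auto simp: bergman_ball_def)
    have hR: "cmod (h w) < \<eta>" if "w \<in> exhaust R" for w
      by (rule P(2)[OF hl C1(2)[OF hl hb A hi] small that])
    have tail: "\<forall>z\<in>tube. berezin_integral \<nu>2 t h z < \<infinity>"
      "(\<integral>\<^sup>+z. ennreal (enn2real (berezin_integral \<nu>2 t h z) powr p2 * rho_diag z powr \<alpha>2) * indicator tube z \<partial>lborel)
      \<le> ennreal (\<epsilon> / (2 * 2 powr p2))"
      using C(2)[OF hl hb A hi nu2 m near2] unfolding mA by blast+
    define X where "X z = \<eta> * L * cmod (rho base_point z) powr (- t)" for z :: "complex^'n::{finite,linorder}"
    have X0: "0 \<le> X z" for z using eta L by (simp add: X_def)
    have split: "berezin_integral \<nu> t h z \<le> berezin_integral \<nu>2 t h z + ennreal (X z)" if z: "z \<in> tube" for z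
    proof -
      define k where "k w = ennreal (cmod (h w) * cmod (rho z w) powr (- t)) * indicator tube w" for w
      have [measurable]: "k \<in> borel_measurable borel" unfolding k_def by measurable
      have "berezin_integral \<nu> t h z = (\<integral>\<^sup>+w. indicator (- exhaust R) w * k w + k w * indicator (exhaust R) w \<partial>\<nu>)"
        unfolding berezin_integral_def k_def by (intro nn_integral_cong) (auto simp: indicator_def)
      also have "\<dots> = (\<integral>\<^sup>+w. indicator (- exhaust R) w * k w \<partial>\<nu>) + (\<integral>\<^sup>+w. k w * indicator (exhaust R) w \<partial>\<nu>)"
        by (rule nn_integral_add) measurable
      also have "(\<integral>\<^sup>+w. indicator (- exhaust R) w * k w \<partial>\<nu>) = berezin_integral \<nu>2 t h z"
        unfolding berezin_integral_def \<nu>2_def k_def[symmetric] by (rule nn_integral_density[symmetric]) measurable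
      also have "(\<integral>\<^sup>+w. k w * indicator (exhaust R) w \<partial>\<nu>)
        \<le> (\<integral>\<^sup>+w. ennreal (\<eta> * K powr t * cmod (rho base_point z) powr (- t)) * indicator (exhaust R) w \<partial>\<nu>)"
      proof (rule nn_integral_mono)
        fix w
        show "k w * indicator (exhaust R) w \<le> ennreal (\<eta> * K powr t * cmod (rho base_point z) powr (- t)) * indicator (exhaust R) w"
        proof (cases "w \<in> exhaust R")
          case True
          then have w: "w \<in> tube" using exhaust_subset_tube by blast
          have "cmod (rho z w) \<le> K * cmod (rho base_point z)" "cmod (rho base_point z) \<le> K * cmod (rho z w)"
            using exhaust_rho_comparable[OF True z] R(1) cmod_rho_commute[of z w] by (auto simp: K_def)
          then have "cmod (rho z w) powr (- t) \<le> K powr \<bar>- t\<bar> * cmod (rho base_point z) powr (- t)"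
            using z w cmod_rho_pos by (intro powr_comparable) auto
          then have "cmod (rho z w) powr (- t) \<le> K powr t * cmod (rho base_point z) powr (- t)"
            using t0 by simp
          then have "cmod (h w) * cmod (rho z w) powr (- t) \<le> \<eta> * (K powr t * cmod (rho base_point z) powr (- t))"
            using hR[OF True] eta by (intro mult_mono) auto
          then show ?thesis using True w by (simp add: k_def mult.assoc ennreal_leI)
        qed simp
      qed
      also have "\<dots> = ennreal (\<eta> * K powr t * cmod (rho base_point z) powr (- t)) * emeasure \<nu> (exhaust R)"
        by (rule nn_integral_cmult_indicator) (simp add: sets_nu)
      also have "emeasure \<nu> (exhaust R) = ennreal (enn2real (emeasure \<nu> (exhaust R)))"
        using fin R(1) by (simp add: finite_on_exhaust_def)
      also have "ennreal (\<eta> * K powr t * cmod (rho base_point z) powr (- t)) * ennreal (enn2real (emeasure \<nu> (exhaust R))) = ennreal (X z)"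
        using eta by (subst ennreal_mult[symmetric]) (auto simp: X_def L_def mult_ac)
      finally show ?thesis by (simp add: add_left_mono)
    qed
    have le: "enn2real (berezin_integral \<nu> t h z) powr p2
      \<le> 2 powr p2 * (enn2real (berezin_integral \<nu>2 t h z) powr p2 + X z powr p2)" if z: "z \<in> tube" for z
    proof -
      have "berezin_integral \<nu> t h z \<le> ennreal (enn2real (berezin_integral \<nu>2 t h z) + X z)"
        using split[OF z] tail(1) z X0 by (simp add: ennreal_plus)
      then have "enn2real (berezin_integral \<nu> t h z) \<le> enn2real (berezin_integral \<nu>2 t h z) + X z"
        using X0 by (intro enn2real_leI) auto
      then have "enn2real (berezin_integral \<nu> t h z) powr p2 \<le> (enn2real (berezin_integral \<nu>2 t h z) + X z) powr p2"
        using p2 by (intro powr_mono2) auto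
      also have "\<dots> \<le> 2 powr p2 * (enn2real (berezin_integral \<nu>2 t h z) powr p2 + X z powr p2)"
        using X0 p2 by (intro powr_add_le) auto
      finally show ?thesis .
    qed
    interpret nu2: tube_measure \<nu>2 by fact
    have I2 [measurable]: "(\<lambda>z. berezin_integral \<nu>2 t h z) \<in> borel_measurable borel"
    proof -
      have "(\<lambda>z. berezin_integral \<nu>2 t h z) \<in> borel_measurable lborel"
        unfolding berezin_integral_def
        by (rule sigma_finite_measure.borel_measurable_nn_integral) (unfold_locales, measurable)
      then show ?thesis by simp
    qed
    have [measurable]: "X \<in> borel_measurable borel" unfolding X_def by measurable
    have "(\<integral>\<^sup>+z. ennreal (enn2real (berezin_integral \<nu> t h z) powr p2 * rho_diag z powr \<alpha>2) * indicator tube z \<partial>lborel)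
      \<le> (\<integral>\<^sup>+z. ennreal (2 powr p2) * (ennreal (enn2real (berezin_integral \<nu>2 t h z) powr p2 * rho_diag z powr \<alpha>2) * indicator tube z
          + ennreal (X z powr p2 * rho_diag z powr \<alpha>2) * indicator tube z) \<partial>lborel)"
    proof (rule nn_integral_mono)
      fix z :: "complex^'n::{finite,linorder}"
      show "ennreal (enn2real (berezin_integral \<nu> t h z) powr p2 * rho_diag z powr \<alpha>2) * indicator tube z
        \<le> ennreal (2 powr p2) * (ennreal (enn2real (berezin_integral \<nu>2 t h z) powr p2 * rho_diag z powr \<alpha>2) * indicator tube z
          + ennreal (X z powr p2 * rho_diag z powr \<alpha>2) * indicator tube z)"
      proof (cases "z \<in> tube")
        case True
        have "enn2real (berezin_integral \<nu> t h z) powr p2 * rho_diag z powr \<alpha>2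
          \<le> 2 powr p2 * (enn2real (berezin_integral \<nu>2 t h z) powr p2 + X z powr p2) * rho_diag z powr \<alpha>2"
          by (rule mult_right_mono[OF le[OF True]]) simp
        also have "\<dots> = 2 powr p2 * (enn2real (berezin_integral \<nu>2 t h z) powr p2 * rho_diag z powr \<alpha>2 + X z powr p2 * rho_diag z powr \<alpha>2)"
          by (simp add: algebra_simps)
        finally have "ennreal (enn2real (berezin_integral \<nu> t h z) powr p2 * rho_diag z powr \<alpha>2)
          \<le> ennreal (2 powr p2 * (enn2real (berezin_integral \<nu>2 t h z) powr p2 * rho_diag z powr \<alpha>2 + X z powr p2 * rho_diag z powr \<alpha>2))"
          by (rule ennreal_leI)
        then show ?thesis using True by (simp add: ennreal_mult ennreal_plus)
      qed simp
    qed
    also have "\<dots> = ennreal (2 powr p2) * ((\<integral>\<^sup>+z. ennreal (enn2real (berezin_integral \<nu>2 t h z) powr p2 * rho_diag z powr \<alpha>2) * indicator tube z \<partial>lborel)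
        + (\<integral>\<^sup>+z. ennreal (X z powr p2 * rho_diag z powr \<alpha>2) * indicator tube z \<partial>lborel))"
      by (subst nn_integral_cmult) (auto simp: nn_integral_add)
    also have "\<dots> \<le> ennreal (2 powr p2) * (ennreal (\<epsilon> / (2 * 2 powr p2)) + ennreal (\<epsilon> / (2 * 2 powr p2)))"
    proof (intro mult_left_mono add_mono tail(2))
      have "ennreal (X z powr p2 * rho_diag z powr \<alpha>2) = ennreal ((\<eta> * L) powr p2) * ennreal (rho_diag z powr \<alpha>2 * cmod (rho base_point z) powr (- (t * p2)))" for z
      proof -
        have "X z powr p2 = (\<eta> * L) powr p2 * cmod (rho base_point z) powr (- (t * p2))"
          using eta L by (simp add: X_def powr_mult powr_powr)
        then have "X z powr p2 * rho_diag z powr \<alpha>2 = (\<eta> * L) powr p2 * (rho_diag z powr \<alpha>2 * cmod (rho base_point z) powr (- (t * p2)))"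
          by (simp only: mult_ac)
        then show ?thesis by (simp only: ennreal_mult powr_ge_zero mult_nonneg_nonneg)
      qed
      then have "(\<integral>\<^sup>+z. ennreal (X z powr p2 * rho_diag z powr \<alpha>2) * indicator tube z \<partial>lborel)
        = (\<integral>\<^sup>+z. ennreal ((\<eta> * L) powr p2) * (ennreal (rho_diag z powr \<alpha>2 * cmod (rho base_point z) powr (- (t * p2))) * indicator tube z)
            \<partial>(lborel :: (complex^'n::{finite,linorder}) measure))"
        by (simp only: mult.assoc)
      also have "\<dots> = ennreal ((\<eta> * L) powr p2) * (\<integral>\<^sup>+z. ennreal (rho_diag z powr \<alpha>2 * cmod (rho base_point z) powr (- (t * p2))) * indicator tube z
          \<partial>(lborel :: (complex^'n::{finite,linorder}) measure))"
        by (rule nn_integral_cmult) measurable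
      also have "\<dots> \<le> ennreal ((\<eta> * L) powr p2) * ennreal C2"
        using C2(2)[OF base_point_tube] by (intro mult_left_mono) auto
      also have "\<dots> = ennreal ((\<eta> * L) powr p2 * C2)"
        using C2(1) by (intro ennreal_mult[symmetric]) auto
      also have "\<dots> \<le> ennreal (\<epsilon> / (2 * 2 powr p2))"
        by (rule ennreal_leI[OF etaL])
      finally show "(\<integral>\<^sup>+z. ennreal (X z powr p2 * rho_diag z powr \<alpha>2) * indicator tube z \<partial>lborel) \<le> ennreal (\<epsilon> / (2 * 2 powr p2))" .
    qed simp
    also have "\<dots> = ennreal (2 powr p2 * (\<epsilon> / (2 * 2 powr p2) + \<epsilon> / (2 * 2 powr p2)))"
      using eps by (simp add: ennreal_mult[symmetric] ennreal_plus[symmetric] del: ennreal_plus)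
    also have "2 powr p2 * (\<epsilon> / (2 * 2 powr p2) + \<epsilon> / (2 * 2 powr p2)) = \<epsilon>" by simp
    finally show "(\<integral>\<^sup>+z. ennreal (enn2real (berezin_integral \<nu> t h z) powr p2 * rho_diag z powr \<alpha>2) * indicator tube z \<partial>lborel) \<le> ennreal \<epsilon>" .
  qed
qed

text \<open>Members of \<open>Bergman\<close> have arbitrary values off \<open>tube\<close>; setting
  these to 0 selects the representative that belongs to a \<open>bergman_ball\<close>.\<close>

definition extend0 :: "(complex^'n::{finite,linorder} \<Rightarrow> complex) \<Rightarrow> complex^'n::{finite,linorder} \<Rightarrow> complex" where
  "extend0 f z = (if z \<in> tube then f z else 0)"

lemma extend0_in_bergman_ball:
  assumes f: "f \<in> Bergman p \<alpha>" and p: "0 < p" and A: "Lp_norm p \<alpha> f \<le> A"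
  shows "extend0 f \<in> bergman_ball p \<alpha> A"
proof -
  have fL: "f \<in> Lp p \<alpha>" and h: "line_holomorphic_on f tube"
    using f holomorphic_tube_line_holomorphic by (auto simp: Bergman_def)
  have "continuous_on tube (extend0 f)"
    using h by (subst continuous_on_cong[of tube tube _ f]) (auto simp: extend0_def line_holomorphic_on_def)
  moreover have "(\<lambda>t. extend0 f (a + t *s v)) holomorphic_on {t. a + t *s v \<in> tube}" for a v
    using h by (subst holomorphic_cong[where g = "\<lambda>t. f (a + t *s v)"]) (auto simp: extend0_def line_holomorphic_on_def)
  ultimately have "line_holomorphic_on (extend0 f) tube"
    by (simp add: line_holomorphic_on_def)
  moreover have "(\<integral>\<^sup>+w. ennreal (cmod (extend0 f w) powr p * rho_diag w powr \<alpha>) * indicator tube w \<partial>lborel) \<le> ennreal (A powr p)"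
  proof -
    have "(\<integral>\<^sup>+w. ennreal (cmod (extend0 f w) powr p * rho_diag w powr \<alpha>) * indicator tube w \<partial>lborel)
      = (\<integral>\<^sup>+w. ennreal (rho_diag w powr \<alpha>) * ennreal (cmod (f w) powr p) * indicator tube w \<partial>lborel)"
      by (intro nn_integral_cong) (auto simp: extend0_def indicator_def ennreal_mult mult.commute)
    also have "\<dots> = (\<integral>\<^sup>+w. ennreal (cmod (f w) powr p) \<partial>dV \<alpha>)"
    proof (rule nn_integral_dV[symmetric])
      have [measurable]: "f \<in> borel_measurable (lebesgue_on tube)" using fL by (simp add: Lp_def)
      show "(\<lambda>w. ennreal (cmod (f w) powr p)) \<in> borel_measurable (lebesgue_on tube)" by measurable
    qed
    also have "\<dots> = ennreal (Lp_norm p \<alpha> f powr p)" by (rule nn_integral_Lp[OF fL p])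
    also have "\<dots> \<le> ennreal (A powr p)"
      using A p Lp_norm_nonneg by (intro ennreal_leI powr_mono2) auto
    finally show ?thesis .
  qed
  ultimately show ?thesis by (simp add: bergman_ball_def extend0_def)
qed

lemma berezin_integral_Lp:
  fixes p1 p2 \<alpha>1 \<alpha>2 \<xi> :: real and \<nu> :: "(complex^'n::{finite,linorder}) measure"
  assumes p: "0 < p1" "p1 \<le> p2" "1 < p2" and al: "-1 < \<alpha>2" and xi: "-1 < \<xi>" and cond: "1 + \<alpha>2 < p2 * (1 + \<xi>)"
    and t: "t = real CARD('n) + 1 + \<xi>"
    and b: "b = t + (real CARD('n) + 1 + \<alpha>1) / p1 - (real CARD('n) + 1 + \<alpha>2) / p2"
    and nu: "tube_measure \<nu>" and van: "vanishing_near b \<nu>" and fin: "finite_on_exhaust \<nu>"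
  obtains c where "0 < c" "\<And>f A. 0 < A \<Longrightarrow> f \<in> bergman_ball p1 \<alpha>1 A \<Longrightarrow> (\<forall>z\<in>tube. berezin_integral \<nu> t f z < \<infinity>) \<and>
    (\<integral>\<^sup>+z. ennreal (enn2real (berezin_integral \<nu> t f z) powr p2 * rho_diag z powr \<alpha>2) * indicator tube z \<partial>lborel)
      \<le> ennreal ((c * A) powr p2)"
proof -
  interpret tube_measure \<nu> by fact
  obtain m where m: "0 < m" "\<And>u. u \<in> tube \<Longrightarrow> emeasure \<nu> {w. near u w} \<le> ennreal (m * rho_diag u powr b)"
    by (rule near_measure_bound[OF van fin]) blast
  obtain C where C: "0 < C" "\<And>(f :: complex^'n::{finite,linorder} \<Rightarrow> complex) A \<nu> m. line_holomorphic_on f tube \<Longrightarrow>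
    f \<in> borel_measurable borel \<Longrightarrow> 0 < A \<Longrightarrow>
    (\<integral>\<^sup>+w. ennreal (cmod (f w) powr p1 * rho_diag w powr \<alpha>1) * indicator tube w \<partial>lborel) \<le> ennreal (A powr p1) \<Longrightarrow>
    tube_measure \<nu> \<Longrightarrow> 0 < m \<Longrightarrow> (\<And>u. u \<in> tube \<Longrightarrow> emeasure \<nu> {w. near u w} \<le> ennreal (m * rho_diag u powr b)) \<Longrightarrow>
    (\<forall>z\<in>tube. berezin_integral \<nu> t f z < \<infinity>) \<and>
    (\<integral>\<^sup>+z. ennreal (enn2real (berezin_integral \<nu> t f z) powr p2 * rho_diag z powr \<alpha>2) * indicator tube z \<partial>lborel)
      \<le> ennreal (C * (m * A) powr p2)"
    by (rule berezin_integral_bound[OF p al xi cond t b]) blast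
  show thesis
  proof (rule that)
    show "0 < C powr (1 / p2) * m" using C(1) m(1) by simp
    fix f :: "complex^'n::{finite,linorder} \<Rightarrow> complex" and A assume A: "0 < A" and f: "f \<in> bergman_ball p1 \<alpha>1 A"
    have "C * (m * A) powr p2 = (C powr (1 / p2) * m * A) powr p2"
      using C(1) m(1) A p by (simp add: powr_mult powr_powr)
    moreover have "line_holomorphic_on f tube"
      "(\<integral>\<^sup>+w. ennreal (cmod (f w) powr p1 * rho_diag w powr \<alpha>1) * indicator tube w \<partial>lborel) \<le> ennreal (A powr p1)"
      using f by (auto simp: bergman_ball_def)
    ultimately show "(\<forall>z\<in>tube. berezin_integral \<nu> t f z < \<infinity>) \<and>
      (\<integral>\<^sup>+z. ennreal (enn2real (berezin_integral \<nu> t f z) powr p2 * rho_diag z powr \<alpha>2) * indicator tube z \<partial>lborel)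
        \<le> ennreal ((C powr (1 / p2) * m * A) powr p2)"
      using C(2)[OF _ bergman_ball_borel[OF f] A _ nu m] by simp
  qed
qed

text \<open>Common reduction for both operators. Not only S f but also the difference of two values
  of S is required to be dominated by a Berezin-type integral; the second condition replaces
  linearity, which a sublinear operator lacks. Continuity on the compact Bergman balls then gives
  relative compactness.\<close>

lemma compact_op_dominated:
  fixes p1 p2 \<alpha>1 \<alpha>2 \<xi> :: real and \<nu> :: "(complex^'n::{finite,linorder}) measure"
    and S :: "(complex^'n::{finite,linorder} \<Rightarrow> complex) \<Rightarrow> complex^'n::{finite,linorder} \<Rightarrow> complex"
  assumes p: "0 < p1" "p1 \<le> p2" "1 < p2" and al: "-1 < \<alpha>2" and xi: "-1 < \<xi>" and cond: "1 + \<alpha>2 < p2 * (1 + \<xi>)"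
    and tp: "real CARD('n) + 1 + \<alpha>2 < t * p2"
    and t: "t = real CARD('n) + 1 + \<xi>"
    and b: "b = t + (real CARD('n) + 1 + \<alpha>1) / p1 - (real CARD('n) + 1 + \<alpha>2) / p2"
    and nu: "tube_measure \<nu>" and van: "vanishing_near b \<nu>" and fin: "finite_on_exhaust \<nu>"
    and dom: "Bergman p1 \<alpha>1 \<subseteq> D" and Y: "Y \<subseteq> Lp p2 \<alpha>2"
    and ext: "\<And>f. S (extend0 f) = S f"
    and SY: "\<And>f A. 0 < A \<Longrightarrow> f \<in> bergman_ball p1 \<alpha>1 A \<Longrightarrow> S f \<in> Y"
    and S_le: "\<And>f A z. 0 < A \<Longrightarrow> f \<in> bergman_ball p1 \<alpha>1 A \<Longrightarrow> z \<in> tube \<Longrightarrow>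
      cmod (S f z) \<le> enn2real (berezin_integral \<nu> t f z)"
    and S_diff: "\<And>f g A z. 0 < A \<Longrightarrow> f \<in> bergman_ball p1 \<alpha>1 A \<Longrightarrow> g \<in> bergman_ball p1 \<alpha>1 A \<Longrightarrow> z \<in> tube \<Longrightarrow>
      cmod (S g z - S f z) \<le> enn2real (berezin_integral \<nu> t (\<lambda>w. g w - f w) z)"
  shows "compact_op D S (Bergman p1 \<alpha>1) (Lp_norm p1 \<alpha>1) Y (Lp_norm p2 \<alpha>2)"
proof -
  have p2: "0 < p2" using p by simp
  obtain c where c: "0 < c" "\<And>f A. 0 < A \<Longrightarrow> f \<in> bergman_ball p1 \<alpha>1 A \<Longrightarrow> (\<forall>z\<in>tube. berezin_integral \<nu> t f z < \<infinity>) \<and>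
    (\<integral>\<^sup>+z. ennreal (enn2real (berezin_integral \<nu> t f z) powr p2 * rho_diag z powr \<alpha>2) * indicator tube z \<partial>lborel)
      \<le> ennreal ((c * A) powr p2)"
    by (rule berezin_integral_Lp[OF p al xi cond t b nu van fin]) blast
  have in_ball: "extend0 f \<in> bergman_ball p1 \<alpha>1 A" if "f \<in> Bergman p1 \<alpha>1" "Lp_norm p1 \<alpha>1 f \<le> A"
    for f :: "complex^'n::{finite,linorder} \<Rightarrow> complex" and A
    by (rule extend0_in_bergman_ball[OF that(1) p(1) that(2)])
  have meas: "F \<in> borel_measurable (lebesgue_on tube)" if "F \<in> Y" for F
    using that Y by (auto simp: Lp_def)
  \<comment> \<open>A lies strictly above the norm so that it is positive even for norm 0; letting
    it decrease to the norm recovers the operator bound.\<close>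
  have le: "Lp_norm p2 \<alpha>2 (S f) \<le> c * A" if f: "f \<in> Bergman p1 \<alpha>1" and A: "Lp_norm p1 \<alpha>1 f < A"
    for f :: "complex^'n::{finite,linorder} \<Rightarrow> complex" and A
  proof -
    have A0: "0 < A" using A Lp_norm_nonneg[of p1 \<alpha>1 f] by linarith
    have ball: "extend0 f \<in> bergman_ball p1 \<alpha>1 A" by (rule in_ball[OF f less_imp_le[OF A]])
    have "Lp_norm p2 \<alpha>2 (S (extend0 f)) \<le> ((c * A) powr p2) powr (1 / p2)"
      by (rule Lp_dominated(2)[OF p2 powr_ge_zero meas[OF SY[OF A0 ball]] S_le[OF A0 ball] conjunct2[OF c(2)[OF A0 ball]]])
    then show ?thesis using p2 c(1) A0 by (simp add: ext powr_powr)
  qed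
  have "bounded_op D S (Bergman p1 \<alpha>1) (Lp_norm p1 \<alpha>1) Y (Lp_norm p2 \<alpha>2)"
    unfolding bounded_op_def
  proof (intro conjI exI ballI)
    show "Bergman p1 \<alpha>1 \<subseteq> D" by (rule dom)
    show "S ` Bergman p1 \<alpha>1 \<subseteq> Y"
    proof (rule image_subsetI)
      fix f :: "complex^'n::{finite,linorder} \<Rightarrow> complex" assume f: "f \<in> Bergman p1 \<alpha>1"
      have "S (extend0 f) \<in> Y"
        by (rule SY[OF _ in_ball[OF f, of "Lp_norm p1 \<alpha>1 f + 1"]]) (simp_all add: Lp_norm_nonneg add_nonneg_pos)
      then show "S f \<in> Y" by (simp add: ext)
    qed
    fix f :: "complex^'n::{finite,linorder} \<Rightarrow> complex" assume f: "f \<in> Bergman p1 \<alpha>1"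
    show "Lp_norm p2 \<alpha>2 (S f) \<le> c * Lp_norm p1 \<alpha>1 f"
    proof (rule field_le_epsilon)
      fix e :: real assume e: "0 < e"
      have "Lp_norm p2 \<alpha>2 (S f) \<le> c * (Lp_norm p1 \<alpha>1 f + e / c)"
        using e c(1) by (intro le f) simp
      then show "Lp_norm p2 \<alpha>2 (S f) \<le> c * Lp_norm p1 \<alpha>1 f + e" using c(1) by (simp add: distrib_left)
    qed
  qed
  moreover have "relatively_compact Y (Lp_norm p2 \<alpha>2) (S ` X)"
    if X: "X \<subseteq> Bergman p1 \<alpha>1" "\<forall>f\<in>X. Lp_norm p1 \<alpha>1 f \<le> M" for X M
  proof (rule relatively_compact_continuous_image[where K = "bergman_ball p1 \<alpha>1 (max M 1)" and S = S and c = "2 * 2 powr (1 / p2)"])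
    define A where "A = max M 1"
    have A: "0 < A" by (simp add: A_def)
    show "compact (bergman_ball p1 \<alpha>1 (max M 1) :: (complex^'n::{finite,linorder} \<Rightarrow> complex) set)"
      by (rule compact_bergman_ball[OF p(1)]) simp
    show "S ` bergman_ball p1 \<alpha>1 (max M 1) \<subseteq> Y"
      using SY[of "max M 1"] by auto
    show "0 < 2 * 2 powr (1 / p2)" by simp
    show "0 \<le> Lp_norm p2 \<alpha>2 f" for f by (rule Lp_norm_nonneg)
    show "Lp_norm p2 \<alpha>2 (\<lambda>z. f z - g z) = Lp_norm p2 \<alpha>2 (\<lambda>z. g z - f z)" for f g
      by (rule Lp_norm_commute)
    show "Lp_norm p2 \<alpha>2 (\<lambda>z. f z - h z) \<le> 2 * 2 powr (1 / p2) * (Lp_norm p2 \<alpha>2 (\<lambda>z. f z - g z) + Lp_norm p2 \<alpha>2 (\<lambda>z. g z - h z))"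
      if "f \<in> Y" "g \<in> Y" "h \<in> Y" for f g h
      using that Y by (intro Lp_norm_quasi_triangle[OF p2]) auto
    show "Lp_norm p2 \<alpha>2 (\<lambda>_. 0) = 0" using p2 by (simp add: Lp_norm_def)
    show "S ` X \<subseteq> S ` bergman_ball p1 \<alpha>1 (max M 1)"
    proof (rule image_subsetI)
      fix f :: "complex^'n::{finite,linorder} \<Rightarrow> complex" assume f: "f \<in> X"
      then have "extend0 f \<in> bergman_ball p1 \<alpha>1 (max M 1)" using X by (intro in_ball) auto
      then have "S (extend0 f) \<in> S ` bergman_ball p1 \<alpha>1 (max M 1)" by (rule imageI)
      then show "S f \<in> S ` bergman_ball p1 \<alpha>1 (max M 1)" by (simp only: ext)
    qed
    fix f :: "complex^'n::{finite,linorder} \<Rightarrow> complex" and \<epsilon> :: real assume f: "f \<in> bergman_ball p1 \<alpha>1 (max M 1)" and eps: "0 < \<epsilon>"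
    \<comment> \<open>Radius of a ball that contains all differences of two members of the ball of
      radius A.\<close>
    define A' where "A' = 2 * 2 powr (1 / p1) * A"
    have A': "0 < A'" using A by (simp add: A'_def)
    have e': "0 < (\<epsilon> / 2) powr p2" using eps by simp
    obtain P \<delta> where P: "finite P" "0 < \<delta>" "\<And>h. h \<in> bergman_ball p1 \<alpha>1 A' \<Longrightarrow> (\<And>x. x \<in> P \<Longrightarrow> cmod (h x) < \<delta>) \<Longrightarrow>
      (\<integral>\<^sup>+z. ennreal (enn2real (berezin_integral \<nu> t h z) powr p2 * rho_diag z powr \<alpha>2) * indicator tube z \<partial>lborel) \<le> ennreal ((\<epsilon> / 2) powr p2)"
      by (rule berezin_integral_continuous[OF p al xi cond tp t b nu van fin A' e']) blast
    show "\<exists>V. open V \<and> f \<in> V \<and> (\<forall>g\<in>bergman_ball p1 \<alpha>1 (max M 1) \<inter> V. Lp_norm p2 \<alpha>2 (\<lambda>z. S g z - S f z) < \<epsilon>)"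
    proof (intro exI conjI ballI)
      show "open {g. \<forall>x\<in>P. cmod (g x - f x) < \<delta>}" by (rule open_pointwise_nbhd[OF P(1)])
      show "f \<in> {g. \<forall>x\<in>P. cmod (g x - f x) < \<delta>}" using P(2) by simp
      fix g assume g: "g \<in> bergman_ball p1 \<alpha>1 (max M 1) \<inter> {g. \<forall>x\<in>P. cmod (g x - f x) < \<delta>}"
      have fg: "f \<in> bergman_ball p1 \<alpha>1 A" "g \<in> bergman_ball p1 \<alpha>1 A" using f g by (auto simp: A_def)
      have "(\<lambda>z. S g z - S f z) \<in> Lp p2 \<alpha>2"
        using SY[OF A fg(1)] SY[OF A fg(2)] Y by (intro Lp_diff_mem[OF p2]) auto
      then have m: "(\<lambda>z. S g z - S f z) \<in> borel_measurable (lebesgue_on tube)" by (simp add: Lp_def)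
      have "(\<lambda>w. g w - f w) \<in> bergman_ball p1 \<alpha>1 A'"
        unfolding A'_def by (rule bergman_ball_diff[OF p(1) A fg(2,1)])
      then have int: "(\<integral>\<^sup>+z. ennreal (enn2real (berezin_integral \<nu> t (\<lambda>w. g w - f w) z) powr p2 * rho_diag z powr \<alpha>2) * indicator tube z \<partial>lborel)
        \<le> ennreal ((\<epsilon> / 2) powr p2)"
        using g by (intro P(3)) auto
      have "Lp_norm p2 \<alpha>2 (\<lambda>z. S g z - S f z) \<le> ((\<epsilon> / 2) powr p2) powr (1 / p2)"
        by (rule Lp_dominated(2)[OF p2 powr_ge_zero m S_diff[OF A fg] int])
      also have "\<dots> < \<epsilon>" using p2 eps by (simp add: powr_powr)
      finally show "Lp_norm p2 \<alpha>2 (\<lambda>z. S g z - S f z) < \<epsilon>" .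
    qed
  qed
  ultimately show ?thesis
    unfolding compact_op_def by blast
qed

section \<open>Test functions and uniform tails\<close>

lemma norm_powr_of_real: "z \<noteq> 0 \<Longrightarrow> cmod (z powr of_real t) = cmod z powr t"
  by (simp add: powr_def)

lemma rho_not_nonpos: "z \<in> tube \<Longrightarrow> w \<in> tube \<Longrightarrow> rho z w \<notin> \<real>\<^sub>\<le>\<^sub>0"
  using Re_rho_pos[of z w] by (auto simp: complex_nonpos_Reals_iff)

lemma rho_nonzero: "z \<in> tube \<Longrightarrow> w \<in> tube \<Longrightarrow> rho z w \<noteq> 0"
  using cmod_rho_pos by force

definition rho_derivative :: "complex^'n::{finite,linorder} \<Rightarrow> complex^'n::{finite,linorder} \<Rightarrow> complex^'n::{finite,linorder} \<Rightarrow> complex" where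
  "rho_derivative z w h = 1/4 * ((\<Sum>j\<in>UNIV - {last_ix}. 2 * (z $ j - cnj (w $ j)) * h $ j) - 2 * \<i> * h $ last_ix)"

lemma rho_has_derivative: "((\<lambda>z. rho z w) has_derivative rho_derivative z w) (at z)"
proof -
  have nth: "((\<lambda>z. z $ j - c) has_derivative (\<lambda>h. h $ j)) (at z)" for j and c :: complex
    by (rule has_derivative_eq_rhs[OF has_derivative_diff[OF
          bounded_linear_imp_has_derivative[OF bounded_linear_vec_nth] has_derivative_const]]) simp
  have sq: "((\<lambda>z. (z $ j - c)\<^sup>2) has_derivative (\<lambda>h. 2 * (z $ j - c) * h $ j)) (at z)" for j and c :: complex
    by (rule has_derivative_eq_rhs[OF has_derivative_power[OF nth]]) (simp add: mult_ac)
  show ?thesis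
    unfolding rho_def rho_derivative_def
    by (intro has_derivative_mult_right has_derivative_diff has_derivative_sum sq nth)
qed

lemma rho_derivative_linear: "rho_derivative z w (c *s h) = c * rho_derivative z w h"
  unfolding rho_derivative_def by (simp add: algebra_simps sum_distrib_left)

lemma rho_powr_has_derivative:
  assumes "z \<in> tube" "w \<in> tube"
  shows "((\<lambda>z. rho z w powr of_real e) has_derivative
    (\<lambda>h. of_real e * rho z w powr (of_real e - 1) * rho_derivative z w h)) (at z)"
proof -
  have "((\<lambda>u. u powr of_real e) has_field_derivative of_real e * rho z w powr (of_real e - 1)) (at (rho z w))"
    using assms by (intro has_field_derivative_powr rho_not_nonpos)
  from has_derivative_compose[OF rho_has_derivative this[THEN has_field_derivative_imp_has_derivative]]
  show ?thesis .
qed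

text \<open>\<open>rho\<close> is holomorphic in its first argument and antiholomorphic in the
  second, hence the order of the arguments. The real factor in front normalises the norm, see
  \<open>test_function_Bergman\<close>.\<close>

definition test_function :: "real \<Rightarrow> real \<Rightarrow> complex^'n::{finite,linorder} \<Rightarrow> complex^'n::{finite,linorder} \<Rightarrow> complex" where
  "test_function s t a w = of_real (rho_diag a powr s) * rho w a powr of_real (- t)"

lemma cmod_test_function:
  "a \<in> tube \<Longrightarrow> w \<in> tube \<Longrightarrow> cmod (test_function s t a w) = rho_diag a powr s * cmod (rho a w) powr (- t)"
  unfolding test_function_def using rho_nonzero[of w a]
  by (simp add: norm_mult norm_powr_of_real[of _ "- t", simplified] cmod_rho_commute[of w a])

lemma test_function_holomorphic:
  fixes a :: "complex^'n::{finite,linorder}"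
  assumes "a \<in> tube" shows "holomorphic_tube (test_function s t a)"
  unfolding holomorphic_tube_def
proof
  fix z :: "complex^'n::{finite,linorder}" assume z: "z \<in> tube"
  define D where "D h = of_real (rho_diag a powr s) * (of_real (- t) * rho z a powr (of_real (- t) - 1) * rho_derivative z a h)" for h
  have "(test_function s t a has_derivative D) (at z)"
    unfolding test_function_def[abs_def] D_def[abs_def] by (intro has_derivative_mult_right rho_powr_has_derivative z assms)
  moreover have "\<forall>c v. D (c *s v) = c * D v"
    by (simp add: D_def rho_derivative_linear)
  ultimately show "\<exists>D. (test_function s t a has_derivative D) (at z) \<and> (\<forall>c v. D (c *s v) = c * D v)"
    by (intro exI conjI)
qed

lemma line_holomorphic_lebesgue_measurable:
  fixes f :: "complex^'n::{finite,linorder} \<Rightarrow> complex"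
  assumes "line_holomorphic_on f tube" shows "f \<in> borel_measurable (lebesgue_on tube)"
proof -
  have "(\<lambda>z. indicator tube z *\<^sub>R f z) \<in> borel_measurable borel"
    using assms by (intro borel_measurable_continuous_on_indicator) (auto simp: line_holomorphic_on_def)
  then have "(\<lambda>z. indicator tube z *\<^sub>R f z) \<in> borel_measurable (lebesgue_on tube)"
    by (rule borel_measurable_lebesgue_on_tube)
  then show ?thesis
    by (subst measurable_cong[where g = "\<lambda>z. indicator tube z *\<^sub>R f z"]) (simp_all add: space_restrict_space)
qed

text \<open>The Forelli-Rudin estimate bounds the p-th power of the norm by a multiple of rho_diag a
  to the power s p + (n + 1 + \<open>\<alpha>\<close>) - t p. The choice of s makes this exponent 0,
  so the bound is uniform in a.\<close>

lemma test_function_Bergman: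
  assumes p: "0 < p" and al: "-1 < \<alpha>" and tp: "real CARD('n) + 1 + \<alpha> < t * p"
    and s: "s = t - (real CARD('n) + 1 + \<alpha>) / p"
  obtains C where "\<And>a :: complex^'n::{finite,linorder}. a \<in> tube \<Longrightarrow>
    test_function s t a \<in> Bergman p \<alpha> \<and> Lp_norm p \<alpha> (test_function s t a) \<le> C"
proof -
  define N where "N = real CARD('n) + 1 + \<alpha>"
  obtain C where C: "0 \<le> C" "\<And>a :: complex^'n::{finite,linorder}. a \<in> tube \<Longrightarrow>
    (\<integral>\<^sup>+w. ennreal (rho_diag w powr \<alpha> * cmod (rho a w) powr (- (t * p))) * indicator tube w \<partial>lborel)
      \<le> ennreal (C * rho_diag a powr (N - t * p))"
    unfolding N_def by (rule kernel_integral[OF al tp]) blast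
  have sp: "s * p = t * p - N" using p by (simp add: s N_def left_diff_distrib)
  show thesis
  proof (rule that)
    fix a :: "complex^'n::{finite,linorder}" assume a: "a \<in> tube"
    define G where "G w = rho_diag a powr s * cmod (rho a w) powr (- t)" for w
    have hol: "holomorphic_tube (test_function s t a)" by (rule test_function_holomorphic[OF a])
    have "(\<integral>\<^sup>+w. ennreal (G w powr p * rho_diag w powr \<alpha>) * indicator tube w \<partial>lborel)
      = (\<integral>\<^sup>+w. ennreal (rho_diag a powr (s * p)) * (ennreal (rho_diag w powr \<alpha> * cmod (rho a w) powr (- (t * p))) * indicator tube w) \<partial>lborel)"
    proof (rule nn_integral_cong)
      fix w
      have "G w powr p * rho_diag w powr \<alpha> = rho_diag a powr (s * p) * (rho_diag w powr \<alpha> * cmod (rho a w) powr (- (t * p)))"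
        by (simp add: G_def powr_mult powr_powr)
      then show "ennreal (G w powr p * rho_diag w powr \<alpha>) * indicator tube w
        = ennreal (rho_diag a powr (s * p)) * (ennreal (rho_diag w powr \<alpha> * cmod (rho a w) powr (- (t * p))) * indicator tube w)"
        by (simp only: ennreal_mult powr_ge_zero mult_nonneg_nonneg mult.assoc)
    qed
    also have "\<dots> = ennreal (rho_diag a powr (s * p)) * (\<integral>\<^sup>+w. ennreal (rho_diag w powr \<alpha> * cmod (rho a w) powr (- (t * p))) * indicator tube w \<partial>lborel)"
      by (rule nn_integral_cmult) measurable
    also have "\<dots> \<le> ennreal (rho_diag a powr (s * p)) * ennreal (C * rho_diag a powr (N - t * p))"
      by (intro mult_left_mono C(2) a) auto
    also have "\<dots> = ennreal C"
    proof -
      have "rho_diag a powr (s * p) * rho_diag a powr (N - t * p) = 1"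
        unfolding sp using a by (simp add: mem_tube flip: powr_add)
      then have "rho_diag a powr (s * p) * (C * rho_diag a powr (N - t * p)) = C"
        by (simp add: mult.left_commute)
      then show ?thesis using C(1) by (simp add: ennreal_mult[symmetric])
    qed
    finally have int: "(\<integral>\<^sup>+w. ennreal (G w powr p * rho_diag w powr \<alpha>) * indicator tube w \<partial>lborel) \<le> ennreal C" .
    note * = Lp_dominated[OF p C(1) line_holomorphic_lebesgue_measurable[OF holomorphic_tube_line_holomorphic[OF hol]] _ int]
    have "cmod (test_function s t a w) \<le> G w" if "w \<in> tube" for w
      using a that by (simp add: cmod_test_function G_def)
    then show "test_function s t a \<in> Bergman p \<alpha> \<and> Lp_norm p \<alpha> (test_function s t a) \<le> C powr (1 / p)"
      using * hol by (simp add: Bergman_def)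
  qed
qed

section \<open>Uniform tails of relatively compact sets\<close>

lemma exhaust_sets_dV: "0 < R \<Longrightarrow> exhaust R \<in> sets (dV \<alpha>)"
proof -
  assume "0 < R"
  then have "exhaust R \<in> sets lborel" by simp
  then have "exhaust R \<in> sets lebesgue" by (rule sets_completionI_sets)
  then have "tube \<inter> exhaust R \<in> (\<inter>) tube ` sets lebesgue" by (rule imageI)
  then show ?thesis
    by (simp only: sets_dV sets_restrict_space Int_absorb1[OF exhaust_subset_tube])
qed

definition tail_integral :: "real \<Rightarrow> real \<Rightarrow> real \<Rightarrow> (complex^'n::{finite,linorder} \<Rightarrow> complex) \<Rightarrow> real" where
  "tail_integral p \<alpha> R g = (\<integral>z. indicator (- exhaust R) z * cmod (g z) powr p \<partial>dV \<alpha>)"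

lemma tail_integrable:
  assumes "integrable (dV \<alpha>) (\<lambda>z. cmod (g z) powr p)" "0 < R"
  shows "integrable (dV \<alpha>) (\<lambda>z. indicator (- exhaust R) z * cmod (g z) powr p)"
proof -
  have eq: "indicator (- exhaust R) z * cmod (g z) powr p = cmod (g z) powr p - indicator (exhaust R) z *\<^sub>R (cmod (g z) powr p)" for z
    by (simp add: indicator_def)
  show ?thesis
    unfolding eq using assms
    by (intro Bochner_Integration.integrable_diff integrable_mult_indicator exhaust_sets_dV)
qed

lemma tail_integral_tendsto:
  fixes g :: "complex^'n::{finite,linorder} \<Rightarrow> complex"
  assumes g: "g \<in> Lp p \<alpha>"
  shows "(\<lambda>n. tail_integral p \<alpha> (real n + 1) g) \<longlonglongrightarrow> 0"
proof -
  have "(\<lambda>n. tail_integral p \<alpha> (real n + 1) g) \<longlonglongrightarrow> (\<integral>z. 0 \<partial>(dV \<alpha> :: (complex^'n::{finite,linorder}) measure))"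
    unfolding tail_integral_def
  proof (rule integral_dominated_convergence[where w = "\<lambda>z. cmod (g z) powr p"])
    show "integrable (dV \<alpha>) (\<lambda>z. cmod (g z) powr p)" by (rule Lp_integrable[OF g])
    show "(\<lambda>z. indicator (- exhaust (real n + 1)) z * cmod (g z) powr p) \<in> borel_measurable (dV \<alpha>)" for n
      by (rule borel_measurable_integrable[OF tail_integrable[OF Lp_integrable[OF g]]]) simp
    show "AE z in dV \<alpha>. (\<lambda>n. indicator (- exhaust (real n + 1)) z * cmod (g z) powr p) \<longlonglongrightarrow> 0"
    proof (rule AE_I2)
      fix z :: "complex^'n::{finite,linorder}" assume "z \<in> space (dV \<alpha>)"
      then have z: "z \<in> tube" by (simp add: dV_def space_restrict_space)
      obtain n where n: "max (1 / rho_diag z) (cmod (rho z base_point)) \<le> real n" using real_arch_simple by blast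
      have "indicator (- exhaust (real k + 1)) z * cmod (g z) powr p = 0" if "n \<le> k" for k
      proof -
        have "z \<in> exhaust (real k + 1)"
          by (rule subsetD[OF exhaust_mono exhaust_cover[OF z]]) (use n that in linarith)
        then show ?thesis by simp
      qed
      then show "(\<lambda>n. indicator (- exhaust (real n + 1)) z * cmod (g z) powr p) \<longlonglongrightarrow> 0"
        by (intro tendsto_eventually eventually_sequentiallyI[of n])
    qed
    show "AE z in dV \<alpha>. norm (indicator (- exhaust (real n + 1)) z * cmod (g z) powr p) \<le> cmod (g z) powr p" for n
      by (auto simp: indicator_def)
  qed simp
  then show ?thesis by simp
qed

lemma tail_integral_mono:
  assumes g: "g \<in> Lp p \<alpha>" and R: "0 < R" "R \<le> R'"
  shows "tail_integral p \<alpha> R' g \<le> tail_integral p \<alpha> R g"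
  unfolding tail_integral_def
proof (rule integral_mono)
  show "indicator (- exhaust R') z * cmod (g z) powr p \<le> indicator (- exhaust R) z * cmod (g z) powr p" for z
    using exhaust_mono[OF R(2)] by (intro mult_right_mono) (auto simp: indicator_def)
qed (use R in \<open>auto intro!: tail_integrable Lp_integrable g\<close>)

text \<open>Serves to show that a strict bound on the tail integral is an open condition, which is
  why the factor of the old tail has to come arbitrarily close to 1.\<close>

lemma tail_integral_add_le:
  assumes p: "0 < p" and k: "0 < k" and R: "0 < R" and g: "g \<in> Lp p \<alpha>" and h: "h \<in> Lp p \<alpha>"
  shows "tail_integral p \<alpha> R h \<le> (1 + k) powr p * tail_integral p \<alpha> R g + (1 + 1 / k) powr p * Lp_norm p \<alpha> (\<lambda>z. h z - g z) powr p"
proof -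
  note ints = tail_integrable[OF Lp_integrable[OF g] R] Lp_diff(1)[OF p h g]
  have "tail_integral p \<alpha> R h \<le> (\<integral>z. (1 + k) powr p * (indicator (- exhaust R) z * cmod (g z) powr p) + (1 + 1 / k) powr p * cmod (h z - g z) powr p \<partial>dV \<alpha>)"
    unfolding tail_integral_def
  proof (rule integral_mono)
    fix z
    show "indicator (- exhaust R) z * cmod (h z) powr p \<le> (1 + k) powr p * (indicator (- exhaust R) z * cmod (g z) powr p) + (1 + 1 / k) powr p * cmod (h z - g z) powr p"
    proof (cases "z \<in> exhaust R")
      case False
      have "cmod (h z) powr p \<le> (cmod (g z) + cmod (h z - g z)) powr p"
        using p norm_triangle_sub[of "h z" "g z"] by (intro powr_mono2) auto
      also have "\<dots> \<le> (1 + k) powr p * cmod (g z) powr p + (1 + 1 / k) powr p * cmod (h z - g z) powr p"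
        by (rule powr_add_le_eps) (use p k in auto)
      finally show ?thesis using False by simp
    qed simp
  qed (intro tail_integrable Lp_integrable h R Bochner_Integration.integrable_add integrable_mult_right ints)+
  also have "\<dots> = (1 + k) powr p * tail_integral p \<alpha> R g + (1 + 1 / k) powr p * Lp_norm p \<alpha> (\<lambda>z. h z - g z) powr p"
    unfolding tail_integral_def Lp_norm_powr[OF p]
    by (simp add: Bochner_Integration.integral_add ints)
  finally show ?thesis .
qed

lemma powr_perturbation:
  fixes v \<epsilon> p :: real
  assumes "0 \<le> v" "v < \<epsilon>" "0 < p"
  obtains k where "0 < k" "(1 + k) powr p * v < \<epsilon>"
proof -
  have "((\<lambda>k. (1 + k) powr p * v) \<longlongrightarrow> (1 + 0) powr p * v) (at_right 0)"
    by (intro tendsto_intros) auto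
  then have "\<forall>\<^sub>F k in at_right 0. (1 + k) powr p * v < \<epsilon>"
    using assms(2) by (intro order_tendstoD) auto
  then have "\<forall>\<^sub>F k in at_right 0. 0 < k \<and> (1 + k) powr p * v < \<epsilon>"
    using eventually_at_right_less[of "0::real"] by eventually_elim simp
  then obtain k where "0 < k \<and> (1 + k) powr p * v < \<epsilon>"
    by (rule eventually_happens'[OF trivial_limit_at_right_real, THEN exE])
  then show thesis using that by blast
qed

text \<open>The sets \<open>U n\<close> of functions whose tail beyond
  \<open>exhaust (real n + 1)\<close> is below \<open>\<epsilon>\<close> are open, increase with n
  and cover Y by dominated convergence; compactness of the closure selects a single n.\<close>

lemma relatively_compact_uniform_tails:
  fixes A :: "(complex^'n::{finite,linorder} \<Rightarrow> complex) set"
  assumes p: "0 < p" and Y: "Y \<subseteq> Lp p \<alpha>" and A: "relatively_compact Y (Lp_norm p \<alpha>) A" and eps: "0 < \<epsilon>"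
  obtains R where "0 < R" "\<And>g. g \<in> A \<Longrightarrow> tail_integral p \<alpha> R g < \<epsilon>"
proof -
  let ?T = "norm_topology Y (Lp_norm p \<alpha>)"
  define U where "U n = {g \<in> Y. tail_integral p \<alpha> (real n + 1) g < \<epsilon>}" for n
  have Umono: "U n \<subseteq> U m" if "n \<le> m" for n m
  proof
    fix g assume g: "g \<in> U n"
    then have "tail_integral p \<alpha> (real m + 1) g \<le> tail_integral p \<alpha> (real n + 1) g"
      using that Y by (intro tail_integral_mono) (auto simp: U_def)
    then show "g \<in> U m" using g by (simp add: U_def)
  qed
  have Uopen: "openin ?T (U n)" for n
    unfolding openin_norm_topology
  proof (intro conjI ballI)
    fix g assume g: "g \<in> U n"
    define v where "v = tail_integral p \<alpha> (real n + 1) g"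
    have gY: "g \<in> Lp p \<alpha>" using g Y by (auto simp: U_def)
    have v: "0 \<le> v" "v < \<epsilon>" using g by (auto simp: U_def v_def tail_integral_def intro!: integral_nonneg)
    obtain k where k: "0 < k" "(1 + k) powr p * v < \<epsilon>" by (rule powr_perturbation[OF v p])
    \<comment> \<open>The distance at which the error term of \<open>tail_integral_add_le\<close>
      exactly uses up the slack left after the choice of k.\<close>
    define \<delta> where "\<delta> = ((\<epsilon> - (1 + k) powr p * v) / (1 + 1 / k) powr p) powr (1 / p)"
    have "0 < 1 + 1 / k" using k(1) by (simp add: add_pos_pos)
    then have k1: "0 < (1 + 1 / k) powr p" by simp
    have \<delta>: "0 < \<delta>" "(1 + 1 / k) powr p * \<delta> powr p = \<epsilon> - (1 + k) powr p * v"
      using k k1 p by (auto simp: \<delta>_def powr_powr)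
    show "\<exists>\<epsilon>>0. \<forall>h\<in>Y. Lp_norm p \<alpha> (\<lambda>z. h z - g z) < \<epsilon> \<longrightarrow> h \<in> U n"
    proof (intro exI conjI ballI impI)
      show "0 < \<delta>" by (rule \<delta>(1))
      fix h assume h: "h \<in> Y" "Lp_norm p \<alpha> (\<lambda>z. h z - g z) < \<delta>"
      have "Lp_norm p \<alpha> (\<lambda>z. h z - g z) powr p < \<delta> powr p"
        using h(2) p Lp_norm_nonneg by (intro powr_less_mono2) auto
      then have "(1 + 1 / k) powr p * Lp_norm p \<alpha> (\<lambda>z. h z - g z) powr p < (1 + 1 / k) powr p * \<delta> powr p"
        using k1 by (intro mult_strict_left_mono) auto
      moreover have "tail_integral p \<alpha> (real n + 1) h \<le> (1 + k) powr p * v + (1 + 1 / k) powr p * Lp_norm p \<alpha> (\<lambda>z. h z - g z) powr p"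
        unfolding v_def using h(1) Y by (intro tail_integral_add_le p k(1) gY) auto
      ultimately show "h \<in> U n" using h(1) \<delta>(2) by (simp add: U_def)
    qed
  qed (auto simp: U_def)
  have cover: "?T closure_of A \<subseteq> \<Union>(range U)"
  proof
    fix g assume "g \<in> ?T closure_of A"
    then have gY: "g \<in> Y" using closure_of_subset_topspace[of ?T A] by (auto simp: topspace_norm_topology)
    have "(\<lambda>n. tail_integral p \<alpha> (real n + 1) g) \<longlonglongrightarrow> 0"
      using gY Y by (intro tail_integral_tendsto) auto
    then have "\<forall>\<^sub>F n in sequentially. tail_integral p \<alpha> (real n + 1) g < \<epsilon>"
      using eps by (rule order_tendstoD)
    then obtain n where "tail_integral p \<alpha> (real n + 1) g < \<epsilon>"
      by (rule eventually_happens'[OF sequentially_bot, THEN exE])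
    then show "g \<in> \<Union>(range U)" using gY by (auto simp: U_def)
  qed
  have "compactin ?T (?T closure_of A)" and AY: "A \<subseteq> Y"
    using A by (auto simp: relatively_compact_def)
  from this(1) have "\<exists>\<F>. finite \<F> \<and> \<F> \<subseteq> range U \<and> ?T closure_of A \<subseteq> \<Union>\<F>"
    by (rule compactinD) (use Uopen cover in auto)
  then obtain \<F> where F: "finite \<F>" "\<F> \<subseteq> range U" "?T closure_of A \<subseteq> \<Union>\<F>" by (elim exE conjE)
  obtain I where I: "finite I" "\<F> = U ` I" using F(1,2) by (meson finite_subset_image)
  define n where "n = Max (insert 0 I)"
  have "A \<subseteq> U n"
  proof -
    have "A \<subseteq> ?T closure_of A" using AY by (intro closure_of_subset) (simp add: topspace_norm_topology)
    also have "\<dots> \<subseteq> \<Union>(U ` I)" using F(3) I(2) by simp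
    also have "\<dots> \<subseteq> U n" using I(1) Umono by (intro UN_least) (auto simp: n_def)
    finally show ?thesis .
  qed
  then show thesis
    by (intro that[of "real n + 1"]) (auto simp: U_def)
qed

text \<open>For u in \<open>exhaust R\<close> all points near u lie in
  \<open>exhaust (20 * R)\<close>, so removing that set leaves nothing; for the other u the
  assumption applies.\<close>

lemma vanishing_nearI:
  fixes \<nu> :: "(complex^'n::{finite,linorder}) measure"
  assumes "\<And>\<epsilon>. 0 < \<epsilon> \<Longrightarrow> \<exists>R>0. \<forall>u\<in>tube - exhaust R. emeasure \<nu> {w. near u w} \<le> ennreal (\<epsilon> * rho_diag u powr b)"
    and sets: "sets \<nu> = sets borel"
  shows "vanishing_near b \<nu>"
  unfolding vanishing_near_def
proof (intro allI impI)
  fix \<epsilon> :: real assume "0 < \<epsilon>"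
  from assms(1)[OF this] obtain R where R: "0 < R" "\<forall>u\<in>tube - exhaust R. emeasure \<nu> {w. near u w} \<le> ennreal (\<epsilon> * rho_diag u powr b)"
    by (elim exE conjE)
  show "\<exists>R>0. \<forall>u\<in>tube. emeasure \<nu> ({w. near u w} - exhaust R) \<le> ennreal (\<epsilon> * rho_diag u powr b)"
  proof (intro exI conjI ballI)
    show "0 < 20 * R" using R(1) by simp
    fix u :: "complex^'n::{finite,linorder}" assume u: "u \<in> tube"
    show "emeasure \<nu> ({w. near u w} - exhaust (20 * R)) \<le> ennreal (\<epsilon> * rho_diag u powr b)"
    proof (cases "u \<in> exhaust R")
      case True
      have "{w. near u w} - exhaust (20 * R) = {}"
        using near_exhaust[OF _ True] R(1) by (auto simp: near_commute)
      then show ?thesis by (simp only: emeasure_empty zero_le)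
    next
      case False
      have "emeasure \<nu> ({w. near u w} - exhaust (20 * R)) \<le> emeasure \<nu> {w. near u w}"
        by (intro emeasure_mono) (auto simp: sets)
      then show ?thesis using R(2) u False by (meson DiffI order_trans)
    qed
  qed
qed

section \<open>Sufficiency\<close>

locale M_plus_measure =
  fixes \<mu> :: "(complex^'n::{finite,linorder}) measure"
  assumes M_plus: "\<mu> \<in> M_plus"
begin

text \<open>
  \<open>\<mu>\<close> is a measure on \<open>tube\<close> only; \<open>push\<close> is its extension by zero to the whole space.
\<close>

definition push :: "(complex^'n::{finite,linorder}) measure" where
  "push = distr \<mu> borel (\<lambda>w. w)"

lemma sets_mu: "sets \<mu> = sets (restrict_space borel tube)"
  using M_plus by (simp add: M_plus_def)

lemma space_mu: "space \<mu> = tube"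
  using sets_eq_imp_space_eq[OF sets_mu] by (simp add: space_restrict_space)

lemma borel_measurable_mu: "borel_measurable \<mu> = borel_measurable (restrict_space borel tube)"
  by (rule measurable_cong_sets[OF sets_mu refl])

lemma measurable_mu: "g \<in> borel_measurable borel \<Longrightarrow> g \<in> borel_measurable \<mu>"
  unfolding borel_measurable_mu by (rule measurable_restrict_space1)

lemma continuous_measurable_mu: "continuous_on tube g \<Longrightarrow> g \<in> borel_measurable \<mu>"
  unfolding borel_measurable_mu by (rule borel_measurable_continuous_on_restrict)

lemma ident_measurable_mu: "(\<lambda>w. w) \<in> measurable \<mu> borel"
  unfolding borel_measurable_mu by (rule measurable_restrict_space1) simp

lemma sets_push: "sets push = sets borel"
  by (simp add: push_def)

lemma nn_integral_push: "g \<in> borel_measurable borel \<Longrightarrow> (\<integral>\<^sup>+w. g w \<partial>push) = (\<integral>\<^sup>+w. g w \<partial>\<mu>)"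
  unfolding push_def by (rule nn_integral_distr[OF ident_measurable_mu]) simp

lemma nn_integral_push_tube:
  assumes [measurable]: "g \<in> borel_measurable borel"
  shows "(\<integral>\<^sup>+w. g w * indicator tube w \<partial>push) = (\<integral>\<^sup>+w. g w \<partial>\<mu>)"
proof -
  have "(\<integral>\<^sup>+w. g w * indicator tube w \<partial>push) = (\<integral>\<^sup>+w. g w * indicator tube w \<partial>\<mu>)"
    by (rule nn_integral_push) measurable
  also have "\<dots> = (\<integral>\<^sup>+w. g w \<partial>\<mu>)"
    by (intro nn_integral_cong) (simp add: space_mu)
  finally show ?thesis .
qed

text \<open>On \<open>exhaust R\<close> the integrand from the definition of \<open>M_plus\<close>
  is bounded below by R^(-t).\<close>

lemma finite_on_exhaust_push: "finite_on_exhaust push"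
  unfolding finite_on_exhaust_def
proof (intro allI impI)
  fix R :: real assume R: "0 < R"
  obtain t where t: "0 < t" "(\<integral>\<^sup>+z. ennreal (cmod (rho z base_point) powr (- t)) \<partial>\<mu>) < \<infinity>"
    using M_plus by (auto simp: M_plus_def)
  have [measurable]: "exhaust R \<in> sets borel" using R by measurable
  have "emeasure push (exhaust R) = (\<integral>\<^sup>+z. indicator (exhaust R) z \<partial>push)"
    by (simp add: sets_push)
  also have "\<dots> \<le> (\<integral>\<^sup>+z. ennreal (R powr t) * ennreal (cmod (rho z base_point) powr (- t)) \<partial>push)"
  proof (rule nn_integral_mono)
    fix z :: "complex^'n::{finite,linorder}"
    show "indicator (exhaust R) z \<le> ennreal (R powr t) * ennreal (cmod (rho z base_point) powr (- t))"
    proof (cases "z \<in> exhaust R")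
      case True
      then have z: "z \<in> tube" "cmod (rho z base_point) \<le> R" by (auto simp: exhaust_def)
      have "R powr (- t) \<le> cmod (rho z base_point) powr (- t)"
        using z t R cmod_rho_pos[OF z(1) base_point_tube] by (intro powr_mono2') auto
      then have "R powr t * R powr (- t) \<le> R powr t * cmod (rho z base_point) powr (- t)"
        by (rule mult_left_mono) simp
      moreover have "R powr t * R powr (- t) = 1" using R by (simp flip: powr_add)
      ultimately have "ennreal 1 \<le> ennreal (R powr t * cmod (rho z base_point) powr (- t))"
        by (intro ennreal_leI) simp
      then show ?thesis using True by (simp add: ennreal_mult)
    qed simp
  qed
  also have "\<dots> = ennreal (R powr t) * (\<integral>\<^sup>+z. ennreal (cmod (rho z base_point) powr (- t)) \<partial>push)"
    by (rule nn_integral_cmult) (simp add: push_def)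
  also have "(\<integral>\<^sup>+z. ennreal (cmod (rho z base_point) powr (- t)) \<partial>push) = (\<integral>\<^sup>+z. ennreal (cmod (rho z base_point) powr (- t)) \<partial>\<mu>)"
    by (rule nn_integral_push) measurable
  also have "ennreal (R powr t) * \<dots> < \<infinity>" using t(2) by (simp add: ennreal_mult_less_top)
  finally show "emeasure push (exhaust R) < \<infinity>" .
qed

lemma tube_measure_push: "tube_measure push"
proof (intro tube_measure.intro tube_measure_axioms.intro sigma_finite_measure.intro)
  show "sets push = sets borel" by (rule sets_push)
  \<comment> \<open>The complement of \<open>tube\<close> is a null set for \<open>push\<close> and
    completes the exhaustion to a cover of the whole space.\<close>
  define \<A> where "\<A> = insert (- tube) (range (\<lambda>n. exhaust (real n + 1) :: (complex^'n::{finite,linorder}) set))"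
  show "\<exists>A. countable A \<and> A \<subseteq> sets push \<and> \<Union>A = space push \<and> (\<forall>a\<in>A. emeasure push a \<noteq> \<infinity>)"
  proof (intro exI conjI ballI)
    show "countable \<A>" unfolding \<A>_def by simp
    show "\<A> \<subseteq> sets push" unfolding \<A>_def sets_push by auto
    show "\<Union>\<A> = space push"
    proof -
      have "z \<in> \<Union>\<A>" for z
      proof (cases "z \<in> tube")
        case True
        obtain n where "max (1 / rho_diag z) (cmod (rho z base_point)) \<le> real n" using real_arch_simple by blast
        then have "z \<in> exhaust (real n + 1)"
          by (intro subsetD[OF exhaust_mono exhaust_cover[OF True]]) linarith
        then show ?thesis unfolding \<A>_def by blast
      qed (simp add: \<A>_def)
      then show ?thesis by (auto simp: push_def)
    qed
    fix a assume "a \<in> \<A>"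
    then consider "a = - tube" | n where "a = exhaust (real n + 1)" by (auto simp: \<A>_def)
    then show "emeasure push a \<noteq> \<infinity>"
    proof cases
      case 1
      have "emeasure push (- tube) = emeasure \<mu> ((\<lambda>w. w) -` (- tube) \<inter> space \<mu>)"
        unfolding push_def by (rule emeasure_distr[OF ident_measurable_mu]) simp
      then show ?thesis by (simp add: 1 space_mu)
    next
      case 2
      then show ?thesis using finite_on_exhaust_push by (auto simp: finite_on_exhaust_def less_top[symmetric])
    qed
  qed
qed

lemma Berezin_eq:
  fixes f :: "complex^'n::{finite,linorder} \<Rightarrow> complex" and z :: "complex^'n::{finite,linorder}"
  assumes f [measurable]: "extend0 f \<in> borel_measurable borel"
  shows "Berezin \<mu> \<xi> f z = berezin_integral push (real CARD('n) + 1 + \<xi>) (extend0 f) z"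
proof -
  have "berezin_integral push (real CARD('n) + 1 + \<xi>) (extend0 f) z
    = (\<integral>\<^sup>+w. ennreal (cmod (extend0 f w) * cmod (rho z w) powr (- (real CARD('n) + 1 + \<xi>))) \<partial>\<mu>)"
    unfolding berezin_integral_def by (rule nn_integral_push_tube) measurable
  also have "\<dots> = Berezin \<mu> \<xi> f z"
    unfolding Berezin_def
    by (intro nn_integral_cong) (simp only: space_mu extend0_def if_True powr_minus_divide times_divide_eq_right mult_1_right)
  finally show ?thesis by simp
qed

lemma extend0_bergman_ball: "f \<in> bergman_ball p \<alpha> A \<Longrightarrow> extend0 f = f"
  by (auto simp: bergman_ball_def extend0_def fun_eq_iff)

lemma Berezin_op_extend0: "Berezin_op \<mu> \<xi> (extend0 f) = Berezin_op \<mu> \<xi> f"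
proof -
  have "Berezin \<mu> \<xi> (extend0 f) z = Berezin \<mu> \<xi> f z" for z
    unfolding Berezin_def by (intro nn_integral_cong) (simp add: space_mu extend0_def)
  then show ?thesis by (simp add: Berezin_op_def)
qed

lemma Toeplitz_op_extend0: "Toeplitz_op \<mu> \<xi> (extend0 f) = Toeplitz_op \<mu> \<xi> f"
  unfolding Toeplitz_op_def by (intro ext Bochner_Integration.integral_cong) (simp_all add: space_mu extend0_def)

lemma berezin_integral_measurable:
  assumes [measurable]: "f \<in> borel_measurable borel"
  shows "(\<lambda>z. berezin_integral push t f z) \<in> borel_measurable borel"
proof -
  interpret tube_measure push by (rule tube_measure_push)
  have "(\<lambda>z. berezin_integral push t f z) \<in> borel_measurable lborel"
    unfolding berezin_integral_def
    by (rule sigma_finite_measure.borel_measurable_nn_integral) (unfold_locales, measurable)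
  then show ?thesis by simp
qed

lemma berezin_integral_add_le:
  assumes [measurable]: "f \<in> borel_measurable borel" "g \<in> borel_measurable borel"
  shows "berezin_integral push t g z \<le> berezin_integral push t f z + berezin_integral push t (\<lambda>w. g w - f w) z"
proof -
  interpret tube_measure push by (rule tube_measure_push)
  have "berezin_integral push t g z \<le> (\<integral>\<^sup>+w. ennreal (cmod (f w) * cmod (rho z w) powr (- t)) * indicator tube w
      + ennreal (cmod (g w - f w) * cmod (rho z w) powr (- t)) * indicator tube w \<partial>push)"
    unfolding berezin_integral_def
  proof (rule nn_integral_mono)
    fix w
    have "cmod (g w) * cmod (rho z w) powr (- t) \<le> (cmod (f w) + cmod (g w - f w)) * cmod (rho z w) powr (- t)"
      using norm_triangle_sub[of "g w" "f w"] by (rule mult_right_mono) simp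
    also have "\<dots> = cmod (f w) * cmod (rho z w) powr (- t) + cmod (g w - f w) * cmod (rho z w) powr (- t)"
      by (rule distrib_right)
    finally show "ennreal (cmod (g w) * cmod (rho z w) powr (- t)) * indicator tube w
      \<le> ennreal (cmod (f w) * cmod (rho z w) powr (- t)) * indicator tube w + ennreal (cmod (g w - f w) * cmod (rho z w) powr (- t)) * indicator tube w"
      by (simp add: indicator_def ennreal_plus[symmetric] ennreal_leI del: ennreal_plus)
  qed
  also have "\<dots> = berezin_integral push t f z + berezin_integral push t (\<lambda>w. g w - f w) z"
    unfolding berezin_integral_def by (rule nn_integral_add) measurable
  finally show ?thesis .
qed

lemma kernel_continuous: "z \<in> tube \<Longrightarrow> continuous_on tube (\<lambda>w. rho z w powr of_real e)"
  using Re_rho_pos[of z] rho_nonzero[of z]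
  by (intro continuous_on_powr_complex continuous_on_rho continuous_intros) (auto intro: less_imp_le)

lemma Toeplitz_integrable:
  assumes f: "f \<in> borel_measurable borel" and z: "z \<in> tube" and fin: "berezin_integral push t f z < \<infinity>"
  shows "integrable \<mu> (\<lambda>w. f w / rho z w powr of_real t)"
    and "(\<integral>\<^sup>+w. ennreal (cmod (f w / rho z w powr of_real t)) \<partial>\<mu>) = berezin_integral push t f z"
proof -
  note [measurable] = f
  have "(\<integral>\<^sup>+w. ennreal (cmod (f w / rho z w powr of_real t)) \<partial>\<mu>) = (\<integral>\<^sup>+w. ennreal (cmod (f w) * cmod (rho z w) powr (- t)) \<partial>\<mu>)"
    using z by (intro nn_integral_cong)
      (simp add: space_mu norm_divide norm_powr_of_real rho_nonzero powr_minus_divide)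
  also have "\<dots> = berezin_integral push t f z"
    unfolding berezin_integral_def by (rule nn_integral_push_tube[symmetric]) measurable
  finally show eq: "(\<integral>\<^sup>+w. ennreal (cmod (f w / rho z w powr of_real t)) \<partial>\<mu>) = berezin_integral push t f z" .
  have [measurable]: "(\<lambda>w. rho z w powr of_real t) \<in> borel_measurable \<mu>"
    by (rule continuous_measurable_mu[OF kernel_continuous[OF z]])
  have [measurable]: "f \<in> borel_measurable \<mu>" by (rule measurable_mu[OF f])
  show "integrable \<mu> (\<lambda>w. f w / rho z w powr of_real t)"
    unfolding integrable_iff_bounded eq using fin by simp
qed

lemma cmod_Toeplitz_le:
  assumes f: "f \<in> borel_measurable borel" and z: "z \<in> tube" and fin: "berezin_integral push (real CARD('n) + 1 + \<xi>) f z < \<infinity>"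
  shows "cmod (Toeplitz_op \<mu> \<xi> f z) \<le> enn2real (berezin_integral push (real CARD('n) + 1 + \<xi>) f z)"
proof -
  note * = Toeplitz_integrable[OF f z fin]
  let ?g = "\<lambda>w. f w / rho z w powr of_real (real CARD('n) + 1 + \<xi>)"
  have "cmod (Toeplitz_op \<mu> \<xi> f z) \<le> (\<integral>w. cmod (?g w) \<partial>\<mu>)"
    unfolding Toeplitz_op_def by (rule integral_norm_bound)
  also have "(\<integral>w. cmod (?g w) \<partial>\<mu>) = enn2real (\<integral>\<^sup>+w. ennreal (cmod (?g w)) \<partial>\<mu>)"
    by (subst nn_integral_eq_integral[OF integrable_norm[OF *(1)]]) (auto intro: integral_nonneg_AE)
  finally show ?thesis unfolding *(2) .
qed

end

text \<open>Restriction to the complex line in direction h reduces both bounds to one variable. They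
  involve F only through a bound on a ball, so they can be integrated when F carries a
  parameter.\<close>

lemma holomorphic_tube_remainder:
  fixes F :: "complex^'n::{finite,linorder} \<Rightarrow> complex"
  assumes F: "line_holomorphic_on F tube" and D: "(F has_derivative D) (at z)" "\<And>c v. D (c *s v) = c * D v"
    and r: "0 < r" "ball z r \<subseteq> tube" and B: "\<And>u. u \<in> ball z r \<Longrightarrow> cmod (F u) \<le> B" and h: "norm h < r / 4"
  shows "cmod (F (z + h) - F z - D h) \<le> 32 * B / r\<^sup>2 * (norm h)\<^sup>2" and "cmod (D h) \<le> 4 * B / r * norm h"
proof -
  have D0: "D 0 = 0" using D(2)[of 0 0] by simp
  have "cmod (F (z + h) - F z - D h) \<le> 32 * B / r\<^sup>2 * (norm h)\<^sup>2 \<and> cmod (D h) \<le> 4 * B / r * norm h"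
  proof (cases "h = 0")
    case False
    define d where "d = norm h"
    have d: "0 < d" "d < r / 4" using False h by (auto simp: d_def)
    define v where "v = of_real (1 / d) *s h"
    have nv: "norm v = 1" using d unfolding v_def norm_vector_scalar_mult by (simp add: d_def norm_divide)
    have hv: "h = of_real d *s v" using d by (simp add: v_def vec_eq_iff)
    define g where "g t = F (z + t *s v)" for t
    have in_ball: "z + t *s v \<in> ball z r" if "t \<in> ball 0 r" for t
      using that by (simp add: dist_norm norm_vector_scalar_mult nv)
    have g: "g holomorphic_on ball 0 r"
    proof -
      have "g holomorphic_on {t. z + t *s v \<in> tube}"
        using F unfolding g_def line_holomorphic_on_def by blast
      then show ?thesis by (rule holomorphic_on_subset) (use in_ball r(2) in blast)
    qed
    have gB: "cmod (g t) \<le> B" if "t \<in> ball 0 r" for t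
      unfolding g_def by (rule B[OF in_ball[OF that]])
    have "((\<lambda>t. z + t *s v) has_derivative (\<lambda>t. 0 + t *s v)) (at 0)"
      by (intro has_derivative_add has_derivative_const bounded_linear_imp_has_derivative bounded_linear_vector_scalar_mult)
    moreover have "(F has_derivative D) (at (z + 0 *s v))" using D(1) by simp
    ultimately have "((\<lambda>t. F (z + t *s v)) has_derivative (\<lambda>t. D (0 + t *s v))) (at 0)"
      by (rule has_derivative_compose)
    then have "(g has_derivative (\<lambda>t. t * D v)) (at 0)"
      by (simp add: g_def[abs_def] D(2))
    then have "(g has_field_derivative D v) (at 0)"
      unfolding has_field_derivative_def by (rule has_derivative_eq_rhs) (simp add: fun_eq_iff)
    then have deriv: "deriv g 0 = D v" by (rule DERIV_imp_deriv)
    have "cmod (g (of_real d) - g 0 - deriv g 0 * of_real d) \<le> 32 * B / r\<^sup>2 * (cmod (of_real d))\<^sup>2"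
      by (rule holomorphic_quadratic_remainder[OF g gB]) (use d in auto)
    moreover have "cmod (deriv g 0) \<le> 4 * B / r"
      by (rule holomorphic_deriv_bound[OF g gB]) (use r in auto)
    moreover have "g (of_real d) = F (z + h)" "g 0 = F z" by (simp_all add: g_def hv)
    moreover have "D h = D v * of_real d" by (simp add: hv D(2))
    moreover have "cmod (D h) \<le> 4 * B / r * d"
      using mult_right_mono[OF \<open>cmod (deriv g 0) \<le> 4 * B / r\<close>, of d] d
      by (simp only: \<open>D h = D v * of_real d\<close> norm_mult norm_of_real deriv) simp
    ultimately show ?thesis
      using d by (simp add: deriv d_def[symmetric])
  qed (simp add: D0)
  then show "cmod (F (z + h) - F z - D h) \<le> 32 * B / r\<^sup>2 * (norm h)\<^sup>2" "cmod (D h) \<le> 4 * B / r * norm h"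
    by auto
qed

section \<open>Holomorphy of Toeplitz images\<close>

lemma rho_derivative_add: "rho_derivative z w (h + k) = rho_derivative z w h + rho_derivative z w k"
  using bounded_linear.linear[OF has_derivative_bounded_linear[OF rho_has_derivative]] by (rule linear_add)

lemma rho_powr_line_holomorphic:
  assumes "w \<in> tube" shows "line_holomorphic_on (\<lambda>u. rho u w powr of_real e) tube"
proof (rule holomorphic_tube_line_holomorphic)
  show "holomorphic_tube (\<lambda>u. rho u w powr of_real e)"
    unfolding holomorphic_tube_def
  proof (intro ballI exI conjI allI)
    fix z :: "complex^'a::{finite,linorder}" assume z: "z \<in> tube"
    show "((\<lambda>u. rho u w powr of_real e) has_derivative
        (\<lambda>h. of_real e * rho z w powr (of_real e - 1) * rho_derivative z w h)) (at z)"
      by (rule rho_powr_has_derivative[OF z assms])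
  qed (simp add: rho_derivative_linear)
qed

context M_plus_measure
begin

text \<open>Differentiation under the integral sign. On a small ball about z all kernels are at most
  K |rho z w|^(-t), so \<open>holomorphic_tube_remainder\<close> bounds the remainder of the
  integrand by a multiple of |h|^2 times the integrable function \<open>H\<close>. Integrating the
  kernel derivatives gives the complex linear candidate \<open>L\<close>.\<close>

lemma Toeplitz_holomorphic:
  fixes f :: "complex^'n::{finite,linorder} \<Rightarrow> complex"
  assumes f: "f \<in> borel_measurable borel"
    and fin: "\<And>z. z \<in> tube \<Longrightarrow> berezin_integral push (real CARD('n) + 1 + \<xi>) f z < \<infinity>"
  shows "holomorphic_tube (Toeplitz_op \<mu> \<xi> f)"
  unfolding holomorphic_tube_def
proof
  fix z :: "complex^'n::{finite,linorder}" assume z: "z \<in> tube"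
  define t where "t = real CARD('n) + 1 + \<xi>"
  have fin': "berezin_integral push t f u < \<infinity>" if "u \<in> tube" for u using fin[OF that] by (simp add: t_def)
  obtain r where r: "0 < r" "cball z r \<subseteq> tube" using z open_tube open_contains_cball by blast
  obtain R where R: "0 < R" "cball z r \<subseteq> exhaust R" by (rule compact_subset_exhaust[OF compact_cball r(2)])
  \<comment> \<open>Comparing two points of the ball passes through \<open>base_point\<close>, so
    this factor is paid twice.\<close>
  define c where "c = 4 + 8 * R\<^sup>2 + 8 * R"
  have c: "0 < c" using R(1) by (simp add: c_def add_pos_pos)
  define K where "K = (c * c) powr \<bar>- t\<bar>"
  have K: "0 \<le> K" by (simp add: K_def)
  have comp: "cmod (rho u w) \<le> (c * c) * cmod (rho v w)" if "u \<in> cball z r" "v \<in> cball z r" "w \<in> tube" for u v w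
  proof -
    have "cmod (rho u w) \<le> c * cmod (rho base_point w)"
      unfolding c_def using that R by (intro exhaust_rho_comparable(1)) auto
    also have "\<dots> \<le> c * (c * cmod (rho v w))"
      using that R c by (intro mult_left_mono exhaust_rho_comparable(2)[where R = R, folded c_def]) auto
    finally show ?thesis by (simp add: mult.assoc)
  qed
  have zr: "z \<in> cball z r" using r by simp
  have ball_tube: "ball z r \<subseteq> tube" using r(2) ball_subset_cball by blast
  have B: "cmod (rho u w powr of_real (- t)) \<le> K * cmod (rho z w) powr (- t)" if "u \<in> ball z r" "w \<in> tube" for u w
  proof -
    have u: "u \<in> cball z r" using that ball_subset_cball by blast
    then have ut: "u \<in> tube" using r(2) by blast
    have "cmod (rho u w powr of_real (- t)) = cmod (rho u w) powr (- t)"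
      by (rule norm_powr_of_real[OF rho_nonzero[OF ut that(2)]])
    also have "\<dots> \<le> K * cmod (rho z w) powr (- t)"
      unfolding K_def using cmod_rho_pos[OF ut that(2)] cmod_rho_pos[OF z that(2)] comp[OF u zr that(2)] comp[OF zr u that(2)]
      by (rule powr_comparable)
    finally show ?thesis .
  qed
  define D where "D w h = of_real (- t) * rho z w powr (of_real (- t) - 1) * rho_derivative z w h" for w h
  have D_scale: "D w (k *s h) = k * D w h" for w k h by (simp add: D_def rho_derivative_linear)
  have D_add: "D w (h + k) = D w h + D w k" for w k h by (simp add: D_def rho_derivative_add distrib_left)
  have D_deriv: "((\<lambda>u. rho u w powr of_real (- t)) has_derivative D w) (at z)" if "w \<in> tube" for w
    unfolding D_def by (rule rho_powr_has_derivative[OF z that])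
  have rem: "cmod (rho (z + h) w powr of_real (- t) - rho z w powr of_real (- t) - D w h)
        \<le> 32 * (K * cmod (rho z w) powr (- t)) / r\<^sup>2 * (norm h)\<^sup>2"
      "cmod (D w h) \<le> 4 * (K * cmod (rho z w) powr (- t)) / r * norm h"
    if "w \<in> tube" "norm h < r / 4" for w h
    by (rule holomorphic_tube_remainder[OF rho_powr_line_holomorphic[OF that(1)] D_deriv[OF that(1)] D_scale r(1) ball_tube B[OF _ that(1)] that(2)], assumption)+
  define H where "H w = cmod (f w) * cmod (rho z w) powr (- t)" for w
  have quot: "f w / rho u w powr of_real t = f w * rho u w powr of_real (- t)" for u w
    by (simp add: powr_minus divide_inverse)
  have int: "integrable \<mu> (\<lambda>w. f w * rho u w powr of_real (- t))" if "u \<in> tube" for u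
    using Toeplitz_integrable(1)[OF f that fin'[OF that]] by (simp only: quot)
  have H: "integrable \<mu> H"
  proof -
    have "H w = cmod (f w * rho z w powr of_real (- t))" if "w \<in> space \<mu>" for w
      using that by (simp only: space_mu H_def norm_mult norm_powr_of_real[OF rho_nonzero[OF z]])
    then have "integrable \<mu> H \<longleftrightarrow> integrable \<mu> (\<lambda>w. cmod (f w * rho z w powr of_real (- t)))"
      by (rule Bochner_Integration.integrable_cong[OF refl])
    then show ?thesis using integrable_norm[OF int[OF z]] by (rule iffD2)
  qed
  have [measurable]: "f \<in> borel_measurable \<mu>" by (rule measurable_mu[OF f])
  have D_meas [measurable]: "(\<lambda>w. D w h) \<in> borel_measurable \<mu>" for h
  proof (rule continuous_measurable_mu)
    have "continuous_on tube (\<lambda>w. rho z w powr (of_real (- t) - 1))"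
      using kernel_continuous[OF z, of "- t - 1"] by (simp only: of_real_diff of_real_1)
    moreover have "continuous_on tube (\<lambda>w. rho_derivative z w h)"
      unfolding rho_derivative_def by (intro continuous_intros)
    ultimately show "continuous_on tube (\<lambda>w. D w h)"
      unfolding D_def by (intro continuous_on_mult continuous_on_const)
  qed
  have D_int_small: "integrable \<mu> (\<lambda>w. f w * D w h)" if h: "norm h < r / 4" for h
  proof (rule Bochner_Integration.integrable_bound)
    show "integrable \<mu> (\<lambda>w. (4 * K / r * norm h) * H w)" using H by simp
    show "AE w in \<mu>. norm (f w * D w h) \<le> norm (4 * K / r * norm h * H w)"
    proof (rule AE_I2)
      fix w assume "w \<in> space \<mu>"
      then have "cmod (D w h) \<le> 4 * (K * cmod (rho z w) powr (- t)) / r * norm h" using rem(2)[OF _ h] by (simp only: space_mu)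
      then have "cmod (f w) * cmod (D w h) \<le> cmod (f w) * (4 * (K * cmod (rho z w) powr (- t)) / r * norm h)"
        by (rule mult_left_mono) simp
      also have "\<dots> = 4 * K / r * norm h * H w" by (simp add: H_def field_simps)
      also have "\<dots> \<le> norm (4 * K / r * norm h * H w)" unfolding real_norm_def by (rule abs_ge_self)
      finally show "norm (f w * D w h) \<le> norm (4 * K / r * norm h * H w)" by (simp only: norm_mult)
    qed
  qed measurable
  have D_int: "integrable \<mu> (\<lambda>w. f w * D w h)" for h
  proof -
    \<comment> \<open>The bound on the derivative is used for short h only; complex homogeneity
      extends integrability to every h.\<close>
    define k where "k = r / (8 * (norm h + 1))"
    have k: "0 < k" "k * norm h < r / 4"
      using r(1) by (simp_all add: k_def field_simps add_pos_nonneg)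
    have "integrable \<mu> (\<lambda>w. of_real (1 / k) * (f w * D w (of_real k *s h)))"
      using k by (intro integrable_mult_right D_int_small) (simp add: norm_vector_scalar_mult)
    then show ?thesis using k by (simp add: D_scale)
  qed
  define L where "L h = (\<integral>w. f w * D w h \<partial>\<mu>)" for h
  have L_scale: "L (k *s h) = k * L h" for k h
    unfolding L_def D_scale by (simp only: mult.left_commute[of _ k] integral_mult_right_zero)
  have L_add: "L (h + k) = L h + L k" for k h
    unfolding L_def D_add distrib_left by (rule Bochner_Integration.integral_add[OF D_int D_int])
  have "linear L"
  proof (rule linearI)
    fix k :: real and h :: "complex^'n::{finite,linorder}"
    have "k *\<^sub>R h = of_real k *s h" by (simp only: vec_eq_iff vector_scaleR_component vector_smult_component) (simp add: scaleR_conv_of_real)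
    then show "L (k *\<^sub>R h) = k *\<^sub>R L h" by (simp only: L_scale scaleR_conv_of_real)
  qed (rule L_add)
  then have L: "bounded_linear L" by (simp add: linear_conv_bounded_linear)
  have Top: "Toeplitz_op \<mu> \<xi> f u = (\<integral>w. f w * rho u w powr of_real (- t) \<partial>\<mu>)" for u
    unfolding Toeplitz_op_def t_def[symmetric] quot ..
  define M where "M = 32 * K / r\<^sup>2 * (\<integral>w. H w \<partial>\<mu>)"
  have M: "0 \<le> M" unfolding M_def using K by (simp add: H_def)
  have T_rem: "cmod (Toeplitz_op \<mu> \<xi> f (z + h) - Toeplitz_op \<mu> \<xi> f z - L h) \<le> M * (norm h)\<^sup>2" if h: "norm h < r / 4" for h
  proof -
    have zh: "z + h \<in> tube" using r h by (intro subsetD[OF r(2)]) (simp add: dist_norm)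
    have "Toeplitz_op \<mu> \<xi> f (z + h) - Toeplitz_op \<mu> \<xi> f z - L h
      = (\<integral>w. f w * rho (z + h) w powr of_real (- t) - f w * rho z w powr of_real (- t) - f w * D w h \<partial>\<mu>)"
      unfolding Top L_def using int[OF zh] int[OF z] D_int by (simp only: Bochner_Integration.integral_diff Bochner_Integration.integrable_diff)
    also have "cmod \<dots> \<le> (\<integral>w. 32 * K / r\<^sup>2 * (norm h)\<^sup>2 * H w \<partial>\<mu>)"
    proof (rule Bochner_Integration.integral_norm_bound_integral)
      show "integrable \<mu> (\<lambda>w. 32 * K / r\<^sup>2 * (norm h)\<^sup>2 * H w)" using H by simp
      fix w assume "w \<in> space \<mu>"
      then have w: "w \<in> tube" by (simp add: space_mu)
      have "cmod (f w * rho (z + h) w powr of_real (- t) - f w * rho z w powr of_real (- t) - f w * D w h)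
        = cmod (f w) * cmod (rho (z + h) w powr of_real (- t) - rho z w powr of_real (- t) - D w h)"
        by (simp only: norm_mult[symmetric] right_diff_distrib)
      also have "\<dots> \<le> cmod (f w) * (32 * (K * cmod (rho z w) powr (- t)) / r\<^sup>2 * (norm h)\<^sup>2)"
        by (intro mult_left_mono rem(1)[OF w h]) simp
      also have "\<dots> = 32 * K / r\<^sup>2 * (norm h)\<^sup>2 * H w" by (simp add: H_def field_simps)
      finally show "cmod (f w * rho (z + h) w powr of_real (- t) - f w * rho z w powr of_real (- t) - f w * D w h)
        \<le> 32 * K / r\<^sup>2 * (norm h)\<^sup>2 * H w" .
    qed (use int[OF zh] int[OF z] D_int in \<open>intro Bochner_Integration.integrable_diff\<close>)
    also have "\<dots> = M * (norm h)\<^sup>2" by (simp add: M_def)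
    finally show ?thesis .
  qed
  have "(Toeplitz_op \<mu> \<xi> f has_derivative L) (at z)"
    unfolding has_derivative_at'
  proof (intro conjI allI impI L)
    fix e :: real assume e: "0 < e"
    define d where "d = min (r / 4) (e / (M + 1))"
    have d: "0 < d" using r e M by (simp add: d_def)
    show "\<exists>d>0. \<forall>x'. 0 < norm (x' - z) \<and> norm (x' - z) < d \<longrightarrow>
      norm (Toeplitz_op \<mu> \<xi> f x' - Toeplitz_op \<mu> \<xi> f z - L (x' - z)) / norm (x' - z) < e"
    proof (intro exI[of _ d] conjI allI impI d)
      fix u assume u: "0 < norm (u - z) \<and> norm (u - z) < d"
      have "cmod (Toeplitz_op \<mu> \<xi> f (z + (u - z)) - Toeplitz_op \<mu> \<xi> f z - L (u - z)) \<le> M * (norm (u - z))\<^sup>2"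
        using u by (intro T_rem) (simp add: d_def)
      then have "norm (Toeplitz_op \<mu> \<xi> f u - Toeplitz_op \<mu> \<xi> f z - L (u - z)) / norm (u - z) \<le> M * norm (u - z)"
        using u by (simp add: divide_le_eq power2_eq_square mult.assoc)
      also have "\<dots> \<le> M * (e / (M + 1))"
        using u M by (intro mult_left_mono) (simp_all add: d_def)
      also have "\<dots> < e" using e M by (simp add: field_simps)
      finally show "norm (Toeplitz_op \<mu> \<xi> f u - Toeplitz_op \<mu> \<xi> f z - L (u - z)) / norm (u - z) < e" .
    qed
  qed
  then show "\<exists>D. (Toeplitz_op \<mu> \<xi> f has_derivative D) (at z) \<and> (\<forall>c v. D (c *s v) = c * D v)"
    using L_scale by blast
qed

end

text \<open>\<open>cond\<close> is the exponent condition of the theorem for p > 1, multiplied by p.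
  The number b will turn out to be the critical Carleson exponent
  \<open>l * (real CARD('n) + 1 + \<gamma>)\<close>.\<close>

locale Toeplitz_setting = M_plus_measure \<mu> for \<mu> :: "(complex^'n::{finite,linorder}) measure" +
  fixes p1 p2 \<alpha>1 \<alpha>2 \<xi> t b :: real
  assumes p: "1 < p1" "p1 \<le> p2" and al: "-1 < \<alpha>1" "-1 < \<alpha>2" and xi: "-1 < \<xi>"
    and cond: "1 + \<alpha>1 < p1 * (1 + \<xi>)" "1 + \<alpha>2 < p2 * (1 + \<xi>)"
    and t: "t = real CARD('n) + 1 + \<xi>"
    and b: "b = t + (real CARD('n) + 1 + \<alpha>1) / p1 - (real CARD('n) + 1 + \<alpha>2) / p2"
begin

section \<open>Compactness of both operators under the vanishing condition\<close>

lemma p_pos: "0 < p1" "0 < p2" "1 < p2"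
  using p by auto

text \<open>p > 1 gives n <= n p, and the rest is \<open>cond\<close>. These are the convergence
  conditions for the powers of the kernel and for the test functions.\<close>

lemma kernel_exponent: "real CARD('n) + 1 + \<alpha>1 < t * p1" "real CARD('n) + 1 + \<alpha>2 < t * p2"
proof -
  have "real CARD('n) * 1 \<le> real CARD('n) * p1" "real CARD('n) * 1 \<le> real CARD('n) * p2"
    using p by (intro mult_left_mono; simp)+
  moreover have "t * p1 = real CARD('n) * p1 + p1 * (1 + \<xi>)" "t * p2 = real CARD('n) * p2 + p2 * (1 + \<xi>)"
    by (simp_all add: t algebra_simps)
  ultimately show "real CARD('n) + 1 + \<alpha>1 < t * p1" "real CARD('n) + 1 + \<alpha>2 < t * p2"
    using cond by linarith+
qed

lemma berezin_integral_finite_on_ball: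
  assumes "vanishing_near b push" "0 < A" "f \<in> bergman_ball p1 \<alpha>1 A" "z \<in> tube"
  shows "berezin_integral push t f z < \<infinity>"
proof -
  obtain c where c: "\<And>(f :: complex^'n::{finite,linorder} \<Rightarrow> complex) A. 0 < A \<Longrightarrow> f \<in> bergman_ball p1 \<alpha>1 A \<Longrightarrow> (\<forall>z\<in>tube. berezin_integral push t f z < \<infinity>) \<and>
    (\<integral>\<^sup>+z. ennreal (enn2real (berezin_integral push t f z) powr p2 * rho_diag z powr \<alpha>2) * indicator tube z \<partial>lborel)
      \<le> ennreal ((c * A) powr p2)"
    by (rule berezin_integral_Lp[OF p_pos(1) p(2) p_pos(3) al(2) xi cond(2) t b tube_measure_push assms(1) finite_on_exhaust_push]) blast
  show ?thesis using c[OF assms(2,3)] assms(4) by blast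
qed

lemma extend0_in_ball:
  assumes "f \<in> Bergman p1 \<alpha>1"
  obtains A where "0 < A" "extend0 f \<in> bergman_ball p1 \<alpha>1 A"
proof (rule that)
  show "0 < Lp_norm p1 \<alpha>1 f + 1" using Lp_norm_nonneg[of p1 \<alpha>1 f] by simp
  show "extend0 f \<in> bergman_ball p1 \<alpha>1 (Lp_norm p1 \<alpha>1 f + 1)"
    by (rule extend0_in_bergman_ball[OF assms p_pos(1)]) simp
qed

lemma berezin_dominated_Lp:
  assumes van: "vanishing_near b push" and A: "0 < A" and f: "f \<in> bergman_ball p1 \<alpha>1 A"
    and F: "F \<in> borel_measurable (lebesgue_on tube)"
    and le: "\<And>z. z \<in> tube \<Longrightarrow> cmod (F z) \<le> enn2real (berezin_integral push t f z)"
  shows "F \<in> Lp p2 \<alpha>2"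
proof -
  obtain c where c: "\<And>(f :: complex^'n::{finite,linorder} \<Rightarrow> complex) A. 0 < A \<Longrightarrow> f \<in> bergman_ball p1 \<alpha>1 A \<Longrightarrow> (\<forall>z\<in>tube. berezin_integral push t f z < \<infinity>) \<and>
    (\<integral>\<^sup>+z. ennreal (enn2real (berezin_integral push t f z) powr p2 * rho_diag z powr \<alpha>2) * indicator tube z \<partial>lborel)
      \<le> ennreal ((c * A) powr p2)"
    by (rule berezin_integral_Lp[OF p_pos(1) p(2) p_pos(3) al(2) xi cond(2) t b tube_measure_push van finite_on_exhaust_push]) blast
  show ?thesis
    by (rule Lp_dominated(1)[OF p_pos(2) _ F le conjunct2[OF c[OF A f]]]) simp_all
qed

lemma Berezin_op_eq: "f \<in> bergman_ball p1 \<alpha>1 A \<Longrightarrow> Berezin_op \<mu> \<xi> f z = of_real (enn2real (berezin_integral push t f z))"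
  using Berezin_eq[of f \<xi> z] by (simp add: Berezin_op_def extend0_bergman_ball bergman_ball_borel t)

text \<open>On Bergman balls the operator equals the dominating integral, and the difference bound
  is the triangle inequality in both orders. \<open>enn2real\<close> respects sums and order only
  for finite values, so finiteness at every point is established first.\<close>

lemma Berezin_compact:
  assumes van: "vanishing_near b push"
  shows "compact_op (Berezin_dom \<mu> \<xi>) (Berezin_op \<mu> \<xi>) (Bergman p1 \<alpha>1) (Lp_norm p1 \<alpha>1) (Lp p2 \<alpha>2) (Lp_norm p2 \<alpha>2)"
proof (rule compact_op_dominated[where S = "Berezin_op \<mu> \<xi>" and Y = "Lp p2 \<alpha>2", OF p_pos(1) p(2) p_pos(3) al(2) xi cond(2) kernel_exponent(2) t b tube_measure_push van finite_on_exhaust_push _ subset_refl Berezin_op_extend0])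
  show "Bergman p1 \<alpha>1 \<subseteq> Berezin_dom \<mu> \<xi>"
  proof
    fix f :: "complex^'n::{finite,linorder} \<Rightarrow> complex" assume "f \<in> Bergman p1 \<alpha>1"
    then obtain A where A: "0 < A" "extend0 f \<in> bergman_ball p1 \<alpha>1 A" by (rule extend0_in_ball)
    have "Berezin \<mu> \<xi> f z < \<infinity>" if "z \<in> tube" for z
      unfolding Berezin_eq[OF bergman_ball_borel[OF A(2)]] t[symmetric]
      by (rule berezin_integral_finite_on_ball[OF van A that])
    then show "f \<in> Berezin_dom \<mu> \<xi>" unfolding Berezin_dom_def by (auto intro!: AE_I2 simp: space_restrict_space)
  qed
next
  fix f :: "complex^'n::{finite,linorder} \<Rightarrow> complex" and A :: real and z :: "complex^'n::{finite,linorder}"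
  assume A: "0 < A" and f: "f \<in> bergman_ball p1 \<alpha>1 A"
  show le: "cmod (Berezin_op \<mu> \<xi> f z) \<le> enn2real (berezin_integral push t f z)" for z
    by (simp add: Berezin_op_eq[OF f])
  have [measurable]: "(\<lambda>z. berezin_integral push t f z) \<in> borel_measurable borel"
    by (rule berezin_integral_measurable[OF bergman_ball_borel[OF f]])
  have "Berezin_op \<mu> \<xi> f \<in> borel_measurable borel"
    unfolding Berezin_op_eq[OF f, abs_def] by measurable
  then show "Berezin_op \<mu> \<xi> f \<in> Lp p2 \<alpha>2"
    by (rule berezin_dominated_Lp[OF van A f borel_measurable_lebesgue_on_tube le])
next
  fix f g :: "complex^'n::{finite,linorder} \<Rightarrow> complex" and A :: real and z :: "complex^'n::{finite,linorder}"
  assume A: "0 < A" and f: "f \<in> bergman_ball p1 \<alpha>1 A" and g: "g \<in> bergman_ball p1 \<alpha>1 A" and z: "z \<in> tube"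
  let ?I = "\<lambda>h. berezin_integral push t h z"
  have A': "0 < 2 * 2 powr (1 / p1) * A" using A by simp
  have fin: "?I f < \<infinity>" "?I g < \<infinity>" "?I (\<lambda>w. g w - f w) < \<infinity>"
    using berezin_integral_finite_on_ball[OF van A f z] berezin_integral_finite_on_ball[OF van A g z]
      berezin_integral_finite_on_ball[OF van A' bergman_ball_diff[OF p_pos(1) A g f] z]
    by blast+
  have le: "enn2real x \<le> enn2real y + enn2real d" if "x \<le> y + d" "y < \<infinity>" "d < \<infinity>" for x y d :: ennreal
  proof -
    have "enn2real x \<le> enn2real (y + d)" using that by (intro enn2real_mono) auto
    also have "\<dots> = enn2real y + enn2real d" using that by (intro enn2real_plus) auto
    finally show ?thesis .
  qed
  have "?I (\<lambda>w. f w - g w) = ?I (\<lambda>w. g w - f w)"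
    unfolding berezin_integral_def by (simp only: norm_minus_commute)
  then have "?I g \<le> ?I f + ?I (\<lambda>w. g w - f w)" "?I f \<le> ?I g + ?I (\<lambda>w. g w - f w)"
    using berezin_integral_add_le[OF bergman_ball_borel[OF f] bergman_ball_borel[OF g], of t z]
      berezin_integral_add_le[OF bergman_ball_borel[OF g] bergman_ball_borel[OF f], of t z] by simp_all
  then have "enn2real (?I g) \<le> enn2real (?I f) + enn2real (?I (\<lambda>w. g w - f w))"
    "enn2real (?I f) \<le> enn2real (?I g) + enn2real (?I (\<lambda>w. g w - f w))"
    using fin le by blast+
  then show "cmod (Berezin_op \<mu> \<xi> g z - Berezin_op \<mu> \<xi> f z) \<le> enn2real (?I (\<lambda>w. g w - f w))"
    unfolding Berezin_op_eq[OF f] Berezin_op_eq[OF g] of_real_diff[symmetric] norm_of_real by linarith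
qed

text \<open>Here domination is the triangle inequality for integrals and the difference bound is
  linearity; the additional duty, placing the image in the Bergman space, falls to
  \<open>Toeplitz_holomorphic\<close>.\<close>

lemma Toeplitz_compact:
  assumes van: "vanishing_near b push"
  shows "compact_op (Toeplitz_dom \<mu> \<xi>) (Toeplitz_op \<mu> \<xi>) (Bergman p1 \<alpha>1) (Lp_norm p1 \<alpha>1) (Bergman p2 \<alpha>2) (Lp_norm p2 \<alpha>2)"
proof (rule compact_op_dominated[where S = "Toeplitz_op \<mu> \<xi>" and Y = "Bergman p2 \<alpha>2", OF p_pos(1) p(2) p_pos(3) al(2) xi cond(2) kernel_exponent(2) t b tube_measure_push van finite_on_exhaust_push _ _ Toeplitz_op_extend0])
  show "Bergman p2 \<alpha>2 \<subseteq> Lp p2 \<alpha>2" unfolding Bergman_def by blast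
  show "Bergman p1 \<alpha>1 \<subseteq> Toeplitz_dom \<mu> \<xi>"
  proof
    fix f :: "complex^'n::{finite,linorder} \<Rightarrow> complex" assume "f \<in> Bergman p1 \<alpha>1"
    then obtain A where A: "0 < A" "extend0 f \<in> bergman_ball p1 \<alpha>1 A" by (rule extend0_in_ball)
    show "f \<in> Toeplitz_dom \<mu> \<xi>"
      unfolding Toeplitz_dom_def
    proof (intro CollectI ballI)
      fix z :: "complex^'n::{finite,linorder}" assume z: "z \<in> tube"
      have "integrable \<mu> (\<lambda>w. extend0 f w / rho z w powr of_real t)"
        by (rule Toeplitz_integrable(1)[OF bergman_ball_borel[OF A(2)] z berezin_integral_finite_on_ball[OF van A z]])
      moreover have "integrable \<mu> (\<lambda>w. extend0 f w / rho z w powr of_real t) \<longleftrightarrow> integrable \<mu> (\<lambda>w. f w / rho z w powr of_real t)"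
        by (rule Bochner_Integration.integrable_cong[OF refl]) (simp add: space_mu extend0_def)
      ultimately show "integrable \<mu> (\<lambda>w. f w / rho z w powr of_real (real CARD('n) + 1 + \<xi>))"
        by (simp only: t)
    qed
  qed
next
  fix f :: "complex^'n::{finite,linorder} \<Rightarrow> complex" and A :: real and z :: "complex^'n::{finite,linorder}"
  assume A: "0 < A" and f: "f \<in> bergman_ball p1 \<alpha>1 A"
  have fin: "berezin_integral push (real CARD('n) + 1 + \<xi>) f z < \<infinity>" if "z \<in> tube" for z
    using berezin_integral_finite_on_ball[OF van A f that] by (simp only: t)
  show le: "cmod (Toeplitz_op \<mu> \<xi> f z) \<le> enn2real (berezin_integral push t f z)" if "z \<in> tube" for z
    using cmod_Toeplitz_le[OF bergman_ball_borel[OF f] that fin[OF that]] by (simp only: t)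
  have hol: "holomorphic_tube (Toeplitz_op \<mu> \<xi> f)"
    by (rule Toeplitz_holomorphic[OF bergman_ball_borel[OF f] fin])
  have "Toeplitz_op \<mu> \<xi> f \<in> Lp p2 \<alpha>2"
    by (rule berezin_dominated_Lp[OF van A f line_holomorphic_lebesgue_measurable[OF holomorphic_tube_line_holomorphic[OF hol]] le])
  with hol show "Toeplitz_op \<mu> \<xi> f \<in> Bergman p2 \<alpha>2" by (simp add: Bergman_def)
next
  fix f g :: "complex^'n::{finite,linorder} \<Rightarrow> complex" and A :: real and z :: "complex^'n::{finite,linorder}"
  assume A: "0 < A" and f: "f \<in> bergman_ball p1 \<alpha>1 A" and g: "g \<in> bergman_ball p1 \<alpha>1 A" and z: "z \<in> tube"
  have A': "0 < 2 * 2 powr (1 / p1) * A" using A by simp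
  have d: "(\<lambda>w. g w - f w) \<in> bergman_ball p1 \<alpha>1 (2 * 2 powr (1 / p1) * A)"
    by (rule bergman_ball_diff[OF p_pos(1) A g f])
  have int: "integrable \<mu> (\<lambda>w. h w / rho z w powr of_real (real CARD('n) + 1 + \<xi>))" if "h \<in> bergman_ball p1 \<alpha>1 A" for h
    using Toeplitz_integrable(1)[OF bergman_ball_borel[OF that] z berezin_integral_finite_on_ball[OF van A that z]] by (simp only: t)
  have "Toeplitz_op \<mu> \<xi> g z - Toeplitz_op \<mu> \<xi> f z = Toeplitz_op \<mu> \<xi> (\<lambda>w. g w - f w) z"
    unfolding Toeplitz_op_def diff_divide_distrib by (rule Bochner_Integration.integral_diff[OF int[OF g] int[OF f], symmetric])
  also have "cmod \<dots> \<le> enn2real (berezin_integral push t (\<lambda>w. g w - f w) z)"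
    using cmod_Toeplitz_le[OF bergman_ball_borel[OF d] z] berezin_integral_finite_on_ball[OF van A' d z] by (simp only: t)
  finally show "cmod (Toeplitz_op \<mu> \<xi> g z - Toeplitz_op \<mu> \<xi> f z) \<le> enn2real (berezin_integral push t (\<lambda>w. g w - f w) z)" .
qed

end

section \<open>Necessity\<close>

lemma extend0_Bergman:
  assumes "f \<in> Bergman p \<alpha>" "0 < p"
  shows "extend0 f \<in> borel_measurable borel" "line_holomorphic_on (extend0 f) tube"
proof -
  have *: "extend0 f \<in> bergman_ball p \<alpha> (Lp_norm p \<alpha> f)" by (rule extend0_in_bergman_ball[OF assms order_refl])
  show "extend0 f \<in> borel_measurable borel" by (rule bergman_ball_borel[OF *])
  show "line_holomorphic_on (extend0 f) tube" using * by (simp add: bergman_ball_def)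
qed

lemma powr_le_imp_le: "x powr p \<le> y powr p \<Longrightarrow> 0 < p \<Longrightarrow> 0 \<le> y \<Longrightarrow> x \<le> (y::real)"
  using powr_less_mono2[of p y x] by linarith

context M_plus_measure
begin

lemma near_measure_finite:
  assumes a: "a \<in> tube" obtains v where "0 \<le> v" "emeasure push {w. near a w} = ennreal v"
proof -
  define R where "R = max 1 (max (1 / rho_diag a) (cmod (rho a base_point)))"
  have "exhaust (max (1 / rho_diag a) (cmod (rho a base_point))) \<subseteq> exhaust R"
    by (rule exhaust_mono) (simp add: R_def)
  then have a': "a \<in> exhaust R" using exhaust_cover[OF a] by blast
  have R: "0 < R" unfolding R_def by (simp add: less_max_iff_disj)
  have "{w. near a w} \<subseteq> exhaust (20 * R)"
  proof
    fix w assume "w \<in> {w. near a w}"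
    then have "near w a" using near_commute by blast
    then show "w \<in> exhaust (20 * R)" using a' R by (intro near_exhaust) simp_all
  qed
  then have "emeasure push {w. near a w} \<le> emeasure push (exhaust (20 * R))"
    using R by (intro emeasure_mono) (simp_all add: sets_push)
  also have "\<dots> < \<infinity>" using finite_on_exhaust_push R by (simp add: finite_on_exhaust_def)
  finally have "emeasure push {w. near a w} < \<infinity>" .
  then show ?thesis using that by (cases "emeasure push {w. near a w}") auto
qed

lemma nn_integral_near_ge:
  assumes k: "0 \<le> k" and g: "g \<in> borel_measurable borel" and le: "\<And>w. near a w \<Longrightarrow> ennreal k \<le> g w"
  shows "ennreal k * emeasure push {w. near a w} \<le> (\<integral>\<^sup>+w. g w \<partial>\<mu>)"
proof -
  have "ennreal k * emeasure push {w. near a w} = (\<integral>\<^sup>+w. ennreal k * indicator {w. near a w} w \<partial>push)"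
    by (rule nn_integral_cmult_indicator[symmetric]) (simp add: sets_push)
  also have "\<dots> \<le> (\<integral>\<^sup>+w. g w \<partial>push)"
    by (intro nn_integral_mono) (auto simp: indicator_def le)
  also have "\<dots> = (\<integral>\<^sup>+w. g w \<partial>\<mu>)" by (rule nn_integral_push[OF g])
  finally show ?thesis .
qed

end

context Toeplitz_setting
begin

text \<open>The exponent t of the operator kernel is reused for the test function: at z = a the
  Toeplitz integrand then becomes |rho a w|^(-2t) up to a positive factor.\<close>

definition probe :: "complex^'n::{finite,linorder} \<Rightarrow> complex^'n::{finite,linorder} \<Rightarrow> complex" where
  "probe a = test_function (t - (real CARD('n) + 1 + \<alpha>1) / p1) t a"

lemma compact_op_probe:
  assumes "compact_op D S (Bergman p1 \<alpha>1) (Lp_norm p1 \<alpha>1) Y NY"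
  shows "relatively_compact Y NY (S ` probe ` tube)" and "probe ` tube \<subseteq> D" "probe ` tube \<subseteq> Bergman p1 \<alpha>1" "S ` probe ` tube \<subseteq> Y"
proof -
  obtain C where C: "\<And>a :: complex^'n::{finite,linorder}. a \<in> tube \<Longrightarrow> test_function (t - (real CARD('n) + 1 + \<alpha>1) / p1) t a \<in> Bergman p1 \<alpha>1
      \<and> Lp_norm p1 \<alpha>1 (test_function (t - (real CARD('n) + 1 + \<alpha>1) / p1) t a) \<le> C"
    by (rule test_function_Bergman[OF p_pos(1) al(1) kernel_exponent(1) refl]) blast
  have C': "probe a \<in> Bergman p1 \<alpha>1" "Lp_norm p1 \<alpha>1 (probe a) \<le> C" if "a \<in> tube" for a
    using C[OF that] by (simp_all add: probe_def)
  show sub: "probe ` tube \<subseteq> Bergman p1 \<alpha>1" by (rule image_subsetI[OF C'(1)])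
  have "\<forall>f\<in>probe ` tube. Lp_norm p1 \<alpha>1 f \<le> C" by (intro ballI; elim imageE) (simp add: C'(2))
  then have bdd: "\<exists>M. \<forall>f\<in>probe ` tube. Lp_norm p1 \<alpha>1 f \<le> M" by (rule exI)
  have op: "Bergman p1 \<alpha>1 \<subseteq> D" "S ` Bergman p1 \<alpha>1 \<subseteq> Y"
    "\<And>A. A \<subseteq> Bergman p1 \<alpha>1 \<Longrightarrow> \<exists>M. \<forall>f\<in>A. Lp_norm p1 \<alpha>1 f \<le> M \<Longrightarrow> relatively_compact Y NY (S ` A)"
    using assms unfolding compact_op_def bounded_op_def by simp_all
  show "relatively_compact Y NY (S ` probe ` tube)" by (rule op(3)[OF sub bdd])
  show "probe ` tube \<subseteq> D" by (rule subset_trans[OF sub op(1)])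
  show "S ` probe ` tube \<subseteq> Y" by (rule subset_trans[OF image_mono[OF sub] op(2)])
qed

text \<open>If a is off \<open>exhaust (20 * R)\<close>, the points near a are off
  \<open>exhaust R\<close>, so the local mass on the right of \<open>lower\<close> is part of a
  uniformly small tail. Solving for v leaves the power -e - (n + 1 + \<open>\<alpha>2\<close>) / p2,
  which is b.\<close>

lemma vanishing_near_if_lower_bound:
  assumes rc: "relatively_compact Y (Lp_norm p2 \<alpha>2) (S ` probe ` tube)" and Y: "Y \<subseteq> Lp p2 \<alpha>2"
    and k: "0 < k" and C: "0 < C" and e: "e = - t - (real CARD('n) + 1 + \<alpha>1) / p1"
    and lower: "\<And>a v. a \<in> tube \<Longrightarrow> 0 \<le> v \<Longrightarrow> emeasure push {w. near a w} = ennreal v \<Longrightarrow>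
      ennreal ((k * rho_diag a powr e * v) powr p2) \<le> ennreal (C * rho_diag a powr (- (real CARD('n) + 1 + \<alpha>2))) *
        (\<integral>\<^sup>+z. ennreal (cmod (S (probe a) z) powr p2) * indicator {w. near a w} z \<partial>dV \<alpha>2)"
  shows "vanishing_near b push"
proof (rule vanishing_nearI[OF _ sets_push])
  fix \<epsilon> :: real assume eps: "0 < \<epsilon>"
  have eps': "0 < (k * \<epsilon>) powr p2 / C" using k eps C by simp
  obtain R where R: "0 < R" "\<And>g. g \<in> S ` probe ` tube \<Longrightarrow> tail_integral p2 \<alpha>2 R g < (k * \<epsilon>) powr p2 / C"
    by (rule relatively_compact_uniform_tails[OF p_pos(2) Y rc eps']) blast
  have rcY: "S ` probe ` tube \<subseteq> Y" using rc by (simp add: relatively_compact_def)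
  show "\<exists>R>0. \<forall>u\<in>tube - exhaust R. emeasure push {w. near u w} \<le> ennreal (\<epsilon> * rho_diag u powr b)"
  proof (intro exI[of _ "20 * R"] conjI ballI)
    show "0 < 20 * R" using R by simp
    fix a :: "complex^'n::{finite,linorder}" assume a': "a \<in> tube - exhaust (20 * R)"
    then have a: "a \<in> tube" by blast
    let ?g = "S (probe a)"
    have g: "?g \<in> Lp p2 \<alpha>2" using a rcY Y by blast
    have disj: "w \<notin> exhaust R" if "near a w" for w using near_exhaust[OF that] a' R by auto
    obtain v where v: "0 \<le> v" "emeasure push {w. near a w} = ennreal v" by (rule near_measure_finite[OF a])
    have ra: "0 < rho_diag a" using a by (simp add: mem_tube)
    have "(\<integral>\<^sup>+z. ennreal (cmod (?g z) powr p2) * indicator {w. near a w} z \<partial>dV \<alpha>2)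
      \<le> (\<integral>\<^sup>+z. ennreal (indicator (- exhaust R) z * cmod (?g z) powr p2) \<partial>dV \<alpha>2)"
      by (intro nn_integral_mono) (auto simp: indicator_def disj)
    also have "\<dots> = ennreal (tail_integral p2 \<alpha>2 R ?g)"
      unfolding tail_integral_def
      by (rule nn_integral_eq_integral[OF tail_integrable[OF Lp_integrable[OF g] R(1)]]) simp
    also have "\<dots> \<le> ennreal ((k * \<epsilon>) powr p2 / C)"
      using R(2)[of ?g] a by (intro ennreal_leI less_imp_le) blast
    finally have "ennreal ((k * rho_diag a powr e * v) powr p2)
        \<le> ennreal (C * rho_diag a powr (- (real CARD('n) + 1 + \<alpha>2))) * ennreal ((k * \<epsilon>) powr p2 / C)"
      using lower[OF a v] by (meson mult_left_mono order_trans zero_le)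
    also have "\<dots> = ennreal (C * rho_diag a powr (- (real CARD('n) + 1 + \<alpha>2)) * ((k * \<epsilon>) powr p2 / C))"
      using C eps' by (intro ennreal_mult[symmetric]) auto
    finally have "(k * rho_diag a powr e * v) powr p2 \<le> rho_diag a powr (- (real CARD('n) + 1 + \<alpha>2)) * (k * \<epsilon>) powr p2"
      using C by (simp add: ennreal_le_iff)
    also have "\<dots> = (k * \<epsilon> * rho_diag a powr (- ((real CARD('n) + 1 + \<alpha>2) / p2))) powr p2"
      using p_pos k eps by (simp add: powr_mult powr_powr)
    finally have "k * rho_diag a powr e * v \<le> k * \<epsilon> * rho_diag a powr (- ((real CARD('n) + 1 + \<alpha>2) / p2))"
      by (rule powr_le_imp_le) (use p_pos k eps in auto)
    then have "rho_diag a powr e * v \<le> \<epsilon> * rho_diag a powr (- ((real CARD('n) + 1 + \<alpha>2) / p2))"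
      using k by (simp add: mult.assoc)
    then have "rho_diag a powr (- e) * (rho_diag a powr e * v)
        \<le> rho_diag a powr (- e) * (\<epsilon> * rho_diag a powr (- ((real CARD('n) + 1 + \<alpha>2) / p2)))"
      by (rule mult_left_mono) simp
    moreover have "rho_diag a powr (- e) * rho_diag a powr e = 1" using ra by (simp flip: powr_add)
    moreover have "rho_diag a powr (- e) * rho_diag a powr (- ((real CARD('n) + 1 + \<alpha>2) / p2)) = rho_diag a powr b"
      by (simp only: powr_add[symmetric]) (simp add: b e add.commute)
    ultimately have "v \<le> \<epsilon> * rho_diag a powr b"
      by (simp only: mult.assoc[symmetric] mult_1_left) (simp only: mult.assoc mult.left_commute[of _ \<epsilon>])
    then show "emeasure push {w. near a w} \<le> ennreal (\<epsilon> * rho_diag a powr b)"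
      unfolding v(2) by (rule ennreal_leI)
  qed
qed

lemma cmod_probe_mult_ge:
  assumes "near a w" "z \<in> tube" "cmod (rho z w) \<le> k * rho_diag a" "0 < k"
  shows "2 powr (- t) * k powr (- t) * rho_diag a powr (- t - (real CARD('n) + 1 + \<alpha>1) / p1)
    \<le> cmod (probe a w) * cmod (rho z w) powr (- t)"
proof -
  have aw: "a \<in> tube" "w \<in> tube" using near_tube[OF assms(1)] by auto
  have ra: "0 < rho_diag a" using aw by (simp add: mem_tube)
  have t0: "0 < t" using xi by (simp add: t add_pos_pos)
  have "(2 * rho_diag a) powr (- t) \<le> cmod (rho a w) powr (- t)"
    using assms(1) t0 cmod_rho_pos[OF aw] by (intro powr_mono2') (auto simp: near_def)
  moreover have "(k * rho_diag a) powr (- t) \<le> cmod (rho z w) powr (- t)"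
    using assms t0 cmod_rho_pos[OF assms(2) aw(2)] by (intro powr_mono2') auto
  ultimately have "rho_diag a powr (t - (real CARD('n) + 1 + \<alpha>1) / p1) * ((2 * rho_diag a) powr (- t) * (k * rho_diag a) powr (- t))
      \<le> rho_diag a powr (t - (real CARD('n) + 1 + \<alpha>1) / p1) * (cmod (rho a w) powr (- t) * cmod (rho z w) powr (- t))"
    by (intro mult_left_mono mult_mono) auto
  also have "\<dots> = cmod (probe a w) * cmod (rho z w) powr (- t)"
    by (simp add: probe_def cmod_test_function[OF aw] mult.assoc)
  also have "rho_diag a powr (t - (real CARD('n) + 1 + \<alpha>1) / p1) * ((2 * rho_diag a) powr (- t) * (k * rho_diag a) powr (- t))
    = 2 powr (- t) * k powr (- t) * (rho_diag a powr (t - (real CARD('n) + 1 + \<alpha>1) / p1) * (rho_diag a powr (- t) * rho_diag a powr (- t)))"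
    by (simp only: powr_mult mult_ac)
  also have "rho_diag a powr (t - (real CARD('n) + 1 + \<alpha>1) / p1) * (rho_diag a powr (- t) * rho_diag a powr (- t))
    = rho_diag a powr (- t - (real CARD('n) + 1 + \<alpha>1) / p1)"
    by (simp only: powr_add[symmetric]) (simp add: algebra_simps)
  finally show ?thesis .
qed

end

context Toeplitz_setting
begin

text \<open>At z = a the two kernel powers are complex conjugates of each other, so the integrand is
  nonnegative, no cancellation occurs, and the integral may be restricted to the set near a.\<close>

lemma Toeplitz_probe_ge:
  assumes a: "a \<in> tube" and v: "0 \<le> v" "emeasure push {w. near a w} = ennreal v"
    and int: "integrable \<mu> (\<lambda>w. probe a w / rho a w powr of_real t)"
  shows "2 powr (- t) * 2 powr (- t) * rho_diag a powr (- t - (real CARD('n) + 1 + \<alpha>1) / p1) * v \<le> cmod (Toeplitz_op \<mu> \<xi> (probe a) a)"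
proof -
  define s where "s = t - (real CARD('n) + 1 + \<alpha>1) / p1"
  define g where "g w = rho_diag a powr s * cmod (rho a w) powr (- t) * cmod (rho a w) powr (- t)" for w
  have eq: "probe a w / rho a w powr of_real t = of_real (g w)" if w: "w \<in> tube" for w
  proof -
    let ?x = "rho a w"
    have "rho w a powr of_real (- t) = cnj (?x powr of_real (- t))"
      using rho_not_nonpos[OF a w] by (subst cnj_powr) (auto simp: rho_commute[of w a] complex_nonpos_Reals_iff)
    then have "probe a w / ?x powr of_real t = of_real (rho_diag a powr s) * (cnj (?x powr of_real (- t)) * ?x powr of_real (- t))"
      by (simp add: probe_def test_function_def s_def powr_minus divide_inverse)
    also have "cnj (?x powr of_real (- t)) * ?x powr of_real (- t) = of_real ((cmod (?x powr of_real (- t)))\<^sup>2)"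
      by (simp only: complex_norm_square mult.commute)
    also have "cmod (?x powr of_real (- t)) = cmod ?x powr (- t)"
      by (rule norm_powr_of_real[OF rho_nonzero[OF a w]])
    finally show ?thesis by (simp add: g_def power2_eq_square)
  qed
  have g0: "0 \<le> g w" for w by (simp add: g_def)
  have "integrable \<mu> (\<lambda>w. of_real (g w) :: complex)"
    using int by (rule Bochner_Integration.integrable_cong[OF refl, THEN iffD1, rotated]) (simp add: eq space_mu)
  then have gi: "integrable \<mu> g" by (simp add: complex_of_real_integrable_eq)
  have "Toeplitz_op \<mu> \<xi> (probe a) a = (\<integral>w. of_real (g w) \<partial>\<mu>)"
    unfolding Toeplitz_op_def t[symmetric] by (intro Bochner_Integration.integral_cong refl) (simp add: eq space_mu)
  then have T: "Toeplitz_op \<mu> \<xi> (probe a) a = of_real (\<integral>w. g w \<partial>\<mu>)" by simp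
  let ?k = "2 powr (- t) * 2 powr (- t) * rho_diag a powr (- t - (real CARD('n) + 1 + \<alpha>1) / p1)"
  have "ennreal ?k * emeasure push {w. near a w} \<le> (\<integral>\<^sup>+w. ennreal (g w) \<partial>\<mu>)"
  proof (rule nn_integral_near_ge)
    show "(\<lambda>w. ennreal (g w)) \<in> borel_measurable borel" unfolding g_def by measurable
    fix w assume w: "near a w"
    then have w': "w \<in> tube" "cmod (rho a w) \<le> 2 * rho_diag a" using near_tube by (auto simp: near_def)
    have "?k \<le> cmod (probe a w) * cmod (rho a w) powr (- t)"
      by (rule cmod_probe_mult_ge[OF w a w'(2)]) simp
    also have "\<dots> = g w" by (simp add: g_def probe_def cmod_test_function[OF a w'(1)] s_def)
    finally show "ennreal ?k \<le> ennreal (g w)" by (rule ennreal_leI)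
  qed simp
  then have "ennreal ?k * ennreal v \<le> ennreal (\<integral>w. g w \<partial>\<mu>)"
    unfolding v(2) using nn_integral_eq_integral[OF gi] g0 by simp
  then have "?k * v \<le> (\<integral>w. g w \<partial>\<mu>)"
    using v(1) integral_nonneg_AE[of g \<mu>] g0 by (simp add: ennreal_mult[symmetric] ennreal_le_iff)
  then show ?thesis unfolding T by simp
qed

text \<open>The image is holomorphic, so \<open>weighted_mean\<close> converts the lower bound at
  the single point a into a lower bound for its mass on the set near a.\<close>

lemma Toeplitz_compact_imp:
  assumes comp: "compact_op (Toeplitz_dom \<mu> \<xi>) (Toeplitz_op \<mu> \<xi>) (Bergman p1 \<alpha>1) (Lp_norm p1 \<alpha>1) (Bergman p2 \<alpha>2) (Lp_norm p2 \<alpha>2)"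
  shows "vanishing_near b push"
proof -
  note probe = compact_op_probe[OF comp]
  obtain C where C: "0 < C" "\<And>(f :: complex^'n::{finite,linorder} \<Rightarrow> complex) z. line_holomorphic_on f tube \<Longrightarrow>
    f \<in> borel_measurable borel \<Longrightarrow> z \<in> tube \<Longrightarrow>
    ennreal (cmod (f z) powr p2) \<le> ennreal (C * rho_diag z powr (- (real CARD('n) + 1 + \<alpha>2))) *
      (\<integral>\<^sup>+w. ennreal (cmod (f w) powr p2 * rho_diag w powr \<alpha>2) * indicator {w. near z w} w \<partial>lborel)"
    by (rule weighted_mean[OF p_pos(2)]) blast
  have Y: "Bergman p2 \<alpha>2 \<subseteq> Lp p2 \<alpha>2" unfolding Bergman_def by blast
  have k: "0 < (2::real) powr (- t) * 2 powr (- t)" by simp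
  show ?thesis
  proof (rule vanishing_near_if_lower_bound[OF probe(1) Y k C(1) refl])
    fix a :: "complex^'n::{finite,linorder}" and v :: real
    assume a: "a \<in> tube" and v: "0 \<le> v" "emeasure push {w. near a w} = ennreal v"
    let ?T = "Toeplitz_op \<mu> \<xi> (probe a)"
    let ?I = "\<lambda>G. \<integral>\<^sup>+w. ennreal (cmod (G w) powr p2 * rho_diag w powr \<alpha>2) * indicator {w. near a w} w \<partial>lborel"
    have T: "?T \<in> Bergman p2 \<alpha>2" using probe(4) a by blast
    then have [measurable]: "?T \<in> borel_measurable (lebesgue_on tube)" by (simp add: Bergman_def Lp_def)
    have nearm: "(indicator {w. near a w} :: _ \<Rightarrow> ennreal) \<in> borel_measurable (lebesgue_on tube)"
      by (rule borel_measurable_lebesgue_on_tube) measurable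
    have "probe a \<in> Toeplitz_dom \<mu> \<xi>" using probe(2) a by blast
    then have "integrable \<mu> (\<lambda>w. probe a w / rho a w powr of_real t)" using a by (simp add: Toeplitz_dom_def t)
    note ge = Toeplitz_probe_ge[OF a v this]
    have "ennreal ((2 powr (- t) * 2 powr (- t) * rho_diag a powr (- t - (real CARD('n) + 1 + \<alpha>1) / p1) * v) powr p2)
        \<le> ennreal (cmod (extend0 ?T a) powr p2)"
      using ge v p_pos a by (intro ennreal_leI powr_mono2) (simp_all add: extend0_def)
    also have "\<dots> \<le> ennreal (C * rho_diag a powr (- (real CARD('n) + 1 + \<alpha>2))) * ?I (extend0 ?T)"
      by (rule C(2)[OF extend0_Bergman(2)[OF T p_pos(2)] extend0_Bergman(1)[OF T p_pos(2)] a])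
    also have "?I (extend0 ?T) = (\<integral>\<^sup>+w. ennreal (rho_diag w powr \<alpha>2) * (ennreal (cmod (?T w) powr p2) * indicator {w. near a w} w) * indicator tube w \<partial>lborel)"
    proof (rule nn_integral_cong)
      fix w :: "complex^'n::{finite,linorder}"
      show "ennreal (cmod (extend0 ?T w) powr p2 * rho_diag w powr \<alpha>2) * indicator {w. near a w} w
        = ennreal (rho_diag w powr \<alpha>2) * (ennreal (cmod (?T w) powr p2) * indicator {w. near a w} w) * indicator tube w"
        using near_tube[of a w] by (cases "near a w") (simp_all add: extend0_def ennreal_mult mult.commute)
    qed
    also have "\<dots> = (\<integral>\<^sup>+z. ennreal (cmod (?T z) powr p2) * indicator {w. near a w} z \<partial>dV \<alpha>2)"
      by (rule nn_integral_dV[symmetric], rule borel_measurable_times_ennreal[OF _ nearm]) measurable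
    finally show "ennreal ((2 powr (- t) * 2 powr (- t) * rho_diag a powr (- t - (real CARD('n) + 1 + \<alpha>1) / p1) * v) powr p2)
      \<le> ennreal (C * rho_diag a powr (- (real CARD('n) + 1 + \<alpha>2))) *
        (\<integral>\<^sup>+z. ennreal (cmod (?T z) powr p2) * indicator {w. near a w} z \<partial>dV \<alpha>2)" .
  qed
qed

text \<open>Images under the Berezin-type operator need not be holomorphic, so the lower bound is
  proved at every z near a instead of being spread from a by a mean value estimate. There |rho z w|
  <= 20 |rho a w| <= 40 rho_diag a, hence the 40.\<close>

lemma Berezin_probe_ge:
  assumes z: "near z a" and v: "0 \<le> v" "emeasure push {w. near a w} = ennreal v"
  shows "ennreal (2 powr (- t) * 40 powr (- t) * rho_diag a powr (- t - (real CARD('n) + 1 + \<alpha>1) / p1) * v) \<le> Berezin \<mu> \<xi> (probe a) z"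
proof -
  have za: "z \<in> tube" "a \<in> tube" using near_tube[OF z] by auto
  let ?k = "2 powr (- t) * 40 powr (- t) * rho_diag a powr (- t - (real CARD('n) + 1 + \<alpha>1) / p1)"
  define s where "s = t - (real CARD('n) + 1 + \<alpha>1) / p1"
  define g where "g w = rho_diag a powr s * cmod (rho a w) powr (- t) * cmod (rho z w) powr (- t)" for w
  have "ennreal ?k * emeasure push {w. near a w} \<le> (\<integral>\<^sup>+w. ennreal (g w) \<partial>\<mu>)"
  proof (rule nn_integral_near_ge)
    show "(\<lambda>w. ennreal (g w)) \<in> borel_measurable borel" unfolding g_def by measurable
    fix w assume w: "near a w"
    then have w': "w \<in> tube" "cmod (rho a w) \<le> 2 * rho_diag a" using near_tube by (auto simp: near_def)
    have "cmod (rho z w) \<le> 20 * cmod (rho a w)" by (rule near_rho[OF z w'(1)])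
    then have "cmod (rho z w) \<le> 40 * rho_diag a" using w'(2) by simp
    then have "?k \<le> cmod (probe a w) * cmod (rho z w) powr (- t)"
      by (rule cmod_probe_mult_ge[OF w za(1)]) simp
    also have "\<dots> = g w" by (simp add: g_def probe_def cmod_test_function[OF za(2) w'(1)] s_def)
    finally show "ennreal ?k \<le> ennreal (g w)" by (rule ennreal_leI)
  qed simp
  also have "(\<integral>\<^sup>+w. ennreal (g w) \<partial>\<mu>) = Berezin \<mu> \<xi> (probe a) z"
    unfolding Berezin_def t[symmetric]
    by (intro nn_integral_cong)
      (simp add: space_mu g_def probe_def cmod_test_function[OF za(2)] s_def powr_minus_divide)
  finally show ?thesis using v by (simp add: ennreal_mult)
qed

lemma Berezin_compact_imp:
  assumes comp: "compact_op (Berezin_dom \<mu> \<xi>) (Berezin_op \<mu> \<xi>) (Bergman p1 \<alpha>1) (Lp_norm p1 \<alpha>1) (Lp p2 \<alpha>2) (Lp_norm p2 \<alpha>2)"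
  shows "vanishing_near b push"
proof -
  note probe = compact_op_probe[OF comp]
  obtain C where C: "0 < C" "\<And>(f :: complex^'n::{finite,linorder} \<Rightarrow> complex) z. line_holomorphic_on f tube \<Longrightarrow>
    f \<in> borel_measurable borel \<Longrightarrow> z \<in> tube \<Longrightarrow>
    ennreal (cmod (f z) powr p2) \<le> ennreal (C * rho_diag z powr (- (real CARD('n) + 1 + \<alpha>2))) *
      (\<integral>\<^sup>+w. ennreal (cmod (f w) powr p2 * rho_diag w powr \<alpha>2) * indicator {w. near z w} w \<partial>lborel)"
    by (rule weighted_mean[OF p_pos(2)]) blast
  have k: "0 < (2::real) powr (- t) * 40 powr (- t)" by simp
  show ?thesis
  proof (rule vanishing_near_if_lower_bound[OF probe(1) subset_refl k C(1) refl])
    fix a :: "complex^'n::{finite,linorder}" and v :: real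
    assume a: "a \<in> tube" and v: "0 \<le> v" "emeasure push {w. near a w} = ennreal v"
    let ?B = "Berezin_op \<mu> \<xi> (probe a)"
    let ?D = "C * rho_diag a powr (- (real CARD('n) + 1 + \<alpha>2))"
    define x where "x = 2 powr (- t) * 40 powr (- t) * rho_diag a powr (- t - (real CARD('n) + 1 + \<alpha>1) / p1) * v"
    have x: "0 \<le> x" using v by (simp add: x_def)
    have near_borel: "(indicator {w. near a w} :: _ \<Rightarrow> ennreal) \<in> borel_measurable (lebesgue_on tube)"
      by (rule borel_measurable_lebesgue_on_tube) measurable
    \<comment> \<open>\<open>enn2real\<close> sends an infinite value to 0, which would destroy the
      lower bound; well-definedness on the domain confines such values to a null set.\<close>
    have "probe a \<in> Berezin_dom \<mu> \<xi>" using probe(2) a by blast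
    then have "AE z in lebesgue_on tube. Berezin \<mu> \<xi> (probe a) z < \<infinity>" by (simp add: Berezin_dom_def)
    then have "AE z in lebesgue_on tube. near a z \<longrightarrow> x \<le> cmod (?B z)"
    proof eventually_elim
      case (elim z)
      show ?case
      proof
        assume "near a z"
        then have "near z a" using near_commute by blast
        then have "ennreal x \<le> Berezin \<mu> \<xi> (probe a) z" unfolding x_def by (rule Berezin_probe_ge[OF _ v])
        then have "enn2real (ennreal x) \<le> enn2real (Berezin \<mu> \<xi> (probe a) z)" using elim by (intro enn2real_mono) auto
        then show "x \<le> cmod (?B z)" using x by (simp add: Berezin_op_def)
      qed
    qed
    then have AE: "AE z in dV \<alpha>2. near a z \<longrightarrow> x \<le> cmod (?B z)"
      unfolding dV_def by (subst AE_density) (auto intro: borel_measurable_lebesgue_on_tube)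
    \<comment> \<open>\<open>weighted_mean\<close> for the constant function 1, read as a lower
      bound for the weighted volume of the set near a.\<close>
    have "1 \<le> ennreal ?D * (\<integral>\<^sup>+w. ennreal (rho_diag w powr \<alpha>2) * indicator {w. near a w} w \<partial>lborel)"
      using C(2)[OF line_holomorphic_const[of 1] _ a] by simp
    also have "(\<integral>\<^sup>+w. ennreal (rho_diag w powr \<alpha>2) * indicator {w. near a w} w \<partial>lborel)
      = (\<integral>\<^sup>+w. ennreal (rho_diag w powr \<alpha>2) * indicator {w. near a w} w * indicator tube w \<partial>lborel)"
    proof (rule nn_integral_cong)
      fix w :: "complex^'n::{finite,linorder}"
      show "ennreal (rho_diag w powr \<alpha>2) * indicator {w. near a w} w
        = ennreal (rho_diag w powr \<alpha>2) * indicator {w. near a w} w * indicator tube w"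
        using near_tube[of a w] by (cases "near a w") simp_all
    qed
    also have "\<dots> = (\<integral>\<^sup>+z. indicator {w. near a w} z \<partial>dV \<alpha>2)"
      by (rule nn_integral_dV[symmetric, OF near_borel])
    finally have one: "1 \<le> ennreal ?D * (\<integral>\<^sup>+z. indicator {w. near a w} z \<partial>dV \<alpha>2)" .
    have "ennreal (x powr p2) * 1 \<le> ennreal (x powr p2) * (ennreal ?D * (\<integral>\<^sup>+z. indicator {w. near a w} z \<partial>dV \<alpha>2))"
      by (rule mult_left_mono[OF one]) simp
    also have "\<dots> = ennreal ?D * (\<integral>\<^sup>+z. ennreal (x powr p2) * indicator {w. near a w} z \<partial>dV \<alpha>2)"
      using near_borel by (subst nn_integral_cmult) (simp_all add: borel_measurable_dV mult.left_commute)
    also have "\<dots> \<le> ennreal ?D * (\<integral>\<^sup>+z. ennreal (cmod (?B z) powr p2) * indicator {w. near a w} z \<partial>dV \<alpha>2)"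
    proof (intro mult_left_mono nn_integral_mono_AE)
      show "AE z in dV \<alpha>2. ennreal (x powr p2) * indicator {w. near a w} z \<le> ennreal (cmod (?B z) powr p2) * indicator {w. near a w} z"
        using AE by eventually_elim (use x p_pos in \<open>auto simp: indicator_def intro!: ennreal_leI powr_mono2\<close>)
    qed simp
    finally show "ennreal ((2 powr (- t) * 40 powr (- t) * rho_diag a powr (- t - (real CARD('n) + 1 + \<alpha>1) / p1) * v) powr p2)
      \<le> ennreal ?D * (\<integral>\<^sup>+z. ennreal (cmod (?B z) powr p2) * indicator {w. near a w} z \<partial>dV \<alpha>2)"
      unfolding x_def by simp
  qed
qed

end

section \<open>Vanishing Carleson measures\<close>

text \<open>A point leaves \<open>exhaust k\<close> in one of two ways. With x = |rho a base_point|,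
  a small height gives rho_diag a <= 1 / k while x >= 1/2, and x > k gives rho_diag a * x^(-T) <= 2
  x^(1-T), small since T > 1. Comparing w with \<open>base_point\<close> costs the factor in
  front.\<close>

lemma cmod_test_function_exhaust_le:
  assumes w: "w \<in> exhaust R" and R: "0 < R" and a: "a \<in> tube - exhaust k" and k: "0 < k" and T: "1 < T"
  shows "cmod (test_function 1 T a w) \<le> (4 + 8 * R\<^sup>2 + 8 * R) powr T * (2 powr T / k + 2 * k powr (1 - T))"
proof -
  have at: "a \<in> tube" using a by blast
  have wt: "w \<in> tube" using w exhaust_subset_tube by blast
  define c where "c = 4 + 8 * R\<^sup>2 + 8 * R"
  have c: "0 < c" using R by (simp add: c_def add_pos_pos)
  define x where "x = cmod (rho a base_point)"
  have x: "0 < x" unfolding x_def by (rule cmod_rho_pos[OF at base_point_tube])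
  have x2: "rho_diag a \<le> 2 * x" "1 \<le> 2 * x"
    using cmod_rho_ge[OF base_point_tube, of a] cmod_rho_ge'[OF at, of base_point] by (simp_all add: x_def)
  have ra: "0 < rho_diag a" using at by (simp add: mem_tube)
  have "x \<le> c * cmod (rho a w)"
    using exhaust_rho_comparable(2)[OF w at] R by (simp add: x_def c_def cmod_rho_commute[of a])
  then have "(c * cmod (rho a w)) powr (- T) \<le> x powr (- T)" using x T by (intro powr_mono2') auto
  then have "c powr T * (c powr (- T) * cmod (rho a w) powr (- T)) \<le> c powr T * x powr (- T)"
    unfolding powr_mult by (rule mult_left_mono) simp
  moreover have "c powr T * c powr (- T) = 1" using c by (simp flip: powr_add)
  ultimately have 1: "cmod (rho a w) powr (- T) \<le> c powr T * x powr (- T)" by (simp only: mult.assoc[symmetric] mult_1_left)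
  have 2: "rho_diag a * x powr (- T) \<le> 2 powr T / k + 2 * k powr (1 - T)"
  proof (cases "1 \<le> k * rho_diag a")
    case True
    then have "k < x" using a by (auto simp: exhaust_def x_def)
    have "rho_diag a * x powr (- T) \<le> 2 * x * x powr (- T)" using x2 by (intro mult_right_mono) auto
    also have "\<dots> = 2 * x powr (1 - T)" using x by (simp add: powr_diff powr_minus_divide)
    also have "\<dots> \<le> 2 * k powr (1 - T)" using \<open>k < x\<close> k T by (intro mult_left_mono powr_mono2') auto
    also have "\<dots> \<le> 2 powr T / k + 2 * k powr (1 - T)" using k by simp
    finally show ?thesis .
  next
    case False
    then have "rho_diag a \<le> 1 / k" using k by (simp add: field_simps)
    moreover have "x powr (- T) \<le> (1 / 2) powr (- T)" using x2 T by (intro powr_mono2') auto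
    moreover have "(1 / 2 :: real) powr (- T) = 2 powr T" by (simp add: powr_divide powr_minus_divide)
    ultimately have "rho_diag a * x powr (- T) \<le> 1 / k * 2 powr T" using k by (intro mult_mono) auto
    also have "\<dots> \<le> 2 powr T / k + 2 * k powr (1 - T)" by simp
    finally show ?thesis .
  qed
  have "cmod (test_function 1 T a w) = rho_diag a * cmod (rho a w) powr (- T)"
    using ra by (simp add: cmod_test_function[OF at wt])
  also have "\<dots> \<le> rho_diag a * (c powr T * x powr (- T))" using 1 ra by (intro mult_left_mono) auto
  also have "\<dots> = c powr T * (rho_diag a * x powr (- T))" by simp
  also have "\<dots> \<le> c powr T * (2 powr T / k + 2 * k powr (1 - T))" by (rule mult_left_mono[OF 2]) simp
  finally show ?thesis by (simp only: c_def)
qed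

context M_plus_measure
begin

text \<open>If the little-o condition fails, there are points a_k escaping every compact set such
  that the sets near them keep mass at least \<open>\<epsilon>\<close> times the critical power.
  Test functions at these points tend to 0 locally uniformly, but their integrals stay bounded
  below. The pair p = 1, q = l is enough.\<close>

lemma vanishing_Carleson_imp:
  assumes car: "vanishing_Carleson l \<gamma> \<mu>" and l: "0 < l" and g: "-1 < \<gamma>"
  shows "vanishing_near (l * (real CARD('n) + 1 + \<gamma>)) push"
proof (rule vanishing_nearI[OF _ sets_push])
  \<comment> \<open>Any exponent above n + 1 + \<open>\<gamma>\<close> gives bounded test functions;
    this one makes their normalising power s equal to 1.\<close>
  define T where "T = real CARD('n) + 1 + \<gamma> + 1"
  have T: "1 < T" using g by (simp add: T_def)
  fix \<epsilon> :: real assume eps: "0 < \<epsilon>"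
  show "\<exists>R>0. \<forall>u\<in>tube - exhaust R. emeasure push {w. near u w} \<le> ennreal (\<epsilon> * rho_diag u powr (l * (real CARD('n) + 1 + \<gamma>)))"
  proof (rule ccontr)
    assume no: "\<not> ?thesis"
    have "\<exists>u\<in>tube - exhaust (real k + 1). \<not> emeasure push {w. near u w} \<le> ennreal (\<epsilon> * rho_diag u powr (l * (real CARD('n) + 1 + \<gamma>)))" for k
    proof (rule ccontr)
      assume "\<not> ?thesis"
      then have "\<forall>u\<in>tube - exhaust (real k + 1). emeasure push {w. near u w} \<le> ennreal (\<epsilon> * rho_diag u powr (l * (real CARD('n) + 1 + \<gamma>)))" by blast
      moreover have "0 < real k + 1" by simp
      ultimately show False using no by blast
    qed
    then have "\<forall>k. \<exists>u. u \<in> tube - exhaust (real k + 1) \<and> ennreal (\<epsilon> * rho_diag u powr (l * (real CARD('n) + 1 + \<gamma>))) \<le> emeasure push {w. near u w}"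
      by (meson linear)
    then obtain a where a: "\<And>k. a k \<in> tube - exhaust (real k + 1)"
      "\<And>k. ennreal (\<epsilon> * rho_diag (a k) powr (l * (real CARD('n) + 1 + \<gamma>))) \<le> emeasure push {w. near (a k) w}"
      by (drule_tac choice) blast
    have at: "a k \<in> tube" for k using a(1) by blast
    define f where "f k = test_function 1 T (a k)" for k
    have car': "\<And>p q f. p > 0 \<Longrightarrow> q > 0 \<Longrightarrow> q / p = l \<Longrightarrow>
        (\<forall>k. f k \<in> Bergman p \<gamma>) \<Longrightarrow> (\<exists>M. \<forall>k. Lp_norm p \<gamma> (f k) \<le> M) \<Longrightarrow>
        (\<forall>K. compact K \<and> K \<subseteq> tube \<longrightarrow> uniform_limit K f (\<lambda>_. 0) sequentially)
        \<Longrightarrow> (\<lambda>k. \<integral>\<^sup>+z. ennreal (cmod (f k z) powr q) \<partial>\<mu>) \<longlonglongrightarrow> 0"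
      using car unfolding vanishing_Carleson_def by blast
    obtain C where C: "\<And>a :: complex^'n::{finite,linorder}. a \<in> tube \<Longrightarrow>
        test_function 1 T a \<in> Bergman 1 \<gamma> \<and> Lp_norm 1 \<gamma> (test_function 1 T a) \<le> C"
      by (rule test_function_Bergman[of 1 \<gamma> T 1, where 'n = 'n]) (use g in \<open>auto simp: T_def\<close>)
    have "(\<lambda>k. \<integral>\<^sup>+z. ennreal (cmod (f k z) powr l) \<partial>\<mu>) \<longlonglongrightarrow> 0"
    proof (rule car'[of 1 l f])
      show "\<forall>k. f k \<in> Bergman 1 \<gamma>" using C at by (simp add: f_def)
      have "\<forall>k. Lp_norm 1 \<gamma> (f k) \<le> C" using C at by (simp add: f_def)
      then show "\<exists>M. \<forall>k. Lp_norm 1 \<gamma> (f k) \<le> M" by (rule exI)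
      show "\<forall>K. compact K \<and> K \<subseteq> tube \<longrightarrow> uniform_limit K f (\<lambda>_. 0) sequentially"
      proof (intro allI impI)
        fix K :: "(complex^'n::{finite,linorder}) set" assume K: "compact K \<and> K \<subseteq> tube"
        obtain R where R: "0 < R" "K \<subseteq> exhaust R" by (rule compact_subset_exhaust[OF conjunct1[OF K] conjunct2[OF K]])
        define B where "B k = (4 + 8 * R\<^sup>2 + 8 * R) powr T * (2 powr T / (real k + 1) + 2 * (real k + 1) powr (1 - T))" for k
        have inf: "filterlim (\<lambda>k. real k + 1) at_top sequentially"
          by (rule filterlim_at_top_mono[OF filterlim_real_sequentially]) simp
        then have "(\<lambda>k. (real k + 1) powr (1 - T)) \<longlonglongrightarrow> 0"
          using T by (intro tendsto_neg_powr) auto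
        moreover have "(\<lambda>k. 2 powr T / (real k + 1)) \<longlonglongrightarrow> 0"
          by (rule tendsto_divide_0[OF tendsto_const filterlim_at_top_imp_at_infinity[OF inf]])
        ultimately have "B \<longlonglongrightarrow> (4 + 8 * R\<^sup>2 + 8 * R) powr T * (0 + 2 * 0)"
          unfolding B_def by (intro tendsto_intros)
        then have B: "B \<longlonglongrightarrow> 0" by simp
        have le: "cmod (f k w) \<le> B k" if "w \<in> K" for k w
          unfolding f_def B_def by (rule cmod_test_function_exhaust_le[OF subsetD[OF R(2) that] R(1) a(1) _ T]) simp
        show "uniform_limit K f (\<lambda>_. 0) sequentially"
        proof (rule uniform_limitI)
          fix e :: real assume "0 < e"
          have "\<forall>\<^sub>F k in sequentially. B k < e" by (rule order_tendstoD(2)[OF B \<open>0 < e\<close>])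
          then show "\<forall>\<^sub>F k in sequentially. \<forall>w\<in>K. dist (f k w) 0 < e"
          proof eventually_elim
            case (elim k)
            then show ?case using le by (auto simp: dist_norm intro: le_less_trans)
          qed
        qed
      qed
    qed (use l in auto)
    \<comment> \<open>On the set near a_k the test function is at least 2^(-T) rho_diag^(1-T) in
      modulus, and l (T - 1) is exactly the critical exponent, so all powers of the height
      cancel.\<close>
    moreover have "ennreal (2 powr (- (T * l)) * \<epsilon>) \<le> (\<integral>\<^sup>+z. ennreal (cmod (f k z) powr l) \<partial>\<mu>)" for k
    proof -
      have ra: "0 < rho_diag (a k)" using at[of k] by (simp add: mem_tube)
      let ?k = "2 powr (- (T * l)) * rho_diag (a k) powr (- (l * (T - 1)))"
      define h where "h w = (rho_diag (a k) * cmod (rho (a k) w) powr (- T)) powr l" for w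
      have eq: "?k = (rho_diag (a k) * (2 * rho_diag (a k)) powr (- T)) powr l"
      proof -
        have "rho_diag (a k) * (2 * rho_diag (a k)) powr (- T) = 2 powr (- T) * (rho_diag (a k) powr 1 * rho_diag (a k) powr (- T))"
          using ra by (simp add: powr_mult)
        also have "\<dots> = 2 powr (- T) * rho_diag (a k) powr (1 - T)" by (simp only: powr_add[symmetric]) simp
        finally have "(rho_diag (a k) * (2 * rho_diag (a k)) powr (- T)) powr l = 2 powr (- T * l) * rho_diag (a k) powr ((1 - T) * l)"
          by (simp only: powr_mult powr_powr)
        then show ?thesis by (simp add: algebra_simps)
      qed
      have "ennreal ?k * emeasure push {w. near (a k) w} \<le> (\<integral>\<^sup>+w. ennreal (h w) \<partial>\<mu>)"
      proof (rule nn_integral_near_ge)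
        show "(\<lambda>w. ennreal (h w)) \<in> borel_measurable borel" unfolding h_def by measurable
        fix w assume w: "near (a k) w"
        then have wt: "w \<in> tube" using near_tube by blast
        have "(2 * rho_diag (a k)) powr (- T) \<le> cmod (rho (a k) w) powr (- T)"
          using w T cmod_rho_pos[OF at wt] by (intro powr_mono2') (auto simp: near_def)
        then have "rho_diag (a k) * (2 * rho_diag (a k)) powr (- T) \<le> rho_diag (a k) * cmod (rho (a k) w) powr (- T)"
          using ra by (intro mult_left_mono) auto
        then show "ennreal ?k \<le> ennreal (h w)" unfolding eq h_def using ra l by (intro ennreal_leI powr_mono2) auto
      qed simp
      moreover have "ennreal ?k * ennreal (\<epsilon> * rho_diag (a k) powr (l * (real CARD('n) + 1 + \<gamma>))) \<le> ennreal ?k * emeasure push {w. near (a k) w}"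
        by (rule mult_left_mono[OF a(2)]) simp
      moreover have "ennreal ?k * ennreal (\<epsilon> * rho_diag (a k) powr (l * (real CARD('n) + 1 + \<gamma>))) = ennreal (2 powr (- (T * l)) * \<epsilon>)"
      proof -
        have "?k * (\<epsilon> * rho_diag (a k) powr (l * (real CARD('n) + 1 + \<gamma>)))
          = 2 powr (- (T * l)) * \<epsilon> * (rho_diag (a k) powr (- (l * (T - 1))) * rho_diag (a k) powr (l * (real CARD('n) + 1 + \<gamma>)))"
          by (simp only: mult_ac)
        also have "rho_diag (a k) powr (- (l * (T - 1))) * rho_diag (a k) powr (l * (real CARD('n) + 1 + \<gamma>)) = 1"
          using ra by (simp only: powr_add[symmetric]) (simp add: T_def algebra_simps)
        finally have "?k * (\<epsilon> * rho_diag (a k) powr (l * (real CARD('n) + 1 + \<gamma>))) = 2 powr (- (T * l)) * \<epsilon>"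
          by (simp only: mult_1_right)
        then show ?thesis using eps by (simp only: ennreal_mult[symmetric] powr_ge_zero mult_nonneg_nonneg less_imp_le)
      qed
      moreover have "(\<integral>\<^sup>+w. ennreal (h w) \<partial>\<mu>) = (\<integral>\<^sup>+z. ennreal (cmod (f k z) powr l) \<partial>\<mu>)"
        using ra by (intro nn_integral_cong) (simp add: space_mu f_def cmod_test_function[OF at] h_def)
      ultimately show ?thesis by simp
    qed
    ultimately have "ennreal (2 powr (- (T * l)) * \<epsilon>) \<le> 0"
      by (intro tendsto_lowerbound[where F = sequentially]) auto
    moreover have "0 < 2 powr (- (T * l)) * \<epsilon>" using eps by simp
    ultimately show False by simp
  qed
qed

end

context M_plus_measure
begin

text \<open>l >= 1 means p <= q, the range of \<open>carleson_embedding\<close>, used here with c =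
  0. Off \<open>exhaust R\<close> a small Carleson constant controls the integral for the whole
  bounded sequence; on \<open>exhaust R\<close> the measure is finite and the convergence
  uniform.\<close>

lemma vanishing_Carleson_if:
  assumes van: "vanishing_near (l * (real CARD('n) + 1 + \<gamma>)) push" and l: "1 \<le> l"
  shows "vanishing_Carleson l \<gamma> \<mu>"
  unfolding vanishing_Carleson_def
proof (intro allI impI, elim conjE exE)
  fix p q M :: real and f :: "nat \<Rightarrow> complex^'n::{finite,linorder} \<Rightarrow> complex"
  assume p: "p > 0" and q: "q > 0" and ql: "q / p = l" and f: "\<forall>k. f k \<in> Bergman p \<gamma>"
    and M: "\<forall>k. Lp_norm p \<gamma> (f k) \<le> M"
    and lim: "\<forall>K. compact K \<and> K \<subseteq> tube \<longrightarrow> uniform_limit K f (\<lambda>_. 0) sequentially"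
  interpret tube_measure push by (rule tube_measure_push)
  define A where "A = max M 0 + 1"
  have A: "0 < A" by (simp add: A_def)
  have ball: "extend0 (f k) \<in> bergman_ball p \<gamma> A" for k
    by (rule extend0_in_bergman_ball[OF f[rule_format] p]) (use M in \<open>simp add: A_def le_max_iff_disj add_increasing2\<close>)
  have meas [measurable]: "extend0 (f k) \<in> borel_measurable borel" for k by (rule bergman_ball_borel[OF ball])
  have pq: "p \<le> q" using ql l p by (simp add: field_simps)
  have bc: "l * (real CARD('n) + 1 + \<gamma>) + 0 = (real CARD('n) + 1 + \<gamma>) * q / p" by (simp add: ql[symmetric])
  obtain C where C: "0 < C" "\<And>(f :: complex^'n::{finite,linorder} \<Rightarrow> complex) A \<nu> m. line_holomorphic_on f tube \<Longrightarrow>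
    f \<in> borel_measurable borel \<Longrightarrow> 0 < A \<Longrightarrow>
    (\<integral>\<^sup>+w. ennreal (cmod (f w) powr p * rho_diag w powr \<gamma>) * indicator tube w \<partial>lborel) \<le> ennreal (A powr p) \<Longrightarrow>
    tube_measure \<nu> \<Longrightarrow> 0 < m \<Longrightarrow> (\<And>u. u \<in> tube \<Longrightarrow> emeasure \<nu> {w. near u w} \<le> ennreal (m * rho_diag u powr (l * (real CARD('n) + 1 + \<gamma>)))) \<Longrightarrow>
    (\<integral>\<^sup>+w. ennreal (cmod (f w) powr q * rho_diag w powr 0) * indicator tube w \<partial>\<nu>) \<le> ennreal (C * m * A powr q)"
    by (rule carleson_embedding[OF p pq bc]) blast
  show "(\<lambda>k. \<integral>\<^sup>+z. ennreal (cmod (f k z) powr q) \<partial>\<mu>) \<longlonglongrightarrow> 0"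
  proof (rule order_tendstoI)
    fix x :: ennreal assume "0 < x"
    then obtain y where y: "0 < y" "y < x" using dense by blast
    then obtain \<delta> where \<delta>: "y = ennreal \<delta>" "0 < \<delta>" by (cases y) auto
    \<comment> \<open>Each of the two parts is allotted \<open>\<delta>\<close> / 2; the v + 1 in
      \<open>\<eta>\<close> below guards against an \<open>exhaust R\<close> of measure
      zero.\<close>
    define \<epsilon> where "\<epsilon> = \<delta> / (2 * C * A powr q)"
    have eps: "0 < \<epsilon>" using \<delta> C A by (simp add: \<epsilon>_def)
    obtain R where R: "0 < R" "\<And>u. u \<in> tube \<Longrightarrow> emeasure push ({w. near u w} - exhaust R) \<le> ennreal (\<epsilon> * rho_diag u powr (l * (real CARD('n) + 1 + \<gamma>)))"
      using van eps unfolding vanishing_near_def by blast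
    have ex_borel [measurable]: "exhaust R \<in> sets borel" using R(1) by (rule exhaust_sets)
    have "emeasure push (exhaust R) < \<infinity>" using finite_on_exhaust_push R(1) by (simp add: finite_on_exhaust_def)
    then obtain v where v: "0 \<le> v" "emeasure push (exhaust R) = ennreal v" by (cases "emeasure push (exhaust R)") auto
    define \<eta> where "\<eta> = (\<delta> / (2 * (v + 1))) powr (1 / q)"
    have eta: "0 < \<eta>" using \<delta> v by (simp add: \<eta>_def)
    have eta_q: "\<eta> powr q = \<delta> / (2 * (v + 1))" using \<delta> v q by (simp add: \<eta>_def powr_powr)
    let ?\<nu> = "density push (indicator (- exhaust R))"
    have nu: "tube_measure ?\<nu>" by (rule tube_measure_density) measurable
    have nu_near: "emeasure ?\<nu> {w. near u w} \<le> ennreal (\<epsilon> * rho_diag u powr (l * (real CARD('n) + 1 + \<gamma>)))" if "u \<in> tube" for u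
    proof -
      have "emeasure ?\<nu> {w. near u w} = emeasure push ({w. near u w} - exhaust R)"
        by (subst emeasure_density) (auto simp: sets_push indicator_inter_arith[symmetric] Diff_eq Int_commute intro!: arg_cong2[where f = nn_integral] nn_integral_indicator[THEN sym, THEN trans[rotated]])
      then show ?thesis using R(2)[OF that] by simp
    qed
    have "uniform_limit (exhaust R) f (\<lambda>_. 0) sequentially"
      using lim compact_exhaust[of R] exhaust_subset_tube R(1) by auto
    then have "\<forall>\<^sub>F k in sequentially. \<forall>w\<in>exhaust R. dist (f k w) 0 < \<eta>"
      by (rule uniform_limitD[OF _ eta])
    then show "\<forall>\<^sub>F k in sequentially. (\<integral>\<^sup>+z. ennreal (cmod (f k z) powr q) \<partial>\<mu>) < x"
    proof eventually_elim
      case (elim k)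
      let ?h = "extend0 (f k)"
      have h: "line_holomorphic_on ?h tube"
        "(\<integral>\<^sup>+w. ennreal (cmod (?h w) powr p * rho_diag w powr \<gamma>) * indicator tube w \<partial>lborel) \<le> ennreal (A powr p)"
        using ball[of k] by (simp_all add: bergman_ball_def)
      have "(\<integral>\<^sup>+z. ennreal (cmod (f k z) powr q) \<partial>\<mu>) = (\<integral>\<^sup>+z. ennreal (cmod (?h z) powr q) \<partial>\<mu>)"
        by (intro nn_integral_cong) (simp add: space_mu extend0_def)
      also have "\<dots> = (\<integral>\<^sup>+z. ennreal (cmod (?h z) powr q) * indicator tube z \<partial>push)"
        by (rule nn_integral_push_tube[symmetric]) measurable
      also have "\<dots> \<le> (\<integral>\<^sup>+z. ennreal (\<eta> powr q) * indicator (exhaust R) z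
          + indicator (- exhaust R) z * (ennreal (cmod (?h z) powr q * rho_diag z powr 0) * indicator tube z) \<partial>push)"
      proof (rule nn_integral_mono)
        fix z :: "complex^'n::{finite,linorder}"
        show "ennreal (cmod (?h z) powr q) * indicator tube z \<le> ennreal (\<eta> powr q) * indicator (exhaust R) z
          + indicator (- exhaust R) z * (ennreal (cmod (?h z) powr q * rho_diag z powr 0) * indicator tube z)"
        proof (cases "z \<in> exhaust R")
          case True
          then have "z \<in> tube" using exhaust_subset_tube by blast
          moreover have "cmod (f k z) powr q \<le> \<eta> powr q" using elim True q by (intro powr_mono2) (auto intro: less_imp_le)
          ultimately show ?thesis using True by (simp add: extend0_def ennreal_leI)
        next
          case False
          then show ?thesis by (cases "z \<in> tube") (auto simp: mem_tube)
        qed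
      qed
      also have "\<dots> = (\<integral>\<^sup>+z. ennreal (\<eta> powr q) * indicator (exhaust R) z \<partial>push)
          + (\<integral>\<^sup>+z. indicator (- exhaust R) z * (ennreal (cmod (?h z) powr q * rho_diag z powr 0) * indicator tube z) \<partial>push)"
        by (rule nn_integral_add) measurable
      also have "(\<integral>\<^sup>+z. ennreal (\<eta> powr q) * indicator (exhaust R) z \<partial>push) = ennreal (\<eta> powr q) * ennreal v"
        unfolding v(2)[symmetric] by (rule nn_integral_cmult_indicator) (simp add: sets_push)
      also have "\<dots> = ennreal (\<eta> powr q * v)" using v by (simp add: ennreal_mult)
      also have "(\<integral>\<^sup>+z. indicator (- exhaust R) z * (ennreal (cmod (?h z) powr q * rho_diag z powr 0) * indicator tube z) \<partial>push)
          = (\<integral>\<^sup>+z. ennreal (cmod (?h z) powr q * rho_diag z powr 0) * indicator tube z \<partial>?\<nu>)"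
        by (rule nn_integral_density[symmetric]) measurable
      also have "\<dots> \<le> ennreal (C * \<epsilon> * A powr q)"
        by (rule C(2)[OF h(1) meas A h(2) nu eps nu_near])
      also have "ennreal (\<eta> powr q * v) + ennreal (C * \<epsilon> * A powr q) = ennreal (\<eta> powr q * v + C * \<epsilon> * A powr q)"
        using v C eps by (intro ennreal_plus[symmetric]) auto
      also have "\<dots> \<le> ennreal \<delta>"
      proof (rule ennreal_leI)
        have "\<eta> powr q * v \<le> \<delta> / 2" unfolding eta_q using v \<delta> by (simp add: field_simps)
        moreover have "C * \<epsilon> * A powr q = \<delta> / 2" using C A by (simp add: \<epsilon>_def)
        ultimately show "\<eta> powr q * v + C * \<epsilon> * A powr q \<le> \<delta>" by simp
      qed
      also have "\<dots> < x" using y \<delta> by simp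
      finally show ?case by (simp add: add_left_mono)
    qed
  qed simp
qed

end

theorem theorem5p2:
  fixes p1 p2 \<alpha>1 \<alpha>2 \<xi> l \<gamma> :: real
    and \<mu> :: "(complex^'n::{finite,linorder}) measure"
  assumes "1 < p1" and "p1 \<le> p2"
    and "-1 < \<alpha>1" and "-1 < \<alpha>2" and "-1 < \<xi>"
    and "\<mu> \<in> M_plus"
    and "real CARD('n) + 1 + \<xi> > real CARD('n) * max 1 (1 / p1) + (1 + \<alpha>1) / p1"
    and "real CARD('n) + 1 + \<xi> > real CARD('n) * max 1 (1 / p2) + (1 + \<alpha>2) / p2"
    and "l = 1 + 1 / p1 - 1 / p2"
    and "\<gamma> = 1 / l * (\<xi> + \<alpha>1 / p1 - \<alpha>2 / p2)"
  shows "(compact_op (Berezin_dom \<mu> \<xi>) (Berezin_op \<mu> \<xi>)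
            (Bergman p1 \<alpha>1) (Lp_norm p1 \<alpha>1) (Lp p2 \<alpha>2) (Lp_norm p2 \<alpha>2)
          \<longleftrightarrow>
          compact_op (Toeplitz_dom \<mu> \<xi>) (Toeplitz_op \<mu> \<xi>)
            (Bergman p1 \<alpha>1) (Lp_norm p1 \<alpha>1) (Bergman p2 \<alpha>2) (Lp_norm p2 \<alpha>2))
       \<and> (compact_op (Toeplitz_dom \<mu> \<xi>) (Toeplitz_op \<mu> \<xi>)
            (Bergman p1 \<alpha>1) (Lp_norm p1 \<alpha>1) (Bergman p2 \<alpha>2) (Lp_norm p2 \<alpha>2)
          \<longleftrightarrow>
          vanishing_Carleson l \<gamma> \<mu>)"
proof -
  have p: "0 < p1" "0 < p2" "1 / p1 \<le> 1" "1 / p2 \<le> 1" using assms(1,2) by auto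
  \<comment> \<open>Both exponents exceed 1, so the maxima equal 1 and the terms in n
    cancel.\<close>
  have c: "(1 + \<alpha>1) / p1 < 1 + \<xi>" "(1 + \<alpha>2) / p2 < 1 + \<xi>"
    using assms(7,8) unfolding max_absorb1[OF p(3)] max_absorb1[OF p(4)] by simp_all
  define t where "t = real CARD('n) + 1 + \<xi>"
  define b where "b = t + (real CARD('n) + 1 + \<alpha>1) / p1 - (real CARD('n) + 1 + \<alpha>2) / p2"
  interpret Toeplitz_setting \<mu> p1 p2 \<alpha>1 \<alpha>2 \<xi> t b
  proof unfold_locales
    show "1 + \<alpha>1 < p1 * (1 + \<xi>)" "1 + \<alpha>2 < p2 * (1 + \<xi>)" using c p by (simp_all add: field_simps)
  qed (use assms in \<open>simp_all add: t_def b_def\<close>)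
  have "1 / p2 \<le> 1 / p1" using assms(1,2) by (simp add: frac_le)
  then have l: "1 \<le> l" by (simp add: assms(9))
  then have lg: "l * \<gamma> = \<xi> + \<alpha>1 / p1 - \<alpha>2 / p2" by (simp add: assms(10))
  have "0 < (1 + \<alpha>1) / p1" using assms(3) p by simp
  \<comment> \<open>After inserting the definition of l this reads 0 < 1 + \<open>\<xi>\<close> + (1
    + \<open>\<alpha>1\<close>) / p1 - (1 + \<open>\<alpha>2\<close>) / p2; it is
    \<open>\<gamma>\<close> > -1 multiplied by l.\<close>
  then have "- l < \<xi> + \<alpha>1 / p1 - \<alpha>2 / p2" using c assms(9) by (simp add: add_divide_distrib)
  then have "l * (- 1) < l * \<gamma>" by (simp add: lg)
  then have g: "- 1 < \<gamma>" using l by (subst (asm) mult_less_cancel_left_pos) auto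
  \<comment> \<open>The critical Carleson exponent coincides with the exponent b that the operator
    estimates produce, which ties the Carleson condition to the two compactness statements.\<close>
  have "l * (real CARD('n) + 1 + \<gamma>) = l * (real CARD('n) + 1) + l * \<gamma>" by (simp add: distrib_left)
  also have "\<dots> = b" unfolding lg unfolding b_def t_def assms(9)
    by (simp add: add_divide_distrib algebra_simps)
  finally have b_eq: "l * (real CARD('n) + 1 + \<gamma>) = b" .
  have "vanishing_Carleson l \<gamma> \<mu> \<longleftrightarrow> vanishing_near b push"
    using vanishing_Carleson_imp[of l \<gamma>] vanishing_Carleson_if[of l \<gamma>] l g by (auto simp: b_eq)
  then show ?thesis
    using Berezin_compact Berezin_compact_imp Toeplitz_compact Toeplitz_compact_imp by blast
qed

end
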